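(* Let $M$ be a compact surface without boundary with $\chi(M)<0$, let a topological triangulation of $M$ be given, and let numbers $\theta^e\in(0,\pi)$ be assigned to its edges such that $(\star)$ $\quad\sum_{e\in S}\theta^e>\pi|S|$ for every nonempty set $S$ of triangles, and $\sum_{e\in v}(\pi-\theta^e)=2\pi$ at each vertex $v$. Then there is a uniquely associated constant curvature ($-1$) surface on which the given triangulation is realized as a geodesic triangulation and in which the circles in which the triangles live (their circumscribing circles) meet with the specified angles $\theta^e$.
   Context: $\{e\in S\}$ is the set of edges belonging to at least one triangle in $S$, $|S|$ is the number of triangles in $S$, and $\{e\in v\}$ is the collection of edges at the vertex $v$ (counted as in the universal cover). Uniqueness is up to isometry. The intersection angle of the circumscribing circles of two geodesic triangles $t_1,t_2$ sharing an edge $e$ (lifted to the universal cover) is $$\theta^e=\frac{\pi+A_1-B_1-C_1}{2}+\frac{\pi+A_2-B_2-C_2}{2},$$ where $A_i,B_i,C_i$ are the angles of $t_i$ and $A_i$ is opposite to $e$; it lies in $(0,\pi)$ exactly when the vertex of $t_1$ not on $e$ is outside the circumscribing disk of $t_2$. *)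

theory Defs
  imports "HOL-Analysis.Analysis"
begin

section \<open>Closed surfaces and topological triangulations\<close>

definition closed_surface :: "'a topology \<Rightarrow> bool" where
  "closed_surface M \<longleftrightarrow>
     compact_space M \<and> Hausdorff_space M \<and>
     (\<forall>p\<in>topspace M. \<exists>U. openin M U \<and> p \<in> U \<and>
        subtopology M U homeomorphic_space top_of_set (ball (0::complex) 1))"

text \<open>The model triangle in barycentric coordinates. Corners and sides are indexed by the
  type \<^typ>\<open>3\<close>, whose arithmetic is modulo 3; side \<open>i\<close> is the one opposite to corner \<open>i\<close>.\<close>

definition std_triangle :: "(real^3) set" where
  "std_triangle = {x. (\<forall>i. 0 \<le> x $ i) \<and> (\<Sum>i\<in>UNIV. x $ i) = 1}"

definition open_triangle :: "(real^3) set" where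
  "open_triangle = {x. (\<forall>i. 0 < x $ i) \<and> (\<Sum>i\<in>UNIV. x $ i) = 1}"

definition corner :: "3 \<Rightarrow> real^3" where
  "corner i = axis i 1"

definition side_pt :: "3 \<Rightarrow> real \<Rightarrow> real^3" where
  "side_pt i s = (1 - s) *\<^sub>R corner (i + 1) + s *\<^sub>R corner (i + 2)"

text \<open>A triangulation presents \<open>M\<close> as finitely many triangles glued along their sides by affine
  identifications: \<open>T\<close> is the index set of the triangles and \<open>\<phi> t\<close> is the characteristic map of
  triangle \<open>t\<close>. As is usual for surface triangulations that only need to be simplicial in the
  universal cover, corners of a triangle may coincide in \<open>M\<close>, edges may be loops, and two sides of
  the same triangle may be glued to each other. Open triangles are embedded and disjoint from
  everything else; open edges are embedded, and two sides that meet in the interior of one of them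
  agree completely, with either of the two directions. Since \<open>M\<close> is compact Hausdorff, its topology
  is then the quotient topology. The last clause (each edge belongs to exactly two sides) is
  automatic when \<open>M\<close> is a surface without boundary.\<close>

definition side_edge :: "('t \<Rightarrow> real^3 \<Rightarrow> 'a) \<Rightarrow> 't \<Rightarrow> 3 \<Rightarrow> 'a set" where
  "side_edge \<phi> t i = (\<lambda>s. \<phi> t (side_pt i s)) ` {0..1}"

definition surface_triangulation ::
  "'a topology \<Rightarrow> 't set \<Rightarrow> ('t \<Rightarrow> real^3 \<Rightarrow> 'a) \<Rightarrow> bool" where
  "surface_triangulation M T \<phi> \<longleftrightarrow>
     finite T \<and>
     (\<forall>t\<in>T. continuous_map (top_of_set std_triangle) M (\<phi> t)) \<and>
     topspace M = (\<Union>t\<in>T. \<phi> t ` std_triangle) \<and>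
     (\<forall>t\<in>T. \<forall>x\<in>open_triangle. \<forall>t'\<in>T. \<forall>x'\<in>std_triangle.
        \<phi> t' x' = \<phi> t x \<longrightarrow> t' = t \<and> x' = x) \<and>
     (\<forall>t\<in>T. \<forall>i. inj_on (\<lambda>s. \<phi> t (side_pt i s)) {0<..<1}) \<and>
     (\<forall>t\<in>T. \<forall>i. \<forall>s\<in>{0<..<1}. \<forall>t'\<in>T. \<forall>x'\<in>std_triangle.
        \<phi> t' x' = \<phi> t (side_pt i s) \<longrightarrow>
          (\<exists>j. x' = side_pt j s \<and>
               (\<forall>u\<in>{0..1}. \<phi> t' (side_pt j u) = \<phi> t (side_pt i u))) \<or>
          (\<exists>j. x' = side_pt j (1 - s) \<and>
               (\<forall>u\<in>{0..1}. \<phi> t' (side_pt j (1 - u)) = \<phi> t (side_pt i u)))) \<and>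
     (\<forall>t\<in>T. \<forall>i. card {(t', j). t' \<in> T \<and> side_edge \<phi> t' j = side_edge \<phi> t i} = 2)"

definition vertices :: "('t \<Rightarrow> real^3 \<Rightarrow> 'a) \<Rightarrow> 't set \<Rightarrow> 'a set" where
  "vertices \<phi> T = {\<phi> t (corner i) |t i. t \<in> T}"

definition edges :: "('t \<Rightarrow> real^3 \<Rightarrow> 'a) \<Rightarrow> 't set \<Rightarrow> 'a set set" where
  "edges \<phi> S = {side_edge \<phi> t i |t i. t \<in> S}"

definition euler_char :: "('t \<Rightarrow> real^3 \<Rightarrow> 'a) \<Rightarrow> 't set \<Rightarrow> int" where
  "euler_char \<phi> T = int (card (vertices \<phi> T)) - int (card (edges \<phi> T)) + int (card T)"

text \<open>The number of lifts of the edge \<open>e\<close> that emanate from a fixed lift of the vertex \<open>v\<close> in the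
  universal cover is the number of ends of \<open>e\<close> at \<open>v\<close>; a loop at \<open>v\<close> has no vertex other than \<open>v\<close>
  and is counted twice.\<close>

definition ends_at :: "('t \<Rightarrow> real^3 \<Rightarrow> 'a) \<Rightarrow> 't set \<Rightarrow> 'a \<Rightarrow> 'a set \<Rightarrow> nat" where
  "ends_at \<phi> T v e = (if v \<notin> e then 0 else if e \<inter> vertices \<phi> T = {v} then 2 else 1)"


section \<open>The hyperbolic plane (Beltrami--Klein model)\<close>

text \<open>The points are those of the open unit disk, geodesics are Euclidean line segments, and the
  Riemannian metric of curvature \<open>-1\<close> is
  \<open>|dx|\<^sup>2 / (1 - |x|\<^sup>2) + (x \<bullet> dx)\<^sup>2 / (1 - |x|\<^sup>2)\<^sup>2\<close>. The model is not conformal, so angles have to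
  be computed with this metric.\<close>

definition hyp_plane :: "complex set" where
  "hyp_plane = ball 0 1"

definition hyp_dist :: "complex \<Rightarrow> complex \<Rightarrow> real" where
  "hyp_dist x y =
     arcosh ((1 - x \<bullet> y) / (sqrt (1 - (norm x)\<^sup>2) * sqrt (1 - (norm y)\<^sup>2)))"

definition hyp_inner :: "complex \<Rightarrow> complex \<Rightarrow> complex \<Rightarrow> real" where
  "hyp_inner p u v =
     (u \<bullet> v) / (1 - (norm p)\<^sup>2) + (p \<bullet> u) * (p \<bullet> v) / (1 - (norm p)\<^sup>2)\<^sup>2"

definition hyp_angle :: "complex \<Rightarrow> complex \<Rightarrow> complex \<Rightarrow> real" where
  "hyp_angle p q r =
     arccos (hyp_inner p (q - p) (r - p) /
       (sqrt (hyp_inner p (q - p) (q - p)) * sqrt (hyp_inner p (r - p) (r - p))))"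

definition hyp_isometry :: "(complex \<Rightarrow> complex) \<Rightarrow> bool" where
  "hyp_isometry g \<longleftrightarrow>
     bij_betw g hyp_plane hyp_plane \<and>
     (\<forall>x\<in>hyp_plane. \<forall>y\<in>hyp_plane. hyp_dist (g x) (g y) = hyp_dist x y)"

definition hyp_triangle :: "(3 \<Rightarrow> complex) \<Rightarrow> bool" where
  "hyp_triangle a \<longleftrightarrow> inj a \<and> range a \<subseteq> hyp_plane \<and> \<not> collinear (range a)"

definition tri_angle :: "(3 \<Rightarrow> complex) \<Rightarrow> 3 \<Rightarrow> real" where
  "tri_angle a i = hyp_angle (a i) (a (i + 1)) (a (i + 2))"

text \<open>Intersection angle of the circumscribing circles of two triangles \<open>a\<close> and \<open>b\<close> that are glued
  along side \<open>i\<close> of \<open>a\<close> and side \<open>j\<close> of \<open>b\<close>.\<close>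

definition intersection_angle ::
  "(3 \<Rightarrow> complex) \<Rightarrow> 3 \<Rightarrow> (3 \<Rightarrow> complex) \<Rightarrow> 3 \<Rightarrow> real" where
  "intersection_angle a i b j =
     (pi + tri_angle a i - tri_angle a (i + 1) - tri_angle a (i + 2)) / 2 +
     (pi + tri_angle b j - tri_angle b (j + 1) - tri_angle b (j + 2)) / 2"


section \<open>Surfaces of constant curvature -1\<close>

text \<open>A constant curvature \<open>-1\<close> surface is given by an atlas of charts into the hyperbolic plane
  whose transition maps are locally restrictions of isometries of the hyperbolic plane.\<close>

definition hyperbolic_surface ::
  "'a topology \<Rightarrow> ('a set \<times> ('a \<Rightarrow> complex)) set \<Rightarrow> bool" where
  "hyperbolic_surface N A \<longleftrightarrow>
     compact_space N \<and> Hausdorff_space N \<and>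
     (\<Union>(U, c)\<in>A. U) = topspace N \<and>
     (\<forall>(U, c)\<in>A. openin N U \<and> c ` U \<subseteq> hyp_plane \<and> open (c ` U) \<and>
        homeomorphic_map (subtopology N U) (top_of_set (c ` U)) c) \<and>
     (\<forall>(U, c)\<in>A. \<forall>(U', c')\<in>A. \<forall>p\<in>U \<inter> U'.
        \<exists>g W. hyp_isometry g \<and> openin N W \<and> p \<in> W \<and> W \<subseteq> U \<inter> U' \<and>
          (\<forall>q\<in>W. c' q = g (c q)))"

text \<open>Isometries in the Riemannian sense, i.e. homeomorphisms that are isometric in charts.\<close>

definition surface_isometry ::
  "'a topology \<Rightarrow> ('a set \<times> ('a \<Rightarrow> complex)) set \<Rightarrow>
   'b topology \<Rightarrow> ('b set \<times> ('b \<Rightarrow> complex)) set \<Rightarrow> ('a \<Rightarrow> 'b) \<Rightarrow> bool" where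
  "surface_isometry N A N' A' f \<longleftrightarrow>
     homeomorphic_map N N' f \<and>
     (\<forall>(U, c)\<in>A. \<forall>(U', c')\<in>A'. \<forall>p\<in>U. f p \<in> U' \<longrightarrow>
        (\<exists>g W. hyp_isometry g \<and> openin N W \<and> p \<in> W \<and> W \<subseteq> U \<and> f ` W \<subseteq> U' \<and>
          (\<forall>q\<in>W. c' (f q) = g (c q))))"

text \<open>The singular triangle \<open>\<sigma>\<close> in \<open>N\<close> is geodesic with (developed) vertices \<open>a\<close> if, up to a
  homeomorphism \<open>k\<close> preserving corners and sides, it is a local isometry defined on the geodesic
  triangle with vertices \<open>a\<close>. The latter is thus a lift of \<open>\<sigma>\<close> to the universal cover.\<close>

definition geodesic_triangle ::
  "'a topology \<Rightarrow> ('a set \<times> ('a \<Rightarrow> complex)) set \<Rightarrow> (real^3 \<Rightarrow> 'a) \<Rightarrow> (3 \<Rightarrow> complex) \<Rightarrow> bool" where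
  "geodesic_triangle N A \<sigma> a \<longleftrightarrow>
     hyp_triangle a \<and>
     (\<exists>k. homeomorphic_map (top_of_set std_triangle) (top_of_set (convex hull (range a))) k \<and>
        (\<forall>i. k (corner i) = a i) \<and>
        (\<forall>i. k ` side_pt i ` {0..1} = closed_segment (a (i + 1)) (a (i + 2))) \<and>
        (\<forall>x\<in>std_triangle. \<forall>(U, c)\<in>A. \<sigma> x \<in> U \<longrightarrow>
           (\<exists>g W. hyp_isometry g \<and> openin (top_of_set std_triangle) W \<and> x \<in> W \<and>
              (\<forall>y\<in>W. \<sigma> y \<in> U \<and> c (\<sigma> y) = g (k y)))))"

text \<open>The homeomorphism \<open>h\<close> from the triangulated surface \<open>M\<close> to the hyperbolic surface \<open>(N, A)\<close>
  realizes the triangulation geodesically, with circumscribing circles meeting at the angles \<open>\<theta>\<close>.\<close>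

definition geodesic_realization ::
  "'a topology \<Rightarrow> 't set \<Rightarrow> ('t \<Rightarrow> real^3 \<Rightarrow> 'a) \<Rightarrow> ('a set \<Rightarrow> real) \<Rightarrow>
   'b topology \<Rightarrow> ('b set \<times> ('b \<Rightarrow> complex)) set \<Rightarrow> ('a \<Rightarrow> 'b) \<Rightarrow> bool" where
  "geodesic_realization M T \<phi> \<theta> N A h \<longleftrightarrow>
     hyperbolic_surface N A \<and>
     homeomorphic_map M N h \<and>
     (\<exists>a. (\<forall>t\<in>T. geodesic_triangle N A (h \<circ> \<phi> t) (a t)) \<and>
        (\<forall>t\<in>T. \<forall>t'\<in>T. \<forall>i j. (t, i) \<noteq> (t', j) \<and> side_edge \<phi> t i = side_edge \<phi> t' j \<longrightarrow>
           intersection_angle (a t) i (a t') j = \<theta> (side_edge \<phi> t i)))"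

end

theory Submission
  imports Defs
begin

text \<open>
  A hyperbolic triangle is determined by the angles \<open>\<psi>\<close> that its circumscribing circle makes with its
  sides, and the prescribed intersection angles are a linear condition: the two angles \<open>\<psi>\<close> at an edge
  \<open>e\<close> add up to \<open>\<theta> e\<close>. By linear duality the condition \<open>(\<star>)\<close> is what makes this system of linear
  conditions and strict inequalities solvable. On its solutions there is a strictly convex energy,
  a sum over the triangles of primitives of \<open>ln \<circ> sin\<close>, whose partial derivatives are increasing
  functions of the side lengths. Hence its critical points are exactly the solutions for which glued
  sides have equal length. The closure of the solutions is compact and the energy has slope \<open>-\<infinity>\<close>
  when entering the interior from the boundary, so there is exactly one critical point.

  Gluing the resulting triangles gives charts around faces, around edges and, since the angles around
  a vertex add up to \<open>2\<pi>\<close>, around vertices. Conversely, the triangles of any realization solve the same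
  equations with equal lengths of glued sides, so they are congruent to the ones constructed, and
  the congruences fit together to an isometry.\<close>

section \<open>Cyclic indices\<close>

text \<open>A variation that keeps the prescribed angles adds at one side of an edge what it takes
  from the other, which is why criticality compares the lengths of exactly the two sides that are
  glued. Three features of the setting shape the rest. A triangle may be glued to itself and no
  orientation is given, so unknowns are indexed by sides and incidences by directed ends of sides,
  rather than by edges or points of M. The notion of triangulation says nothing about links of
  vertices: that the triangles at a vertex form a single cycle has to be extracted from the local
  Euclidean structure of M, and only then does a total angle of 2\<pi> close up to a disc. Finally,
  a competing realization may parametrise its triangles by arbitrary homeomorphisms that respect
  corners and sides. The map between the surfaces that it suggests is therefore in general no
  isometry; it is corrected triangle by triangle, and the corrections have to be shown to agree on
  glued sides.\<close>

lemma cyc3: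
  fixes i :: 3
  shows "i + 1 + 1 = i + 2" "i + 1 + 2 = i" "i + 2 + 1 = i" "i + 2 + 2 = i + 1"
    "i + 3 = i" "i + 4 = i + 1"
  using exhaust_3[of i] by (auto simp: numeral_eq_Suc)

lemma cyc3_neq:
  fixes i :: 3
  shows "i + 1 \<noteq> i" "i + 2 \<noteq> i" "i + 1 \<noteq> i + 2" "i \<noteq> i + 1" "i \<noteq> i + 2" "i + 2 \<noteq> i + 1"
  using exhaust_3[of i] by auto

lemma UNIV_cyc3: "(UNIV :: 3 set) = {i, i + 1, i + 2}"
proof -
  have "x = i \<or> x = i + 1 \<or> x = i + 2" for x
    using exhaust_3[of i] exhaust_3[of x] by auto
  then show ?thesis by auto
qed

lemma exhaust_cyc3: "(j :: 3) = i \<or> j = i + 1 \<or> j = i + 2"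
  using UNIV_cyc3[of i] by auto

lemma sum_cyc3:
  fixes f :: "3 \<Rightarrow> 'a :: comm_monoid_add"
  shows "sum f UNIV = f i + f (i + 1) + f (i + 2)"
  by (subst UNIV_cyc3[of i]) (simp add: cyc3_neq add.assoc)

section \<open>Convexity of the energy of a single triangle\<close>

section \<open>Angle coordinates of a hyperbolic triangle\<close>

text \<open>A triangle with angles \<open>A\<close> is encoded by the angles
  \<open>\<psi> i = (\<pi> + A i - A (i + 1) - A (i + 2)) / 2\<close> that its circumscribing circle makes with its
  sides; \<open>tri_ang\<close> inverts this transformation.\<close>

definition tri_ang :: "(3 \<Rightarrow> real) \<Rightarrow> 3 \<Rightarrow> real" where
  "tri_ang \<psi> i = pi - \<psi> (i + 1) - \<psi> (i + 2)"

text \<open>In terms of the angles A this is (\<pi> - A 1 - A 2 - A 3) / 2, half the area of the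
  triangle; \<open>tri_dom\<close> thus asks for positive area and positive angles.\<close>

definition tri_excess :: "(3 \<Rightarrow> real) \<Rightarrow> real" where
  "tri_excess \<psi> = (\<Sum>i\<in>UNIV. \<psi> i) - pi"

definition tri_dom :: "(3 \<Rightarrow> real) \<Rightarrow> bool" where
  "tri_dom \<psi> \<longleftrightarrow> 0 < tri_excess \<psi> \<and> (\<forall>i. 0 < tri_ang \<psi> i)"

text \<open>The function \<open>tri_grad \<psi> i\<close> is \<open>ln (sinh\<^sup>2 (l / 2))\<close>, where \<open>l\<close> is the length of side \<open>i\<close>.\<close>

definition tri_grad :: "(3 \<Rightarrow> real) \<Rightarrow> 3 \<Rightarrow> real" where
  "tri_grad \<psi> i = ln (sin (tri_excess \<psi>)) + ln (sin (\<psi> i))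
     - ln (sin (tri_ang \<psi> (i + 1))) - ln (sin (tri_ang \<psi> (i + 2)))"

lemma psi_eq_excess: "\<psi> i = tri_excess \<psi> + tri_ang \<psi> i"
  by (simp add: tri_excess_def tri_ang_def sum_cyc3[of _ i])

lemma tri_dom_bounds:
  assumes "tri_dom \<psi>"
  shows "0 < tri_excess \<psi>" "tri_excess \<psi> < pi" "0 < tri_ang \<psi> i" "tri_ang \<psi> i < pi"
    "0 < \<psi> i" "\<psi> i < pi"
proof -
  have p: "0 < \<psi> j" for j
    using assms psi_eq_excess[of \<psi> j] by (auto simp: tri_dom_def add_pos_pos)
  have a: "0 < tri_ang \<psi> j" "0 < tri_excess \<psi>" for j
    using assms by (auto simp: tri_dom_def)
  have a1: "tri_ang \<psi> i < pi" "tri_ang \<psi> (i+1) < pi" "\<psi> i < pi"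
    using p[of i] p[of "i+1"] p[of "i+2"] a(1)[of "i+1"] by (auto simp: tri_ang_def cyc3)
  have "tri_excess \<psi> < pi"
    using a1(3) psi_eq_excess[of \<psi> i] a(1)[of i] by simp
  with a1 a p show "0 < tri_excess \<psi>" "tri_excess \<psi> < pi" "0 < tri_ang \<psi> i" "tri_ang \<psi> i < pi"
    "0 < \<psi> i" "\<psi> i < pi" by auto
qed

lemma tri_dom_sin_pos:
  assumes "tri_dom \<psi>"
  shows "0 < sin (tri_excess \<psi>)" "0 < sin (tri_ang \<psi> i)" "0 < sin (\<psi> i)"
  using tri_dom_bounds[OF assms] by (auto intro!: sin_gt_zero)

section \<open>Strict convexity\<close>

lemma quadratic_form_2_pos:
  fixes a b c :: real
  assumes "0 < a" "b\<^sup>2 < a * c" "y \<noteq> 0 \<or> z \<noteq> 0"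
  shows "0 < a * y\<^sup>2 + 2 * b * y * z + c * z\<^sup>2"
proof -
  have "a * (a * y\<^sup>2 + 2 * b * y * z + c * z\<^sup>2) = (a * y + b * z)\<^sup>2 + (a * c - b\<^sup>2) * z\<^sup>2"
    by (simp add: power2_eq_square algebra_simps)
  also have "\<dots> > 0"
  proof (cases "z = 0")
    case True
    then show ?thesis using assms by simp
  next
    case False
    then show ?thesis using assms by (intro add_nonneg_pos mult_pos_pos) auto
  qed
  finally show ?thesis using assms(1) by (simp add: zero_less_mult_iff)
qed

text \<open>Sylvester's criterion for the matrix with rows (a, h, g), (h, b, f), (g, f, c):
  multiplication by \<open>a\<close> splits off a square, and the binary form that remains has
  determinant \<open>a\<close> times the full determinant.\<close>

lemma quadratic_form_3_pos:
  fixes a b c f g h :: real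
  assumes "0 < a" "h\<^sup>2 < a * b" "0 < a * b * c + 2 * f * g * h - a * f\<^sup>2 - b * g\<^sup>2 - c * h\<^sup>2"
    and "x \<noteq> 0 \<or> y \<noteq> 0 \<or> z \<noteq> 0"
  shows "0 < a * x\<^sup>2 + b * y\<^sup>2 + c * z\<^sup>2 + 2 * f * y * z + 2 * g * x * z + 2 * h * x * y"
proof (cases "y = 0 \<and> z = 0")
  case True
  then show ?thesis using assms by simp
next
  case False
  let ?p = "a * b - h\<^sup>2" and ?q = "a * f - g * h" and ?r = "a * c - g\<^sup>2"
  have *: "?p * ?r - ?q\<^sup>2 = a * (a * b * c + 2 * f * g * h - a * f\<^sup>2 - b * g\<^sup>2 - c * h\<^sup>2)"
    by (simp add: power2_eq_square algebra_simps)
  have "0 < a * (a * b * c + 2 * f * g * h - a * f\<^sup>2 - b * g\<^sup>2 - c * h\<^sup>2)"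
    by (rule mult_pos_pos[OF assms(1,3)])
  then have "?q\<^sup>2 < ?p * ?r" using * by linarith
  then have "0 < ?p * y\<^sup>2 + 2 * ?q * y * z + ?r * z\<^sup>2"
    using assms False by (intro quadratic_form_2_pos) auto
  then have "0 < (a * x + h * y + g * z)\<^sup>2 + (?p * y\<^sup>2 + 2 * ?q * y * z + ?r * z\<^sup>2)"
    by (rule add_nonneg_pos[OF zero_le_power2])
  also have "\<dots> = a * (a * x\<^sup>2 + b * y\<^sup>2 + c * z\<^sup>2 + 2 * f * y * z + 2 * g * x * z + 2 * h * x * y)"
    by (simp add: power2_eq_square algebra_simps)
  finally show ?thesis using assms(1) by (simp add: zero_less_mult_iff)
qed

text \<open>The \<open>S\<close> stand for sinh^2 (l / 2) of the three sides, so that 1 + S is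
  cosh^2 (l / 2), and the quantity in assumption \<open>E\<close> is a quarter of the Gram
  determinant of the vertices in the hyperboloid. Written in 1 + S the off-diagonal entries are
  products, the principal minors factor, and the determinant is the product of the 1 + S with that
  quantity.\<close>

lemma hessian_core_pos:
  fixes S1 S2 S3 :: real
  assumes S: "0 < S1" "0 < S2" "0 < S3"
    and E: "0 < 2 * (S1 * S2 + S1 * S3 + S2 * S3) - S1\<^sup>2 - S2\<^sup>2 - S3\<^sup>2 + 4 * S1 * S2 * S3"
    and d: "d1 \<noteq> 0 \<or> d2 \<noteq> 0 \<or> d3 \<noteq> 0"
  shows "0 < (d1 + d2 + d3)\<^sup>2 + S1 * ((d1 + d2 + d3)\<^sup>2 - 2 * d2 * d3)
     + S2 * ((d1 + d2 + d3)\<^sup>2 - 2 * d1 * d3) + S3 * ((d1 + d2 + d3)\<^sup>2 - 2 * d1 * d2)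
     + S2 * S3 * (d2 + d3)\<^sup>2 + S1 * S3 * (d1 + d3)\<^sup>2 + S1 * S2 * (d1 + d2)\<^sup>2" (is "0 < ?Q")
proof -
  let ?C1 = "1 + S1" and ?C2 = "1 + S2" and ?C3 = "1 + S3"
  let ?a = "?C1 * (?C2 + ?C3 - 1)" and ?b = "?C2 * (?C1 + ?C3 - 1)" and ?c = "?C3 * (?C1 + ?C2 - 1)"
  let ?f = "?C2 * ?C3" and ?g = "?C1 * ?C3" and ?h = "?C1 * ?C2"
  have Q: "?Q = ?a * d1\<^sup>2 + ?b * d2\<^sup>2 + ?c * d3\<^sup>2 + 2 * ?f * d2 * d3 + 2 * ?g * d1 * d3 + 2 * ?h * d1 * d2"
    by (simp add: power2_eq_square algebra_simps)
  have m2: "?a * ?b - ?h\<^sup>2 = ?C1 * ?C2 * (S3 * (2 + S1 + S2 + S3))"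
    by (simp add: power2_eq_square algebra_simps)
  \<comment> \<open>Pulling c1 * c2 * c3 out of the determinant before substituting 1 + S keeps the
    identity \<open>m3\<close> small.\<close>
  have factor: "(c1 * p1) * (c2 * p2) * (c3 * p3) + 2 * (c2 * c3) * (c1 * c3) * (c1 * c2)
      - (c1 * p1) * (c2 * c3)\<^sup>2 - (c2 * p2) * (c1 * c3)\<^sup>2 - (c3 * p3) * (c1 * c2)\<^sup>2
      = c1 * c2 * c3 * (p1 * p2 * p3 + 2 * c1 * c2 * c3 - p1 * c2 * c3 - p2 * c1 * c3 - p3 * c1 * c2)"
    for c1 c2 c3 p1 p2 p3 :: real
    by (simp add: power2_eq_square algebra_simps)
  have m3: "?a * ?b * ?c + 2 * ?f * ?g * ?h - ?a * ?f\<^sup>2 - ?b * ?g\<^sup>2 - ?c * ?h\<^sup>2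
      = ?C1 * ?C2 * ?C3 * (2 * (S1 * S2 + S1 * S3 + S2 * S3) - S1\<^sup>2 - S2\<^sup>2 - S3\<^sup>2 + 4 * S1 * S2 * S3)"
    unfolding factor by (rule arg_cong2[where f = "(*)", OF refl]) (simp add: power2_eq_square algebra_simps)
  have "0 < ?C1 * ?C2 * (S3 * (2 + S1 + S2 + S3))" using S by (intro mult_pos_pos add_pos_pos) auto
  then have h: "?h\<^sup>2 < ?a * ?b" unfolding m2[symmetric] by (simp only: diff_gt_0_iff_gt)
  have "0 < ?C1 * ?C2 * ?C3 * (2 * (S1 * S2 + S1 * S3 + S2 * S3) - S1\<^sup>2 - S2\<^sup>2 - S3\<^sup>2 + 4 * S1 * S2 * S3)"
    using S by (intro mult_pos_pos[OF _ E] mult_pos_pos add_pos_pos) auto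
  then have f: "0 < ?a * ?b * ?c + 2 * ?f * ?g * ?h - ?a * ?f\<^sup>2 - ?b * ?g\<^sup>2 - ?c * ?h\<^sup>2"
    by (simp only: m3)
  have a: "0 < ?a" using S by (intro mult_pos_pos) auto
  show ?thesis
    unfolding Q by (rule quadratic_form_3_pos[OF a h f d])
qed

text \<open>The Hessian of the triangle functional in the variables \<open>x\<^sub>i = cot \<psi>\<^sub>i\<close>: dividing by
  \<open>y\<^sub>1 y\<^sub>2 y\<^sub>3 / D\<close> and setting \<open>S\<^sub>k = D y\<^sub>k / (y\<^sub>1 y\<^sub>2 y\<^sub>3)\<close> gives the form of \<open>hessian_core_pos\<close>.\<close>

lemma hessian_cot_pos:
  fixes x1 x2 x3 :: real
  defines "D \<equiv> 1 - (x1 * x2 + x1 * x3 + x2 * x3)"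
  assumes D: "0 < D" and y: "0 < x2 + x3" "0 < x1 + x3" "0 < x1 + x2"
    and d: "d1 \<noteq> 0 \<or> d2 \<noteq> 0 \<or> d3 \<noteq> 0"
  shows "0 < (x1 + x2 + x3 + (x2 + x3) * (x1 + x3) * (x1 + x2) / D) * (d1 + d2 + d3)\<^sup>2
     + x1 * d1\<^sup>2 + x2 * d2\<^sup>2 + x3 * d3\<^sup>2
     + (1 - x2 * x3) / (x2 + x3) * (d2 + d3)\<^sup>2 + (1 - x1 * x3) / (x1 + x3) * (d1 + d3)\<^sup>2
     + (1 - x1 * x2) / (x1 + x2) * (d1 + d2)\<^sup>2" (is "0 < ?Q")
proof -
  define y1 y2 y3 where yd: "y1 = x2 + x3" "y2 = x1 + x3" "y3 = x1 + x2"
  have yp: "0 < y1" "0 < y2" "0 < y3" using y yd by auto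
  define P where "P = y1 * y2 * y3"
  have P: "0 < P" unfolding P_def using yp by (intro mult_pos_pos) auto
  define S1 S2 S3 where Sd: "S1 = D / (y2 * y3)" "S2 = D / (y1 * y3)" "S3 = D / (y1 * y2)"
  have Sp: "0 < S1" "0 < S2" "0 < S3" unfolding Sd using D yp by auto
  have PS: "P * S1 = D * y1" "P * S2 = D * y2" "P * S3 = D * y3"
    unfolding P_def Sd using yp by auto
  define E where "E = 2 * (S1 * S2 + S1 * S3 + S2 * S3) - S1\<^sup>2 - S2\<^sup>2 - S3\<^sup>2 + 4 * S1 * S2 * S3"
  \<comment> \<open>D in terms of the pairwise sums y. This relation collapses P^2 * E to 4 * D^2
    and so yields the determinant condition of \<open>hessian_core_pos\<close>.\<close>
  have D_y: "4 * D = 4 - (2 * (y1 * y2 + y1 * y3 + y2 * y3) - y1\<^sup>2 - y2\<^sup>2 - y3\<^sup>2)"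
    unfolding D_def yd by (simp add: power2_eq_square algebra_simps)
  have "P\<^sup>2 * E = 2 * ((P*S1) * (P*S2) + (P*S1) * (P*S3) + (P*S2) * (P*S3)) - (P*S1)\<^sup>2 - (P*S2)\<^sup>2 - (P*S3)\<^sup>2
      + 4 * (P*S1) * (P*S2) * S3"
    unfolding E_def by (simp add: power2_eq_square algebra_simps)
  also have "\<dots> = D\<^sup>2 * (2 * (y1 * y2 + y1 * y3 + y2 * y3) - y1\<^sup>2 - y2\<^sup>2 - y3\<^sup>2 + 4 * (y1 * y2 * S3))"
    unfolding PS by (simp add: power2_eq_square algebra_simps)
  also have "y1 * y2 * S3 = D" using yp unfolding Sd by simp
  also have "D\<^sup>2 * (2 * (y1 * y2 + y1 * y3 + y2 * y3) - y1\<^sup>2 - y2\<^sup>2 - y3\<^sup>2 + 4 * D) = 4 * D\<^sup>2"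
    unfolding D_y by (simp add: algebra_simps)
  finally have "P\<^sup>2 * E = 4 * D\<^sup>2" .
  moreover have "0 < 4 * D\<^sup>2" using D by simp
  ultimately have Ep: "0 < E" by (metis zero_less_mult_pos P zero_less_power)
  have k: "(1 - x2 * x3) / (x2 + x3) = D / y1 + x1" "(1 - x1 * x3) / (x1 + x3) = D / y2 + x2"
    "(1 - x1 * x2) / (x1 + x2) = D / y3 + x3"
    using yp unfolding yd D_def by (simp_all add: field_simps)
  have SS: "P * (S2 * S3) = D * (D / y1)" "P * (S1 * S3) = D * (D / y2)" "P * (S1 * S2) = D * (D / y3)"
    unfolding P_def Sd using yp by (auto simp: field_simps)
  let ?R = "(d1 + d2 + d3)\<^sup>2 + S1 * ((d1 + d2 + d3)\<^sup>2 - 2 * d2 * d3)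
     + S2 * ((d1 + d2 + d3)\<^sup>2 - 2 * d1 * d3) + S3 * ((d1 + d2 + d3)\<^sup>2 - 2 * d1 * d2)
     + S2 * S3 * (d2 + d3)\<^sup>2 + S1 * S3 * (d1 + d3)\<^sup>2 + S1 * S2 * (d1 + d2)\<^sup>2"
  have "0 < P * ?R"
    by (intro mult_pos_pos[OF P] hessian_core_pos Sp d Ep[unfolded E_def])
  also have "P * ?R = P * (d1 + d2 + d3)\<^sup>2 + (P * S1) * ((d1 + d2 + d3)\<^sup>2 - 2 * d2 * d3)
     + (P * S2) * ((d1 + d2 + d3)\<^sup>2 - 2 * d1 * d3) + (P * S3) * ((d1 + d2 + d3)\<^sup>2 - 2 * d1 * d2)
     + (P * (S2 * S3)) * (d2 + d3)\<^sup>2 + (P * (S1 * S3)) * (d1 + d3)\<^sup>2 + (P * (S1 * S2)) * (d1 + d2)\<^sup>2"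
    by (simp add: algebra_simps)
  also have "\<dots> = D * (P / D * (d1 + d2 + d3)\<^sup>2 + y1 * ((d1 + d2 + d3)\<^sup>2 - 2 * d2 * d3)
     + y2 * ((d1 + d2 + d3)\<^sup>2 - 2 * d1 * d3) + y3 * ((d1 + d2 + d3)\<^sup>2 - 2 * d1 * d2)
     + D / y1 * (d2 + d3)\<^sup>2 + D / y2 * (d1 + d3)\<^sup>2 + D / y3 * (d1 + d2)\<^sup>2)"
    unfolding PS SS using D by (simp only: distrib_left) (simp add: mult.assoc)
  also have "P / D * (d1 + d2 + d3)\<^sup>2 + y1 * ((d1 + d2 + d3)\<^sup>2 - 2 * d2 * d3)
     + y2 * ((d1 + d2 + d3)\<^sup>2 - 2 * d1 * d3) + y3 * ((d1 + d2 + d3)\<^sup>2 - 2 * d1 * d2)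
     + D / y1 * (d2 + d3)\<^sup>2 + D / y2 * (d1 + d3)\<^sup>2 + D / y3 * (d1 + d2)\<^sup>2 = ?Q"
    unfolding k P_def[unfolded yd, symmetric] unfolding yd
    by (simp add: power2_eq_square algebra_simps)
  finally show ?thesis using D by (simp add: zero_less_mult_iff)
qed

text \<open>Since ln (sin x) has derivative cot x, this is the second derivative of the triangle
  functional at (a, b, c) in direction d; the assumptions place (a, b, c) in the domain of
  nondegenerate triangles. The addition theorems turn all seven cotangents into rational functions
  of cot a, cot b and cot c.\<close>

lemma hessian_angles_pos:
  fixes a b c :: real
  assumes "0 < a" "0 < b" "0 < c" "pi < a + b + c" "b + c < pi" "a + c < pi" "a + b < pi"
    and d: "d1 \<noteq> 0 \<or> d2 \<noteq> 0 \<or> d3 \<noteq> 0"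
  shows "0 < cot (a + b + c - pi) * (d1 + d2 + d3)\<^sup>2 + cot a * d1\<^sup>2 + cot b * d2\<^sup>2 + cot c * d3\<^sup>2
    + cot (pi - b - c) * (d2 + d3)\<^sup>2 + cot (pi - a - c) * (d1 + d3)\<^sup>2 + cot (pi - a - b) * (d1 + d2)\<^sup>2"
proof -
  have s: "0 < sin a" "0 < sin b" "0 < sin c" using assms by (auto intro!: sin_gt_zero)
  have s2: "0 < sin (b + c)" "0 < sin (a + c)" "0 < sin (a + b)" using assms by (auto intro!: sin_gt_zero)
  have s3: "0 < sin (a + b + c - pi)" using assms by (intro sin_gt_zero) auto
  have y: "cot u + cot v = sin (u + v) / (sin u * sin v)"
    and z: "cot (pi - u - v) = (1 - cot u * cot v) / (cot u + cot v)"
    if "0 < sin u" "0 < sin v" "0 < sin (u + v)" for u v :: real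
  proof -
    show y: "cot u + cot v = sin (u + v) / (sin u * sin v)"
      using that by (simp add: cot_def sin_add field_simps)
    have "1 - cot u * cot v = - cos (u + v) / (sin u * sin v)"
      using that by (simp add: cot_def cos_add field_simps)
    moreover have "cot (pi - u - v) = - cos (u + v) / sin (u + v)"
      by (simp add: cot_def sin_diff cos_diff sin_add cos_add)
    ultimately show "cot (pi - u - v) = (1 - cot u * cot v) / (cot u + cot v)"
      unfolding y using that by simp
  qed
  let ?x = "cot a" and ?y = "cot b" and ?z = "cot c"
  let ?D = "1 - (?x * ?y + ?x * ?z + ?y * ?z)"
  have Ds: "?D * (sin a * sin b * sin c) = sin (a + b + c - pi)"
    using s by (simp add: cot_def sin_diff sin_add cos_add field_simps)
  then have D: "0 < ?D" using s3 s by (metis mult_pos_pos zero_less_mult_pos2)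
  have Cs: "(?x + ?y + ?z - ?x * ?y * ?z) * (sin a * sin b * sin c) = cos (a + b + c - pi)"
    using s by (simp add: cot_def cos_diff sin_add cos_add field_simps)
  have "cot (a + b + c - pi) = (?x + ?y + ?z - ?x * ?y * ?z) / ?D"
    unfolding cot_def Ds[unfolded cot_def, symmetric] Cs[unfolded cot_def, symmetric] using s by simp
  also have "\<dots> = ?x + ?y + ?z + (?y + ?z) * (?x + ?z) * (?x + ?y) / ?D"
    using D by (simp add: field_simps)
  finally have cs: "cot (a + b + c - pi) = ?x + ?y + ?z + (?y + ?z) * (?x + ?z) * (?x + ?y) / ?D" .
  have yp: "0 < ?y + ?z" "0 < ?x + ?z" "0 < ?x + ?y"
    using s s2 by (simp_all add: y)
  show ?thesis
    unfolding cs z[OF s(2,3) s2(1)] z[OF s(1,3) s2(2)] z[OF s(1,2) s2(3)]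
    by (rule hessian_cot_pos[OF D yp d])
qed

text \<open>Grouping by angles shows that \<open>tri_grad\<close> is the gradient of a sum of
  primitives of ln (sin x), evaluated at the excess, the three \<psi> and the three angles.\<close>

lemma tri_grad_inner:
  "(\<Sum>i\<in>UNIV. tri_grad x i * d i) = ln (sin (tri_excess x)) * (\<Sum>i\<in>UNIV. d i)
     + (\<Sum>i\<in>UNIV. ln (sin (x i)) * d i) - (\<Sum>i\<in>UNIV. ln (sin (tri_ang x i)) * (d (i + 1) + d (i + 2)))"
proof -
  fix j :: 3
  show ?thesis by (simp add: tri_grad_def sum_cyc3[of _ j] cyc3 algebra_simps)
qed

lemma tri_excess_line: "tri_excess (\<lambda>i. x i + e * d i) = tri_excess x + e * (\<Sum>i\<in>UNIV. d i)"
  by (simp add: tri_excess_def sum.distrib sum_distrib_left)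

lemma tri_ang_line: "tri_ang (\<lambda>i. x i + e * d i) i = tri_ang x i - e * (d (i + 1) + d (i + 2))"
  by (simp add: tri_ang_def algebra_simps)

lemma tri_dom_convex:
  assumes "tri_dom x" "tri_dom y" "0 \<le> e" "e \<le> 1"
  shows "tri_dom (\<lambda>i. x i + e * (y i - x i))"
proof -
  have *: "0 < u + e * (v - u)" if "0 < u" "0 < v" for u v :: real
  proof -
    have "u + e * (v - u) = (1 - e) * u + e * v" by (simp add: algebra_simps)
    also have "\<dots> > 0"
    proof (cases "e = 0")
      case False
      then have "0 < e * v" using assms that by simp
      moreover have "0 \<le> (1 - e) * u" using assms that by simp
      ultimately show ?thesis by linarith
    qed (use that in simp)
    finally show ?thesis .
  qed
  have "tri_excess (\<lambda>i. x i + e * (y i - x i)) = tri_excess x + e * (tri_excess y - tri_excess x)"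
    by (simp add: tri_excess_line) (simp add: tri_excess_def sum_subtractf)
  moreover have "tri_ang (\<lambda>i. x i + e * (y i - x i)) j = tri_ang x j + e * (tri_ang y j - tri_ang x j)" for j
    by (simp add: tri_ang_def algebra_simps)
  ultimately show ?thesis using assms(1,2) * by (simp add: tri_dom_def)
qed

text \<open>Strict convexity, phrased for the gradient so that uniqueness can be derived without
  integrating: along the segment from x to y the gradient paired with the direction has the positive
  Hessian form as derivative, and the mean value theorem applies.\<close>

lemma tri_grad_strict_mono:
  assumes x: "tri_dom x" and y: "tri_dom y" and ne: "x \<noteq> y"
  shows "0 < (\<Sum>i\<in>UNIV. (tri_grad y i - tri_grad x i) * (y i - x i))"
proof -
  define d where "d = (\<lambda>i. y i - x i)"
  define \<gamma> where "\<gamma> e = (\<lambda>i. x i + e * d i)" for e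
  have dom: "tri_dom (\<gamma> e)" if "0 \<le> e" "e \<le> 1" for e
    unfolding \<gamma>_def d_def using tri_dom_convex[OF x y that] .
  define \<sigma> where "\<sigma> = (\<Sum>i\<in>UNIV. d i)"
  define q where "q e = cot (tri_excess (\<gamma> e)) * \<sigma>\<^sup>2 + (\<Sum>i\<in>UNIV. cot (\<gamma> e i) * (d i)\<^sup>2)
     + (\<Sum>i\<in>UNIV. cot (tri_ang (\<gamma> e) i) * (d (i + 1) + d (i + 2))\<^sup>2)" for e
  have L: "((\<lambda>e. ln (sin (p + e * r)) * r) has_real_derivative cot (p + e * r) * r\<^sup>2) (at e)"
    if "0 < sin (p + e * r)" for p r e :: real
    using that by (auto intro!: derivative_eq_intros simp: cot_def power2_eq_square field_simps)
  have der: "((\<lambda>e. \<Sum>i\<in>UNIV. tri_grad (\<gamma> e) i * d i) has_real_derivative q e) (at e)"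
    if "0 \<le> e" "e \<le> 1" for e
  proof -
    note sp = tri_dom_sin_pos[OF dom[OF that]]
    have "((\<lambda>e. ln (sin (tri_excess (\<gamma> e))) * \<sigma>) has_real_derivative cot (tri_excess (\<gamma> e)) * \<sigma>\<^sup>2) (at e)"
      using L[of "tri_excess x" e \<sigma>] sp(1) unfolding \<gamma>_def tri_excess_line \<sigma>_def by simp
    moreover have "((\<lambda>e. \<Sum>i\<in>UNIV. ln (sin (\<gamma> e i)) * d i) has_real_derivative (\<Sum>i\<in>UNIV. cot (\<gamma> e i) * (d i)\<^sup>2)) (at e)"
      using L[of "x i" e "d i" for i] sp(3) unfolding \<gamma>_def by (intro DERIV_sum) auto
    moreover have "((\<lambda>e. \<Sum>i\<in>UNIV. ln (sin (tri_ang (\<gamma> e) i)) * - (d (i + 1) + d (i + 2))) has_real_derivative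
       (\<Sum>i\<in>UNIV. cot (tri_ang (\<gamma> e) i) * (- (d (i + 1) + d (i + 2)))\<^sup>2)) (at e)"
    proof (intro DERIV_sum)
      fix i :: 3
      have *: "tri_ang (\<gamma> e) i = tri_ang x i + e * (- (d (i + 1) + d (i + 2)))" for e
        unfolding \<gamma>_def tri_ang_line by (simp add: algebra_simps)
      show "((\<lambda>e. ln (sin (tri_ang (\<gamma> e) i)) * - (d (i + 1) + d (i + 2))) has_real_derivative
        cot (tri_ang (\<gamma> e) i) * (- (d (i + 1) + d (i + 2)))\<^sup>2) (at e)"
        using L[of "tri_ang x i" e "- (d (i + 1) + d (i + 2))"] sp(2)[of i] unfolding * .
    qed
    ultimately have "((\<lambda>e. ln (sin (tri_excess (\<gamma> e))) * \<sigma> + (\<Sum>i\<in>UNIV. ln (sin (\<gamma> e i)) * d i)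
       + (\<Sum>i\<in>UNIV. ln (sin (tri_ang (\<gamma> e) i)) * - (d (i + 1) + d (i + 2)))) has_real_derivative
        cot (tri_excess (\<gamma> e)) * \<sigma>\<^sup>2 + (\<Sum>i\<in>UNIV. cot (\<gamma> e i) * (d i)\<^sup>2) +
        (\<Sum>i\<in>UNIV. cot (tri_ang (\<gamma> e) i) * (- (d (i + 1) + d (i + 2)))\<^sup>2)) (at e)"
      by (intro DERIV_add)
    then show ?thesis
      unfolding q_def tri_grad_inner \<sigma>_def
      by (simp only: mult_minus_right sum_negf power2_minus add_uminus_conv_diff)
  qed
  have qpos: "0 < q e" if "0 \<le> e" "e \<le> 1" for e
  proof -
    note D = dom[OF that]
    have nz: "d 1 \<noteq> 0 \<or> d 2 \<noteq> 0 \<or> d 3 \<noteq> 0"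
    proof (rule ccontr)
      assume "\<not> ?thesis"
      then have "y i = x i" for i using exhaust_3[of i] by (auto simp: d_def)
      then show False using ne by auto
    qed
    have [simp]: "(4::3) = 1" "(5::3) = 2" by auto
    have a: "tri_excess (\<gamma> e) = \<gamma> e 1 + \<gamma> e 2 + \<gamma> e 3 - pi"
      "tri_ang (\<gamma> e) 1 = pi - \<gamma> e 2 - \<gamma> e 3" "tri_ang (\<gamma> e) 2 = pi - \<gamma> e 1 - \<gamma> e 3"
      "tri_ang (\<gamma> e) 3 = pi - \<gamma> e 1 - \<gamma> e 2"
      by (simp_all add: tri_excess_def tri_ang_def sum_cyc3[of _ 1])
    have "0 < cot (tri_excess (\<gamma> e)) * (d 1 + d 2 + d 3)\<^sup>2
       + cot (\<gamma> e 1) * (d 1)\<^sup>2 + cot (\<gamma> e 2) * (d 2)\<^sup>2 + cot (\<gamma> e 3) * (d 3)\<^sup>2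
       + cot (tri_ang (\<gamma> e) 1) * (d 2 + d 3)\<^sup>2 + cot (tri_ang (\<gamma> e) 2) * (d 1 + d 3)\<^sup>2
       + cot (tri_ang (\<gamma> e) 3) * (d 1 + d 2)\<^sup>2"
      unfolding a
      by (rule hessian_angles_pos[OF _ _ _ _ _ _ _ nz])
        (use tri_dom_bounds(1)[OF D] tri_dom_bounds(3,5)[OF D, of 1] tri_dom_bounds(3,5)[OF D, of 2]
          tri_dom_bounds(3,5)[OF D, of 3] a in linarith)+
    also have "\<dots> = q e"
      unfolding q_def \<sigma>_def by (simp add: sum_cyc3[of _ 1] add_ac)
    finally show ?thesis .
  qed
  obtain \<xi> where \<xi>: "0 < \<xi>" "\<xi> < 1"
    "(\<Sum>i\<in>UNIV. tri_grad (\<gamma> 1) i * d i) - (\<Sum>i\<in>UNIV. tri_grad (\<gamma> 0) i * d i) = (1 - 0) * q \<xi>"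
    using MVT2[of 0 1 "\<lambda>e. \<Sum>i\<in>UNIV. tri_grad (\<gamma> e) i * d i" q] der by auto
  have "\<gamma> 1 = y" "\<gamma> 0 = x" by (auto simp: \<gamma>_def d_def)
  then have "(\<Sum>i\<in>UNIV. (tri_grad y i - tri_grad x i) * (y i - x i)) = q \<xi>"
    using \<xi>(3) by (simp add: d_def left_diff_distrib sum_subtractf)
  then show ?thesis using qpos[of \<xi>] \<xi> by simp
qed

section \<open>Solving the angle equations: linear duality and minimisation\<close>

section \<open>Side pairings and angle systems\<close>

text \<open>The index type may be infinite, so the coordinates outside S are frozen at 0; the set is
  then a product of compact intervals and points, and Tychonoff's theorem applies.\<close>

lemma compact_coordinate_box:
  fixes a b :: "'p \<Rightarrow> real"
  shows "compact {x. (\<forall>p\<in>S. a p \<le> x p \<and> x p \<le> b p) \<and> (\<forall>p. p \<notin> S \<longrightarrow> x p = 0)}"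
proof -
  have "{x. (\<forall>p\<in>S. a p \<le> x p \<and> x p \<le> b p) \<and> (\<forall>p. p \<notin> S \<longrightarrow> x p = 0)}
    = PiE UNIV (\<lambda>p. if p \<in> S then {a p..b p} else {0})"
    by (auto simp: PiE_iff split: if_splits)
  moreover have "compactin (product_topology (\<lambda>_. euclidean) UNIV)
     (PiE UNIV (\<lambda>p. if p \<in> S then {a p..b p} else {0}))"
    by (auto simp: compactin_PiE)
  ultimately show ?thesis by (simp add: euclidean_product_topology)
qed

text \<open>Of the surface, the variational argument sees only which sides carry the same edge. Both
  sides of an edge may belong to one triangle, hence the count of pairs (triangle, side).\<close>

locale side_pairing =
  fixes T :: "'t set" and ed :: "'t \<Rightarrow> 3 \<Rightarrow> 'e"
  assumes finite_T: "finite T"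
    and two_sides: "\<And>t i. t \<in> T \<Longrightarrow> card {(t', j). t' \<in> T \<and> ed t' j = ed t i} = 2"
begin

definition sides :: "('t \<times> 3) set" where
  "sides = T \<times> UNIV"

definition edge_at :: "'t \<times> 3 \<Rightarrow> 'e" where
  "edge_at p = ed (fst p) (snd p)"

definition opp :: "'t \<times> 3 \<Rightarrow> 't \<times> 3" where
  "opp p = (THE q. q \<in> sides \<and> q \<noteq> p \<and> edge_at q = edge_at p)"

lemma finite_sides: "finite sides"
  unfolding sides_def using finite_T by simp

lemma mem_sides: "(t, i) \<in> sides \<longleftrightarrow> t \<in> T"
  by (simp add: sides_def)

lemma card_sides_of_edge:
  assumes "p \<in> sides"
  shows "card {q \<in> sides. edge_at q = edge_at p} = 2"
proof -
  have "{q \<in> sides. edge_at q = edge_at p} = {(t', j). t' \<in> T \<and> ed t' j = ed (fst p) (snd p)}"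
  proof (rule set_eqI)
    fix q show "q \<in> {q \<in> sides. edge_at q = edge_at p} \<longleftrightarrow> q \<in> {(t', j). t' \<in> T \<and> ed t' j = ed (fst p) (snd p)}"
      by (cases q) (simp add: sides_def edge_at_def)
  qed
  then show ?thesis using two_sides[of "fst p" "snd p"] assms
    by (cases p) (simp add: sides_def)
qed

lemma opp_ex1:
  assumes "p \<in> sides"
  shows "\<exists>!q. q \<in> sides \<and> q \<noteq> p \<and> edge_at q = edge_at p"
proof -
  obtain a b where ab: "{q \<in> sides. edge_at q = edge_at p} = {a, b}" "a \<noteq> b"
    using card_sides_of_edge[OF assms] by (metis card_2_iff)
  have mem: "q \<in> sides \<and> edge_at q = edge_at p \<longleftrightarrow> q = a \<or> q = b" for q
    using arg_cong[OF ab(1), of "\<lambda>A. q \<in> A"] by simp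
  then have "p = a \<or> p = b" using assms by metis
  then show ?thesis using mem ab(2) by metis
qed

lemma opp_props:
  assumes "p \<in> sides"
  shows "opp p \<in> sides" "opp p \<noteq> p" "edge_at (opp p) = edge_at p" "opp (opp p) = p"
    and opp_cases: "q \<in> sides \<Longrightarrow> edge_at q = edge_at p \<Longrightarrow> q = p \<or> q = opp p"
proof -
  have *: "opp p \<in> sides \<and> opp p \<noteq> p \<and> edge_at (opp p) = edge_at p"
    unfolding opp_def by (rule theI'[OF opp_ex1[OF assms]])
  then show 1: "opp p \<in> sides" "opp p \<noteq> p" "edge_at (opp p) = edge_at p" by metis+
  have **: "opp (opp p) \<in> sides \<and> opp (opp p) \<noteq> opp p \<and> edge_at (opp (opp p)) = edge_at (opp p)"
    unfolding opp_def[of "opp p"] by (rule theI'[OF opp_ex1[OF 1(1)]])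
  show "opp (opp p) = p" using opp_ex1[OF 1(1)] ** 1 assms by metis
  show "q = p \<or> q = opp p" if "q \<in> sides" "edge_at q = edge_at p"
    using opp_ex1[OF assms] that 1 by metis
qed

lemma sum_opp: "(\<Sum>p\<in>sides. f (opp p)) = (\<Sum>p\<in>sides. f p)"
  by (rule sum.reindex_bij_witness[of _ opp opp]) (simp_all add: opp_props)

lemma sum_sides: "(\<Sum>p\<in>sides. f p) = (\<Sum>t\<in>T. \<Sum>i\<in>UNIV. f (t, i))"
  unfolding sides_def by (simp add: sum.cartesian_product)

lemma sum_sides_sym:
  fixes f :: "'t \<times> 3 \<Rightarrow> real"
  shows "(\<Sum>p\<in>sides. f p) = (\<Sum>p\<in>sides. f p + f (opp p)) / 2"
  by (simp add: sum.distrib sum_opp)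

definition all_edges :: "'t set \<Rightarrow> 'e set" where
  "all_edges S = {ed t i |t i. t \<in> S}"

lemma all_edges_T: "all_edges T = edge_at ` sides"
proof (rule set_eqI)
  fix e show "e \<in> all_edges T \<longleftrightarrow> e \<in> edge_at ` sides"
    by (simp add: all_edges_def edge_at_def sides_def image_iff Bex_def conj_commute)
qed

lemma finite_all_edges: "S \<subseteq> T \<Longrightarrow> finite (all_edges S)"
  by (rule finite_subset[OF _ finite_imageI[OF finite_sides, of edge_at, unfolded all_edges_T[symmetric]]])
    (auto simp: all_edges_def)

lemma sum_sides_edges:
  fixes f :: "'e \<Rightarrow> real"
  shows "(\<Sum>p\<in>sides. f (edge_at p)) = 2 * (\<Sum>e\<in>all_edges T. f e)"
proof -
  have "(\<Sum>p\<in>sides. f (edge_at p)) = (\<Sum>e\<in>edge_at ` sides. \<Sum>p | p \<in> sides \<and> edge_at p = e. f (edge_at p))"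
    by (rule sum.image_gen[OF finite_sides])
  also have "\<dots> = (\<Sum>e\<in>edge_at ` sides. 2 * f e)"
  proof (rule sum.cong[OF refl])
    fix e assume "e \<in> edge_at ` sides"
    then obtain p where p: "p \<in> sides" "e = edge_at p" by (rule imageE)
    have "(\<Sum>q | q \<in> sides \<and> edge_at q = e. f (edge_at q)) = (\<Sum>q | q \<in> sides \<and> edge_at q = e. f e)"
      by (rule sum.cong) simp_all
    also have "\<dots> = 2 * f e" using card_sides_of_edge[OF p(1)] p(2) by simp
    finally show "(\<Sum>q | q \<in> sides \<and> edge_at q = e. f (edge_at q)) = 2 * f e" .
  qed
  finally show ?thesis by (simp add: all_edges_T sum_distrib_left)
qed

text \<open>The angles \<open>\<psi>\<close> are in the coordinates of \<open>tri_ang\<close>; \<open>balanced\<close> says that glued sides have the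
  same length.\<close>

definition angle_system :: "('e \<Rightarrow> real) \<Rightarrow> ('t \<times> 3 \<Rightarrow> real) \<Rightarrow> bool" where
  "angle_system \<theta> \<psi> \<longleftrightarrow> (\<forall>t\<in>T. tri_dom (\<lambda>i. \<psi> (t, i))) \<and>
     (\<forall>p\<in>sides. \<psi> p + \<psi> (opp p) = \<theta> (edge_at p))"

definition side_grad :: "('t \<times> 3 \<Rightarrow> real) \<Rightarrow> 't \<times> 3 \<Rightarrow> real" where
  "side_grad \<psi> p = tri_grad (\<lambda>i. \<psi> (fst p, i)) (snd p)"

definition balanced :: "('t \<times> 3 \<Rightarrow> real) \<Rightarrow> bool" where
  "balanced \<psi> \<longleftrightarrow> (\<forall>p\<in>sides. side_grad \<psi> (opp p) = side_grad \<psi> p)"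

text \<open>The difference of two solutions changes sign under \<open>opp\<close> while their
  gradients are invariant, so the sum over all sides of gradient difference times difference
  vanishes. By strict monotonicity each triangle contributes a nonnegative amount, and a positive
  one unless both solutions agree on it.\<close>

theorem balanced_angle_system_unique:
  assumes x: "angle_system \<theta> x" "balanced x" and y: "angle_system \<theta> y" "balanced y" and t: "t \<in> T"
  shows "x (t, i) = y (t, i)"
proof -
  define w where "w p = (side_grad y p - side_grad x p) * (y p - x p)" for p
  have "w (opp p) = - w p" if p: "p \<in> sides" for p
  proof -
    have "x p + x (opp p) = \<theta> (edge_at p)" "y p + y (opp p) = \<theta> (edge_at p)"
      using x(1) y(1) p unfolding angle_system_def by blast+
    then have e: "y (opp p) - x (opp p) = - (y p - x p)" by linarith
    have g: "side_grad x (opp p) = side_grad x p" "side_grad y (opp p) = side_grad y p"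
      using x(2) y(2) p unfolding balanced_def by blast+
    show ?thesis unfolding w_def e g by (rule mult_minus_right)
  qed
  then have "(\<Sum>p\<in>sides. w p) = 0" by (subst sum_sides_sym) simp
  then have s0: "(\<Sum>t\<in>T. \<Sum>i\<in>UNIV. w (t, i)) = 0" by (simp add: sum_sides)
  have pos: "0 < (\<Sum>i\<in>UNIV. w (t, i))" if "t \<in> T" "(\<lambda>i. x (t, i)) \<noteq> (\<lambda>i. y (t, i))" for t
    using tri_grad_strict_mono[OF _ _ that(2)] that(1) x(1) y(1)
    unfolding angle_system_def w_def side_grad_def by simp
  have nn: "0 \<le> (\<Sum>i\<in>UNIV. w (t, i))" if "t \<in> T" for t
  proof (cases "(\<lambda>i. x (t, i)) = (\<lambda>i. y (t, i))")
    case True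
    then have "w (t, i) = 0" for i unfolding w_def by (metis diff_self mult_zero_right)
    then show ?thesis by simp
  qed (use pos that in force)
  have "(\<Sum>i\<in>UNIV. w (t, i)) = 0"
    using s0 t by (subst (asm) sum_nonneg_eq_0_iff[OF finite_T nn]) simp_all
  then have "(\<lambda>i. x (t, i)) = (\<lambda>i. y (t, i))" using pos[OF t] by force
  then show ?thesis by metis
qed

section \<open>Existence of angle systems\<close>

text \<open>Discrete layer-cake argument: subtract the smallest positive value of \<open>m\<close> from \<open>m\<close> on its
  support.\<close>

lemma layer_cake:
  assumes "\<And>S. S \<subseteq> T \<Longrightarrow> S \<noteq> {} \<Longrightarrow> pi * real (card S) \<le> (\<Sum>e\<in>all_edges S. \<eta> e)"
    and \<eta>: "\<And>e. e \<in> all_edges T \<Longrightarrow> 0 \<le> \<eta> e"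
    and "\<And>t. t \<in> T \<Longrightarrow> 0 \<le> m t" "\<And>e. e \<in> all_edges T \<Longrightarrow> 0 \<le> w e"
    and "\<And>t i. t \<in> T \<Longrightarrow> m t \<le> w (ed t i)"
  shows "pi * (\<Sum>t\<in>T. m t) \<le> (\<Sum>e\<in>all_edges T. \<eta> e * w e)"
  using assms(3-5)
proof (induction "card {t \<in> T. 0 < m t}" arbitrary: m w rule: less_induct)
  case less
  define S where "S = {t \<in> T. 0 < m t}"
  have ST: "S \<subseteq> T" and fS: "finite S" using finite_T by (auto simp: S_def)
  show ?case
  proof (cases "S = {}")
    case True
    then have "m t = 0" if "t \<in> T" for t using less.prems(1)[OF that] that by (force simp: S_def)
    then have "pi * (\<Sum>t\<in>T. m t) = 0" by simp
    also have "\<dots> \<le> (\<Sum>e\<in>all_edges T. \<eta> e * w e)"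
      using \<eta> less.prems(2) by (intro sum_nonneg mult_nonneg_nonneg) auto
    finally show ?thesis .
  next
    case False
    define \<mu> where "\<mu> = Min (m ` S)"
    have "\<mu> \<in> m ` S" unfolding \<mu>_def using fS False by (intro Min_in) auto
    then obtain t0 where t0: "t0 \<in> S" "m t0 = \<mu>" by auto
    have mu_le: "\<mu> \<le> m t" if "t \<in> S" for t unfolding \<mu>_def using fS that by simp
    have mu_pos: "0 < \<mu>" using t0 by (auto simp: S_def)
    define m' where "m' t = (if t \<in> S then m t - \<mu> else m t)" for t
    define w' where "w' e = (if e \<in> all_edges S then w e - \<mu> else w e)" for e
    have 1: "0 \<le> m' t" if "t \<in> T" for t
      using less.prems(1)[OF that] mu_le[of t] by (simp add: m'_def)
    have 2: "0 \<le> w' e" if "e \<in> all_edges T" for e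
    proof (cases "e \<in> all_edges S")
      case True
      then obtain t i where "t \<in> S" "e = ed t i" unfolding all_edges_def by blast
      then have "\<mu> \<le> w e" using less.prems(3)[of t i] mu_le[of t] ST by force
      then show ?thesis using True by (simp add: w'_def)
    qed (use less.prems(2) that in \<open>simp add: w'_def\<close>)
    have 3: "m' t \<le> w' (ed t i)" if "t \<in> T" for t i
    proof (cases "t \<in> S")
      case True
      then have "ed t i \<in> all_edges S" unfolding all_edges_def by blast
      then show ?thesis using True less.prems(3)[OF that, of i] by (simp add: m'_def w'_def)
    next
      case False
      \<comment> \<open>The edge may still lie in \<open>all_edges S\<close> through the triangle on
        its other side; since m vanishes on t, nonnegativity of w' is enough here.\<close>
      then have "m t = 0" using less.prems(1)[OF that] that by (force simp: S_def)
      moreover have "0 \<le> w' (ed t i)" by (rule 2) (use that in \<open>auto simp: all_edges_def\<close>)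
      ultimately show ?thesis using False by (simp add: m'_def)
    qed
    have "{t \<in> T. 0 < m' t} \<subset> S"
      using mu_pos t0 by (auto simp: m'_def S_def split: if_splits)
    then have "card {t \<in> T. 0 < m' t} < card {t \<in> T. 0 < m t}"
      using fS by (intro psubset_card_mono) (auto simp: S_def)
    from less.hyps[OF this 1 2 3]
    have IH: "pi * (\<Sum>t\<in>T. m' t) \<le> (\<Sum>e\<in>all_edges T. \<eta> e * w' e)" .
    have "(\<Sum>t\<in>T. m t) = (\<Sum>t\<in>T. m' t + (if t \<in> S then \<mu> else 0))"
      by (intro sum.cong) (auto simp: m'_def)
    also have "\<dots> = (\<Sum>t\<in>T. m' t) + \<mu> * real (card S)"
      using ST finite_T by (simp add: sum.distrib sum.If_cases Int_absorb1 inf.absorb2)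
    finally have m: "(\<Sum>t\<in>T. m t) = (\<Sum>t\<in>T. m' t) + \<mu> * real (card S)" .
    have EST: "all_edges S \<subseteq> all_edges T" using ST by (auto simp: all_edges_def)
    have "(\<Sum>e\<in>all_edges T. \<eta> e * w e) = (\<Sum>e\<in>all_edges T. \<eta> e * w' e + (if e \<in> all_edges S then \<mu> * \<eta> e else 0))"
      by (intro sum.cong) (auto simp: w'_def algebra_simps)
    also have "\<dots> = (\<Sum>e\<in>all_edges T. \<eta> e * w' e) + \<mu> * (\<Sum>e\<in>all_edges S. \<eta> e)"
      using EST finite_all_edges[of T]
      by (simp add: sum.distrib sum.If_cases Int_absorb1 inf.absorb2 sum_distrib_left)
    finally have w: "(\<Sum>e\<in>all_edges T. \<eta> e * w e)
        = (\<Sum>e\<in>all_edges T. \<eta> e * w' e) + \<mu> * (\<Sum>e\<in>all_edges S. \<eta> e)" .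
    have "\<mu> * (pi * real (card S)) \<le> \<mu> * (\<Sum>e\<in>all_edges S. \<eta> e)"
      using assms(1)[OF ST False] mu_pos by (intro mult_left_mono) auto
    then show ?thesis using IH unfolding m w by (simp add: algebra_simps)
  qed
qed

end

text \<open>The square of the positive part has the Lipschitz derivative 2 * max 0 a. This quadratic
  upper bound takes the place of differentiation in the penalty argument.\<close>

lemma pos_part_sq_le:
  fixes a h :: real
  shows "(max 0 (a + h))\<^sup>2 \<le> (max 0 a)\<^sup>2 + 2 * h * max 0 a + h\<^sup>2"
proof (cases "0 \<le> a")
  case True
  have "(max 0 (a + h))\<^sup>2 \<le> (a + h)\<^sup>2" by (auto simp: max_def)
  then show ?thesis using True by (simp add: max_def power2_eq_square algebra_simps)
next
  case False
  have "(max 0 (a + h))\<^sup>2 \<le> h\<^sup>2"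
    using False by (cases "0 \<le> a + h") (auto simp: max_def intro: power_mono)
  then show ?thesis using False by (simp add: max_def)
qed

text \<open>The dual certificate of a single triangle, with multipliers \<open>u\<close> of the area constraint and
  \<open>v i\<close> of the angle constraints; \<open>l i\<close> are the resulting multipliers of the sides.\<close>

lemma triangle_certificate:
  fixes u v1 v2 v3 :: real
  assumes "0 \<le> u" "0 \<le> v1" "0 \<le> v2" "0 \<le> v3"
  defines "l1 \<equiv> u - v2 - v3" and "l2 \<equiv> u - v1 - v3" and "l3 \<equiv> u - v1 - v2"
  defines "s \<equiv> min (max 0 l1) (min (max 0 l2) (max 0 l3))
     - (max 0 (- l1) + max 0 (- l2) + max 0 (- l3)) / 2 - (u - v1 - v2 - v3)"
  shows "0 \<le> s" "u + v1 + v2 + v3 \<le> 5 * s + 11 / 2 * (\<bar>l1\<bar> + \<bar>l2\<bar> + \<bar>l3\<bar>)"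
proof -
  define n1 n2 n3 where n: "n1 = max 0 (- l1)" "n2 = max 0 (- l2)" "n3 = max 0 (- l3)"
  define m where "m = min (max 0 l1) (min (max 0 l2) (max 0 l3))"
  have m: "0 \<le> m" unfolding m_def by simp
  have s: "s = m - (n1 + n2 + n3) / 2 - (u - v1 - v2 - v3)" unfolding s_def m_def n ..
  have na: "n1 \<le> \<bar>l1\<bar>" "n2 \<le> \<bar>l2\<bar>" "n3 \<le> \<bar>l3\<bar>" unfolding n by auto
  note l = l1_def[THEN meta_eq_to_obj_eq] l2_def[THEN meta_eq_to_obj_eq] l3_def[THEN meta_eq_to_obj_eq]
  show "0 \<le> s"
  proof (cases "0 \<le> l1 \<and> 0 \<le> l2 \<and> 0 \<le> l3")
    case True
    then have "n1 = 0" "n2 = 0" "n3 = 0" unfolding n by auto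
    moreover have "u - v1 - v2 - v3 \<le> m" unfolding m_def using True assms(1-4) l by simp
    ultimately show ?thesis unfolding s by simp
  next
    case False
    have "n1 = 0 \<or> n1 = - l1" "n2 = 0 \<or> n2 = - l2" "n3 = 0 \<or> n3 = - l3" unfolding n by auto
    moreover have "u - v1 - v2 - v3 \<le> 0" using False assms(1-4) l by auto
    ultimately show ?thesis unfolding s using m assms(1-4) l by (elim disjE) (simp_all add: field_simps)
  qed
  have h: "n1 + n2 + n3 = 2 * (m - s - u + v1 + v2 + v3)" unfolding s by (simp add: field_simps)
  have "v2 + v3 - u \<le> \<bar>l1\<bar>" "v1 + v3 - u \<le> \<bar>l2\<bar>" "v1 + v2 - u \<le> \<bar>l3\<bar>"
    "u - v2 - v3 \<le> \<bar>l1\<bar>" "u - v1 - v3 \<le> \<bar>l2\<bar>" "u - v1 - v2 \<le> \<bar>l3\<bar>"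
    unfolding l by linarith+
  \<comment> \<open>The first bound plus half of the second gives the constants 5 and 11/2.\<close>
  then have "u \<le> 2 * s + 2 * (\<bar>l1\<bar> + \<bar>l2\<bar> + \<bar>l3\<bar>)"
    "2 * (v1 + v2 + v3) \<le> 6 * s + 7 * (\<bar>l1\<bar> + \<bar>l2\<bar> + \<bar>l3\<bar>)"
    using na m h by argo+
  then show "u + v1 + v2 + v3 \<le> 5 * s + 11 / 2 * (\<bar>l1\<bar> + \<bar>l2\<bar> + \<bar>l3\<bar>)" by argo
qed

context side_pairing
begin

text \<open>The shortfall in the constraint that the excess be at least \<epsilon>. At a minimiser
  of the summed squares the shortfalls themselves act as dual multipliers.\<close>

definition penalty_u :: "real \<Rightarrow> (3 \<Rightarrow> real) \<Rightarrow> real" where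
  "penalty_u \<epsilon> x = max 0 (\<epsilon> - tri_excess x)"

definition penalty_v :: "real \<Rightarrow> (3 \<Rightarrow> real) \<Rightarrow> 3 \<Rightarrow> real" where
  "penalty_v \<epsilon> x i = max 0 (\<epsilon> - tri_ang x i)"

definition penalty :: "real \<Rightarrow> (3 \<Rightarrow> real) \<Rightarrow> real" where
  "penalty \<epsilon> x = (penalty_u \<epsilon> x)\<^sup>2 + (\<Sum>i\<in>UNIV. (penalty_v \<epsilon> x i)\<^sup>2)"

text \<open>Minus one half of the partial derivative of \<open>penalty\<close> with respect to
  \<open>x i\<close>: the coordinate raises the excess and lowers the angles at the other two
  corners.\<close>

definition multiplier :: "real \<Rightarrow> (3 \<Rightarrow> real) \<Rightarrow> 3 \<Rightarrow> real" where
  "multiplier \<epsilon> x i = penalty_u \<epsilon> x - penalty_v \<epsilon> x (i + 1) - penalty_v \<epsilon> x (i + 2)"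

text \<open>The bound \<open>pos_part_sq_le\<close> summed over the four constraints. The
  coefficient of the square of h does not depend on x, which makes small steps along d
  controllable.\<close>

lemma penalty_line:
  "penalty \<epsilon> (\<lambda>i. x i + h * d i) \<le> penalty \<epsilon> x - 2 * h * (\<Sum>i\<in>UNIV. multiplier \<epsilon> x i * d i)
     + h\<^sup>2 * ((\<Sum>i\<in>UNIV. d i)\<^sup>2 + (\<Sum>i\<in>UNIV. (d (i + 1) + d (i + 2))\<^sup>2))"
proof -
  define \<sigma> where "\<sigma> = (\<Sum>i\<in>UNIV. d i)"
  define D where "D i = d (i + 1) + d (i + 2)" for i
  have "(penalty_u \<epsilon> (\<lambda>i. x i + h * d i))\<^sup>2 \<le> (penalty_u \<epsilon> x)\<^sup>2 + 2 * (- h * \<sigma>) * penalty_u \<epsilon> x + (- h * \<sigma>)\<^sup>2"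
    using pos_part_sq_le[of "\<epsilon> - tri_excess x" "- h * \<sigma>"]
    by (simp add: penalty_u_def tri_excess_line \<sigma>_def[symmetric] algebra_simps)
  moreover have line_ang: "tri_ang (\<lambda>i. x i + h * d i) i = tri_ang x i - h * D i" for i
    by (simp only: tri_ang_line D_def)
  have "(penalty_v \<epsilon> (\<lambda>i. x i + h * d i) i)\<^sup>2 \<le> (penalty_v \<epsilon> x i)\<^sup>2
     + 2 * (h * D i) * penalty_v \<epsilon> x i + (h * D i)\<^sup>2" for i
    using pos_part_sq_le[of "\<epsilon> - tri_ang x i" "h * D i"]
    by (simp add: penalty_v_def line_ang algebra_simps)
  ultimately have "penalty \<epsilon> (\<lambda>i. x i + h * d i) \<le> ((penalty_u \<epsilon> x)\<^sup>2 + 2 * (- h * \<sigma>) * penalty_u \<epsilon> x + (- h * \<sigma>)\<^sup>2)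
     + (\<Sum>i\<in>UNIV. (penalty_v \<epsilon> x i)\<^sup>2
     + 2 * (h * D i) * penalty_v \<epsilon> x i + (h * D i)\<^sup>2)"
    unfolding penalty_def by (intro add_mono sum_mono)
  also have "\<dots> = penalty \<epsilon> x + 2 * h * (- \<sigma> * penalty_u \<epsilon> x + (\<Sum>i\<in>UNIV. D i * penalty_v \<epsilon> x i))
     + h\<^sup>2 * (\<sigma>\<^sup>2 + (\<Sum>i\<in>UNIV. (D i)\<^sup>2))"
    unfolding penalty_def by (simp add: sum.distrib sum_distrib_left power_mult_distrib algebra_simps)
  also have "- \<sigma> * penalty_u \<epsilon> x + (\<Sum>i\<in>UNIV. D i * penalty_v \<epsilon> x i)
     = - (\<Sum>i\<in>UNIV. multiplier \<epsilon> x i * d i)"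
  proof -
    fix j :: 3
    show ?thesis by (simp add: \<sigma>_def D_def multiplier_def sum_cyc3[of _ j] cyc3 algebra_simps)
  qed
  finally show ?thesis by (simp add: \<sigma>_def D_def)
qed

text \<open>From (max 0 a)^2 = a * max 0 a: the penalty equals the constraint violation weighted
  with the multipliers, i.e. the dual objective, with the constants \<pi> + \<epsilon> and \<pi> -
  \<epsilon> coming from the right-hand sides of the constraints.\<close>

lemma penalty_eq:
  "penalty \<epsilon> x = (pi + \<epsilon>) * penalty_u \<epsilon> x - (pi - \<epsilon>) * (\<Sum>i\<in>UNIV. penalty_v \<epsilon> x i)
     - (\<Sum>i\<in>UNIV. multiplier \<epsilon> x i * x i)"
proof -
  have m: "(max 0 a)\<^sup>2 = a * max 0 a" for a :: real by (simp add: max_def power2_eq_square)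
  have "penalty \<epsilon> x = (\<epsilon> - tri_excess x) * penalty_u \<epsilon> x + (\<Sum>i\<in>UNIV. (\<epsilon> - tri_ang x i) * penalty_v \<epsilon> x i)"
    unfolding penalty_def penalty_u_def penalty_v_def m ..
  moreover
  fix j :: 3
  have "(\<epsilon> - tri_excess x) * penalty_u \<epsilon> x + (\<Sum>i\<in>UNIV. (\<epsilon> - tri_ang x i) * penalty_v \<epsilon> x i)
    = (pi + \<epsilon>) * penalty_u \<epsilon> x - (pi - \<epsilon>) * (\<Sum>i\<in>UNIV. penalty_v \<epsilon> x i)
     - (\<Sum>i\<in>UNIV. multiplier \<epsilon> x i * x i)"
    by (simp add: tri_excess_def tri_ang_def multiplier_def sum_cyc3[of _ j] cyc3 algebra_simps)
  ultimately show ?thesis by simp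
qed

text \<open>At a minimiser of the penalty the multipliers satisfy a variational inequality, which is tested
  with the angles that give all of \<open>\<theta> e\<close> to the side of larger multiplier. Then \<open>layer_cake\<close> and
  \<open>triangle_certificate\<close> bound the penalty by \<open>0\<close>.\<close>

lemma angle_system_exists:
  assumes \<theta>: "\<And>e. e \<in> all_edges T \<Longrightarrow> 0 < \<theta> e \<and> \<theta> e < pi"
    and star: "\<And>S. S \<subseteq> T \<Longrightarrow> S \<noteq> {} \<Longrightarrow> pi * real (card S) < (\<Sum>e\<in>all_edges S. \<theta> e)"
  shows "\<exists>\<psi>. angle_system \<theta> \<psi>"
proof -
  have fE: "finite (all_edges T)" by (rule finite_all_edges) simp
  \<comment> \<open>Finitely many strict inequalities leave a common slack \<delta>. It pays for
    replacing the positivity constraints by closed ones with margin \<epsilon>.\<close>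
  have E1: "\<forall>\<^sub>F \<delta> in at_right 0. \<forall>S\<in>Pow T - {{}}. pi * real (card S) < (\<Sum>e\<in>all_edges S. \<theta> e - \<delta>)"
  proof (rule eventually_ball_finite)
    show "\<forall>S\<in>Pow T - {{}}. \<forall>\<^sub>F \<delta> in at_right 0. pi * real (card S) < (\<Sum>e\<in>all_edges S. \<theta> e - \<delta>)"
    proof
      fix S assume S: "S \<in> Pow T - {{}}"
      have "((\<lambda>\<delta>. \<Sum>e\<in>all_edges S. \<theta> e - \<delta>) \<longlongrightarrow> (\<Sum>e\<in>all_edges S. \<theta> e - 0)) (at_right 0)"
        by (intro tendsto_intros)
      then show "\<forall>\<^sub>F \<delta> in at_right 0. pi * real (card S) < (\<Sum>e\<in>all_edges S. \<theta> e - \<delta>)"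
        using star[of S] S by (intro order_tendstoD(1)) auto
    qed
  qed (use finite_T in simp)
  have E2: "\<forall>\<^sub>F \<delta> in at_right 0. \<forall>e\<in>all_edges T. \<delta> < \<theta> e \<and> \<theta> e < pi - \<delta>"
  proof (rule eventually_ball_finite[OF fE], rule ballI)
    fix e assume "e \<in> all_edges T"
    then have "0 < min (\<theta> e) (pi - \<theta> e)" using \<theta> by auto
    then show "\<forall>\<^sub>F \<delta> in at_right 0. \<delta> < \<theta> e \<and> \<theta> e < pi - \<delta>"
      by (auto simp: eventually_at_right intro!: exI[of _ "min (\<theta> e) (pi - \<theta> e)"])
  qed
  have E3: "\<forall>\<^sub>F \<delta>::real in at_right 0. 0 < \<delta> \<and> \<delta> < pi"
    using eventually_at_right_real[OF pi_gt_zero] by (auto elim: eventually_mono)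
  have "\<forall>\<^sub>F \<delta> in at_right 0. (\<forall>S\<in>Pow T - {{}}. pi * real (card S) < (\<Sum>e\<in>all_edges S. \<theta> e - \<delta>))
     \<and> (\<forall>e\<in>all_edges T. \<delta> < \<theta> e \<and> \<theta> e < pi - \<delta>) \<and> 0 < \<delta> \<and> \<delta> < pi"
    by (rule eventually_conj[OF E1 eventually_conj[OF E2 E3]])
  then obtain \<delta> where \<delta>S: "\<And>S. S \<subseteq> T \<Longrightarrow> S \<noteq> {} \<Longrightarrow> pi * real (card S) < (\<Sum>e\<in>all_edges S. \<theta> e - \<delta>)"
    and \<delta>e: "\<And>e. e \<in> all_edges T \<Longrightarrow> \<delta> < \<theta> e" "\<And>e. e \<in> all_edges T \<Longrightarrow> \<theta> e < pi - \<delta>"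
    and \<delta>: "0 < \<delta>" "\<delta> < pi"
    by (auto dest!: eventually_happens)
  \<comment> \<open>Fitted to the constants 5 and 11/2 of \<open>triangle_certificate\<close>: 11/2
    * \<epsilon> is exactly the \<delta> / 2 available per unit of |l|, and 5 * \<epsilon> stays
    below \<pi>.\<close>
  define \<epsilon> where "\<epsilon> = \<delta> / 11"
  have \<epsilon>: "0 < \<epsilon>" using \<delta> by (simp add: \<epsilon>_def)
  \<comment> \<open>The set \<open>K\<close> below keeps only the pairing equations and box bounds,
    so it is compact and visibly nonempty; excess and angle constraints enter through the
    penalty.\<close>
  have eT: "edge_at p \<in> all_edges T" if "p \<in> sides" for p
    unfolding all_edges_T by (rule imageI[OF that])
  define K where "K = {x. (\<forall>p\<in>sides. 0 \<le> x p \<and> x p \<le> \<theta> (edge_at p)) \<and> (\<forall>p. p \<notin> sides \<longrightarrow> x p = 0)}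
     \<inter> (\<Inter>p\<in>sides. {x. x p + x (opp p) = \<theta> (edge_at p)})"
  define tri where "tri x t = (\<lambda>i. x (t, i))" for x :: "'t \<times> 3 \<Rightarrow> real" and t
  define J where "J x = (\<Sum>t\<in>T. penalty \<epsilon> (tri x t))" for x
  have cK: "compact K"
    unfolding K_def
    by (intro compact_Int_closed compact_coordinate_box closed_INT ballI closed_Collect_eq continuous_intros) auto
  have contJ: "continuous_on K J"
  proof -
    have [continuous_intros]: "continuous_on K (\<lambda>x. x p)" for p :: "'t \<times> 3"
      by (rule continuous_on_subset[OF continuous_on_product_coordinates]) simp
    show ?thesis unfolding J_def penalty_def penalty_u_def penalty_v_def tri_excess_def tri_ang_def tri_def
      by (intro continuous_intros)
  qed
  have mid: "(\<lambda>p. if p \<in> sides then \<theta> (edge_at p) / 2 else 0) \<in> K"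
    unfolding K_def using \<theta> eT by (auto simp: opp_props intro: less_imp_le)
  obtain x where x: "x \<in> K" and xmin: "\<And>y. y \<in> K \<Longrightarrow> J x \<le> J y"
    using continuous_attains_inf[OF cK _ contJ] mid by blast
  define l where "l p = multiplier \<epsilon> (tri x (fst p)) (snd p)" for p
  have VI: "(\<Sum>p\<in>sides. l p * y p) \<le> (\<Sum>p\<in>sides. l p * x p)" if y: "y \<in> K" for y
  proof (rule ccontr)
    assume neg: "\<not> ?thesis"
    define d where "d p = y p - x p" for p
    define a where "a = (\<Sum>p\<in>sides. l p * d p)"
    have a: "0 < a" using neg by (simp add: a_def d_def right_diff_distrib sum_subtractf)
    define c where "c = (\<Sum>t\<in>T. (\<Sum>i\<in>UNIV. d (t, i))\<^sup>2 + (\<Sum>i\<in>UNIV. (d (t, i + 1) + d (t, i + 2))\<^sup>2))"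
    have c: "0 \<le> c" unfolding c_def by (intro sum_nonneg add_nonneg_nonneg) auto
    have line: "J (\<lambda>p. x p + h * d p) \<le> J x - 2 * h * a + h\<^sup>2 * c" for h
    proof -
      have "J (\<lambda>p. x p + h * d p) \<le> (\<Sum>t\<in>T. penalty \<epsilon> (tri x t) - 2 * h * (\<Sum>i\<in>UNIV. multiplier \<epsilon> (tri x t) i * d (t, i))
         + h\<^sup>2 * ((\<Sum>i\<in>UNIV. d (t, i))\<^sup>2 + (\<Sum>i\<in>UNIV. (d (t, i + 1) + d (t, i + 2))\<^sup>2)))"
        unfolding J_def tri_def by (intro sum_mono penalty_line)
      also have "\<dots> = J x - 2 * h * a + h\<^sup>2 * c"
        unfolding J_def a_def c_def sum_sides l_def
        by (simp add: sum.distrib sum_subtractf sum_distrib_left distrib_left)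
      finally show ?thesis .
    qed
    \<comment> \<open>This step size makes the quadratic term h^2 * c at most h * a, hence smaller
      than the gain 2 * h * a.\<close>
    define h where "h = min 1 (a / (c + 1))"
    have h: "0 < h" "h \<le> 1" using a c by (auto simp: h_def)
    have "h * c \<le> a / (c + 1) * c" using c by (intro mult_right_mono) (auto simp: h_def)
    also have "\<dots> \<le> a" using a c by (simp add: field_simps)
    finally have "h * (h * c) \<le> h * a" using h by (intro mult_left_mono) auto
    moreover have "0 < h * a" using h a by simp
    ultimately have "J (\<lambda>p. x p + h * d p) < J x"
      using line[of h] by (simp add: power2_eq_square mult.assoc)
    moreover have "(\<lambda>p. x p + h * d p) \<in> K"
    proof -
      have *: "0 \<le> u + h * (v - u) \<and> u + h * (v - u) \<le> b"
        if "0 \<le> u" "u \<le> b" "0 \<le> v" "v \<le> b" for u v b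
      proof -
        have e: "u + h * (v - u) = (1 - h) * u + h * v" by (simp add: algebra_simps)
        have "(1 - h) * u + h * v \<le> (1 - h) * b + h * b"
          using that h by (intro add_mono mult_left_mono) auto
        moreover have "0 \<le> (1 - h) * u + h * v" using that h by (intro add_nonneg_nonneg) auto
        ultimately show ?thesis unfolding e by (simp add: algebra_simps)
      qed
      have "x p + h * d p + (x (opp p) + h * d (opp p)) = \<theta> (edge_at p)" if "p \<in> sides" for p
      proof -
        have "x p + x (opp p) = \<theta> (edge_at p)" "y p + y (opp p) = \<theta> (edge_at p)"
          using x y that unfolding K_def by blast+
        then have "d p + d (opp p) = 0" unfolding d_def by simp
        then have "h * d p + h * d (opp p) = 0" by (simp add: distrib_left[symmetric])
        then show ?thesis using \<open>x p + x (opp p) = _\<close> by linarith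
      qed
      moreover have "0 \<le> x p + h * d p \<and> x p + h * d p \<le> \<theta> (edge_at p)" if "p \<in> sides" for p
        unfolding d_def using x y that by (intro *) (auto simp: K_def)
      moreover have "x p + h * d p = 0" if "p \<notin> sides" for p
      proof -
        have "x p = 0" "y p = 0" using x y that unfolding K_def by blast+
        then show ?thesis by (simp add: d_def)
      qed
      ultimately show ?thesis unfolding K_def by simp
    qed
    ultimately show False using xmin by fastforce
  qed
  \<comment> \<open>On ties \<theta> is split evenly, so that
    \<open>y p + y (opp p) = \<theta> (edge_at p)\<close> holds in every case.\<close>
  define y where "y p = (if p \<notin> sides then 0 else if l p > l (opp p) then \<theta> (edge_at p)
     else if l p < l (opp p) then 0 else \<theta> (edge_at p) / 2)" for p
  have yK: "y \<in> K"
    unfolding K_def y_def using \<theta> eT by (auto simp: opp_props intro: less_imp_le)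
  have "(\<Sum>p\<in>sides. l p * y p) = (\<Sum>p\<in>sides. l p * y p + l (opp p) * y (opp p)) / 2"
    by (rule sum_sides_sym)
  also have "\<dots> = (\<Sum>p\<in>sides. \<theta> (edge_at p) * max (l p) (l (opp p))) / 2"
    by (intro arg_cong[where f = "\<lambda>r. r / 2"] sum.cong refl) (auto simp: y_def opp_props max_def field_simps)
  finally have ly: "(\<Sum>p\<in>sides. l p * y p) = (\<Sum>p\<in>sides. \<theta> (edge_at p) * max (l p) (l (opp p))) / 2" .
  define u where "u t = penalty_u \<epsilon> (tri x t)" for t
  define v where "v t = penalty_v \<epsilon> (tri x t)" for t
  define V where "V t = (\<Sum>i\<in>UNIV. v t i)" for t
  define m where "m t = min (max 0 (l (t, 1))) (min (max 0 (l (t, 2))) (max 0 (l (t, 3))))" for t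
  define N where "N t = (\<Sum>i\<in>UNIV. max 0 (- l (t, i)))" for t
  define L where "L t = (\<Sum>i\<in>UNIV. \<bar>l (t, i)\<bar>)" for t
  have uv: "0 \<le> u t" "0 \<le> v t i" for t i by (auto simp: u_def v_def penalty_u_def penalty_v_def)
  have J1: "J x \<le> (\<Sum>t\<in>T. (pi + \<epsilon>) * u t - (pi - \<epsilon>) * V t)
      - (\<Sum>p\<in>sides. \<theta> (edge_at p) * max (l p) (l (opp p))) / 2"
  proof -
    have "J x = (\<Sum>t\<in>T. (pi + \<epsilon>) * u t - (pi - \<epsilon>) * V t) - (\<Sum>p\<in>sides. l p * x p)"
      unfolding J_def penalty_eq sum_sides u_def V_def v_def l_def by (simp add: sum_subtractf tri_def)
    then show ?thesis using VI[OF yK] unfolding ly by linarith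
  qed
  \<comment> \<open>The arbitrary choice of a side does no harm: the value is symmetric in
    \<open>p\<close> and \<open>opp p\<close>.\<close>
  define W where "W e = (let p = (SOME p. p \<in> sides \<and> edge_at p = e) in max (max 0 (l p)) (max 0 (l (opp p))))" for e
  have W: "W (edge_at p) = max (max 0 (l p)) (max 0 (l (opp p)))" if p: "p \<in> sides" for p
  proof -
    define q where "q = (SOME q. q \<in> sides \<and> edge_at q = edge_at p)"
    have "q \<in> sides \<and> edge_at q = edge_at p" unfolding q_def by (rule someI[of _ p]) (use p in simp)
    then have "q = p \<or> q = opp p" using opp_cases[OF p] by blast
    then show ?thesis unfolding W_def q_def[symmetric] Let_def
      using opp_props(4)[OF p] by (auto simp: max.commute)
  qed
  have W0: "0 \<le> W e" for e by (simp add: W_def Let_def)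
  \<comment> \<open>Applied to \<theta> - \<delta> instead of \<theta>, so that a summand \<delta> *
    W remains to absorb the positive parts of l.\<close>
  have cake: "pi * (\<Sum>t\<in>T. m t) \<le> (\<Sum>e\<in>all_edges T. (\<theta> e - \<delta>) * W e)"
  proof (rule layer_cake)
    show "m t \<le> W (ed t i)" if "t \<in> T" for t i
    proof -
      have "m t \<le> max 0 (l (t, i))" unfolding m_def using exhaust_3[of i] by auto
      also have "\<dots> \<le> W (ed t i)" using W[of "(t, i)"] that by (simp add: mem_sides edge_at_def)
      finally show ?thesis .
    qed
    show "0 \<le> m t" for t by (simp add: m_def)
    show "pi * real (card S) \<le> (\<Sum>e\<in>all_edges S. \<theta> e - \<delta>)" if "S \<subseteq> T" "S \<noteq> {}" for S
      using \<delta>S[OF that] by simp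
    show "0 \<le> \<theta> e - \<delta>" if "e \<in> all_edges T" for e using \<delta>e(1)[OF that] by simp
    show "0 \<le> W e" for e by (rule W0)
  qed
  have "(\<Sum>e\<in>all_edges T. (\<theta> e - \<delta>) * W e) = (\<Sum>p\<in>sides. (\<theta> (edge_at p) - \<delta>) * W (edge_at p)) / 2"
    using sum_sides_edges[of "\<lambda>e. (\<theta> e - \<delta>) * W e"] by simp
  then have cake2: "pi * (\<Sum>t\<in>T. m t) \<le> (\<Sum>p\<in>sides. (\<theta> (edge_at p) - \<delta>) * W (edge_at p)) / 2"
    using cake by simp
  have "(\<Sum>p\<in>sides. (\<theta> (edge_at p) - \<delta>) * W (edge_at p) + \<delta> * ((max 0 (l p) + max 0 (l (opp p))) / 2)
       - (pi - \<delta>) * ((max 0 (- l p) + max 0 (- l (opp p))) / 2))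
     \<le> (\<Sum>p\<in>sides. \<theta> (edge_at p) * max (l p) (l (opp p)))"
  proof (rule sum_mono)
    fix p assume p: "p \<in> sides"
    let ?n = "(max 0 (- l p) + max 0 (- l (opp p))) / 2" and ?q = "(max 0 (l p) + max 0 (l (opp p))) / 2"
    \<comment> \<open>If one multiplier is nonnegative, W is the maximum itself; if both are
      negative, W is 0 and the mean of the two lies below their maximum. The mean negative part is
      charged with \<pi> - \<delta> and the mean positive part credited with \<delta>.\<close>
    have "W (edge_at p) - ?n \<le> max (l p) (l (opp p))" unfolding W[OF p] by (auto simp: max_def field_simps)
    then have "\<theta> (edge_at p) * (W (edge_at p) - ?n) \<le> \<theta> (edge_at p) * max (l p) (l (opp p))"
      using \<theta>[OF eT[OF p]] by (intro mult_left_mono) auto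
    moreover have "\<delta> * ?q \<le> \<delta> * W (edge_at p)" unfolding W[OF p] using \<delta> by (intro mult_left_mono) auto
    moreover have "\<theta> (edge_at p) * ?n \<le> (pi - \<delta>) * ?n"
      using \<delta>e(2)[OF eT[OF p]] by (intro mult_right_mono) auto
    ultimately show "(\<theta> (edge_at p) - \<delta>) * W (edge_at p) + \<delta> * ?q - (pi - \<delta>) * ?n
       \<le> \<theta> (edge_at p) * max (l p) (l (opp p))"
      by (simp only: left_diff_distrib right_diff_distrib)
  qed
  moreover have "(\<Sum>p\<in>sides. (\<theta> (edge_at p) - \<delta>) * W (edge_at p) + \<delta> * ((max 0 (l p) + max 0 (l (opp p))) / 2)
       - (pi - \<delta>) * ((max 0 (- l p) + max 0 (- l (opp p))) / 2))
     = (\<Sum>p\<in>sides. (\<theta> (edge_at p) - \<delta>) * W (edge_at p)) + \<delta> * (\<Sum>p\<in>sides. max 0 (l p))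
       - (pi - \<delta>) * (\<Sum>p\<in>sides. max 0 (- l p))"
    unfolding sum_sides_sym[of "\<lambda>p. max 0 (l p)"] sum_sides_sym[of "\<lambda>p. max 0 (- l p)"]
    by (simp add: sum.distrib sum_subtractf sum_distrib_left[symmetric] sum_divide_distrib[symmetric])
  ultimately have J2: "pi * (\<Sum>t\<in>T. m t) + \<delta> / 2 * (\<Sum>p\<in>sides. max 0 (l p)) - (pi - \<delta>) / 2 * (\<Sum>p\<in>sides. max 0 (- l p))
     \<le> (\<Sum>p\<in>sides. \<theta> (edge_at p) * max (l p) (l (opp p))) / 2"
    using cake2 by (simp add: field_simps)
  have absl: "\<bar>r\<bar> = max 0 r + max 0 (- r)" for r :: real by (simp add: max_def)
  have "\<delta> / 2 * (\<Sum>p\<in>sides. max 0 (l p)) - (pi - \<delta>) / 2 * (\<Sum>p\<in>sides. max 0 (- l p))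
    = \<delta> / 2 * (\<Sum>p\<in>sides. \<bar>l p\<bar>) - pi / 2 * (\<Sum>p\<in>sides. max 0 (- l p))"
    unfolding absl sum.distrib by (simp add: field_simps)
  also have "\<dots> = \<delta> / 2 * (\<Sum>t\<in>T. L t) - pi / 2 * (\<Sum>t\<in>T. N t)"
    unfolding sum_sides L_def N_def ..
  finally have J3: "J x \<le> (\<Sum>t\<in>T. (pi + \<epsilon>) * u t - (pi - \<epsilon>) * V t) - pi * (\<Sum>t\<in>T. m t)
      - \<delta> / 2 * (\<Sum>t\<in>T. L t) + pi / 2 * (\<Sum>t\<in>T. N t)"
    using J1 J2 by linarith
  have "(\<Sum>t\<in>T. (pi + \<epsilon>) * u t - (pi - \<epsilon>) * V t) - pi * (\<Sum>t\<in>T. m t)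
      - \<delta> / 2 * (\<Sum>t\<in>T. L t) + pi / 2 * (\<Sum>t\<in>T. N t)
     = (\<Sum>t\<in>T. (pi + \<epsilon>) * u t - (pi - \<epsilon>) * V t - pi * m t - \<delta> / 2 * L t + pi / 2 * N t)"
    by (simp only: sum.distrib sum_subtractf sum_distrib_left)
  also have "\<dots> \<le> 0"
  proof (rule sum_nonpos)
    fix t assume "t \<in> T"
    define s where "s = m t - N t / 2 - (u t - V t)"
    have [simp]: "(4::3) = 1" "(5::3) = 2" by auto
    have lt: "l (t, 1) = u t - v t 2 - v t 3" "l (t, 2) = u t - v t 1 - v t 3" "l (t, 3) = u t - v t 1 - v t 2"
      by (simp_all add: l_def multiplier_def u_def v_def)
    have V3: "V t = v t 1 + v t 2 + v t 3" "N t = max 0 (- l (t, 1)) + max 0 (- l (t, 2)) + max 0 (- l (t, 3))"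
      "L t = \<bar>l (t, 1)\<bar> + \<bar>l (t, 2)\<bar> + \<bar>l (t, 3)\<bar>"
      unfolding V_def N_def L_def by (simp_all add: sum_cyc3[of _ 1])
    have s_eq: "s = min (max 0 (u t - v t 2 - v t 3)) (min (max 0 (u t - v t 1 - v t 3)) (max 0 (u t - v t 1 - v t 2)))
       - (max 0 (- (u t - v t 2 - v t 3)) + max 0 (- (u t - v t 1 - v t 3)) + max 0 (- (u t - v t 1 - v t 2))) / 2
       - (u t - v t 1 - v t 2 - v t 3)"
      unfolding s_def m_def V3 lt by (simp only: diff_diff_eq add.assoc)
    note cert = triangle_certificate[OF uv(1)[of t] uv(2)[of t 1] uv(2)[of t 2] uv(2)[of t 3], folded s_eq]
    have s: "0 \<le> s" by (rule cert(1))
    have "u t + V t \<le> 5 * s + 11 / 2 * L t"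
      using cert(2) unfolding V3 lt by (simp only: add.assoc)
    note s = s this
    have "\<epsilon> * (u t + V t) \<le> \<epsilon> * (5 * s + 11 / 2 * L t)" using s \<epsilon> by (intro mult_left_mono) auto
    also have "\<dots> = 5 / 11 * (\<delta> * s) + \<delta> / 2 * L t" by (simp add: \<epsilon>_def field_simps)
    also have "\<dots> \<le> pi * s + \<delta> / 2 * L t"
      using mult_right_mono[OF less_imp_le[OF \<delta>(2)] s(1)] mult_nonneg_nonneg[OF less_imp_le[OF \<delta>(1)] s(1)] by linarith
    finally show "(pi + \<epsilon>) * u t - (pi - \<epsilon>) * V t - pi * m t - \<delta> / 2 * L t + pi / 2 * N t \<le> 0"
      by (simp add: s_def algebra_simps)
  qed
  finally have "J x \<le> 0" using J3 by linarith
  have pen0: "0 \<le> penalty \<epsilon> z" for z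
    unfolding penalty_def by (intro add_nonneg_nonneg sum_nonneg) auto
  have "tri_dom (\<lambda>i. x (t, i))" if t: "t \<in> T" for t
  proof -
    have "0 \<le> J x" unfolding J_def by (intro sum_nonneg pen0)
    then have "J x = 0" using \<open>J x \<le> 0\<close> by simp
    then have "penalty \<epsilon> (tri x t) = 0"
      unfolding J_def by (subst (asm) sum_nonneg_eq_0_iff[OF finite_T pen0]) (use t in simp_all)
    moreover have nn: "0 \<le> (\<Sum>i\<in>UNIV. (penalty_v \<epsilon> (tri x t) i)\<^sup>2)" by (intro sum_nonneg) simp
    ultimately have "(penalty_u \<epsilon> (tri x t))\<^sup>2 = 0" "(\<Sum>i\<in>UNIV. (penalty_v \<epsilon> (tri x t) i)\<^sup>2) = 0"
      unfolding penalty_def using add_nonneg_eq_0_iff[OF zero_le_power2 nn] by blast+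
    then have "penalty_u \<epsilon> (tri x t) = 0" and
      "\<forall>i\<in>UNIV. (penalty_v \<epsilon> (tri x t) i)\<^sup>2 = 0"
      using sum_nonneg_eq_0_iff[of "UNIV :: 3 set" "\<lambda>i. (penalty_v \<epsilon> (tri x t) i)\<^sup>2"] by simp_all
    then have z: "max 0 (\<epsilon> - tri_excess (tri x t)) = 0" "max 0 (\<epsilon> - tri_ang (tri x t) i) = 0" for i
      unfolding penalty_u_def penalty_v_def by simp_all
    have m0: "b \<le> a" if "max 0 (b - a) = 0" for a b :: real using that by (simp add: max_def split: if_splits)
    have 1: "\<epsilon> \<le> tri_excess (tri x t)" by (rule m0[OF z(1)])
    have 2: "\<epsilon> \<le> tri_ang (tri x t) i" for i by (rule m0[OF z(2)])
    have "0 < tri_excess (tri x t) \<and> (\<forall>i. 0 < tri_ang (tri x t) i)"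
      using less_le_trans[OF \<epsilon> 1] less_le_trans[OF \<epsilon> 2] by blast
    then show ?thesis unfolding tri_dom_def tri_def by simp
  qed
  then have "angle_system \<theta> x" unfolding angle_system_def using x by (simp add: K_def)
  then show ?thesis by blast
qed

end

section \<open>Minimising the energy\<close>

text \<open>The inequality ln y <= y - 1 at y = 1 / sqrt x.\<close>

lemma abs_x_ln_x_le:
  fixes x :: real
  assumes "0 < x" "x \<le> 1"
  shows "\<bar>x * ln x\<bar> \<le> 2 * sqrt x"
proof -
  have "ln (1 / sqrt x) \<le> 1 / sqrt x - 1" using assms by (intro ln_le_minus_one) auto
  moreover have "ln (1 / sqrt x) = - ln x / 2" using assms by (simp add: ln_div ln_sqrt)
  ultimately have "- ln x \<le> 2 / sqrt x" by simp
  then have "x * - ln x \<le> x * (2 / sqrt x)" using assms by (intro mult_left_mono) auto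
  also have "\<dots> = 2 * sqrt x" using assms by (simp add: field_simps)
  finally show ?thesis using assms by (simp add: abs_mult)
qed

lemma continuous_on_x_ln_x: "continuous_on {0..} (\<lambda>x::real. x * ln x)"
proof (clarsimp simp: continuous_on_eq_continuous_within)
  fix x :: real assume "0 \<le> x"
  show "continuous (at x within {0..}) (\<lambda>x. x * ln x)"
  proof (cases "x = 0")
    case True
    have "((\<lambda>x::real. x * ln x) \<longlongrightarrow> 0) (at 0 within {0..})"
    proof (rule Lim_null_comparison)
      have "\<forall>\<^sub>F x::real in at 0 within {0..}. x \<in> {0..} \<and> x \<noteq> 0" by (auto simp: eventually_at_filter)
      moreover have "\<forall>\<^sub>F x::real in at 0 within {0..}. x < 1"
        by (rule order_tendstoD(2)[OF tendsto_ident_at]) simp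
      ultimately show "\<forall>\<^sub>F x::real in at 0 within {0..}. norm (x * ln x) \<le> 2 * sqrt x"
        by eventually_elim (auto intro!: abs_x_ln_x_le)
      have "((\<lambda>x::real. 2 * sqrt x) \<longlongrightarrow> 2 * sqrt 0) (at 0 within {0..})" by (intro tendsto_intros)
      then show "((\<lambda>x::real. 2 * sqrt x) \<longlongrightarrow> 0) (at 0 within {0..})" by simp
    qed
    then show ?thesis using True by (simp add: continuous_within)
  qed (auto intro!: continuous_intros)
qed

text \<open>The singularity at 0 is split off as ln x, whose primitive x * ln x - x extends
  continuously; the remainder ln (sin x / x) is continuous on the closed interval. The bound b <
  \<pi> stays away from the singularity at \<pi>.\<close>

lemma ln_sin_primitive:
  fixes b :: real
  assumes b: "0 < b" "b < pi"
  obtains G :: "real \<Rightarrow> real" where "continuous_on {0..b} G"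
    "\<And>x. 0 < x \<Longrightarrow> x < b \<Longrightarrow> (G has_real_derivative ln (sin x)) (at x)"
proof -
  define s where "s x = (if x = 0 then 1 else sin x / x)" for x :: real
  have spos: "0 < s x" if "0 \<le> x" "x \<le> b" for x
    using that b sin_gt_zero[of x] by (auto simp: s_def)
  have conts: "isCont s x" for x
  proof (cases "x = 0")
    case True
    have "((\<lambda>h::real. (sin (0 + h) - sin 0) / h) \<longlongrightarrow> cos 0) (at 0)"
      using DERIV_sin[of "0::real"] unfolding DERIV_def .
    then have "((\<lambda>h::real. sin h / h) \<longlongrightarrow> 1) (at 0)" by simp
    then have "(s \<longlongrightarrow> 1) (at 0)"
      by (rule Lim_transform_eventually) (auto simp: s_def eventually_at_filter)
    then show ?thesis using True by (simp add: isCont_def s_def)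
  next
    case False
    have "isCont (\<lambda>x. sin x / x) x" using False by (intro continuous_intros) auto
    moreover have "\<forall>\<^sub>F y in nhds x. s y = sin y / y"
      using t1_space_nhds[OF False] by (auto simp: s_def elim: eventually_mono)
    ultimately show ?thesis by (subst isCont_cong) auto
  qed
  have "continuous_on {0..b} (\<lambda>x. ln (s x))"
  proof (rule continuous_on_ln)
    show "continuous_on {0..b} s" using conts by (simp add: continuous_at_imp_continuous_on)
    show "\<forall>x\<in>{0..b}. s x \<noteq> 0" using spos by force
  qed
  then obtain g where g: "\<And>x. x \<in> {0..b} \<Longrightarrow> (g has_vector_derivative ln (s x)) (at x within {0..b})"
    by (rule antiderivative_continuous) blast
  define G where "G x = x * ln x - x + g x" for x
  show ?thesis
  proof (rule that)
    have "continuous_on {0..b} g" using g has_vector_derivative_continuous continuous_on_eq_continuous_within by blast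
    moreover have "continuous_on {0..b} (\<lambda>x::real. x * ln x)"
      by (rule continuous_on_subset[OF continuous_on_x_ln_x]) auto
    ultimately show "continuous_on {0..b} G" unfolding G_def by (intro continuous_on_add continuous_on_diff continuous_on_id)
    fix x :: real assume x: "0 < x" "x < b"
    have "at x within {0..b} = at x" using x by (intro at_within_interior) simp
    then have "(g has_real_derivative ln (s x)) (at x)"
      using g[of x] x by (simp add: has_real_derivative_iff_has_vector_derivative)
    then have "(G has_real_derivative 1 * ln x + x * (1 / x) - 1 + ln (s x)) (at x)"
      unfolding G_def using x by (auto intro!: derivative_eq_intros)
    moreover have "1 * ln x + x * (1 / x) - 1 + ln (s x) = ln (sin x)"
      using x b sin_gt_zero[of x] by (simp add: s_def ln_div)
    ultimately show "(G has_real_derivative ln (sin x)) (at x)" by simp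
  qed
qed

text \<open>By the mean value theorem the difference quotient is a value of ln (sin x) at a point
  below e * a, and these values tend to minus infinity.\<close>

lemma ln_sin_primitive_slope_0:
  fixes G :: "real \<Rightarrow> real"
  assumes b: "0 < b" "b < pi" and cont: "continuous_on {0..b} G"
    and der: "\<And>x. 0 < x \<Longrightarrow> x < b \<Longrightarrow> (G has_real_derivative ln (sin x)) (at x)" and a: "0 < a"
  shows "\<forall>\<^sub>F e in at_right 0. G (e * a) - G 0 \<le> - C * e"
proof -
  have "filterlim (\<lambda>e. sin (e * a)) (at_right 0) (at_right 0)"
  proof (rule filterlim_at_withinI)
    have "((\<lambda>e. sin (e * a)) \<longlongrightarrow> sin (0 * a)) (at_right 0)" by (intro tendsto_intros)
    then show "((\<lambda>e. sin (e * a)) \<longlongrightarrow> 0) (at_right 0)" by simp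
    have "\<forall>\<^sub>F e in at_right 0. e \<in> {0<..<pi / a}" using a by (intro eventually_at_right_real) simp
    then show "\<forall>\<^sub>F e in at_right 0. sin (e * a) \<in> {0<..} - {0}"
      by eventually_elim (use a in \<open>auto intro!: sin_gt_zero simp: field_simps\<close>)
  qed
  then have "filterlim (\<lambda>e. ln (sin (e * a))) at_bot (at_right 0)"
    by (rule filterlim_compose[OF ln_at_0])
  then have "\<forall>\<^sub>F e in at_right 0. ln (sin (e * a)) \<le> - C / a" by (simp add: filterlim_at_bot)
  moreover have "\<forall>\<^sub>F e in at_right 0. e \<in> {0<..<min (b / a) (pi / 2 / a)}"
    using a b by (intro eventually_at_right_real) simp
  ultimately show ?thesis
  proof eventually_elim
    case (elim e)
    then have e: "0 < e * a" "e * a < b" "e * a < pi / 2" "0 < e" using a by (auto simp: field_simps)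
    have "continuous_on {0..e * a} G" by (rule continuous_on_subset[OF cont]) (use e in auto)
    moreover have "(G has_real_derivative ln (sin x)) (at x)" if "0 < x" "x < e * a" for x
      using der[of x] that e by simp
    ultimately obtain \<xi> where \<xi>: "0 < \<xi>" "\<xi> < e * a" "G (e * a) - G 0 = (e * a - 0) * ln (sin \<xi>)"
      using MVT[of 0 "e * a" G] e
      by (metis DERIV_unique real_differentiable_def)
    have "sin \<xi> \<le> sin (e * a)" using \<xi> e by (intro sin_monotone_2pi_le) auto
    moreover have "0 < sin \<xi>" using \<xi> e by (intro sin_gt_zero) auto
    ultimately have "ln (sin \<xi>) \<le> - C / a" using elim(1) by (meson ln_mono order.trans less_le_trans)
    then have "(e * a) * ln (sin \<xi>) \<le> (e * a) * (- C / a)" using e by (intro mult_left_mono) auto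
    then show ?case using \<xi>(3) a by (simp add: mult.commute)
  qed
qed

text \<open>Only upper bounds on f e / e for e decreasing to 0 are recorded: some finite bound here,
  every negative bound in \<open>steep_0\<close>. A single steep summand then makes a finite sum of
  sublinear ones steep.\<close>

definition sublinear_0 :: "(real \<Rightarrow> real) \<Rightarrow> bool" where
  "sublinear_0 f \<longleftrightarrow> (\<exists>C. \<forall>\<^sub>F e in at_right 0. f e \<le> C * e)"

definition steep_0 :: "(real \<Rightarrow> real) \<Rightarrow> bool" where
  "steep_0 f \<longleftrightarrow> (\<forall>C. \<forall>\<^sub>F e in at_right 0. f e \<le> - C * e)"

lemma steep_imp_sublinear: "steep_0 f \<Longrightarrow> sublinear_0 f"
  unfolding steep_0_def sublinear_0_def by blast

lemma sublinear_0_add: "sublinear_0 f \<Longrightarrow> sublinear_0 g \<Longrightarrow> sublinear_0 (\<lambda>e. f e + g e)"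
  unfolding sublinear_0_def
proof (elim exE)
  fix C D assume "\<forall>\<^sub>F e in at_right 0. f e \<le> C * e" "\<forall>\<^sub>F e in at_right 0. g e \<le> D * e"
  then have "\<forall>\<^sub>F e in at_right 0. f e + g e \<le> (C + D) * e"
    by eventually_elim (simp add: distrib_right)
  then show "\<exists>C. \<forall>\<^sub>F e in at_right 0. f e + g e \<le> C * e" by blast
qed

lemma steep_0_add: "steep_0 f \<Longrightarrow> sublinear_0 g \<Longrightarrow> steep_0 (\<lambda>e. f e + g e)"
  unfolding sublinear_0_def steep_0_def
proof (elim exE, intro allI)
  fix C D assume "\<forall>C. \<forall>\<^sub>F e in at_right 0. f e \<le> - C * e" "\<forall>\<^sub>F e in at_right 0. g e \<le> D * e"
  then have "\<forall>\<^sub>F e in at_right 0. f e \<le> - (C + D) * e" "\<forall>\<^sub>F e in at_right 0. g e \<le> D * e" by blast+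
  then show "\<forall>\<^sub>F e in at_right 0. f e + g e \<le> - C * e"
    by eventually_elim (simp add: algebra_simps)
qed

lemma sublinear_0_sum:
  assumes "finite A" "\<And>i. i \<in> A \<Longrightarrow> sublinear_0 (f i)"
  shows "sublinear_0 (\<lambda>e. \<Sum>i\<in>A. f i e)"
  using assms
proof (induction A rule: finite_induct)
  case empty
  have "\<forall>\<^sub>F e::real in at_right 0. 0 \<le> 0 * e" by simp
  then show ?case unfolding sublinear_0_def sum.empty by blast
qed (simp add: sublinear_0_add)

lemma steep_0_sum:
  assumes "finite A" "\<And>i. i \<in> A \<Longrightarrow> sublinear_0 (f i)" "k \<in> A" "steep_0 (f k)"
  shows "steep_0 (\<lambda>e. \<Sum>i\<in>A. f i e)"
proof -
  have "steep_0 (\<lambda>e. f k e + (\<Sum>i\<in>A - {k}. f i e))"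
    using assms by (intro steep_0_add sublinear_0_sum) auto
  then show ?thesis unfolding sum.remove[OF assms(1,3)] .
qed

lemma nonneg_on_segment:
  fixes u v e :: real
  assumes "0 \<le> u" "0 \<le> v" "0 \<le> e" "e \<le> 1"
  shows "0 \<le> u + e * (v - u)"
proof -
  have "u + e * (v - u) = (1 - e) * u + e * v" by (simp add: algebra_simps)
  also have "\<dots> \<ge> 0" using assms by (intro add_nonneg_nonneg mult_nonneg_nonneg) auto
  finally show ?thesis .
qed

lemma tri_segment:
  "tri_excess (\<lambda>i. x i + e * (y i - x i)) = tri_excess x + e * (tri_excess y - tri_excess x)"
  "tri_ang (\<lambda>i. x i + e * (y i - x i)) i = tri_ang x i + e * (tri_ang y i - tri_ang x i)"
  by (simp_all add: tri_excess_line tri_ang_line) (simp_all add: tri_excess_def tri_ang_def sum_subtractf algebra_simps)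

context side_pairing
begin

definition closed_systems :: "('e \<Rightarrow> real) \<Rightarrow> ('t \<times> 3 \<Rightarrow> real) set" where
  "closed_systems \<theta> = {x. (\<forall>p\<in>sides. 0 \<le> x p \<and> x p \<le> \<theta> (edge_at p)) \<and> (\<forall>p. p \<notin> sides \<longrightarrow> x p = 0)}
     \<inter> (\<Inter>p\<in>sides. {x. x p + x (opp p) = \<theta> (edge_at p)})
     \<inter> (\<Inter>t\<in>T. {x. 0 \<le> tri_excess (\<lambda>i. x (t, i))}) \<inter> (\<Inter>t\<in>T. \<Inter>i. {x. 0 \<le> tri_ang (\<lambda>i. x (t, i)) i})"

text \<open>The box bounds, from which compactness is read off, are consequences of the geometric
  constraints: \<psi> is excess plus angle and hence nonnegative, and the pairing equation then
  bounds it by \<theta>.\<close>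

lemma closed_systems_mem:
  "x \<in> closed_systems \<theta> \<longleftrightarrow> (\<forall>p. p \<notin> sides \<longrightarrow> x p = 0) \<and> (\<forall>p\<in>sides. x p + x (opp p) = \<theta> (edge_at p))
     \<and> (\<forall>t\<in>T. 0 \<le> tri_excess (\<lambda>i. x (t, i)) \<and> (\<forall>i. 0 \<le> tri_ang (\<lambda>i. x (t, i)) i))"
    (is "?l \<longleftrightarrow> ?r")
proof
  assume ?l
  then have 1: "\<And>p. p \<notin> sides \<Longrightarrow> x p = 0" "\<And>p. p \<in> sides \<Longrightarrow> x p + x (opp p) = \<theta> (edge_at p)"
    "\<And>t. t \<in> T \<Longrightarrow> 0 \<le> tri_excess (\<lambda>i. x (t, i))" "\<And>t i. t \<in> T \<Longrightarrow> 0 \<le> tri_ang (\<lambda>i. x (t, i)) i"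
    unfolding closed_systems_def by (simp_all only: Int_iff mem_Collect_eq INT_iff UNIV_I simp_thms ball_simps)
  then show ?r by blast
next
  assume r: ?r
  have nn: "0 \<le> x p" if "p \<in> sides" for p
  proof -
    obtain t i where p: "p = (t, i)" by (cases p)
    then have "t \<in> T" using that by (simp add: mem_sides)
    then have "0 \<le> tri_excess (\<lambda>i. x (t, i)) + tri_ang (\<lambda>i. x (t, i)) i" using r by (intro add_nonneg_nonneg) auto
    then show ?thesis using psi_eq_excess[of "\<lambda>i. x (t, i)" i] p by simp
  qed
  have "x p \<le> \<theta> (edge_at p)" if "p \<in> sides" for p
    using r that nn[OF opp_props(1)[OF that]] by force
  then show ?l unfolding closed_systems_def using r nn by simp
qed

lemma compact_closed_systems: "compact (closed_systems \<theta>)"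
proof -
  have [simp]: "continuous_on UNIV (\<lambda>x :: 't \<times> 3 \<Rightarrow> real. x p)" for p by (rule continuous_on_product_coordinates)
  show ?thesis
    unfolding closed_systems_def tri_excess_def tri_ang_def Int_assoc
    by (intro compact_Int_closed compact_coordinate_box closed_Int closed_INT ballI closed_Collect_eq
        closed_Collect_le continuous_intros) auto
qed

lemma closed_systems_le:
  assumes "x \<in> closed_systems \<theta>" "t \<in> T"
  shows "0 \<le> x (t, i)" "x (t, i) \<le> \<theta> (ed t i)"
proof -
  have "(t, i) \<in> sides" using assms by (simp add: mem_sides)
  then show "0 \<le> x (t, i)" "x (t, i) \<le> \<theta> (ed t i)"
    using assms unfolding closed_systems_def by (auto simp: edge_at_def)
qed

text \<open>\<open>G\<close> is a primitive of \<open>ln \<circ> sin\<close>, so that the energy \<open>F\<close> has gradient \<open>side_grad\<close>. Its slope \<open>-\<infinity>\<close>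
  at the boundary forces the minimiser into the interior.\<close>

theorem balanced_angle_system_exists:
  assumes \<theta>: "\<And>e. e \<in> all_edges T \<Longrightarrow> 0 < \<theta> e \<and> \<theta> e < pi"
    and star: "\<And>S. S \<subseteq> T \<Longrightarrow> S \<noteq> {} \<Longrightarrow> pi * real (card S) < (\<Sum>e\<in>all_edges S. \<theta> e)"
  shows "\<exists>\<psi>. angle_system \<theta> \<psi> \<and> balanced \<psi>"
proof -
  obtain q0 where q0: "angle_system \<theta> q0" using angle_system_exists[OF assms] by blast
  define q where "q p = (if p \<in> sides then q0 p else 0)" for p
  have qd: "tri_dom (\<lambda>i. q (t, i))" if "t \<in> T" for t
    using q0 that unfolding angle_system_def q_def by (simp add: mem_sides)
  have qK: "q \<in> closed_systems \<theta>"
    unfolding closed_systems_mem using q0 qd unfolding angle_system_def q_def tri_dom_def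
    by (auto simp: opp_props intro: less_imp_le)
  \<comment> \<open>A common bound below \<pi> for all \<theta>. Every argument of \<open>G\<close>
    is at most some \<psi>, hence at most some \<theta>, and stays in {0..<b}.\<close>
  obtain b where b: "0 < b" "b < pi" "\<And>e. e \<in> all_edges T \<Longrightarrow> \<theta> e < b"
  proof -
    have "\<forall>\<^sub>F b in at_left pi. \<forall>e\<in>all_edges T. \<theta> e < b"
    proof (rule eventually_ball_finite)
      show "\<forall>e\<in>all_edges T. \<forall>\<^sub>F b in at_left pi. \<theta> e < b"
        using \<theta> by (auto intro!: order_tendstoD(1)[OF tendsto_ident_at])
    qed (rule finite_all_edges, simp)
    moreover have "\<forall>\<^sub>F b in at_left pi. b \<in> {0<..<pi}" by (rule eventually_at_left_real) simp
    ultimately have "\<forall>\<^sub>F b in at_left pi. (\<forall>e\<in>all_edges T. \<theta> e < b) \<and> b \<in> {0<..<pi}" by (rule eventually_conj)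
    then obtain b where "(\<forall>e\<in>all_edges T. \<theta> e < b) \<and> b \<in> {0<..<pi}" by (auto dest!: eventually_happens)
    then show ?thesis using that by auto
  qed
  obtain G where G: "continuous_on {0..b} G"
    "\<And>x. 0 < x \<Longrightarrow> x < b \<Longrightarrow> (G has_real_derivative ln (sin x)) (at x)"
    using ln_sin_primitive[OF b(1,2)] by blast
  have bounds: "0 \<le> tri_excess (\<lambda>i. x (t, i)) \<and> tri_excess (\<lambda>i. x (t, i)) < b"
    "0 \<le> tri_ang (\<lambda>i. x (t, i)) i \<and> tri_ang (\<lambda>i. x (t, i)) i < b" "0 \<le> x (t, i) \<and> x (t, i) < b"
    if "x \<in> closed_systems \<theta>" "t \<in> T" for x t i
  proof -
    have "0 \<le> tri_excess (\<lambda>i. x (t, i))" "0 \<le> tri_ang (\<lambda>i. x (t, i)) i"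
      using that unfolding closed_systems_mem by blast+
    moreover have "x (t, i) < b"
    proof -
      have "ed t i \<in> all_edges T" using that unfolding all_edges_def by blast
      then show ?thesis using closed_systems_le(2)[OF that, of i] b(3)[of "ed t i"] by linarith
    qed
    ultimately show "0 \<le> tri_excess (\<lambda>i. x (t, i)) \<and> tri_excess (\<lambda>i. x (t, i)) < b"
      "0 \<le> tri_ang (\<lambda>i. x (t, i)) i \<and> tri_ang (\<lambda>i. x (t, i)) i < b" "0 \<le> x (t, i) \<and> x (t, i) < b"
      using psi_eq_excess[of "\<lambda>i. x (t, i)" i] closed_systems_le(1)[OF that, of i] by auto
  qed
  \<comment> \<open>The seven arguments sum to 2 * \<pi>, so linear terms cancel and
    \<open>E\<close> is, up to sign and an additive constant, a sum of seven Lobachevsky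
    functions.\<close>
  define E where "E y = G (tri_excess y) + ((\<Sum>i\<in>UNIV. G (y i)) + (\<Sum>i\<in>UNIV. G (tri_ang y i)))" for y
  define F where "F x = (\<Sum>t\<in>T. E (\<lambda>i. x (t, i)))" for x
  have contF: "continuous_on (closed_systems \<theta>) F"
  proof -
    have c: "continuous_on (closed_systems \<theta>) (\<lambda>x. x p)" for p :: "'t \<times> 3"
      by (rule continuous_on_subset[OF continuous_on_product_coordinates]) simp
    have "continuous_on (closed_systems \<theta>) (\<lambda>x. tri_excess (\<lambda>i. x (t, i)))"
      "continuous_on (closed_systems \<theta>) (\<lambda>x. tri_ang (\<lambda>i. x (t, i)) i)" for t i
      unfolding tri_excess_def tri_ang_def by (intro continuous_intros c)+
    moreover have "tri_excess (\<lambda>i. x (t, i)) \<in> {0..b}" "tri_ang (\<lambda>i. x (t, i)) i \<in> {0..b}" "x (t, i) \<in> {0..b}"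
      if "x \<in> closed_systems \<theta>" "t \<in> T" for x t i
      using bounds(1)[OF that] bounds(2,3)[OF that, of i] by auto
    ultimately show ?thesis
      unfolding F_def E_def
      by (intro continuous_on_sum continuous_on_add continuous_on_compose2[OF G(1)] c) auto
  qed
  obtain m where m: "m \<in> closed_systems \<theta>" and min: "\<And>y. y \<in> closed_systems \<theta> \<Longrightarrow> F m \<le> F y"
    using continuous_attains_inf[OF compact_closed_systems _ contF] qK by blast
  \<comment> \<open>The direction from the minimiser towards the interior solution \<open>q\<close>:
    a constraint that is tight at m strictly relaxes along it.\<close>
  define d where "d p = q p - m p" for p
  have segK: "(\<lambda>p. m p + e * d p) \<in> closed_systems \<theta>" if e: "0 \<le> e" "e \<le> 1" for e
    unfolding closed_systems_mem
  proof (intro conjI ballI allI impI)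
    show "m p + e * d p = 0" if "p \<notin> sides" for p
    proof -
      have "m p = 0" "q p = 0" using m qK that unfolding closed_systems_mem by blast+
      then show ?thesis by (simp add: d_def)
    qed
    show "m p + e * d p + (m (opp p) + e * d (opp p)) = \<theta> (edge_at p)" if "p \<in> sides" for p
    proof -
      have 1: "m p + m (opp p) = \<theta> (edge_at p)" "q p + q (opp p) = \<theta> (edge_at p)"
        using m qK that unfolding closed_systems_mem by blast+
      then have "d (opp p) = - d p" unfolding d_def by linarith
      then show ?thesis using 1(1) by simp
    qed
    fix t assume t: "t \<in> T"
    show "0 \<le> tri_excess (\<lambda>i. m (t, i) + e * d (t, i))"
      unfolding d_def tri_segment using bounds(1)[OF m t] bounds(1)[OF qK t] e by (intro nonneg_on_segment) auto
    show "0 \<le> tri_ang (\<lambda>i. m (t, i) + e * d (t, i)) i" for i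
      unfolding d_def tri_segment using bounds(2)[OF m t] bounds(2)[OF qK t] e by (intro nonneg_on_segment) auto
  qed
  \<comment> \<open>L is the value of an argument of \<open>G\<close> at the minimiser and a its
    rate of change. A vanishing argument has a positive rate, so it contributes slope minus
    infinity, and all others a finite slope.\<close>
  have sub: "sublinear_0 (\<lambda>e. G (L + e * a) - G L)" and steep: "L = 0 \<Longrightarrow> steep_0 (\<lambda>e. G (L + e * a) - G L)"
    if L: "0 \<le> L" "L < b" and a: "L = 0 \<Longrightarrow> 0 < a" for L a
  proof -
    show steep: "steep_0 (\<lambda>e. G (L + e * a) - G L)" if "L = 0"
      unfolding steep_0_def using ln_sin_primitive_slope_0[OF b(1,2) G a[OF that]] that by simp
    show "sublinear_0 (\<lambda>e. G (L + e * a) - G L)"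
    proof (cases "L = 0")
      case False
      have "((\<lambda>e. G (L + e * a)) has_real_derivative ln (sin L) * a) (at 0)"
      proof -
        have "(G has_real_derivative ln (sin L)) (at (L + 0 * a))" using G(2)[of L] L False by simp
        then show ?thesis by (rule DERIV_chain2) (auto intro!: derivative_eq_intros)
      qed
      then have "((\<lambda>h. (G (L + h * a) - G L) / h) \<longlongrightarrow> ln (sin L) * a) (at 0)"
        unfolding DERIV_def by simp
      then have "((\<lambda>h. (G (L + h * a) - G L) / h) \<longlongrightarrow> ln (sin L) * a) (at_right 0)"
        by (rule tendsto_within_subset) simp
      then have "\<forall>\<^sub>F h in at_right 0. (G (L + h * a) - G L) / h < ln (sin L) * a + 1"
        by (rule order_tendstoD(2)) simp
      moreover have "\<forall>\<^sub>F h::real in at_right 0. 0 < h" by (simp add: eventually_at_right_less)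
      ultimately have "\<forall>\<^sub>F h in at_right 0. G (L + h * a) - G L \<le> (ln (sin L) * a + 1) * h"
        by eventually_elim (simp add: pos_divide_less_eq less_imp_le)
      then show ?thesis unfolding sublinear_0_def by blast
    qed (rule steep_imp_sublinear[OF steep])
  qed
  have steep0: "steep_0 (\<lambda>e. G (e * a) - G 0)" if "0 < a" for a
    using steep[of 0 a] that b by simp
  define D where "D t e = E (\<lambda>i. m (t, i) + e * d (t, i)) - E (\<lambda>i. m (t, i))" for t e
  define f0 where "f0 t e = G (tri_excess (\<lambda>i. m (t, i)) + e * (tri_excess (\<lambda>i. q (t, i)) - tri_excess (\<lambda>i. m (t, i))))
     - G (tri_excess (\<lambda>i. m (t, i)))" for t e
  define f1 where "f1 t i e = G (m (t, i) + e * (q (t, i) - m (t, i))) - G (m (t, i))" for t i e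
  define f2 where "f2 t i e = G (tri_ang (\<lambda>i. m (t, i)) i + e * (tri_ang (\<lambda>i. q (t, i)) i - tri_ang (\<lambda>i. m (t, i)) i))
     - G (tri_ang (\<lambda>i. m (t, i)) i)" for t i e
  have D: "D t = (\<lambda>e. f0 t e + ((\<Sum>i\<in>UNIV. f1 t i e) + (\<Sum>i\<in>UNIV. f2 t i e)))" for t
    unfolding D_def E_def f0_def f1_def f2_def d_def tri_segment by (simp add: sum_subtractf fun_eq_iff)
  have f: "sublinear_0 (f0 t)" "sublinear_0 (f1 t i)" "sublinear_0 (f2 t i)"
    "tri_excess (\<lambda>i. m (t, i)) = 0 \<Longrightarrow> steep_0 (f0 t)" "tri_ang (\<lambda>i. m (t, i)) i = 0 \<Longrightarrow> steep_0 (f2 t i)"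
    if t: "t \<in> T" for t i
    unfolding f0_def f1_def f2_def
    using bounds(1)[OF m t] bounds(2,3)[OF m t, of i] tri_dom_bounds(1)[OF qd[OF t]] tri_dom_bounds(3,5)[OF qd[OF t], of i]
    by (auto intro!: sub steep steep0)
  have Dsub: "sublinear_0 (D t)" if "t \<in> T" for t
    unfolding D by (intro sublinear_0_add sublinear_0_sum f[OF that]) auto
  have Dsteep: "steep_0 (D t)" if t: "t \<in> T" "\<not> tri_dom (\<lambda>i. m (t, i))" for t
  proof -
    have "tri_excess (\<lambda>i. m (t, i)) = 0 \<or> (\<exists>i. tri_ang (\<lambda>i. m (t, i)) i = 0)"
      using t(2) bounds(1,2)[OF m t(1)] unfolding tri_dom_def by (metis order_le_less)
    then show ?thesis
    proof
      assume "tri_excess (\<lambda>i. m (t, i)) = 0"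
      then show ?thesis unfolding D
        by (intro steep_0_add sublinear_0_add sublinear_0_sum f[OF t(1)]) auto
    next
      assume "\<exists>i. tri_ang (\<lambda>i. m (t, i)) i = 0"
      then obtain i where i: "tri_ang (\<lambda>i. m (t, i)) i = 0" by blast
      have "steep_0 (\<lambda>e. \<Sum>i\<in>UNIV. f2 t i e)"
        by (rule steep_0_sum[where k = i]) (use f[OF t(1)] i in auto)
      then have "steep_0 (\<lambda>e. (\<Sum>i\<in>UNIV. f2 t i e) + (f0 t e + (\<Sum>i\<in>UNIV. f1 t i e)))"
        by (intro steep_0_add sublinear_0_add sublinear_0_sum f[OF t(1)]) auto
      then show ?thesis unfolding D by (simp add: add_ac)
    qed
  qed
  have dom: "tri_dom (\<lambda>i. m (t, i))" if t: "t \<in> T" for t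
  proof (rule ccontr)
    assume "\<not> ?thesis"
    then have "steep_0 (\<lambda>e. \<Sum>t\<in>T. D t e)"
      by (intro steep_0_sum[OF finite_T Dsub t] Dsteep t)
    then have "\<forall>\<^sub>F e in at_right 0. (\<Sum>t\<in>T. D t e) \<le> - 1 * e" unfolding steep_0_def by blast
    moreover have "\<forall>\<^sub>F e::real in at_right 0. e \<in> {0<..<1}" by (rule eventually_at_right_real) simp
    ultimately have "\<forall>\<^sub>F e::real in at_right 0. (\<Sum>t\<in>T. D t e) \<le> - 1 * e \<and> e \<in> {0<..<1}" by (rule eventually_conj)
    then obtain e where e: "(\<Sum>t\<in>T. D t e) \<le> - e" "0 < e" "e < 1" by (auto dest!: eventually_happens)
    have "F (\<lambda>p. m p + e * d p) = F m + (\<Sum>t\<in>T. D t e)" unfolding F_def D_def by (simp add: sum_subtractf)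
    then show False using min[OF segK[of e]] e by simp
  qed
  have sys: "angle_system \<theta> m"
    unfolding angle_system_def using dom m unfolding closed_systems_mem by blast
  moreover have "balanced m"
    unfolding balanced_def
  proof
    fix p assume p: "p \<in> sides"
    \<comment> \<open>The elementary tangent direction: it moves angle from \<open>opp p\<close> to
      \<open>p\<close>. The derivative of the energy along it is the difference of the two side
      gradients.\<close>
    define r where "r s = (if s = p then 1 else 0) - (if s = opp p then 1 else (0::real))" for s
    have r_off: "r s = 0" if "s \<notin> sides" for s using that p opp_props[OF p] by (auto simp: r_def)
    have r_opp: "r (opp s) = - r s" if "s \<in> sides" for s
    proof -
      have "opp s = p \<longleftrightarrow> s = opp p" "opp s = opp p \<longleftrightarrow> s = p"
        using opp_props(4)[OF p] opp_props(4)[OF that] by metis+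
      then show ?thesis by (simp add: r_def)
    qed
    have ev: "\<forall>\<^sub>F e in nhds 0. (\<lambda>s. m s + e * r s) \<in> closed_systems \<theta>"
    proof -
      have pos: "\<forall>\<^sub>F e in nhds 0. 0 \<le> L + e * a" if "0 < L" for L a :: real
      proof -
        have "((\<lambda>e. L + e * a) \<longlongrightarrow> L + 0 * a) (nhds 0)" by (intro tendsto_intros filterlim_ident)
        then have "\<forall>\<^sub>F e in nhds 0. 0 < L + e * a" by (rule order_tendstoD(1)) (use that in simp)
        then show ?thesis by eventually_elim simp
      qed
      have "\<forall>\<^sub>F e in nhds 0. \<forall>t\<in>T. 0 \<le> tri_excess (\<lambda>i. m (t, i) + e * r (t, i))"
        unfolding tri_excess_line
        using dom by (intro eventually_ball_finite[OF finite_T] ballI pos) (simp add: tri_dom_def)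
      moreover have "\<forall>\<^sub>F e in nhds 0. \<forall>t\<in>T. \<forall>i\<in>UNIV. 0 \<le> tri_ang (\<lambda>i. m (t, i) + e * r (t, i)) i"
      proof (intro eventually_ball_finite[OF finite_T] eventually_ball_finite[OF finite] ballI)
        fix t i assume "t \<in> T"
        then have "\<forall>\<^sub>F e in nhds 0. 0 \<le> tri_ang (\<lambda>i. m (t, i)) i + e * - (r (t, i + 1) + r (t, i + 2))"
          using dom by (intro pos) (simp add: tri_dom_def)
        then show "\<forall>\<^sub>F e in nhds 0. 0 \<le> tri_ang (\<lambda>i. m (t, i) + e * r (t, i)) i"
          unfolding tri_ang_line by (simp only: mult_minus_right add_uminus_conv_diff)
      qed
      ultimately show ?thesis
      proof eventually_elim
        case (elim e)
        show ?case unfolding closed_systems_mem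
        proof (intro conjI ballI allI impI)
          show "m s + e * r s = 0" if "s \<notin> sides" for s
          proof -
            have "m s = 0" using m that unfolding closed_systems_mem by blast
            then show ?thesis using r_off[OF that] by simp
          qed
          show "m s + e * r s + (m (opp s) + e * r (opp s)) = \<theta> (edge_at s)" if "s \<in> sides" for s
          proof -
            have "m s + m (opp s) = \<theta> (edge_at s)" using m that unfolding closed_systems_mem by blast
            then show ?thesis using r_opp[OF that] by simp
          qed
        qed (use elim in blast)+
      qed
    qed
    have der: "((\<lambda>e. F (\<lambda>s. m s + e * r s)) has_real_derivative (\<Sum>t\<in>T. \<Sum>i\<in>UNIV. side_grad m (t, i) * r (t, i))) (at 0)"
      unfolding F_def
    proof (rule DERIV_sum)
      fix t assume t: "t \<in> T"
      have GL: "((\<lambda>e. G (L + e * a)) has_real_derivative ln (sin L) * a) (at 0)" if "0 < L" "L < b" for L a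
      proof -
        have "(G has_real_derivative ln (sin L)) (at (L + 0 * a))" using G(2)[of L] that by simp
        then show ?thesis by (rule DERIV_chain2) (auto intro!: derivative_eq_intros)
      qed
      note bd = bounds[OF m t] and pd = tri_dom_bounds(1,3,5)[OF dom[OF t]]
      have "((\<lambda>e. G (tri_excess (\<lambda>i. m (t, i) + e * r (t, i)))) has_real_derivative
           ln (sin (tri_excess (\<lambda>i. m (t, i)))) * (\<Sum>i\<in>UNIV. r (t, i))) (at 0)"
        unfolding tri_excess_line using bd pd by (intro GL) auto
      moreover have "((\<lambda>e. \<Sum>i\<in>UNIV. G (m (t, i) + e * r (t, i))) has_real_derivative
           (\<Sum>i\<in>UNIV. ln (sin (m (t, i))) * r (t, i))) (at 0)"
        using bd pd by (intro DERIV_sum GL) auto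
      moreover have "((\<lambda>e. \<Sum>i\<in>UNIV. G (tri_ang (\<lambda>i. m (t, i) + e * r (t, i)) i)) has_real_derivative
           (\<Sum>i\<in>UNIV. ln (sin (tri_ang (\<lambda>i. m (t, i)) i)) * - (r (t, i + 1) + r (t, i + 2)))) (at 0)"
      proof (rule DERIV_sum)
        fix i :: 3
        have e: "tri_ang (\<lambda>i. m (t, i) + e * r (t, i)) i
            = tri_ang (\<lambda>i. m (t, i)) i + e * - (r (t, i + 1) + r (t, i + 2))" for e
          unfolding tri_ang_line by (simp only: mult_minus_right add_uminus_conv_diff)
        show "((\<lambda>e. G (tri_ang (\<lambda>i. m (t, i) + e * r (t, i)) i)) has_real_derivative
           ln (sin (tri_ang (\<lambda>i. m (t, i)) i)) * - (r (t, i + 1) + r (t, i + 2))) (at 0)"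
          unfolding e using bd pd by (intro GL) auto
      qed
      ultimately have "((\<lambda>e. E (\<lambda>i. m (t, i) + e * r (t, i))) has_real_derivative
          ln (sin (tri_excess (\<lambda>i. m (t, i)))) * (\<Sum>i\<in>UNIV. r (t, i))
           + ((\<Sum>i\<in>UNIV. ln (sin (m (t, i))) * r (t, i))
           + (\<Sum>i\<in>UNIV. ln (sin (tri_ang (\<lambda>i. m (t, i)) i)) * - (r (t, i + 1) + r (t, i + 2))))) (at 0)"
        unfolding E_def by (intro DERIV_add)
      then show "((\<lambda>e. E (\<lambda>i. m (t, i) + e * r (t, i))) has_real_derivative
          (\<Sum>i\<in>UNIV. side_grad m (t, i) * r (t, i))) (at 0)"
        unfolding side_grad_def fst_conv snd_conv tri_grad_inner
        by (simp only: mult_minus_right sum_negf add_uminus_conv_diff add.assoc add_diff_eq)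
    qed
    have "\<forall>\<^sub>F e in nhds 0. F m \<le> F (\<lambda>s. m s + e * r s)"
      using ev by eventually_elim (rule min)
    then obtain \<rho> where \<rho>: "0 < \<rho>" "\<And>e. dist e 0 < \<rho> \<Longrightarrow> F m \<le> F (\<lambda>s. m s + e * r s)"
      unfolding eventually_nhds_metric by blast
    have "(\<Sum>t\<in>T. \<Sum>i\<in>UNIV. side_grad m (t, i) * r (t, i)) = 0"
      using DERIV_local_min[OF der \<rho>(1)] \<rho>(2) by (simp add: dist_real_def)
    then have "(\<Sum>s\<in>sides. side_grad m s * r s) = 0" by (simp add: sum_sides)
    moreover have "(\<Sum>s\<in>sides. side_grad m s * r s)
       = (\<Sum>s\<in>sides. (if s = p then side_grad m s else 0) - (if s = opp p then side_grad m s else 0))"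
      by (intro sum.cong) (auto simp: r_def)
    ultimately show "side_grad m (opp p) = side_grad m p"
      using p opp_props(1)[OF p] finite_sides by (simp add: sum_subtractf)
  qed
  ultimately show ?thesis by blast
qed

end

section \<open>Hyperbolic plane geometry by Lorentzian linear algebra\<close>

section \<open>The hyperboloid model\<close>

text \<open>The Lorentz form, signed so that lifts of points satisfy \<open>lor v v = 1\<close>;
  between two lifts it is the hyperbolic cosine of the distance.\<close>

definition lor :: "complex \<times> real \<Rightarrow> complex \<times> real \<Rightarrow> real" where
  "lor u v = snd u * snd v - fst u \<bullet> fst v"

definition lift :: "complex \<Rightarrow> complex \<times> real" where
  "lift z = (1 / sqrt (1 - (norm z)\<^sup>2)) *\<^sub>R (z, 1)"

definition proj :: "complex \<times> real \<Rightarrow> complex" where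
  "proj v = fst v /\<^sub>R snd v"

text \<open>The 3 by 3 determinant in the coordinates Re, Im and time. Its sign tells on which side
  of the geodesic through two points a third one lies.\<close>

definition vol :: "complex \<times> real \<Rightarrow> complex \<times> real \<Rightarrow> complex \<times> real \<Rightarrow> real" where
  "vol u v w = Re (fst u) * (Im (fst v) * snd w - snd v * Im (fst w))
     - Im (fst u) * (Re (fst v) * snd w - snd v * Re (fst w))
     + snd u * (Re (fst v) * Im (fst w) - Im (fst v) * Re (fst w))"

lemma lor_algebra:
  "lor (u + v) w = lor u w + lor v w" "lor w (u + v) = lor w u + lor w v"
  "lor (u - v) w = lor u w - lor v w" "lor w (u - v) = lor w u - lor w v"
  "lor (c *\<^sub>R u) w = c * lor u w" "lor w (c *\<^sub>R u) = c * lor w u" "lor 0 w = 0" "lor w 0 = 0"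
  by (simp_all add: lor_def inner_simps algebra_simps)

lemma lor_commute: "lor u v = lor v u"
  by (simp add: lor_def inner_commute mult.commute)

lemma lor_sum_left: "lor (\<Sum>i\<in>I. f i) w = (\<Sum>i\<in>I. lor (f i) w)"
  by (induction I rule: infinite_finite_induct) (simp_all add: lor_algebra)

lemma lor_sum_right: "lor w (\<Sum>i\<in>I. f i) = (\<Sum>i\<in>I. lor w (f i))"
  by (induction I rule: infinite_finite_induct) (simp_all add: lor_algebra)

lemma mem_hyp_plane: "z \<in> hyp_plane \<longleftrightarrow> (norm z)\<^sup>2 < 1"
  by (simp add: hyp_plane_def power_less_one_iff abs_square_less_1)

lemma lift_scale_pos: "z \<in> hyp_plane \<Longrightarrow> 0 < 1 / sqrt (1 - (norm z)\<^sup>2)"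
  by (simp add: mem_hyp_plane)

lemma snd_lift_pos: "z \<in> hyp_plane \<Longrightarrow> 0 < snd (lift z)"
  by (simp add: lift_def mem_hyp_plane)

lemma proj_lift: "z \<in> hyp_plane \<Longrightarrow> proj (lift z) = z"
  by (simp add: lift_def proj_def mem_hyp_plane)

lemma lift_inj: "x \<in> hyp_plane \<Longrightarrow> y \<in> hyp_plane \<Longrightarrow> lift x = lift y \<longleftrightarrow> x = y"
  using proj_lift by metis

lemma lor_lift:
  "lor (lift x) (lift y) = (1 - x \<bullet> y) / (sqrt (1 - (norm x)\<^sup>2) * sqrt (1 - (norm y)\<^sup>2))"
proof -
  have "lor (lift x) (lift y) = (1 / sqrt (1 - (norm x)\<^sup>2)) * ((1 / sqrt (1 - (norm y)\<^sup>2)) * lor (x, 1) (y, 1))"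
    unfolding lift_def lor_algebra by simp
  then show ?thesis by (simp add: lor_def)
qed

lemma hyp_dist_lor: "hyp_dist x y = arcosh (lor (lift x) (lift y))"
  by (simp add: hyp_dist_def lor_lift)

lemma lor_lift_self: "x \<in> hyp_plane \<Longrightarrow> lor (lift x) (lift x) = 1"
  by (simp add: lor_lift mem_hyp_plane power2_norm_eq_inner)

text \<open>For distinct points of the disc the right-hand side is positive; this is the reversed
  Cauchy-Schwarz inequality behind \<open>lor_lift_gt1\<close>.\<close>

lemma lor_lift_gap:
  "(1 - x \<bullet> y)\<^sup>2 - (1 - (norm x)\<^sup>2) * (1 - (norm y)\<^sup>2) = (1 - (norm x)\<^sup>2) * (norm (x - y))\<^sup>2 + (x \<bullet> (x - y))\<^sup>2"
  unfolding power2_norm_eq_inner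
  by (simp add: inner_simps inner_commute power2_eq_square algebra_simps)

lemma lor_lift_gt1:
  assumes x: "x \<in> hyp_plane" and y: "y \<in> hyp_plane" and ne: "x \<noteq> y"
  shows "1 < lor (lift x) (lift y)"
proof -
  have nx: "(norm x)\<^sup>2 < 1" and ny: "(norm y)\<^sup>2 < 1" using x y by (simp_all add: mem_hyp_plane)
  have "norm x < 1" "norm y < 1" using x y by (simp_all add: hyp_plane_def)
  then have "norm x * norm y \<le> 1 * norm y" by (intro mult_right_mono) auto
  then have "x \<bullet> y < 1" using norm_cauchy_schwarz[of x y] \<open>norm y < 1\<close> by linarith
  then have p: "0 < 1 - x \<bullet> y" by simp
  have "0 < (1 - (norm x)\<^sup>2) * (norm (x - y))\<^sup>2 + (x \<bullet> (x - y))\<^sup>2"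
    using nx ne by (intro add_pos_nonneg mult_pos_pos) auto
  then have "(1 - (norm x)\<^sup>2) * (1 - (norm y)\<^sup>2) < (1 - x \<bullet> y)\<^sup>2"
    using lor_lift_gap[of x y] by linarith
  then have "sqrt (1 - (norm x)\<^sup>2) * sqrt (1 - (norm y)\<^sup>2) < 1 - x \<bullet> y"
    using p nx ny by (simp add: real_sqrt_mult[symmetric] real_less_lsqrt)
  moreover have "0 < sqrt (1 - (norm x)\<^sup>2) * sqrt (1 - (norm y)\<^sup>2)" using nx ny by simp
  ultimately show ?thesis by (simp add: lor_lift)
qed

lemma lor_lift_ge1: "x \<in> hyp_plane \<Longrightarrow> y \<in> hyp_plane \<Longrightarrow> 1 \<le> lor (lift x) (lift y)"
  using lor_lift_gt1[of x y] lor_lift_self[of x] by (cases "x = y") (auto intro: less_imp_le)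

lemma hyp_dist_eq_iff:
  assumes "x \<in> hyp_plane" "y \<in> hyp_plane" "x' \<in> hyp_plane" "y' \<in> hyp_plane"
  shows "hyp_dist x y = hyp_dist x' y' \<longleftrightarrow> lor (lift x) (lift y) = lor (lift x') (lift y')"
  using lor_lift_ge1 assms unfolding hyp_dist_lor by (metis cosh_arcosh_real)

lemma hyp_isometry_iff:
  "hyp_isometry g \<longleftrightarrow> bij_betw g hyp_plane hyp_plane \<and>
     (\<forall>x\<in>hyp_plane. \<forall>y\<in>hyp_plane. lor (lift (g x)) (lift (g y)) = lor (lift x) (lift y))"
  unfolding hyp_isometry_def using hyp_dist_eq_iff bij_betw_apply by (metis (no_types, lifting))

lemma hyp_isometry_lor:
  "hyp_isometry g \<Longrightarrow> x \<in> hyp_plane \<Longrightarrow> y \<in> hyp_plane \<Longrightarrow> lor (lift (g x)) (lift (g y)) = lor (lift x) (lift y)"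
  by (simp add: hyp_isometry_iff)

lemma hyp_isometry_mem: "hyp_isometry g \<Longrightarrow> x \<in> hyp_plane \<Longrightarrow> g x \<in> hyp_plane"
  unfolding hyp_isometry_def using bij_betw_apply by fast

lemma hyp_isometry_inj: "hyp_isometry g \<Longrightarrow> x \<in> hyp_plane \<Longrightarrow> y \<in> hyp_plane \<Longrightarrow> g x = g y \<longleftrightarrow> x = y"
  unfolding hyp_isometry_def by (metis bij_betw_imp_inj_on inj_on_eq_iff)

lemma hyp_isometry_comp: "hyp_isometry f \<Longrightarrow> hyp_isometry g \<Longrightarrow> hyp_isometry (\<lambda>z. f (g z))"
  using bij_betw_trans[of g hyp_plane hyp_plane f hyp_plane] hyp_isometry_mem[of g]
  unfolding hyp_isometry_def comp_def by simp

lemma hyp_isometry_inv: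
  assumes "hyp_isometry g"
  obtains g' where "hyp_isometry g'" "\<And>z. z \<in> hyp_plane \<Longrightarrow> g' (g z) = z" "\<And>z. z \<in> hyp_plane \<Longrightarrow> g (g' z) = z"
proof
  define g' where "g' = inv_into hyp_plane g"
  have b: "bij_betw g hyp_plane hyp_plane" using assms by (simp add: hyp_isometry_def)
  show 1: "g' (g z) = z" if "z \<in> hyp_plane" for z
    unfolding g'_def by (rule bij_betw_inv_into_left[OF b that])
  show 2: "g (g' z) = z" if "z \<in> hyp_plane" for z
    unfolding g'_def by (rule bij_betw_inv_into_right[OF b that])
  have b': "bij_betw g' hyp_plane hyp_plane" unfolding g'_def by (rule bij_betw_inv_into[OF b])
  then show "hyp_isometry g'"
    using assms 2 bij_betw_apply[OF b'] unfolding hyp_isometry_def by metis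
qed

lemma timelike_eq_lift:
  assumes "0 < snd v" "0 < lor v v"
  shows "proj v \<in> hyp_plane" "v = sqrt (lor v v) *\<^sub>R lift (proj v)"
proof -
  obtain z s where v: "v = (z, s)" by (cases v)
  have s: "0 < s" and z: "(norm z)\<^sup>2 < s\<^sup>2"
    using assms v unfolding power2_norm_eq_inner lor_def by (simp_all add: power2_eq_square)
  have n: "(norm (proj v))\<^sup>2 = (norm z)\<^sup>2 / s\<^sup>2" using v by (simp add: proj_def power_mult_distrib field_simps)
  then show "proj v \<in> hyp_plane" using z s by (simp add: mem_hyp_plane)
  have "1 - (norm (proj v))\<^sup>2 = lor v v / s\<^sup>2"
    using s unfolding n by (simp add: lor_def v power2_norm_eq_inner[symmetric] power2_eq_square[of s] field_simps)
  then have "sqrt (1 - (norm (proj v))\<^sup>2) = sqrt (lor v v) / s" using s by (simp add: real_sqrt_divide)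
  then show "v = sqrt (lor v v) *\<^sub>R lift (proj v)"
    using assms s by (simp add: lift_def v proj_def)
qed

lemma lor_nondegenerate:
  assumes "\<And>z. z \<in> hyp_plane \<Longrightarrow> lor v (lift z) = 0"
  shows "v = 0"
proof -
  have h: "snd v = fst v \<bullet> z" if "z \<in> hyp_plane" for z
  proof -
    have "(1 / sqrt (1 - (norm z)\<^sup>2)) * lor v (z, 1) = 0"
      using assms[OF that] unfolding lift_def lor_algebra .
    then have "lor v (z, 1) = 0" using lift_scale_pos[OF that] by (metis mult_eq_0_iff less_irrefl)
    then have "snd v - fst v \<bullet> z = 0" by (simp add: lor_def)
    then show ?thesis by simp
  qed
  have "0 \<in> hyp_plane" "1 / 2 \<in> hyp_plane" "\<i> / 2 \<in> hyp_plane" by (auto simp: hyp_plane_def)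
  from this[THEN h] show "v = 0"
    by (auto simp: prod_eq_iff complex_eq_iff inner_complex_def)
qed

text \<open>Multiplicativity of the determinant: the matrix of the form is diag (-1, -1, 1) with
  determinant 1, so the Gram determinant appears without a sign.\<close>

lemma vol_Gram:
  "vol u1 u2 u3 * vol v1 v2 v3 =
     lor u1 v1 * (lor u2 v2 * lor u3 v3 - lor u2 v3 * lor u3 v2)
   - lor u1 v2 * (lor u2 v1 * lor u3 v3 - lor u2 v3 * lor u3 v1)
   + lor u1 v3 * (lor u2 v1 * lor u3 v2 - lor u2 v2 * lor u3 v1)"
  unfolding vol_def lor_def inner_complex_def by (simp only: algebra_simps)

lemma vol_linear:
  "vol (u + u') v w = vol u v w + vol u' v w" "vol (c *\<^sub>R u) v w = c * vol u v w"
  "vol u (v + v') w = vol u v w + vol u v' w" "vol u (c *\<^sub>R v) w = c * vol u v w"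
  "vol u v (w + w') = vol u v w + vol u v w'" "vol u v (c *\<^sub>R w) = c * vol u v w"
  "vol u v (w - w') = vol u v w - vol u v w'"
  by (simp_all add: vol_def algebra_simps)

lemma vol_alt: "vol u u w = 0" "vol u v v = 0" "vol u v u = 0" "vol v u w = - vol u v w" "vol u w v = - vol u v w"
  by (simp_all add: vol_def algebra_simps)

lemma vol_rotate: "vol v w u = vol u v w"
  by (simp add: vol_def algebra_simps)

lemma vol_Cramer: "vol a b c *\<^sub>R v = vol v b c *\<^sub>R a + vol a v c *\<^sub>R b + vol a b v *\<^sub>R c"
  by (simp add: vol_def prod_eq_iff complex_eq_iff algebra_simps)

lemma vol_lift:
  assumes "x \<in> hyp_plane" "y \<in> hyp_plane" "z \<in> hyp_plane"
  shows "vol (lift x) (lift y) (lift z) = 0 \<longleftrightarrow>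
     Re (y - x) * Im (z - x) = Im (y - x) * Re (z - x)"
proof -
  have "vol (lift x) (lift y) (lift z) = (1 / sqrt (1 - (norm x)\<^sup>2)) * ((1 / sqrt (1 - (norm y)\<^sup>2)) * ((1 / sqrt (1 - (norm z)\<^sup>2))
      * (Re (y - x) * Im (z - x) - Im (y - x) * Re (z - x))))"
    unfolding lift_def vol_linear by (simp add: vol_def algebra_simps)
  then show ?thesis using assms[THEN lift_scale_pos] by simp
qed

lemma collinear_complex_iff:
  fixes x y z :: complex
  shows "collinear {x, y, z} \<longleftrightarrow> Re (y - x) * Im (z - x) = Im (y - x) * Re (z - x)"
proof
  assume "collinear {x, y, z}"
  then obtain u where "\<forall>p\<in>{x, y, z}. \<forall>q\<in>{x, y, z}. \<exists>c. p - q = c *\<^sub>R u" unfolding collinear_def by blast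
  then obtain c d where "y - x = c *\<^sub>R u" "z - x = d *\<^sub>R u" by blast
  then show "Re (y - x) * Im (z - x) = Im (y - x) * Re (z - x)" by (simp only:) simp
next
  assume h: "Re (y - x) * Im (z - x) = Im (y - x) * Re (z - x)"
  have eq: "{x, y, z} = {y, x, z}" by auto
  show "collinear {x, y, z}"
  proof (cases "y = x")
    case False
    define u v where "u = y - x" "v = z - x"
    have u: "u \<noteq> 0" and huv: "Re u * Im v = Im u * Re v" using False h by (auto simp: u_v_def)
    have n: "(Re u)\<^sup>2 + (Im u)\<^sup>2 \<noteq> 0" using u by (simp add: complex_eq_iff sum_power2_eq_zero_iff)
    have "v = ((Re u * Re v + Im u * Im v) / ((Re u)\<^sup>2 + (Im u)\<^sup>2)) *\<^sub>R u"
    proof (rule complex_eqI)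
      have "Re v * ((Re u)\<^sup>2 + (Im u)\<^sup>2) = (Re u * Re v + Im u * Im v) * Re u"
        using huv by algebra
      then show "Re v = Re (((Re u * Re v + Im u * Im v) / ((Re u)\<^sup>2 + (Im u)\<^sup>2)) *\<^sub>R u)"
        using n by (simp add: eq_divide_eq)
      have "Im v * ((Re u)\<^sup>2 + (Im u)\<^sup>2) = (Re u * Re v + Im u * Im v) * Im u"
        using huv by algebra
      then show "Im v = Im (((Re u * Re v + Im u * Im v) / ((Re u)\<^sup>2 + (Im u)\<^sup>2)) *\<^sub>R u)"
        using n by (simp add: eq_divide_eq)
    qed
    then have "collinear {0, u, v}" unfolding collinear_lemma by blast
    then show ?thesis
      unfolding eq using collinear_3[of y x z] by (simp add: u_v_def NO_MATCH_def)
  qed simp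
qed

definition tri_lift :: "(3 \<Rightarrow> complex) \<Rightarrow> 3 \<Rightarrow> complex \<times> real" where
  "tri_lift a i = lift (a i)"

definition tri_vol :: "(3 \<Rightarrow> complex) \<Rightarrow> real" where
  "tri_vol a = vol (lift (a 0)) (lift (a 1)) (lift (a 2))"

lemma tri_vol_cyc: "vol (lift (a i)) (lift (a (i + 1))) (lift (a (i + 2))) = tri_vol a"
proof -
  have [simp]: "(3::3) = 0" "(4::3) = 1" by auto
  consider "i = 0" | "i = 1" | "i = 2" using exhaust_3[of i] by auto
  then show ?thesis
  proof cases
    case 2
    then show ?thesis using vol_rotate[of "lift (a 1)" "lift (a 2)" "lift (a 0)"] by (simp add: tri_vol_def)
  next
    case 3
    then show ?thesis using vol_rotate[of "lift (a 2)" "lift (a 0)" "lift (a 1)"] vol_rotate[of "lift (a 1)" "lift (a 2)" "lift (a 0)"]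
      by (simp add: tri_vol_def)
  qed (simp add: tri_vol_def)
qed

text \<open>Injectivity and non-collinearity are both captured by one determinant, which the later
  arguments can compute with.\<close>

lemma hyp_triangle_iff: "hyp_triangle a \<longleftrightarrow> (\<forall>i. a i \<in> hyp_plane) \<and> tri_vol a \<noteq> 0"
proof -
  have r: "range a = {a 0, a 1, a 2}"
    using arg_cong[OF UNIV_cyc3[of 0], of "image a"] by simp
  have "tri_vol a \<noteq> 0 \<longleftrightarrow> \<not> collinear (range a)" if "\<forall>i. a i \<in> hyp_plane"
    unfolding tri_vol_def r collinear_complex_iff using vol_lift that by blast
  moreover have "inj a" if "tri_vol a \<noteq> 0"
  proof (rule injI, rule ccontr)
    fix i j assume ij: "a i = a j" "i \<noteq> j"
    then have "j = i + 1 \<or> j = i + 2" using exhaust_cyc3[of j i] by auto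
    then have "tri_vol a = 0" using tri_vol_cyc[of a i] ij vol_alt by metis
    then show False using that by simp
  qed
  ultimately show ?thesis unfolding hyp_triangle_def by auto
qed

definition side_cosh :: "(3 \<Rightarrow> complex) \<Rightarrow> 3 \<Rightarrow> real" where
  "side_cosh a i = lor (lift (a (i + 1))) (lift (a (i + 2)))"

lemma lor_side_cosh:
  "lor (lift (a i)) (lift (a (i + 1))) = side_cosh a (i + 2)"
  "lor (lift (a i)) (lift (a (i + 2))) = side_cosh a (i + 1)"
  "lor (lift (a (i + 1))) (lift (a i)) = side_cosh a (i + 2)"
  "lor (lift (a (i + 2))) (lift (a i)) = side_cosh a (i + 1)"
  by (simp_all add: side_cosh_def cyc3 lor_commute)

lemma tri_vol_sq:
  assumes "\<And>i. a i \<in> hyp_plane"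
  shows "(tri_vol a)\<^sup>2 = 1 + 2 * side_cosh a i * side_cosh a (i + 1) * side_cosh a (i + 2)
     - (side_cosh a i)\<^sup>2 - (side_cosh a (i + 1))\<^sup>2 - (side_cosh a (i + 2))\<^sup>2"
  unfolding power2_eq_square tri_vol_cyc[of a i, symmetric] vol_Gram
  by (simp only: lor_side_cosh lor_lift_self[OF assms] side_cosh_def[of a i, symmetric]
      lor_commute[of "lift (a (i + 2))" "lift (a (i + 1))"]) (simp add: algebra_simps)

lemma all_lor_eq_side_cosh:
  assumes "\<And>i. a i \<in> hyp_plane" "\<And>i. b i \<in> hyp_plane" "\<And>i. side_cosh a i = side_cosh b i"
  shows "lor (lift (a i)) (lift (a j)) = lor (lift (b i)) (lift (b j))"
  using exhaust_cyc3[of j i] assms by (auto simp: lor_side_cosh lor_lift_self)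

text \<open>The linear map taking one basis of lifts to another with the same Gram matrix is
  a Lorentz transformation.\<close>

theorem triangle_congruence:
  assumes a: "hyp_triangle a" and b: "\<And>i. b i \<in> hyp_plane" and ab: "\<And>i. side_cosh a i = side_cosh b i"
  obtains g where "hyp_isometry g" "\<And>i. g (a i) = b i"
proof -
  have a': "\<And>i. a i \<in> hyp_plane" and va: "tri_vol a \<noteq> 0" using a unfolding hyp_triangle_iff by auto
  have "(tri_vol b)\<^sup>2 = (tri_vol a)\<^sup>2"
    using tri_vol_sq[of a 0, OF a'] tri_vol_sq[of b 0, OF b] ab by simp
  then have vb: "tri_vol b \<noteq> 0" using va by auto
  define co where "co a v i = vol v (lift (a (i + 1))) (lift (a (i + 2))) / tri_vol a" for a :: "3 \<Rightarrow> complex" and v and i :: 3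
  have co: "v = (\<Sum>i\<in>UNIV. co a v i *\<^sub>R lift (a i))" if "tri_vol a \<noteq> 0" for a v
  proof -
    have [simp]: "(3::3) = 0" "(4::3) = 1" by auto
    have "tri_vol a *\<^sub>R v = tri_vol a *\<^sub>R (\<Sum>i\<in>UNIV. co a v i *\<^sub>R lift (a i))"
    proof -
      have "(\<Sum>i\<in>UNIV. co a v i *\<^sub>R lift (a i)) = co a v 0 *\<^sub>R lift (a 0) + co a v 1 *\<^sub>R lift (a 1) + co a v 2 *\<^sub>R lift (a 2)"
        by (simp add: sum_cyc3[of _ 0])
      moreover have "tri_vol a * co a v 0 = vol v (lift (a 1)) (lift (a 2))"
        "tri_vol a * co a v 1 = vol (lift (a 0)) v (lift (a 2))"
        "tri_vol a * co a v 2 = vol (lift (a 0)) (lift (a 1)) v"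
        using that vol_rotate by (simp_all add: co_def) metis+
      ultimately show ?thesis
        unfolding tri_vol_def[of a] vol_Cramer[of _ _ _ v] by (simp add: scaleR_add_right tri_vol_def)
    qed
    then show ?thesis using that by simp
  qed
  have co_lin: "co a (\<Sum>i\<in>UNIV. c i *\<^sub>R lift (a i)) j = c j" if "tri_vol a \<noteq> 0" for a c j
  proof -
    have "vol (\<Sum>i\<in>UNIV. c i *\<^sub>R lift (a i)) (lift (a (j + 1))) (lift (a (j + 2))) = c j * tri_vol a"
      unfolding sum_cyc3[of _ j] vol_linear tri_vol_cyc by (simp add: vol_alt)
    then show ?thesis using that by (simp add: co_def)
  qed
  \<comment> \<open>Kept general in both triangles, so that the inverse map arises by exchanging
    them.\<close>
  define L where "L a b v = (\<Sum>i\<in>UNIV. co a v i *\<^sub>R lift (b i))" for a b :: "3 \<Rightarrow> complex" and v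
  have L_lor: "lor (L a b v) (L a b w) = lor v w"
    if "tri_vol a \<noteq> 0" "\<And>i j. lor (lift (a i)) (lift (a j)) = lor (lift (b i)) (lift (b j))" for a b v w
  proof -
    have "lor v w = lor (\<Sum>i\<in>UNIV. co a v i *\<^sub>R lift (a i)) (\<Sum>i\<in>UNIV. co a w i *\<^sub>R lift (a i))"
      using co[OF that(1)] by metis
    then show ?thesis unfolding L_def lor_sum_left lor_sum_right lor_algebra that(2) by simp
  qed
  have L_base: "L a b (lift (a i)) = lift (b i)" if "tri_vol a \<noteq> 0" for a b i
  proof -
    have "lift (a i) = (\<Sum>j\<in>UNIV. (if j = i then 1 else 0) *\<^sub>R lift (a j))" 
      by (simp add: if_distrib[of "\<lambda>c. c *\<^sub>R _"] cong: if_cong)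
    then have "co a (lift (a i)) j = (if j = i then 1 else 0)" for j
      using co_lin[OF that, of "\<lambda>j. if j = i then 1 else 0" j] by simp
    then show ?thesis unfolding L_def by (simp add: if_distrib[of "\<lambda>c. c *\<^sub>R _"] cong: if_cong)
  qed
  define g where "g a b z = proj (L a b (lift z))" for a b z
  have main: "g a b z \<in> hyp_plane \<and> lift (g a b z) = L a b (lift z)"
    if va: "tri_vol a \<noteq> 0" and ab: "\<And>i j. lor (lift (a i)) (lift (a j)) = lor (lift (b i)) (lift (b j))"
      and b: "\<And>i. b i \<in> hyp_plane" and a: "\<And>i. a i \<in> hyp_plane" and z: "z \<in> hyp_plane" for a b z
  proof -
    let ?v = "L a b (lift z)"
    have l1: "lor ?v ?v = 1" using L_lor[OF va ab] lor_lift_self[OF z] by simp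
    have "lor ?v (lift (b 0)) = lor (lift z) (lift (a 0))" using L_lor[OF va ab] L_base[OF va, of b 0] by metis
    then have l2: "1 \<le> lor ?v (lift (b 0))" using lor_lift_ge1[OF z a, of 0] by simp
    \<comment> \<open>A unit timelike vector with nonpositive time lies on the lower sheet, where
      the product with a lift is at most 0; but this product is preserved and at least 1.\<close>
    have "0 < snd ?v"
    proof (rule ccontr)
      assume neg: "\<not> 0 < snd ?v"
      have n1: "(norm (fst ?v))\<^sup>2 = (snd ?v)\<^sup>2 - 1"
        using l1 unfolding lor_def power2_norm_eq_inner by (simp add: power2_eq_square)
      then have "(norm (fst ?v))\<^sup>2 \<le> (snd ?v)\<^sup>2" by simp
      then have n: "norm (fst ?v) \<le> - snd ?v" using neg by (metis abs_le_square_iff abs_norm_cancel abs_of_nonpos not_less)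
      have sb: "0 < snd (lift (b 0))" by (rule snd_lift_pos[OF b])
      have "norm (b 0) < 1" using b[of 0] by (simp add: hyp_plane_def)
      then have nb: "norm (fst (lift (b 0))) \<le> snd (lift (b 0))" using lift_scale_pos[OF b, of 0]
        by (simp add: lift_def divide_right_mono)
      have "- (fst ?v \<bullet> fst (lift (b 0))) \<le> norm (fst ?v) * norm (fst (lift (b 0)))"
        using norm_cauchy_schwarz[of "- fst ?v" "fst (lift (b 0))"] by simp
      also have "\<dots> \<le> (- snd ?v) * snd (lift (b 0))" using n nb neg by (intro mult_mono) auto
      finally have "lor ?v (lift (b 0)) \<le> 0" by (simp add: lor_def)
      then show False using l2 by simp
    qed
    then show ?thesis using timelike_eq_lift[of ?v] l1 unfolding g_def by simp
  qed
  have E: "lor (lift (a i)) (lift (a j)) = lor (lift (b i)) (lift (b j))" for i j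
    by (rule all_lor_eq_side_cosh[OF a' b ab])
  have LL: "L b a (L a b v) = v" if "tri_vol a \<noteq> 0" "tri_vol b \<noteq> 0" for a b v
    unfolding L_def[of b a] unfolding L_def[of a b] co_lin[OF that(2)] using co[OF that(1)] by metis
  have inv: "g b a (g a b z) = z"
    if "tri_vol a \<noteq> 0" "tri_vol b \<noteq> 0" "\<And>i j. lor (lift (a i)) (lift (a j)) = lor (lift (b i)) (lift (b j))"
      "\<And>i. b i \<in> hyp_plane" "\<And>i. a i \<in> hyp_plane" "z \<in> hyp_plane" for a b z
    unfolding g_def[of b a] using main[of a b z] that LL[of a b "lift z"] proj_lift[of z] by simp
  have m1: "z \<in> hyp_plane \<Longrightarrow> g a b z \<in> hyp_plane \<and> lift (g a b z) = L a b (lift z)" for z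
    by (rule main[OF va E b a'])
  have m2: "z \<in> hyp_plane \<Longrightarrow> g b a z \<in> hyp_plane \<and> lift (g b a z) = L b a (lift z)" for z
    by (rule main[OF vb E[symmetric] a' b])
  have "bij_betw (g a b) hyp_plane hyp_plane"
  proof (rule bij_betw_byWitness[where f' = "g b a"])
    show "\<forall>z\<in>hyp_plane. g b a (g a b z) = z" using inv[OF va vb E b a'] by blast
    show "\<forall>z\<in>hyp_plane. g a b (g b a z) = z" using inv[OF vb va E[symmetric] a' b] by blast
  qed (use m1 m2 in auto)
  then have "hyp_isometry (g a b)"
    unfolding hyp_isometry_iff using m1 L_lor[OF va E] by simp
  moreover have "g a b (a i) = b i" for i
    unfolding g_def L_base[OF va] by (rule proj_lift[OF b])
  ultimately show ?thesis using that by blast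
qed

section \<open>Hyperbolic barycentric coordinates\<close>

text \<open>Coordinates are taken in the hyperboloid, so that they commute with isometries.\<close>

definition bvec :: "(3 \<Rightarrow> complex) \<Rightarrow> real^3 \<Rightarrow> complex \<times> real" where
  "bvec a y = (\<Sum>i\<in>UNIV. (y $ i) *\<^sub>R lift (a i))"

definition bary :: "(3 \<Rightarrow> complex) \<Rightarrow> real^3 \<Rightarrow> complex" where
  "bary a y = proj (bvec a y)"

definition bnorm :: "(3 \<Rightarrow> complex) \<Rightarrow> real^3 \<Rightarrow> real" where
  "bnorm a y = sqrt (lor (bvec a y) (bvec a y))"

lemma std_triangleD: "y \<in> std_triangle \<Longrightarrow> 0 \<le> y $ i" "y \<in> std_triangle \<Longrightarrow> (\<Sum>i\<in>UNIV. y $ i) = 1"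
  by (auto simp: std_triangle_def)

lemma std_triangle_le1: "y \<in> std_triangle \<Longrightarrow> y $ i \<le> 1"
  using member_le_sum[of i UNIV "\<lambda>i. y $ i"] std_triangleD by force

lemma std_triangle_pos: assumes "y \<in> std_triangle" obtains i where "0 < y $ i"
proof -
  have "\<exists>i. y $ i \<noteq> 0"
  proof (rule ccontr)
    assume "\<not> ?thesis"
    then have "(\<Sum>i\<in>UNIV. y $ i) = 0" by simp
    then show False using std_triangleD(2)[OF assms] by simp
  qed
  then show ?thesis using std_triangleD(1)[OF assms] that by (metis order_le_less)
qed

lemma corner_nth: "corner i $ j = (if j = i then 1 else 0)"
  by (simp add: corner_def axis_def)

lemma corner_std: "corner i \<in> std_triangle"
  by (simp add: std_triangle_def corner_nth)

lemma convex_std_triangle: "convex std_triangle"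
proof (rule convexI)
  fix x y :: "real^3" and u v :: real
  assume "x \<in> std_triangle" "y \<in> std_triangle" "0 \<le> u" "0 \<le> v" "u + v = 1"
  then show "u *\<^sub>R x + v *\<^sub>R y \<in> std_triangle"
    by (simp add: std_triangle_def sum.distrib sum_distrib_left[symmetric])
qed

lemma compact_std_triangle: "compact std_triangle"
proof -
  have "std_triangle = cbox 0 1 \<inter> {x. (\<Sum>i\<in>UNIV. x $ i) = 1}"
    using std_triangle_le1 by (auto simp: mem_box_cart std_triangle_def)
  moreover have "closed {x :: real^3. (\<Sum>i\<in>UNIV. x $ i) = 1}"
    by (intro closed_Collect_eq continuous_intros)
  ultimately show ?thesis by (metis compact_Int_closed compact_cbox)
qed

lemma snd_bvec_pos:
  assumes a: "\<And>i. a i \<in> hyp_plane" and y: "y \<in> std_triangle"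
  shows "0 < snd (bvec a y)"
proof -
  obtain i where i: "0 < y $ i" by (rule std_triangle_pos[OF y])
  have "0 < (\<Sum>i\<in>UNIV. y $ i * snd (lift (a i)))"
    using mult_pos_pos[OF i snd_lift_pos[OF a, of i]] std_triangleD(1)[OF y] less_imp_le[OF snd_lift_pos[OF a]]
    by (intro sum_pos2[of _ i]) (auto intro: mult_nonneg_nonneg)
  then show ?thesis by (simp add: bvec_def snd_sum)
qed

text \<open>All products of lifts are at least 1, and the weights y i * y j sum to 1.\<close>

lemma lor_bvec_ge1:
  assumes a: "\<And>i. a i \<in> hyp_plane" and y: "y \<in> std_triangle"
  shows "1 \<le> lor (bvec a y) (bvec a y)"
proof -
  have "(\<Sum>i\<in>UNIV. \<Sum>j\<in>UNIV. y $ i * (y $ j * 1)) \<le> (\<Sum>i\<in>UNIV. \<Sum>j\<in>UNIV. y $ i * (y $ j * lor (lift (a i)) (lift (a j))))"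
    using lor_lift_ge1 a std_triangleD(1)[OF y] by (intro sum_mono mult_left_mono) auto
  moreover have "(\<Sum>i\<in>UNIV. \<Sum>j\<in>UNIV. y $ i * (y $ j * 1)) = 1"
    using std_triangleD(2)[OF y] by (simp add: sum_distrib_left[symmetric])
  moreover have "lor (bvec a y) (bvec a y) = (\<Sum>i\<in>UNIV. \<Sum>j\<in>UNIV. y $ i * (y $ j * lor (lift (a i)) (lift (a j))))"
    unfolding bvec_def lor_sum_left lor_sum_right lor_algebra by (simp add: sum_distrib_left lor_commute)
  ultimately show ?thesis by simp
qed

lemma bary_mem: "(\<And>i. a i \<in> hyp_plane) \<Longrightarrow> y \<in> std_triangle \<Longrightarrow> bary a y \<in> hyp_plane"
  unfolding bary_def using timelike_eq_lift(1) snd_bvec_pos lor_bvec_ge1 by (metis less_le_trans zero_less_one)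

lemma bnorm_pos: "(\<And>i. a i \<in> hyp_plane) \<Longrightarrow> y \<in> std_triangle \<Longrightarrow> 0 < bnorm a y"
  unfolding bnorm_def using lor_bvec_ge1[of a y] by simp

lemma bvec_eq_lift: "(\<And>i. a i \<in> hyp_plane) \<Longrightarrow> y \<in> std_triangle \<Longrightarrow> bvec a y = bnorm a y *\<^sub>R lift (bary a y)"
  unfolding bary_def bnorm_def using timelike_eq_lift(2) snd_bvec_pos lor_bvec_ge1 by (metis less_le_trans zero_less_one)

lemma lift_bary: "(\<And>i. a i \<in> hyp_plane) \<Longrightarrow> y \<in> std_triangle \<Longrightarrow> lift (bary a y) = (1 / bnorm a y) *\<^sub>R bvec a y"
  using bvec_eq_lift[of a y] bnorm_pos[of a y] by simp

lemma bvec_corner: "bvec a (corner i) = lift (a i)"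
  by (simp add: bvec_def corner_nth if_distrib[of "\<lambda>c. c *\<^sub>R _"] cong: if_cong)

lemma bary_corner: "a i \<in> hyp_plane \<Longrightarrow> bary a (corner i) = a i"
  by (simp add: bary_def bvec_corner proj_lift)

text \<open>An isometry is only known to preserve products of lifts; linearity is not at hand. Both
  sides have the same products with every lift of a point \<open>g w'\<close>, and the form is
  nondegenerate.\<close>

theorem isometry_bary:
  assumes g: "hyp_isometry g" and a: "\<And>i. a i \<in> hyp_plane" and y: "y \<in> std_triangle"
  shows "g (bary a y) = bary (\<lambda>i. g (a i)) y"
proof -
  let ?b = "\<lambda>i. g (a i)"
  have b: "\<And>i. ?b i \<in> hyp_plane" using hyp_isometry_mem[OF g a] .
  have z: "bary a y \<in> hyp_plane" "bary ?b y \<in> hyp_plane" using bary_mem a b y by auto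
  have ll: "lor (lift (g (a i))) (lift (g w)) = lor (lift (a i)) (lift w)" if "w \<in> hyp_plane" for i w
    using hyp_isometry_lor[OF g a that] .
  have nn: "bnorm ?b y = bnorm a y"
    unfolding bnorm_def bvec_def lor_sum_left lor_sum_right lor_algebra ll[OF a] ..
  have "lift (g (bary a y)) - lift (bary ?b y) = 0"
  proof (rule lor_nondegenerate)
    fix w assume "w \<in> hyp_plane"
    then obtain w' where w: "w' \<in> hyp_plane" "w = g w'"
      using g unfolding hyp_isometry_def bij_betw_def by blast
    have "lor (lift (g (bary a y))) (lift w) = lor (lift (bary a y)) (lift w')"
      using hyp_isometry_lor[OF g z(1) w(1)] w by simp
    also have "\<dots> = (1 / bnorm a y) * (\<Sum>i\<in>UNIV. y $ i * lor (lift (a i)) (lift w'))"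
      unfolding lift_bary[of a, OF a y] by (simp add: bvec_def lor_sum_left lor_algebra)
    also have "\<dots> = lor (lift (bary ?b y)) (lift w)"
      unfolding lift_bary[of ?b, OF b y] nn w(2) by (simp add: bvec_def lor_sum_left lor_algebra ll[OF w(1)])
    finally show "lor (lift (g (bary a y)) - lift (bary ?b y)) (lift w) = 0" by (simp add: lor_algebra)
  qed
  then show ?thesis using lift_inj hyp_isometry_mem[OF g] z by simp
qed

lemma vol_bvec: "vol (bvec a y) (lift (a (i + 1))) (lift (a (i + 2))) = y $ i * tri_vol a"
  unfolding bvec_def sum_cyc3[of _ i] vol_linear tri_vol_cyc by (simp add: vol_alt)

text \<open>By \<open>vol_bvec\<close> determinants recover the coordinates up to a common factor,
  and the coordinate sum 1 fixes that factor.\<close>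

lemma bary_inj:
  assumes a: "hyp_triangle a" and x: "x \<in> std_triangle" and y: "y \<in> std_triangle" and eq: "bary a x = bary a y"
  shows "x = y"
proof -
  have a': "\<And>i. a i \<in> hyp_plane" and v: "tri_vol a \<noteq> 0" using a unfolding hyp_triangle_iff by auto
  define c where "c = bnorm a x / bnorm a y"
  have bxy: "bvec a x = c *\<^sub>R bvec a y"
    using bvec_eq_lift[of a, OF a' x] bvec_eq_lift[of a, OF a' y] eq bnorm_pos[of a, OF a' y] by (simp add: c_def)
  have "x $ i * tri_vol a = c * (y $ i * tri_vol a)" for i
    using arg_cong[OF bxy, of "\<lambda>v. vol v (lift (a (i + 1))) (lift (a (i + 2)))"] by (simp only: vol_linear vol_bvec)
  then have xc: "x $ i = c * y $ i" for i using v by simp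
  then have "(\<Sum>i\<in>UNIV. x $ i) = c * (\<Sum>i\<in>UNIV. y $ i)" by (simp add: sum_distrib_left)
  then have "c = 1" using std_triangleD(2) x y by simp
  then show ?thesis using xc by (simp add: vec_eq_iff)
qed

lemma continuous_on_bvec: "continuous_on S (bvec a)"
  unfolding bvec_def by (intro continuous_intros)

lemma continuous_on_bary:
  assumes a: "\<And>i. a i \<in> hyp_plane"
  shows "continuous_on std_triangle (bary a)"
proof -
  have "snd (bvec a y) \<noteq> 0" if "y \<in> std_triangle" for y using snd_bvec_pos[of a, OF a that] by simp
  then show ?thesis unfolding bary_def proj_def
    by (intro continuous_intros continuous_on_bvec) auto
qed

lemma bary_eq_sum:
  assumes a: "\<And>i. a i \<in> hyp_plane" and y: "y \<in> std_triangle"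
  defines "\<mu> \<equiv> \<lambda>i. 1 / sqrt (1 - (norm (a i))\<^sup>2)"
  defines "s \<equiv> \<Sum>i\<in>UNIV. y $ i * \<mu> i"
  shows "0 < s" "bary a y = (\<Sum>i\<in>UNIV. (y $ i * \<mu> i / s) *\<^sub>R a i)"
proof -
  have b: "bvec a y = (\<Sum>i\<in>UNIV. (y $ i * \<mu> i) *\<^sub>R a i, s)"
    by (simp add: bvec_def lift_def s_def \<mu>_def prod_eq_iff fst_sum snd_sum)
  then show s: "0 < s" using snd_bvec_pos[of a, OF a y] by simp
  show "bary a y = (\<Sum>i\<in>UNIV. (y $ i * \<mu> i / s) *\<^sub>R a i)"
    unfolding bary_def proj_def b by (simp add: scaleR_sum_right divide_inverse mult_ac)
qed

lemma reweight_std: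
  assumes \<mu>: "\<And>i. 0 < \<mu> i" and w: "w \<in> std_triangle"
  shows "\<exists>y\<in>std_triangle. \<forall>i. y $ i * \<mu> i / (\<Sum>i\<in>UNIV. y $ i * \<mu> i) = w $ i \<and> (y $ i = 0 \<longleftrightarrow> w $ i = 0)"
proof -
  define r where "r = (\<Sum>i\<in>UNIV. w $ i / \<mu> i)"
  obtain i0 where "0 < w $ i0" by (rule std_triangle_pos[OF w])
  then have r: "0 < r" unfolding r_def using \<mu> std_triangleD(1)[OF w]
    by (intro sum_pos2[of _ i0]) (auto intro!: divide_pos_pos divide_nonneg_pos)
  define y :: "real^3" where "y = (\<chi> i. w $ i / \<mu> i / r)"
  have y\<mu>: "y $ i * \<mu> i = w $ i / r" for i using \<mu>[of i] by (simp add: y_def)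
  have s: "(\<Sum>i\<in>UNIV. y $ i * \<mu> i) = 1 / r"
    unfolding y\<mu> using std_triangleD(2)[OF w] by (simp add: sum_divide_distrib[symmetric])
  show ?thesis
  proof (intro bexI[of _ y] allI conjI)
    have "(\<Sum>i\<in>UNIV. y $ i) = (\<Sum>i\<in>UNIV. w $ i / \<mu> i) / r" by (simp add: y_def sum_divide_distrib)
    then have "(\<Sum>i\<in>UNIV. y $ i) = r / r" unfolding r_def[symmetric] .
    then show "y \<in> std_triangle" using r \<mu> std_triangleD(1)[OF w]
      by (auto simp: std_triangle_def y_def intro!: divide_nonneg_pos)
    show "y $ i * \<mu> i / (\<Sum>i\<in>UNIV. y $ i * \<mu> i) = w $ i" for i by (subst s, subst y\<mu>) (use r in simp)
    show "y $ i = 0 \<longleftrightarrow> w $ i = 0" for i using \<mu>[of i] r by (simp add: y_def)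
  qed
qed

text \<open>Hyperbolic and Euclidean barycentric coordinates differ by positive weights and a
  normalisation, so the same coordinates vanish. The set Z is empty for the whole triangle and a
  singleton for a side.\<close>

lemma bary_image_weights:
  assumes a: "\<And>i. a i \<in> hyp_plane"
  shows "bary a ` {y \<in> std_triangle. \<forall>i\<in>Z. y $ i = 0} = (\<lambda>w. \<Sum>i\<in>UNIV. (w $ i) *\<^sub>R a i) ` {w \<in> std_triangle. \<forall>i\<in>Z. w $ i = 0}"
    (is "?L = ?R")
proof
  define \<mu> where "\<mu> = (\<lambda>i. 1 / sqrt (1 - (norm (a i))\<^sup>2))"
  have \<mu>: "0 < \<mu> i" for i unfolding \<mu>_def by (rule lift_scale_pos[OF a])
  show "?L \<subseteq> ?R"
  proof safe
    fix y assume y: "y \<in> std_triangle" "\<forall>i\<in>Z. y $ i = 0"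
    define s where "s = (\<Sum>i\<in>UNIV. y $ i * \<mu> i)"
    have b: "0 < s" "bary a y = (\<Sum>i\<in>UNIV. (y $ i * \<mu> i / s) *\<^sub>R a i)"
      unfolding s_def \<mu>_def by (rule bary_eq_sum[of a y, OF a y(1)])+
    define w :: "real^3" where "w = (\<chi> i. y $ i * \<mu> i / s)"
    have "w \<in> std_triangle"
      unfolding std_triangle_def
    proof (intro CollectI conjI allI)
      show "0 \<le> w $ i" for i
        unfolding w_def using b(1) less_imp_le[OF \<mu>[of i]] std_triangleD(1)[OF y(1), of i] by simp
      show "(\<Sum>i\<in>UNIV. w $ i) = 1"
        using b(1) unfolding w_def by (simp add: sum_divide_distrib[symmetric] s_def[symmetric])
    qed
    moreover have "\<forall>i\<in>Z. w $ i = 0" using y(2) by (simp add: w_def)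
    moreover have "bary a y = (\<Sum>i\<in>UNIV. (w $ i) *\<^sub>R a i)" using b(2) by (simp add: w_def)
    ultimately show "bary a y \<in> ?R" by blast
  qed
  show "?R \<subseteq> ?L"
  proof safe
    fix w assume w: "w \<in> std_triangle" "\<forall>i\<in>Z. w $ i = 0"
    obtain y where y: "y \<in> std_triangle" "\<And>i. y $ i * \<mu> i / (\<Sum>i\<in>UNIV. y $ i * \<mu> i) = w $ i"
      "\<And>i. y $ i = 0 \<longleftrightarrow> w $ i = 0" using reweight_std[of \<mu> w, OF \<mu> w(1)] by metis
    have e: "(\<Sum>i\<in>UNIV. (w $ i) *\<^sub>R a i) = bary a y"
      using bary_eq_sum(2)[of a y, OF a y(1)] y(2) unfolding \<mu>_def by simp
    have "y \<in> {y \<in> std_triangle. \<forall>i\<in>Z. y $ i = 0}" using y(1,3) w(2) by simp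
    then show "(\<Sum>i\<in>UNIV. (w $ i) *\<^sub>R a i) \<in> ?L" unfolding e by (rule imageI)
  qed
qed

lemma bary_image_std:
  assumes a: "\<And>i. a i \<in> hyp_plane"
  shows "bary a ` std_triangle = convex hull (range a)"
proof -
  have 1: "bary a ` std_triangle = (\<lambda>w. \<Sum>i\<in>UNIV. (w $ i) *\<^sub>R a i) ` std_triangle" (is "_ = ?f ` _")
    using bary_image_weights[of a "{}", OF a] by simp
  have lin: "linear ?f" by (rule linearI) (simp_all add: scaleR_add_left sum.distrib scaleR_sum_right)
  have "?f ` std_triangle = convex hull (range a)"
  proof
    show "?f ` std_triangle \<subseteq> convex hull (range a)"
    proof clarify
      fix w :: "real^3" assume "w \<in> std_triangle"
      then show "?f w \<in> convex hull (range a)"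
        using std_triangleD by (intro convex_sum[OF finite convex_convex_hull]) (auto intro: hull_inc)
    qed
    show "convex hull (range a) \<subseteq> ?f ` std_triangle"
    proof (rule hull_minimal)
      show "range a \<subseteq> ?f ` std_triangle"
      proof
        fix z assume "z \<in> range a"
        then obtain i where "z = a i" by blast
        then have "z = ?f (corner i)" by (simp add: corner_nth if_distrib[of "\<lambda>c. c *\<^sub>R _"] cong: if_cong)
        then show "z \<in> ?f ` std_triangle" using corner_std by blast
      qed
      show "convex (?f ` std_triangle)" by (rule convex_linear_image[OF lin convex_std_triangle])
    qed
  qed
  then show ?thesis using 1 by simp
qed

text \<open>Unlike \<open>side_pt\<close>, whose direction is dictated by the cyclic order, this
  admits both directions of a side; gluings may reverse sides.\<close>

definition edge_pt :: "3 \<Rightarrow> 3 \<Rightarrow> real \<Rightarrow> real^3" where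
  "edge_pt i k s = (1 - s) *\<^sub>R corner i + s *\<^sub>R corner k"

lemma side_pt_edge_pt: "side_pt i s = edge_pt (i + 1) (i + 2) s"
  by (simp add: side_pt_def edge_pt_def)

lemma edge_pt_swap: "edge_pt k i s = edge_pt i k (1 - s)"
  by (simp add: edge_pt_def add.commute)

lemma edge_pt_nth:
  assumes "i \<noteq> k"
  shows "edge_pt i k s $ j = (if j = i then 1 - s else if j = k then s else 0)"
  using assms by (simp add: edge_pt_def corner_nth)

lemma edge_pt_ends: "edge_pt i k 0 = corner i" "edge_pt i k 1 = corner k"
  by (simp_all add: edge_pt_def)

lemma edge_pt_std: "0 \<le> s \<Longrightarrow> s \<le> 1 \<Longrightarrow> edge_pt i k s \<in> std_triangle"
  unfolding edge_pt_def using convex_std_triangle corner_std by (intro convexD) auto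

lemma edge_pt_inj: "i \<noteq> k \<Longrightarrow> edge_pt i k s = edge_pt i k s' \<longleftrightarrow> s = s'"
proof -
  assume "i \<noteq> k"
  then have "edge_pt i k r $ k = r" for r using edge_pt_nth[of i k r k] by simp
  then show ?thesis by metis
qed

lemma side_image: "side_pt i ` {0..1} = {y \<in> std_triangle. y $ i = 0}"
proof
  show "side_pt i ` {0..1} \<subseteq> {y \<in> std_triangle. y $ i = 0}"
    by (auto simp: side_pt_edge_pt edge_pt_std edge_pt_nth cyc3_neq)
  show "{y \<in> std_triangle. y $ i = 0} \<subseteq> side_pt i ` {0..1}"
  proof safe
    fix y assume y: "y \<in> std_triangle" "y $ i = 0"
    have s: "y $ (i + 1) + y $ (i + 2) = 1"
      using std_triangleD(2)[OF y(1)] y(2) by (simp add: sum_cyc3[of _ i])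
    have "y = side_pt i (y $ (i + 2))"
    proof (rule vec_eq_iff[THEN iffD2], rule allI)
      fix j show "y $ j = side_pt i (y $ (i + 2)) $ j"
        using exhaust_cyc3[of j i] s y(2) by (auto simp: side_pt_edge_pt edge_pt_nth cyc3_neq)
    qed
    then show "y \<in> side_pt i ` {0..1}"
      using std_triangleD(1)[OF y(1), of "i + 2"] std_triangle_le1[OF y(1), of "i + 2"] by auto
  qed
qed

lemma bary_side_image:
  assumes a: "\<And>i. a i \<in> hyp_plane"
  shows "bary a ` side_pt i ` {0..1} = closed_segment (a (i + 1)) (a (i + 2))"
proof -
  have "bary a ` side_pt i ` {0..1} = (\<lambda>w. \<Sum>j\<in>UNIV. (w $ j) *\<^sub>R a j) ` side_pt i ` {0..1}"
    unfolding side_image using bary_image_weights[of a "{i}", OF a] by simp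
  also have "\<dots> = (\<lambda>s. (1 - s) *\<^sub>R a (i + 1) + s *\<^sub>R a (i + 2)) ` {0..1}"
    unfolding image_image by (intro image_cong refl)
      (simp add: sum_cyc3[of _ i] side_pt_edge_pt edge_pt_nth cyc3_neq)
  also have "\<dots> = closed_segment (a (i + 1)) (a (i + 2))"
    by (auto simp: closed_segment_def)
  finally show ?thesis .
qed

lemma homeomorphic_map_bary:
  assumes a: "hyp_triangle a"
  shows "homeomorphic_map (top_of_set std_triangle) (top_of_set (convex hull (range a))) (bary a)"
proof (rule continuous_imp_homeomorphic_map)
  have a': "\<And>i. a i \<in> hyp_plane" using a unfolding hyp_triangle_iff by auto
  show "compact_space (top_of_set std_triangle)" using compact_std_triangle by (simp add: compact_space_subtopology)
  show "Hausdorff_space (top_of_set (convex hull range a))" by (simp add: Hausdorff_space_subtopology)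
  show "continuous_map (top_of_set std_triangle) (top_of_set (convex hull range a)) (bary a)"
    using continuous_on_bary[of a, OF a'] bary_image_std[of a, OF a'] by auto
  show "bary a ` topspace (top_of_set std_triangle) = topspace (top_of_set (convex hull range a))"
    using bary_image_std[of a, OF a'] by simp
  show "inj_on (bary a) (topspace (top_of_set std_triangle))"
    using bary_inj[OF a] by (auto intro: inj_onI)
qed

lemma bvec_edge_pt: "bvec a (edge_pt i k s) = (1 - s) *\<^sub>R lift (a i) + s *\<^sub>R lift (a k)"
proof -
  have "bvec a (u *\<^sub>R x + v *\<^sub>R y) = u *\<^sub>R bvec a x + v *\<^sub>R bvec a y" for u v x y
    by (simp add: bvec_def scaleR_add_left sum.distrib scaleR_sum_right)
  then show ?thesis by (simp add: edge_pt_def bvec_corner)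
qed

text \<open>The point is that the norm depends on the triangle only through the length of the side,
  so equal parameters on sides of equal length mean equal hyperbolic positions.\<close>

lemma bnorm_edge_pt:
  assumes "a i \<in> hyp_plane" "a k \<in> hyp_plane"
  shows "bnorm a (edge_pt i k s) = sqrt ((1 - s)\<^sup>2 + s\<^sup>2 + 2 * s * (1 - s) * lor (lift (a i)) (lift (a k)))"
  using assms by (simp add: bnorm_def bvec_edge_pt lor_algebra lor_lift_self lor_commute[of "lift (a k)" "lift (a i)"]
      power2_eq_square algebra_simps)

section \<open>Hyperbolic trigonometry\<close>

text \<open>Substituting q = p + u and r = p + v turns both sides into expressions in p, u, v. The
  right-hand side is a multiple of the product of the tangential parts of the lifts at p, which
  links the angle of the Klein metric to the law of cosines.\<close>

lemma hyp_inner_lor: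
  assumes p: "p \<in> hyp_plane" and q: "q \<in> hyp_plane" and r: "r \<in> hyp_plane"
  shows "(1 - (norm p)\<^sup>2) * hyp_inner p (q - p) (r - p) =
     (lor (lift p) (lift q) * lor (lift p) (lift r) - lor (lift q) (lift r))
       * (sqrt (1 - (norm q)\<^sup>2) * sqrt (1 - (norm r)\<^sup>2))"
proof -
  define \<alpha> where "\<alpha> = 1 - p \<bullet> p"
  have \<alpha>: "0 < \<alpha>" "1 - (norm p)\<^sup>2 = \<alpha>"
    using p unfolding mem_hyp_plane \<alpha>_def power2_norm_eq_inner by simp_all
  have q0: "0 < sqrt (1 - (norm q)\<^sup>2)" "0 < sqrt (1 - (norm r)\<^sup>2)" using q r by (simp_all add: mem_hyp_plane)
  have "(lor (lift p) (lift q) * lor (lift p) (lift r) - lor (lift q) (lift r))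
       * (sqrt (1 - (norm q)\<^sup>2) * sqrt (1 - (norm r)\<^sup>2))
     = (1 - p \<bullet> q) * (1 - p \<bullet> r) / (sqrt \<alpha> * sqrt \<alpha>) - (1 - q \<bullet> r)"
  proof -
    have "(n1 / (Z * X) * (n2 / (Z * Y)) - n3 / (X * Y)) * (X * Y) = n1 * n2 / (Z * Z) - n3"
      if "0 < X" "0 < Y" "0 < Z" for X Y Z n1 n2 n3 :: real
      using that by (simp add: field_simps)
    then show ?thesis unfolding lor_lift \<alpha>(2) using q0 \<alpha>(1) by simp
  qed
  also have "sqrt \<alpha> * sqrt \<alpha> = \<alpha>" using \<alpha> by simp
  also have "(1 - p \<bullet> q) * (1 - p \<bullet> r) / \<alpha> - (1 - q \<bullet> r) = \<alpha> * hyp_inner p (q - p) (r - p)"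
  proof -
    define u v where "u = q - p" and "v = r - p"
    have qr: "q = p + u" "r = p + v" by (simp_all add: u_def v_def)
    have 1: "1 - p \<bullet> q = \<alpha> - p \<bullet> u" "1 - p \<bullet> r = \<alpha> - p \<bullet> v" "1 - q \<bullet> r = \<alpha> - p \<bullet> u - p \<bullet> v - u \<bullet> v"
      unfolding qr \<alpha>_def by (simp_all add: inner_simps inner_commute)
    have 2: "hyp_inner p u v = (u \<bullet> v) / \<alpha> + (p \<bullet> u) * (p \<bullet> v) / \<alpha>\<^sup>2" by (simp add: hyp_inner_def \<alpha>(2))
    show ?thesis
      unfolding 1 u_def[symmetric] v_def[symmetric] 2 using \<alpha>(1)
      by (simp add: field_simps power2_eq_square)
  qed
  finally show ?thesis using \<alpha> by simp
qed

lemma hyp_angle_lor: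
  assumes p: "p \<in> hyp_plane" and q: "q \<in> hyp_plane" and r: "r \<in> hyp_plane"
  shows "hyp_angle p q r = arccos ((lor (lift p) (lift q) * lor (lift p) (lift r) - lor (lift q) (lift r))
     / (sqrt ((lor (lift p) (lift q))\<^sup>2 - 1) * sqrt ((lor (lift p) (lift r))\<^sup>2 - 1)))"
proof -
  define \<alpha> where "\<alpha> = 1 - (norm p)\<^sup>2"
  have \<alpha>: "0 < \<alpha>" using p unfolding mem_hyp_plane \<alpha>_def by simp
  have s: "0 < sqrt (1 - (norm q)\<^sup>2)" "0 < sqrt (1 - (norm r)\<^sup>2)" using q r by (simp_all add: mem_hyp_plane)
  have self: "sqrt (hyp_inner p (x - p) (x - p)) = sqrt ((lor (lift p) (lift x))\<^sup>2 - 1) * sqrt (1 - (norm x)\<^sup>2) / sqrt \<alpha>"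
    if x: "x \<in> hyp_plane" for x
  proof -
    have "0 < 1 - (norm x)\<^sup>2" using x by (simp add: mem_hyp_plane)
    then have "sqrt (1 - (norm x)\<^sup>2) * sqrt (1 - (norm x)\<^sup>2) = 1 - (norm x)\<^sup>2" by simp
    then have "\<alpha> * hyp_inner p (x - p) (x - p) = ((lor (lift p) (lift x))\<^sup>2 - 1) * (1 - (norm x)\<^sup>2)"
      using hyp_inner_lor[OF p x x] lor_lift_self[OF x] by (simp add: \<alpha>_def power2_eq_square)
    then have "hyp_inner p (x - p) (x - p) = ((lor (lift p) (lift x))\<^sup>2 - 1) * (1 - (norm x)\<^sup>2) / \<alpha>"
      using \<alpha> by (simp add: field_simps)
    then show ?thesis by (simp add: real_sqrt_mult real_sqrt_divide)
  qed
  have qr: "hyp_inner p (q - p) (r - p) = (lor (lift p) (lift q) * lor (lift p) (lift r) - lor (lift q) (lift r))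
       * (sqrt (1 - (norm q)\<^sup>2) * sqrt (1 - (norm r)\<^sup>2)) / \<alpha>"
    using hyp_inner_lor[OF p q r] \<alpha> by (simp add: \<alpha>_def[symmetric] field_simps)
  have sa: "sqrt \<alpha> * sqrt \<alpha> = \<alpha>" using \<alpha> by simp
  have cancel: "X * (a * b) / \<alpha> / (Y * a / sqrt \<alpha> * (Z * b / sqrt \<alpha>)) = X / (Y * Z)"
    if "0 < a" "0 < b" for X Y Z a b :: real
  proof -
    have "Y * a / sqrt \<alpha> * (Z * b / sqrt \<alpha>) = (Y * Z) * (a * b) / \<alpha>"
      using sa by (simp add: mult_ac)
    then show ?thesis using that \<alpha> by simp
  qed
  show ?thesis unfolding hyp_angle_def qr self[OF q] self[OF r] cancel[OF s] ..
qed

lemma tri_angle_side_cosh: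
  assumes "\<And>i. a i \<in> hyp_plane"
  shows "tri_angle a i = arccos ((side_cosh a (i + 1) * side_cosh a (i + 2) - side_cosh a i)
     / (sqrt ((side_cosh a (i + 1))\<^sup>2 - 1) * sqrt ((side_cosh a (i + 2))\<^sup>2 - 1)))"
  unfolding tri_angle_def hyp_angle_lor[OF assms assms assms] lor_side_cosh
  by (simp add: side_cosh_def[of a i, symmetric] mult.commute)

text \<open>Here \<open>c\<^sub>i = cosh l\<^sub>i\<close>, and \<open>\<Delta>\<close> is the Gram determinant.\<close>

lemma cosine_laws:
  fixes c0 c1 c2 :: real
  assumes c: "1 < c0" "1 < c1" "1 < c2"
    and \<Delta>: "0 < 1 + 2 * c0 * c1 * c2 - c0\<^sup>2 - c1\<^sup>2 - c2\<^sup>2"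
  defines "A x y z \<equiv> arccos ((y * z - x) / (sqrt (y\<^sup>2 - 1) * sqrt (z\<^sup>2 - 1)))"
  shows "0 < A c0 c1 c2" "A c0 c1 c2 < pi"
    "cos (A c0 c1 c2) + cos (A c1 c2 c0) * cos (A c2 c0 c1) = c0 * sin (A c1 c2 c0) * sin (A c2 c0 c1)"
    "cos (A c0 c1 c2) = (c1 * c2 - c0) / (sqrt (c1\<^sup>2 - 1) * sqrt (c2\<^sup>2 - 1))"
proof -
  define D where "D = 1 + 2 * c0 * c1 * c2 - c0\<^sup>2 - c1\<^sup>2 - c2\<^sup>2"
  have D: "0 < D" using \<Delta> by (simp add: D_def)
  have gen: "0 < A x y z \<and> A x y z < pi \<and> cos (A x y z) = (y * z - x) / (sqrt (y\<^sup>2 - 1) * sqrt (z\<^sup>2 - 1))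
     \<and> sin (A x y z) = sqrt D / (sqrt (y\<^sup>2 - 1) * sqrt (z\<^sup>2 - 1))"
    if y: "1 < y" and z: "1 < z" and d: "D = 1 + 2 * x * y * z - x\<^sup>2 - y\<^sup>2 - z\<^sup>2" for x y z
  proof -
    have yz: "0 < y\<^sup>2 - 1" "0 < z\<^sup>2 - 1" using y z by (simp_all add: power_gt1_lemma one_less_power)
    define t where "t = (y * z - x) / (sqrt (y\<^sup>2 - 1) * sqrt (z\<^sup>2 - 1))"
    have d': "D = (y\<^sup>2 - 1) * (z\<^sup>2 - 1) - (y * z - x)\<^sup>2" unfolding d by (simp add: power2_eq_square algebra_simps)
    have t2: "t\<^sup>2 = (y * z - x)\<^sup>2 / ((y\<^sup>2 - 1) * (z\<^sup>2 - 1))"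
      using yz by (simp add: t_def power_divide power_mult_distrib)
    have e: "1 - t\<^sup>2 = D / ((y\<^sup>2 - 1) * (z\<^sup>2 - 1))" unfolding t2 d' using yz by (simp add: diff_divide_distrib)
    then have "0 < 1 - t\<^sup>2" using D yz by simp
    then have t: "-1 < t" "t < 1" using abs_square_less_1[of t] by (auto simp: abs_less_iff)
    have At: "A x y z = arccos t" by (simp add: A_def t_def)
    have "sin (arccos t) = sqrt (1 - t\<^sup>2)" using t by (intro sin_arccos) auto
    also have "\<dots> = sqrt D / (sqrt (y\<^sup>2 - 1) * sqrt (z\<^sup>2 - 1))" unfolding e by (simp add: real_sqrt_divide real_sqrt_mult)
    finally show ?thesis unfolding At t_def[symmetric] using t arccos_lt_bounded[of t] by (simp add: cos_arccos)
  qed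
  have g0: "0 < A c0 c1 c2 \<and> A c0 c1 c2 < pi \<and> cos (A c0 c1 c2) = (c1 * c2 - c0) / (sqrt (c1\<^sup>2 - 1) * sqrt (c2\<^sup>2 - 1))
     \<and> sin (A c0 c1 c2) = sqrt D / (sqrt (c1\<^sup>2 - 1) * sqrt (c2\<^sup>2 - 1))"
    by (rule gen) (use c in \<open>simp_all add: D_def\<close>)
  have g1: "cos (A c1 c2 c0) = (c2 * c0 - c1) / (sqrt (c2\<^sup>2 - 1) * sqrt (c0\<^sup>2 - 1))"
     "sin (A c1 c2 c0) = sqrt D / (sqrt (c2\<^sup>2 - 1) * sqrt (c0\<^sup>2 - 1))"
    using gen[of c2 c0 c1] c by (simp_all add: D_def)
  have g2: "cos (A c2 c0 c1) = (c0 * c1 - c2) / (sqrt (c0\<^sup>2 - 1) * sqrt (c1\<^sup>2 - 1))"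
     "sin (A c2 c0 c1) = sqrt D / (sqrt (c0\<^sup>2 - 1) * sqrt (c1\<^sup>2 - 1))"
    using gen[of c0 c1 c2] c by (simp_all add: D_def)
  show "0 < A c0 c1 c2" "A c0 c1 c2 < pi"
    "cos (A c0 c1 c2) = (c1 * c2 - c0) / (sqrt (c1\<^sup>2 - 1) * sqrt (c2\<^sup>2 - 1))" using g0 by blast+
  define s0 s1 s2 where "s0 = sqrt (c0\<^sup>2 - 1)" and "s1 = sqrt (c1\<^sup>2 - 1)" and "s2 = sqrt (c2\<^sup>2 - 1)"
  have s: "0 < s0" "0 < s1" "0 < s2" using c by (simp_all add: s0_def s1_def s2_def)
  have s00: "s0 * s0 = c0\<^sup>2 - 1" using c by (simp add: s0_def power2_eq_square[symmetric])
  have DD: "sqrt D * sqrt D = D" using D by simp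
  have num: "(c1 * c2 - c0) * (s0 * s0) + (c2 * c0 - c1) * (c0 * c1 - c2) = c0 * D"
    unfolding s00 D_def by (simp add: power2_eq_square algebra_simps)
  have "(c1 * c2 - c0) / (s1 * s2) + (c2 * c0 - c1) / (s2 * s0) * ((c0 * c1 - c2) / (s0 * s1))
     = ((c1 * c2 - c0) * (s0 * s0) + (c2 * c0 - c1) * (c0 * c1 - c2)) / ((s0 * s0) * s1 * s2)"
    using s by (simp add: field_simps)
  also have "\<dots> = c0 * (sqrt D / (s2 * s0)) * (sqrt D / (s0 * s1))"
    unfolding num using s DD by (simp add: field_simps)
  finally show "cos (A c0 c1 c2) + cos (A c1 c2 c0) * cos (A c2 c0 c1) = c0 * sin (A c1 c2 c0) * sin (A c2 c0 c1)"
    using g0 g1 g2 by (simp add: s0_def s1_def s2_def)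
qed

lemma side_cosh_gt1: "hyp_triangle a \<Longrightarrow> 1 < side_cosh a i"
  unfolding side_cosh_def hyp_triangle_def
  by (intro lor_lift_gt1) (auto simp: inj_eq cyc3_neq)

lemma hyp_triangle_laws:
  assumes a: "hyp_triangle a"
  shows "0 < tri_angle a i" "tri_angle a i < pi"
    "cos (tri_angle a i) + cos (tri_angle a (i + 1)) * cos (tri_angle a (i + 2))
       = side_cosh a i * sin (tri_angle a (i + 1)) * sin (tri_angle a (i + 2))"
proof -
  have a': "\<And>i. a i \<in> hyp_plane" and v: "tri_vol a \<noteq> 0" using a unfolding hyp_triangle_iff by auto
  have \<Delta>: "0 < 1 + 2 * side_cosh a i * side_cosh a (i + 1) * side_cosh a (i + 2)
     - (side_cosh a i)\<^sup>2 - (side_cosh a (i + 1))\<^sup>2 - (side_cosh a (i + 2))\<^sup>2"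
    using tri_vol_sq[of a i, OF a'] v by (metis zero_less_power2)
  note L = cosine_laws[OF side_cosh_gt1[OF a, of i] side_cosh_gt1[OF a, of "i + 1"] side_cosh_gt1[OF a, of "i + 2"] \<Delta>]
  have e: "tri_angle a (i + 1) = arccos ((side_cosh a (i + 2) * side_cosh a i - side_cosh a (i + 1))
     / (sqrt ((side_cosh a (i + 2))\<^sup>2 - 1) * sqrt ((side_cosh a i)\<^sup>2 - 1)))"
    "tri_angle a (i + 2) = arccos ((side_cosh a i * side_cosh a (i + 1) - side_cosh a (i + 2))
     / (sqrt ((side_cosh a i)\<^sup>2 - 1) * sqrt ((side_cosh a (i + 1))\<^sup>2 - 1)))"
    using tri_angle_side_cosh[of a "i + 1", OF a'] tri_angle_side_cosh[of a "i + 2", OF a'] by (simp_all only: cyc3)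
  show "0 < tri_angle a i" "tri_angle a i < pi"
    "cos (tri_angle a i) + cos (tri_angle a (i + 1)) * cos (tri_angle a (i + 2))
       = side_cosh a i * sin (tri_angle a (i + 1)) * sin (tri_angle a (i + 2))"
    using L(1-3) unfolding e tri_angle_side_cosh[of a i, OF a'] by blast+
qed

text \<open>Each inequality between cosines leaves two alternatives for an angle X: X < \<pi> - Y -
  Z, which is the claim, or X < Y + Z - \<pi>. The second one for all three angles would force a sum
  above 3 * \<pi>.\<close>

lemma angle_sum_lt_pi:
  fixes A B C :: real
  assumes A: "0 < A" "A < pi" and B: "0 < B" "B < pi" and C: "0 < C" "C < pi"
    and c: "- cos (B + C) < cos A" "- cos (A + C) < cos B" "- cos (A + B) < cos C"
  shows "A + B + C < pi"
proof -
  have key: "X < pi - Y - Z \<or> X < Y + Z - pi"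
    if "0 < X" "X < pi" "0 < Y" "Y < pi" "0 < Z" "Z < pi" "- cos (Y + Z) < cos X" for X Y Z :: real
  proof (cases "Y + Z \<le> pi")
    case True
    have "cos (pi - (Y + Z)) < cos X" using that by (simp add: cos_diff)
    then have "X < pi - (Y + Z)" using that True by (subst (asm) cos_mono_less_eq) auto
    then show ?thesis by simp
  next
    case False
    have "cos (Y + Z - pi) < cos X" using that by (simp add: cos_diff)
    then have "X < Y + Z - pi" using that False by (subst (asm) cos_mono_less_eq) auto
    then show ?thesis by simp
  qed
  show ?thesis
    using key[of A B C] key[of B A C] key[of C A B] assms by argo
qed

text \<open>In the dual law of cosines the hyperbolic cosine of the side exceeds 1, which gives the
  strict inequalities that \<open>angle_sum_lt_pi\<close> asks for.\<close>

lemma tri_angle_sum: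
  assumes a: "hyp_triangle a"
  shows "(\<Sum>i\<in>UNIV. tri_angle a i) < pi"
proof -
  have k: "- cos (tri_angle a (i + 1) + tri_angle a (i + 2)) < cos (tri_angle a i)" for i
  proof -
    have "0 < sin (tri_angle a (i + 1)) * sin (tri_angle a (i + 2))"
      using hyp_triangle_laws(1,2)[OF a] by (intro mult_pos_pos sin_gt_zero)
    then have "1 * (sin (tri_angle a (i + 1)) * sin (tri_angle a (i + 2)))
        < side_cosh a i * (sin (tri_angle a (i + 1)) * sin (tri_angle a (i + 2)))"
      using side_cosh_gt1[OF a, of i] by (intro mult_strict_right_mono)
    then show ?thesis using hyp_triangle_laws(3)[OF a, of i] by (simp add: cos_add)
  qed
  fix j :: 3
  have "tri_angle a j + tri_angle a (j + 1) + tri_angle a (j + 2) < pi"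
    using k[of j] k[of "j + 1", unfolded cyc3] k[of "j + 2", unfolded cyc3] hyp_triangle_laws(1,2)[OF a]
    by (intro angle_sum_lt_pi) (simp_all add: add.commute)
  then show ?thesis by (simp add: sum_cyc3[of _ j])
qed

definition psi_of :: "(3 \<Rightarrow> complex) \<Rightarrow> 3 \<Rightarrow> real" where
  "psi_of a i = (pi + tri_angle a i - tri_angle a (i + 1) - tri_angle a (i + 2)) / 2"

lemma tri_ang_psi_of: "tri_ang (psi_of a) i = tri_angle a i"
  by (simp add: tri_ang_def psi_of_def cyc3 field_simps)

lemma tri_dom_psi_of:
  assumes a: "hyp_triangle a"
  shows "tri_dom (psi_of a)"
proof -
  fix j :: 3
  have "tri_excess (psi_of a) = (pi - (\<Sum>i\<in>UNIV. tri_angle a i)) / 2"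
    by (simp add: tri_excess_def psi_of_def sum_cyc3[of _ j] cyc3 field_simps)
  then show ?thesis
    using tri_angle_sum[OF a] hyp_triangle_laws(1)[OF a] by (simp add: tri_dom_def tri_ang_psi_of)
qed

text \<open>The half-argument formula cosh l = 1 + 2 * sinh^2 (l / 2).\<close>

definition tri_cosh :: "(3 \<Rightarrow> real) \<Rightarrow> 3 \<Rightarrow> real" where
  "tri_cosh \<psi> i = 1 + 2 * exp (tri_grad \<psi> i)"

text \<open>Excess minus \<psi> i is minus the angle at i, and excess plus \<psi> i is \<pi> minus
  the other two angles. Product-to-sum therefore turns \<open>exp (tri_grad \<psi> i)\<close> into
  (cos a + cos (b + c)) / (2 * sin b * sin c), which is the dual law of cosines.\<close>

lemma tri_cosh_law:
  assumes d: "tri_dom \<psi>"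
  shows "tri_cosh \<psi> i * sin (tri_ang \<psi> (i + 1)) * sin (tri_ang \<psi> (i + 2))
     = cos (tri_ang \<psi> i) + cos (tri_ang \<psi> (i + 1)) * cos (tri_ang \<psi> (i + 2))"
proof -
  note s = tri_dom_sin_pos[OF d]
  define a b c where "a = tri_ang \<psi> i" "b = tri_ang \<psi> (i + 1)" "c = tri_ang \<psi> (i + 2)"
  have e: "tri_excess \<psi> = (pi - a - b - c) / 2" "\<psi> i = (pi + a - b - c) / 2"
    by (simp_all add: a_b_c_def tri_excess_def tri_ang_def sum_cyc3[of _ i] cyc3 field_simps)
  have "exp (tri_grad \<psi> i) = sin (tri_excess \<psi>) * sin (\<psi> i) / (sin b * sin c)"
    using s unfolding tri_grad_def a_b_c_def
    by (simp add: exp_diff exp_add)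
  moreover have "2 * (sin (tri_excess \<psi>) * sin (\<psi> i)) = cos a + cos (b + c)"
  proof -
    have "sin (tri_excess \<psi>) * sin (\<psi> i) = (cos (tri_excess \<psi> - \<psi> i) - cos (tri_excess \<psi> + \<psi> i)) / 2"
      by (rule sin_times_sin)
    moreover have "tri_excess \<psi> - \<psi> i = - a" "tri_excess \<psi> + \<psi> i = pi - (b + c)" unfolding e by (simp_all add: field_simps)
    ultimately show ?thesis by (simp add: cos_diff)
  qed
  ultimately have "2 * exp (tri_grad \<psi> i) * (sin b * sin c) = cos a + cos (b + c)"
    using s(2)[of "i + 1"] s(2)[of "i + 2"] by (simp add: a_b_c_def)
  then show ?thesis unfolding tri_cosh_def a_b_c_def[symmetric] by (simp add: cos_add algebra_simps)
qed

text \<open>Both sides solve the dual law of cosines for the same angles, and the product of sines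
  in it does not vanish.\<close>

lemma side_cosh_tri_cosh:
  assumes a: "hyp_triangle a"
  shows "side_cosh a i = tri_cosh (psi_of a) i"
proof -
  have "0 < sin (tri_angle a (i + 1)) * sin (tri_angle a (i + 2))"
    using hyp_triangle_laws(1,2)[OF a] by (intro mult_pos_pos sin_gt_zero)
  then have ne: "sin (tri_angle a (i + 1)) * sin (tri_angle a (i + 2)) \<noteq> 0" by (rule less_imp_neq[symmetric])
  have "side_cosh a i * (sin (tri_angle a (i + 1)) * sin (tri_angle a (i + 2)))
     = tri_cosh (psi_of a) i * (sin (tri_angle a (i + 1)) * sin (tri_angle a (i + 2)))"
    using hyp_triangle_laws(3)[OF a, of i] tri_cosh_law[OF tri_dom_psi_of[OF a], of i]
    unfolding tri_ang_psi_of mult.assoc by (rule trans[OF sym sym])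
  then show ?thesis by (simp only: mult_right_cancel[OF ne])
qed

text \<open>The point at distance \<open>arcosh C\<close> from the origin in direction \<open>\<alpha>\<close>.\<close>

definition polar :: "real \<Rightarrow> real \<Rightarrow> complex" where
  "polar C \<alpha> = sqrt (1 - 1 / C\<^sup>2) *\<^sub>R cis \<alpha>"

lemma polar_props:
  assumes C: "1 \<le> C"
  shows polar_mem: "polar C \<alpha> \<in> hyp_plane" and lift_polar: "lift (polar C \<alpha>) = (sqrt (C\<^sup>2 - 1) *\<^sub>R cis \<alpha>, C)"
proof -
  have C1: "1 \<le> C\<^sup>2" using C by simp
  then have "1 / C\<^sup>2 \<le> 1 / 1" by (intro divide_left_mono) auto
  then have "0 \<le> 1 - 1 / C\<^sup>2" by simp
  then have n: "(norm (polar C \<alpha>))\<^sup>2 = 1 - 1 / C\<^sup>2" by (simp add: polar_def power_mult_distrib)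
  then show "polar C \<alpha> \<in> hyp_plane" using C by (simp add: mem_hyp_plane)
  have s: "sqrt (1 / C\<^sup>2) = 1 / C" using C by (simp add: real_sqrt_divide)
  have "C * sqrt (1 - 1 / C\<^sup>2) = sqrt (C\<^sup>2 * (1 - 1 / C\<^sup>2))" using C by (simp add: real_sqrt_mult)
  also have "C\<^sup>2 * (1 - 1 / C\<^sup>2) = C\<^sup>2 - 1" using C by (simp add: field_simps)
  finally show "lift (polar C \<alpha>) = (sqrt (C\<^sup>2 - 1) *\<^sub>R cis \<alpha>, C)"
    unfolding lift_def n using s C by (simp add: polar_def scaleR_conv_of_real mult_ac flip: of_real_mult)
qed

lemma lor_polar:
  assumes "1 \<le> C" "1 \<le> D"
  shows "lor (lift (polar C \<alpha>)) (lift (polar D \<beta>)) = C * D - sqrt (C\<^sup>2 - 1) * sqrt (D\<^sup>2 - 1) * cos (\<alpha> - \<beta>)"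
  unfolding lift_polar[OF assms(1)] lift_polar[OF assms(2)]
  by (simp add: lor_def inner_complex_def cos_diff algebra_simps)

lemma polar_1: "polar 1 \<alpha> = 0" by (simp add: polar_def)

lemma lor_polar_0:
  assumes "1 \<le> C"
  shows "lor (lift 0) (lift (polar C \<alpha>)) = C" "lor (lift (polar C \<alpha>)) (lift 0) = C"
  using lor_polar[of 1 C 0 \<alpha>] lor_polar[of C 1 \<alpha> 0] assms by (simp_all add: polar_1)

text \<open>Passage from the dual law of cosines back to the law itself, with x and S the cosines
  and sines of the angles. The auxiliary D is the common value of (c1^2 - 1) * (S2 * S0)^2 and (c2^2
  - 1) * (S0 * S1)^2; its square root eliminates the roots in the claim.\<close>

lemma cosine_law_from_angles:
  fixes x0 x1 x2 :: real
  assumes S: "0 < S0" "0 < S1" "0 < S2" "S0\<^sup>2 = 1 - x0\<^sup>2" "S1\<^sup>2 = 1 - x1\<^sup>2" "S2\<^sup>2 = 1 - x2\<^sup>2"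
    and c: "1 < c0" "1 < c1" "1 < c2"
    and e: "c0 * S1 * S2 = x0 + x1 * x2" "c1 * S2 * S0 = x1 + x2 * x0" "c2 * S0 * S1 = x2 + x0 * x1"
  shows "c1 * c2 - c0 = sqrt (c1\<^sup>2 - 1) * sqrt (c2\<^sup>2 - 1) * x0"
proof -
  define D where "D = x0\<^sup>2 + x1\<^sup>2 + x2\<^sup>2 + 2 * x0 * x1 * x2 - 1"
  have q: "(c1\<^sup>2 - 1) * (S2 * S0)\<^sup>2 = D" 
  proof -
    have "(c1\<^sup>2 - 1) * (S2 * S0)\<^sup>2 = (c1 * S2 * S0)\<^sup>2 - S2\<^sup>2 * S0\<^sup>2" by (simp add: power2_eq_square algebra_simps)
    then show ?thesis unfolding e S D_def by (simp add: power2_eq_square algebra_simps)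
  qed
  have r: "(c2\<^sup>2 - 1) * (S0 * S1)\<^sup>2 = D"
  proof -
    have "(c2\<^sup>2 - 1) * (S0 * S1)\<^sup>2 = (c2 * S0 * S1)\<^sup>2 - S0\<^sup>2 * S1\<^sup>2" by (simp add: power2_eq_square algebra_simps)
    then show ?thesis unfolding e S D_def by (simp add: power2_eq_square algebra_simps)
  qed
  have "sqrt ((c1\<^sup>2 - 1) * (S2 * S0)\<^sup>2) = sqrt (c1\<^sup>2 - 1) * (S2 * S0)" using S by (simp add: real_sqrt_mult)
  then have q': "sqrt (c1\<^sup>2 - 1) * (S2 * S0) = sqrt D" unfolding q by simp
  have "sqrt ((c2\<^sup>2 - 1) * (S0 * S1)\<^sup>2) = sqrt (c2\<^sup>2 - 1) * (S0 * S1)" using S by (simp add: real_sqrt_mult)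
  then have r': "sqrt (c2\<^sup>2 - 1) * (S0 * S1) = sqrt D" unfolding r by simp
  have "0 < c1\<^sup>2 - 1" using c by simp
  then have D: "0 < D" unfolding q[symmetric] using S by (intro mult_pos_pos) auto
  have "(c1 * c2 - c0) * (S0\<^sup>2 * S1 * S2) = (c1 * S2 * S0) * (c2 * S0 * S1) - (c0 * S1 * S2) * S0\<^sup>2"
    by (simp add: power2_eq_square algebra_simps)
  also have "\<dots> = x0 * D" unfolding e S(4) D_def by (simp add: power2_eq_square algebra_simps)
  also have "\<dots> = x0 * (sqrt D * sqrt D)" using D by simp
  also have "\<dots> = (sqrt (c1\<^sup>2 - 1) * (S2 * S0)) * (sqrt (c2\<^sup>2 - 1) * (S0 * S1)) * x0" unfolding q' r' by (simp add: mult_ac)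
  also have "\<dots> = (sqrt (c1\<^sup>2 - 1) * sqrt (c2\<^sup>2 - 1) * x0) * (S0\<^sup>2 * S1 * S2)" by (simp add: power2_eq_square mult_ac)
  finally show ?thesis using S(1-3) by simp
qed

text \<open>One vertex is put at the origin, the other two at the prescribed distances on rays
  enclosing the prescribed angle. The law of cosines gives the third side, and the same law read
  backwards the remaining angles.\<close>

theorem hyp_triangle_exists:
  assumes d: "tri_dom \<psi>"
  obtains a where "hyp_triangle a" "\<And>i. side_cosh a i = tri_cosh \<psi> i" "\<And>i. tri_angle a i = tri_ang \<psi> i"
proof -
  define c where "c = tri_cosh \<psi>"
  define A where "A = tri_ang \<psi>"
  have c1: "1 < c i" for i by (simp add: c_def tri_cosh_def)
  note bd = tri_dom_bounds(3,4)[OF d, folded A_def]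
  have law: "c (i + 1) * c (i + 2) - c i = sqrt ((c (i + 1))\<^sup>2 - 1) * sqrt ((c (i + 2))\<^sup>2 - 1) * cos (A i)" for i
  proof (rule cosine_law_from_angles)
    show "0 < sin (A i)" "0 < sin (A (i + 1))" "0 < sin (A (i + 2))" using bd by (auto intro: sin_gt_zero)
    show "c i * sin (A (i + 1)) * sin (A (i + 2)) = cos (A i) + cos (A (i + 1)) * cos (A (i + 2))"
      "c (i + 1) * sin (A (i + 2)) * sin (A i) = cos (A (i + 1)) + cos (A (i + 2)) * cos (A i)"
      "c (i + 2) * sin (A i) * sin (A (i + 1)) = cos (A (i + 2)) + cos (A i) * cos (A (i + 1))"
      using tri_cosh_law[OF d, of i, folded c_def A_def] tri_cosh_law[OF d, of "i + 1", folded c_def A_def]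
        tri_cosh_law[OF d, of "i + 2", folded c_def A_def] by (simp_all only: cyc3)
  qed (use c1 in \<open>simp_all add: sin_squared_eq\<close>)
  define a :: "3 \<Rightarrow> complex" where "a i = (if i = 0 then 0 else if i = 1 then polar (c 2) 0 else polar (c 1) (A 0))" for i
  have [simp]: "(3::3) = 0" "(4::3) = 1" by auto
  have a0: "a 0 = 0" "a 1 = polar (c 2) 0" "a 2 = polar (c 1) (A 0)" by (simp_all add: a_def)
  have a': "a i \<in> hyp_plane" for i unfolding a_def using polar_mem c1 by (auto simp: hyp_plane_def less_imp_le)
  have sc: "side_cosh a i = c i" for i
  proof -
    have "side_cosh a 2 = c 2" "side_cosh a 1 = c 1"
      using lor_polar_0 c1 by (simp_all add: side_cosh_def a0 less_imp_le)
    moreover have "side_cosh a 0 = c 0"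
      using law[of 0] c1 by (simp add: side_cosh_def a0 lor_polar less_imp_le mult_ac)
    ultimately show ?thesis using exhaust_3[of i] by auto
  qed
  have pos: "0 < (c i)\<^sup>2 - 1" for i using c1[of i] by simp
  have "(tri_vol a)\<^sup>2 = ((c 1)\<^sup>2 - 1) * ((c 2)\<^sup>2 - 1) - (c 1 * c 2 - c 0)\<^sup>2"
    unfolding tri_vol_sq[of a 0, OF a'] sc by (simp add: power2_eq_square algebra_simps)
  also have "c 1 * c 2 - c 0 = sqrt ((c 1)\<^sup>2 - 1) * sqrt ((c 2)\<^sup>2 - 1) * cos (A 0)" using law[of 0] by simp
  also have "((c 1)\<^sup>2 - 1) * ((c 2)\<^sup>2 - 1) - (sqrt ((c 1)\<^sup>2 - 1) * sqrt ((c 2)\<^sup>2 - 1) * cos (A 0))\<^sup>2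
     = ((c 1)\<^sup>2 - 1) * ((c 2)\<^sup>2 - 1) * (sin (A 0))\<^sup>2"
    using pos[of 1] pos[of 2] by (simp add: power_mult_distrib sin_squared_eq algebra_simps)
  also have "\<dots> > 0" using pos sin_gt_zero[OF bd, of 0] by simp
  finally have "tri_vol a \<noteq> 0" by auto
  then have tri: "hyp_triangle a" using a' by (simp add: hyp_triangle_iff)
  have "tri_angle a i = A i" for i
  proof -
    have "0 < sqrt ((c (i + 1))\<^sup>2 - 1) * sqrt ((c (i + 2))\<^sup>2 - 1)"
      using pos[of "i + 1"] pos[of "i + 2"] by simp
    then have "(c (i + 1) * c (i + 2) - c i) / (sqrt ((c (i + 1))\<^sup>2 - 1) * sqrt ((c (i + 2))\<^sup>2 - 1)) = cos (A i)"
      unfolding law using pos[of "i + 1"] pos[of "i + 2"] by auto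
    then show ?thesis
      unfolding tri_angle_side_cosh[of a i, OF a'] sc using bd[of i] by (simp add: arccos_cos)
  qed
  then show ?thesis using that tri sc unfolding c_def A_def by blast
qed

section \<open>Geometry of triangles with a common side or a common corner\<close>

section \<open>Adjacent triangles\<close>

text \<open>The three indices sum to 0 modulo 3.\<close>

definition third :: "3 \<Rightarrow> 3 \<Rightarrow> 3" where
  "third i k = - (i + k)"

lemma third_props:
  fixes i k :: 3
  assumes "i \<noteq> k"
  shows "third i k \<noteq> i" "third i k \<noteq> k" "third k i = third i k" "third i (third i k) = k"
    "third (third i k) k = i" "j = i \<or> j = k \<or> j = third i k"
    "(i = third i k + 1 \<and> k = third i k + 2) \<or> (i = third i k + 2 \<and> k = third i k + 1)"
  using exhaust_3[of i] exhaust_3[of k] exhaust_3[of j] assms by (auto simp: third_def)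

lemma third_cyc: "third (l + 1) (l + 2) = l" "third (l + 2) (l + 1) = l" "third l (l + 1) = l + 2" "third l (l + 2) = l + 1"
  using exhaust_3[of l] by (auto simp: third_def)

lemma sum_third:
  fixes f :: "3 \<Rightarrow> 'b :: comm_monoid_add"
  assumes "i \<noteq> k"
  shows "sum f UNIV = f i + f k + f (third i k)"
proof -
  have "(UNIV :: 3 set) = {i, k, third i k}" using third_props(6)[OF assms] by auto
  then show ?thesis
    by (rule ssubst) (use third_props(1,2)[OF assms] assms in \<open>auto simp: add.assoc\<close>)
qed

text \<open>Equal lengths give equal norms, so coincidence at a parameter s is the linear equation
  (1 - s) P + s Q = 0 for the differences of the lifted endpoints; two parameters force P = Q =
  0.\<close>

lemma bary_edge_pt_eqD:
  assumes X: "\<And>j. X j \<in> hyp_plane" and Y: "\<And>j. Y j \<in> hyp_plane"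
    and len: "lor (lift (X i)) (lift (X k)) = lor (lift (Y i')) (lift (Y k'))"
    and s: "0 \<le> s1" "s1 < s2" "s2 \<le> 1"
    and eq: "bary X (edge_pt i k s1) = bary Y (edge_pt i' k' s1)" "bary X (edge_pt i k s2) = bary Y (edge_pt i' k' s2)"
  shows "X i = Y i'" "X k = Y k'"
proof -
  define P where "P = lift (X i) - lift (Y i')"
  define Q where "Q = lift (X k) - lift (Y k')"
  have e: "(1 - s) *\<^sub>R P + s *\<^sub>R Q = 0"
    if "bary X (edge_pt i k s) = bary Y (edge_pt i' k' s)" "0 \<le> s" "s \<le> 1" for s
  proof -
    have "bnorm X (edge_pt i k s) = bnorm Y (edge_pt i' k' s)"
      unfolding bnorm_edge_pt[OF X X] bnorm_edge_pt[OF Y Y] len ..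
    then have "bvec X (edge_pt i k s) = bvec Y (edge_pt i' k' s)"
      using bvec_eq_lift[of X, OF X edge_pt_std[OF that(2,3)]] bvec_eq_lift[of Y, OF Y edge_pt_std[OF that(2,3)]] that(1)
      by metis
    then show ?thesis unfolding bvec_edge_pt P_def Q_def by (simp add: algebra_simps)
  qed
  have "(1 - s1) *\<^sub>R P + s1 *\<^sub>R Q = 0" "(1 - s2) *\<^sub>R P + s2 *\<^sub>R Q = 0"
    using e eq s by auto
  then have 1: "s2 *\<^sub>R ((1 - s1) *\<^sub>R P + s1 *\<^sub>R Q) - s1 *\<^sub>R ((1 - s2) *\<^sub>R P + s2 *\<^sub>R Q) = 0"
    and 2: "(1 - s1) *\<^sub>R ((1 - s2) *\<^sub>R P + s2 *\<^sub>R Q) - (1 - s2) *\<^sub>R ((1 - s1) *\<^sub>R P + s1 *\<^sub>R Q) = 0" by simp_all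
  have "s2 *\<^sub>R ((1 - s1) *\<^sub>R P + s1 *\<^sub>R Q) - s1 *\<^sub>R ((1 - s2) *\<^sub>R P + s2 *\<^sub>R Q) = (s2 - s1) *\<^sub>R P"
    by (simp add: prod_eq_iff algebra_simps)
  moreover have "(1 - s1) *\<^sub>R ((1 - s2) *\<^sub>R P + s2 *\<^sub>R Q) - (1 - s2) *\<^sub>R ((1 - s1) *\<^sub>R P + s1 *\<^sub>R Q) = (s2 - s1) *\<^sub>R Q"
    by (simp add: prod_eq_iff algebra_simps)
  ultimately have "P = 0" "Q = 0" using 1 2 s by simp_all
  then show "X i = Y i'" "X k = Y k'" using lift_inj X Y by (simp_all add: P_def Q_def)
qed

lemma bary_edge_pt_cong:
  assumes "X i = Y i'" "X k = Y k'"
  shows "bary X (edge_pt i k s) = bary Y (edge_pt i' k' s)"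
  unfolding bary_def bvec_edge_pt assms ..

text \<open>A small move from an inner point of the common side into the triangle X also enters Y,
  provided that both third vertices lie on the same side of the line. For an injective chart this
  excludes folding along an edge.\<close>

lemma same_side_overlap:
  assumes X: "\<And>j. X j \<in> hyp_plane" and Y: "\<And>j. Y j \<in> hyp_plane"
    and ik: "i \<noteq> k" "i' \<noteq> k'" and XY: "X i = Y i'" "X k = Y k'"
    and vol: "0 < vol (lift (X i)) (lift (X k)) (lift (X (third i k))) * vol (lift (X i)) (lift (X k)) (lift (Y (third i' k')))"
    and s: "0 < s" "s < 1"
    and W: "openin (top_of_set std_triangle) W" "edge_pt i k s \<in> W"
    and W': "openin (top_of_set std_triangle) W'" "edge_pt i' k' s \<in> W'"
  shows "\<exists>y\<in>W \<inter> open_triangle. \<exists>y'\<in>W' \<inter> open_triangle. bary X y = bary Y y'"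
proof -
  let ?P = "lift (X i)" and ?Q = "lift (X k)" and ?R = "lift (X (third i k))" and ?R' = "lift (Y (third i' k'))"
  define V where "V = vol ?P ?Q ?R'"
  define V0 where "V0 = vol ?P ?Q ?R"
  have VV: "0 < V0 / V" "V \<noteq> 0" using vol by (auto simp: V_def V0_def zero_less_mult_iff zero_less_divide_iff)
  define y where "y e = (1 - e) *\<^sub>R edge_pt i k s + e *\<^sub>R corner (third i k)" for e :: real
  define w where "w e = bvec X (y e)" for e
  have bvec_lin: "bvec Z (u *\<^sub>R x + v *\<^sub>R z) = u *\<^sub>R bvec Z x + v *\<^sub>R bvec Z z" for Z u v x z
    by (simp add: bvec_def scaleR_add_left sum.distrib scaleR_sum_right)
  have w: "w e = (1 - e) *\<^sub>R ((1 - s) *\<^sub>R ?P + s *\<^sub>R ?Q) + e *\<^sub>R ?R" for e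
    unfolding w_def y_def bvec_lin bvec_edge_pt bvec_corner ..
  \<comment> \<open>Cramer coordinates of the moving point with respect to the vertices of Y. The
    first two stay near 1 - s and s, and the third grows linearly with a positive rate by
    \<open>vol\<close>.\<close>
  define \<alpha> \<beta> \<gamma> where "\<alpha> e = vol (w e) ?Q ?R' / V" and "\<beta> e = vol ?P (w e) ?R' / V" and "\<gamma> e = vol ?P ?Q (w e) / V" for e
  have comb: "w e = \<alpha> e *\<^sub>R ?P + \<beta> e *\<^sub>R ?Q + \<gamma> e *\<^sub>R ?R'" for e
  proof -
    have "V *\<^sub>R w e = V *\<^sub>R (\<alpha> e *\<^sub>R ?P + \<beta> e *\<^sub>R ?Q + \<gamma> e *\<^sub>R ?R')"
      using vol_Cramer[of ?P ?Q ?R' "w e"] VV(2) by (simp add: \<alpha>_def \<beta>_def \<gamma>_def scaleR_add_right V_def[symmetric])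
    then show ?thesis using VV(2) by simp
  qed
  have \<gamma>: "\<gamma> e = e * (V0 / V)" for e
    unfolding \<gamma>_def w vol_linear by (simp add: vol_alt(1-3) V0_def)
  have ev: "\<alpha> e = (1 - e) * (1 - s) + e * (vol ?R ?Q ?R' / V)" "\<beta> e = (1 - e) * s + e * (vol ?P ?R ?R' / V)" for e
    unfolding \<alpha>_def \<beta>_def w vol_linear using VV(2) by (simp_all add: vol_alt(1-3) V_def[symmetric] field_simps)
  have lim: "(\<alpha> \<longlongrightarrow> 1 - s) (at_right 0)" "(\<beta> \<longlongrightarrow> s) (at_right 0)" "(\<gamma> \<longlongrightarrow> 0) (at_right 0)"
  proof -
    have "((\<lambda>e. (1 - e) * (1 - s) + e * (vol ?R ?Q ?R' / V)) \<longlongrightarrow> (1 - 0) * (1 - s) + 0 * (vol ?R ?Q ?R' / V)) (at_right 0)"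
      "((\<lambda>e. (1 - e) * s + e * (vol ?P ?R ?R' / V)) \<longlongrightarrow> (1 - 0) * s + 0 * (vol ?P ?R ?R' / V)) (at_right 0)"
      "((\<lambda>e. e * (V0 / V)) \<longlongrightarrow> 0 * (V0 / V)) (at_right 0)"
      by (intro tendsto_intros)+
    then show "(\<alpha> \<longlongrightarrow> 1 - s) (at_right 0)" "(\<beta> \<longlongrightarrow> s) (at_right 0)" "(\<gamma> \<longlongrightarrow> 0) (at_right 0)"
      unfolding ev[abs_def] \<gamma>[abs_def] by simp_all
  qed
  define \<sigma> where "\<sigma> e = \<alpha> e + \<beta> e + \<gamma> e" for e
  have lim\<sigma>: "(\<sigma> \<longlongrightarrow> 1) (at_right 0)"
    using tendsto_add[OF tendsto_add[OF lim(1,2)] lim(3)] unfolding \<sigma>_def by simp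
  define y' where "y' e = (\<alpha> e / \<sigma> e) *\<^sub>R corner i' + (\<beta> e / \<sigma> e) *\<^sub>R corner k' + (\<gamma> e / \<sigma> e) *\<^sub>R corner (third i' k')" for e
  have limy': "(y' \<longlongrightarrow> edge_pt i' k' s) (at_right 0)"
  proof -
    have "(y' \<longlongrightarrow> ((1 - s) / 1) *\<^sub>R corner i' + (s / 1) *\<^sub>R corner k' + (0 / 1) *\<^sub>R corner (third i' k')) (at_right 0)"
      unfolding y'_def by (intro tendsto_intros lim lim\<sigma>) simp_all
    then show ?thesis by (simp add: edge_pt_def)
  qed
  have limy: "(y \<longlongrightarrow> edge_pt i k s) (at_right 0)"
  proof -
    have "(y \<longlongrightarrow> (1 - 0) *\<^sub>R edge_pt i k s + 0 *\<^sub>R corner (third i k)) (at_right 0)"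
      unfolding y_def by (intro tendsto_intros)
    then show ?thesis by simp
  qed
  obtain O1 where O1: "open O1" "W = std_triangle \<inter> O1" using W(1) by (auto simp: openin_open)
  obtain O2 where O2: "open O2" "W' = std_triangle \<inter> O2" using W'(1) by (auto simp: openin_open)
  have "\<forall>\<^sub>F e in at_right 0. y e \<in> O1" using topological_tendstoD[OF limy O1(1)] O1(2) W(2) by simp
  moreover have "\<forall>\<^sub>F e in at_right 0. y' e \<in> O2" using topological_tendstoD[OF limy' O2(1)] O2(2) W'(2) by simp
  moreover have "\<forall>\<^sub>F e in at_right 0. 0 < \<alpha> e" by (rule order_tendstoD(1)[OF lim(1)]) (use s in simp)
  moreover have "\<forall>\<^sub>F e in at_right 0. 0 < \<beta> e" by (rule order_tendstoD(1)[OF lim(2)]) (use s in simp)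
  moreover have "\<forall>\<^sub>F e::real in at_right 0. e \<in> {0<..<1}" by (rule eventually_at_right_real) simp
  ultimately have "\<forall>\<^sub>F e in at_right 0. y e \<in> O1 \<and> y' e \<in> O2 \<and> 0 < \<alpha> e \<and> 0 < \<beta> e \<and> e \<in> {0<..<1}"
    by eventually_elim simp
  then obtain e where e: "y e \<in> O1" "y' e \<in> O2" "0 < \<alpha> e" "0 < \<beta> e" "0 < e" "e < 1"
    by (auto dest!: eventually_happens)
  have \<gamma>p: "0 < \<gamma> e" unfolding \<gamma> using VV e by (intro mult_pos_pos)
  then have \<sigma>p: "0 < \<sigma> e" using e by (simp add: \<sigma>_def)
  have yo: "y e \<in> open_triangle"
    unfolding open_triangle_def
  proof (intro CollectI conjI allI)
    show "0 < y e $ j" for j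
      using third_props(6)[OF ik(1), of j] third_props(1,2)[OF ik(1)] ik(1) e s by (auto simp: y_def edge_pt_nth corner_nth)
    show "(\<Sum>j\<in>UNIV. y e $ j) = 1"
      using third_props(1,2)[OF ik(1)] ik(1) by (simp add: sum_third[OF ik(1)] y_def edge_pt_nth corner_nth algebra_simps)
  qed
  have yo': "y' e \<in> open_triangle"
    unfolding open_triangle_def
  proof (intro CollectI conjI allI)
    show "0 < y' e $ j" for j
      using third_props(6)[OF ik(2), of j] third_props(1,2)[OF ik(2)] ik(2) e \<gamma>p \<sigma>p by (auto simp: y'_def corner_nth)
    have "(\<Sum>j\<in>UNIV. y' e $ j) = \<alpha> e / \<sigma> e + \<beta> e / \<sigma> e + \<gamma> e / \<sigma> e"
      using third_props(1,2)[OF ik(2)] ik(2) by (simp add: sum_third[OF ik(2)] y'_def corner_nth)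
    also have "\<dots> = 1" using \<sigma>p by (simp add: add_divide_distrib[symmetric] \<sigma>_def)
    finally show "(\<Sum>j\<in>UNIV. y' e $ j) = 1" .
  qed
  have os: "open_triangle \<subseteq> std_triangle" by (auto simp: open_triangle_def std_triangle_def less_imp_le)
  have "bvec Y (y' e) = (1 / \<sigma> e) *\<^sub>R w e"
  proof -
    have "bvec Y (y' e) = (\<alpha> e / \<sigma> e) *\<^sub>R lift (Y i') + (\<beta> e / \<sigma> e) *\<^sub>R lift (Y k') + (\<gamma> e / \<sigma> e) *\<^sub>R ?R'"
      using third_props(1,2)[OF ik(2)] ik(2) unfolding bvec_def sum_third[OF ik(2)] by (simp add: y'_def corner_nth)
    then show ?thesis unfolding comb XY by (simp add: scaleR_add_right)
  qed
  then have "bary X (y e) = bary Y (y' e)"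
    using \<sigma>p unfolding bary_def proj_def w_def by (simp add: divide_inverse)
  then show ?thesis using e(1,2) yo yo' os O1(2) O2(2) by blast
qed

lemma lor_orthogonal_vol_zero:
  assumes P: "P \<in> hyp_plane" and Q: "Q \<in> hyp_plane" and PQ: "P \<noteq> Q"
    and w: "lor w (lift P) = 0" "lor w (lift Q) = 0" "vol (lift P) (lift Q) w = 0"
  shows "w = 0"
proof (rule lor_nondegenerate)
  fix z assume "z \<in> hyp_plane"
  have "0 = vol (lift P) (lift Q) w * vol (lift P) (lift Q) (lift z)" using w(3) by simp
  also have "\<dots> = (1 - (lor (lift P) (lift Q))\<^sup>2) * lor w (lift z)"
    unfolding vol_Gram using w(1,2) P Q
    by (simp add: lor_lift_self lor_commute[of "lift Q" "lift P"] power2_eq_square algebra_simps)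
  finally have "(1 - (lor (lift P) (lift Q))\<^sup>2) * lor w (lift z) = 0" by simp
  moreover have "1 < (lor (lift P) (lift Q))\<^sup>2" using lor_lift_gt1[OF P Q PQ] by simp
  ultimately show "lor w (lift z) = 0" by auto
qed

lemma isometry_unique:
  assumes h: "hyp_isometry h" and h': "hyp_isometry h'"
    and PQR: "P \<in> hyp_plane" "Q \<in> hyp_plane" "R \<in> hyp_plane" "vol (lift P) (lift Q) (lift R) \<noteq> 0"
    and eq: "h P = h' P" "h Q = h' Q" "h R = h' R" and z: "z \<in> hyp_plane"
  shows "h z = h' z"
proof -
  define w where "w = lift (h z) - lift (h' z)"
  have w: "lor w (lift (h x)) = 0" if "x \<in> {P, Q, R}" for x
  proof -
    have x: "x \<in> hyp_plane" "h x = h' x" using that PQR eq by auto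
    show ?thesis using hyp_isometry_lor[OF h z x(1)] hyp_isometry_lor[OF h' z x(1)] x(2) by (simp add: w_def lor_algebra)
  qed
  have "(vol (lift (h P)) (lift (h Q)) (lift (h R)))\<^sup>2 = (vol (lift P) (lift Q) (lift R))\<^sup>2"
    unfolding power2_eq_square vol_Gram using hyp_isometry_lor[OF h] PQR by simp
  then have V: "vol (lift (h P)) (lift (h Q)) (lift (h R)) \<noteq> 0" using PQR(4) by auto
  have "w = 0"
  proof (rule lor_nondegenerate)
    fix x
    have "vol (lift (h P)) (lift (h Q)) (lift (h R)) * lor w (lift x) = 0"
      using arg_cong[OF vol_Cramer[of "lift (h P)" "lift (h Q)" "lift (h R)" "lift x"], of "lor w"] w
      by (simp add: lor_algebra)
    then show "lor w (lift x) = 0" using V by simp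
  qed
  then show ?thesis using lift_inj hyp_isometry_mem[OF h z] hyp_isometry_mem[OF h' z] by (simp add: w_def)
qed

text \<open>Isometries that agree on two points of a line differ at most by the reflection in it.
  The two sign conditions say that R and R' are separated by the line before and after mapping,
  which rules the reflection out.\<close>

lemma adjacent_isometries_agree:
  assumes h: "hyp_isometry h" and h': "hyp_isometry h'"
    and pl: "P \<in> hyp_plane" "Q \<in> hyp_plane" "R \<in> hyp_plane" "R' \<in> hyp_plane" and PQ: "P \<noteq> Q"
    and eq: "h P = h' P" "h Q = h' Q"
    and opp: "vol (lift P) (lift Q) (lift R) * vol (lift P) (lift Q) (lift R') < 0"
      "vol (lift (h P)) (lift (h Q)) (lift (h R)) * vol (lift (h P)) (lift (h Q)) (lift (h' R')) < 0"
    and z: "z \<in> hyp_plane"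
  shows "h z = h' z"
proof -
  define u where "u = vol (lift (h P)) (lift (h Q)) (lift (h R'))"
  define u' where "u' = vol (lift (h P)) (lift (h Q)) (lift (h' R'))"
  define r where "r = vol (lift (h P)) (lift (h Q)) (lift (h R))"
  have "r * u = vol (lift P) (lift Q) (lift R) * vol (lift P) (lift Q) (lift R')"
    unfolding r_def u_def vol_Gram using hyp_isometry_lor[OF h] pl by simp
  then have ru: "r * u < 0" using opp(1) by simp
  have ru': "r * u' < 0" using opp(2) by (simp add: r_def u'_def)
  have sq: "u\<^sup>2 = u'\<^sup>2"
  proof -
    have "u\<^sup>2 = (vol (lift P) (lift Q) (lift R'))\<^sup>2"
      unfolding u_def power2_eq_square vol_Gram using hyp_isometry_lor[OF h] pl by simp
    moreover have "u'\<^sup>2 = (vol (lift P) (lift Q) (lift R'))\<^sup>2"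
      unfolding u'_def eq power2_eq_square vol_Gram using hyp_isometry_lor[OF h'] pl by simp
    ultimately show ?thesis by simp
  qed
  have uu: "u = u'"
  proof (rule ccontr)
    assume "u \<noteq> u'"
    then have "u' = - u" using sq by (simp add: power2_eq_iff)
    then show False using ru ru' by simp
  qed
  define w where "w = lift (h R') - lift (h' R')"
  have "w = 0"
  proof (rule lor_orthogonal_vol_zero[of "h P" "h Q"])
    show "h P \<in> hyp_plane" "h Q \<in> hyp_plane" "h P \<noteq> h Q"
      using hyp_isometry_mem[OF h] hyp_isometry_inj[OF h] pl PQ by auto
    show "lor w (lift (h P)) = 0"
      using hyp_isometry_lor[OF h pl(4,1)] hyp_isometry_lor[OF h' pl(4,1)] eq(1) by (simp add: w_def lor_algebra)
    show "lor w (lift (h Q)) = 0"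
      using hyp_isometry_lor[OF h pl(4,2)] hyp_isometry_lor[OF h' pl(4,2)] eq(2) by (simp add: w_def lor_algebra)
    show "vol (lift (h P)) (lift (h Q)) w = 0"
      using uu by (simp add: w_def vol_linear u_def u'_def)
  qed
  then have "h R' = h' R'" using lift_inj hyp_isometry_mem[OF h pl(4)] hyp_isometry_mem[OF h' pl(4)] by (simp add: w_def)
  moreover have "vol (lift P) (lift Q) (lift R') \<noteq> 0" using opp(1) by auto
  ultimately show ?thesis using isometry_unique[OF h h' pl(1,2,4) _ eq _ z] by blast
qed

lemma tri_vol_third:
  assumes "i \<noteq> k"
  shows "(vol (lift (a i)) (lift (a k)) (lift (a (third i k))))\<^sup>2 = (tri_vol a)\<^sup>2"
proof -
  define l where "l = third i k"
  consider "i = l + 1" "k = l + 2" | "i = l + 2" "k = l + 1"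
    using third_props(7)[OF assms] unfolding l_def by blast
  then show ?thesis
  proof cases
    case 1
    show ?thesis unfolding l_def[symmetric] 1
      using tri_vol_cyc[of a l] vol_rotate[of "lift (a (l + 1))" "lift (a (l + 2))" "lift (a l)"] by (simp add: third_cyc)
  next
    case 2
    show ?thesis unfolding l_def[symmetric] 2
      using tri_vol_cyc[of a l] vol_rotate[of "lift (a (l + 1))" "lift (a (l + 2))" "lift (a l)"]
        vol_alt(4)[of "lift (a (l + 2))" "lift (a (l + 1))" "lift (a l)"] by (simp add: third_cyc)
  qed
qed

section \<open>Sectors\<close>

text \<open>After rotation by -\<alpha> the imaginary part shows that the direction lies beyond
  \<alpha>, after rotation by -\<beta> that it stays before \<beta>. The equivalences locate the
  boundary rays exactly, as needed for injectivity of charts.\<close>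

lemma cis_combination:
  assumes pq: "0 \<le> p" "0 \<le> q" "p \<noteq> 0 \<or> q \<noteq> 0" and d: "0 < \<beta> - \<alpha>" "\<beta> - \<alpha> < pi"
  obtains r \<gamma> where "0 < r" "\<alpha> \<le> \<gamma>" "\<gamma> \<le> \<beta>" "p *\<^sub>R cis \<alpha> + q *\<^sub>R cis \<beta> = r *\<^sub>R cis \<gamma>"
    "\<gamma> = \<alpha> \<longleftrightarrow> q = 0" "\<gamma> = \<beta> \<longleftrightarrow> p = 0"
proof -
  define \<delta> where "\<delta> = \<beta> - \<alpha>"
  have sd: "0 < sin \<delta>" using d by (simp add: \<delta>_def sin_gt_zero)
  define z where "z = p *\<^sub>R 1 + q *\<^sub>R cis \<delta>"
  have eq: "p *\<^sub>R cis \<alpha> + q *\<^sub>R cis \<beta> = z * cis \<alpha>"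
    by (simp add: z_def \<delta>_def algebra_simps cis_mult)
  consider "q = 0" "0 < p" | "p = 0" "0 < q" | "0 < p" "0 < q" using pq by fastforce
  then show ?thesis
  proof cases
    case 1
    show ?thesis by (rule that[of p \<alpha>]) (use 1 d in auto)
  next
    case 2
    show ?thesis by (rule that[of q \<beta>]) (use 2 d in auto)
  next
    case 3
    define g where "g = Arg z"
    have Im: "Im z = q * sin \<delta>" by (simp add: z_def)
    then have Imp: "0 < Im z" using 3 sd by simp
    then have z0: "z \<noteq> 0" by auto
    have zr: "z = norm z *\<^sub>R cis g" unfolding g_def using z0 by (simp add: scaleR_conv_of_real rcis_def[symmetric] rcis_cmod_Arg)
    have n: "0 < norm z" using z0 by simp
    have "Im z = norm z * sin g" using arg_cong[OF zr, of Im] by simp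
    then have "0 < sin g" using Imp n by (simp add: zero_less_mult_iff)
    then have g0: "0 < g" "g < pi"
    proof -
      have "- pi < g" "g \<le> pi" using Arg_bounded[of z] by (auto simp: g_def)
      moreover have "\<not> g \<le> 0"
      proof
        assume "g \<le> 0"
        then have "0 \<le> sin (- g)" using \<open>- pi < g\<close> by (intro sin_ge_zero) auto
        then show False using \<open>0 < sin g\<close> by simp
      qed
      moreover have "g \<noteq> pi" using \<open>0 < sin g\<close> by auto
      ultimately show "0 < g" "g < pi" by auto
    qed
    have "z * cis (- \<delta>) = p *\<^sub>R cis (- \<delta>) + q *\<^sub>R 1" by (simp add: z_def algebra_simps cis_mult)
    then have "Im (z * cis (- \<delta>)) = - p * sin \<delta>" by simp
    moreover have "z * cis (- \<delta>) = norm z *\<^sub>R cis (g - \<delta>)" by (subst zr) (simp add: cis_mult)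
    ultimately have "norm z * sin (g - \<delta>) = - p * sin \<delta>" by simp
    then have "norm z * sin (g - \<delta>) < 0" using 3 sd by simp
    then have "sin (g - \<delta>) < 0" using n by (simp add: mult_less_0_iff)
    then have gd: "g < \<delta>"
    proof -
      have "\<not> \<delta> \<le> g"
      proof
        assume "\<delta> \<le> g"
        then have "0 \<le> sin (g - \<delta>)" using g0 d by (intro sin_ge_zero) (auto simp: \<delta>_def)
        then show False using \<open>sin (g - \<delta>) < 0\<close> by simp
      qed
      then show ?thesis by simp
    qed
    show ?thesis
    proof (rule that[of "norm z" "\<alpha> + g"])
      show "p *\<^sub>R cis \<alpha> + q *\<^sub>R cis \<beta> = norm z *\<^sub>R cis (\<alpha> + g)"
        unfolding eq by (subst zr) (simp add: cis_mult add.commute)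
    qed (use n g0 gd 3 in \<open>auto simp: \<delta>_def\<close>)
  qed
qed

text \<open>With corner i at the origin the two sides there run along Euclidean rays, and the
  triangle fills part of the sector between them; the boundary rays are met exactly on these
  sides.\<close>

lemma bary_sector:
  assumes b: "\<And>j. b j \<in> hyp_plane" and ik: "i \<noteq> k"
    and pos: "b i = 0" "b k = polar C \<alpha>" "b (third i k) = polar D \<beta>" "1 < C" "1 < D"
    and d: "0 < \<beta> - \<alpha>" "\<beta> - \<alpha> < pi" and y: "y \<in> std_triangle" "y \<noteq> corner i"
  obtains r \<gamma> where "0 < r" "\<alpha> \<le> \<gamma>" "\<gamma> \<le> \<beta>" "bary b y = r *\<^sub>R cis \<gamma>"
    "\<gamma> = \<alpha> \<longleftrightarrow> y $ third i k = 0" "\<gamma> = \<beta> \<longleftrightarrow> y $ k = 0"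
proof -
  define p where "p = y $ k * sqrt (C\<^sup>2 - 1)"
  define q where "q = y $ third i k * sqrt (D\<^sup>2 - 1)"
  have CD: "0 < sqrt (C\<^sup>2 - 1)" "0 < sqrt (D\<^sup>2 - 1)" using pos by simp_all
  have nn: "0 \<le> y $ j" for j using std_triangleD(1)[OF y(1)] .
  have "fst (bvec b y) = p *\<^sub>R cis \<alpha> + q *\<^sub>R cis \<beta>"
    unfolding bvec_def sum_third[OF ik] pos using pos(4,5) by (simp add: lift_polar p_def q_def) (simp add: lift_def)
  then have e: "bary b y = (1 / snd (bvec b y)) *\<^sub>R (p *\<^sub>R cis \<alpha> + q *\<^sub>R cis \<beta>)"
    unfolding bary_def proj_def by (simp add: divide_inverse)
  have s: "0 < snd (bvec b y)" by (rule snd_bvec_pos[of b, OF b y(1)])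
  have "y $ k \<noteq> 0 \<or> y $ third i k \<noteq> 0"
  proof (rule ccontr)
    assume c: "\<not> ?thesis"
    then have "y $ i = 1" using std_triangleD(2)[OF y(1)] by (simp add: sum_third[OF ik])
    then have "y = corner i" using c third_props(6)[OF ik] third_props(1,2)[OF ik] ik by (auto simp: vec_eq_iff corner_nth)
    then show False using y(2) by simp
  qed
  then have pq: "0 \<le> p" "0 \<le> q" "p \<noteq> 0 \<or> q \<noteq> 0" "p = 0 \<longleftrightarrow> y $ k = 0" "q = 0 \<longleftrightarrow> y $ third i k = 0"
    using CD nn by (auto simp: p_def q_def)
  obtain r \<gamma> where r: "0 < r" "\<alpha> \<le> \<gamma>" "\<gamma> \<le> \<beta>" "p *\<^sub>R cis \<alpha> + q *\<^sub>R cis \<beta> = r *\<^sub>R cis \<gamma>"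
    "\<gamma> = \<alpha> \<longleftrightarrow> q = 0" "\<gamma> = \<beta> \<longleftrightarrow> p = 0"
    by (rule cis_combination[OF pq(1-3) d])
  show ?thesis
    by (rule that[of "r / snd (bvec b y)" \<gamma>]) (use r s e pq in auto)
qed

section \<open>Combinatorics and topology of the triangulated surface\<close>

section \<open>Flags of a triangulated surface\<close>

lemma open_subset_std: "open_triangle \<subseteq> std_triangle"
  by (auto simp: open_triangle_def std_triangle_def less_imp_le)

lemma std_triangle_cases:
  assumes "x \<in> std_triangle"
  obtains "x \<in> open_triangle"
    | i k s where "i \<noteq> k" "0 < s" "s < 1" "x = edge_pt i k s"
    | i where "x = corner i"
proof (cases "x \<in> open_triangle")
  case False
  then obtain l where "x $ l = 0"
    using assms std_triangleD unfolding open_triangle_def std_triangle_def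
    by (smt (verit) mem_Collect_eq)
  then have "x \<in> side_pt l ` {0..1}" using assms by (simp add: side_image)
  then obtain s where s: "0 \<le> s" "s \<le> 1" "x = edge_pt (l + 1) (l + 2) s" by (auto simp: side_pt_edge_pt)
  show ?thesis
  proof (cases "s = 0 \<or> s = 1")
    case True
    then show ?thesis using s that(3) by (auto simp: edge_pt_ends)
  next
    case False
    then show ?thesis using s by (intro that(2)[of "l + 1" "l + 2" s]) (auto simp: cyc3_neq)
  qed
qed (use that in blast)

lemma edge_pt_not_corner: "i \<noteq> k \<Longrightarrow> 0 < s \<Longrightarrow> s < 1 \<Longrightarrow> edge_pt i k s \<noteq> corner j"
  using edge_pt_nth[of i k s i] edge_pt_nth[of i k s k] corner_nth[of j i] corner_nth[of j k] by (auto split: if_splits)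

lemma corner_inj: "corner i = corner j \<longleftrightarrow> i = j"
  using corner_nth[of i i] corner_nth[of j i] by (auto split: if_splits)

lemma edge_pt_eq_third:
  assumes "i \<noteq> k" "i' \<noteq> k'" "0 < s" "s < 1" "edge_pt i k s = edge_pt i' k' s'"
  shows "third i k = third i' k'"
proof -
  have "edge_pt i k s $ third i' k' = 0"
    using assms(5) third_props(1,2)[OF assms(2)] by (simp add: edge_pt_nth assms(2))
  then have "third i' k' \<noteq> i" "third i' k' \<noteq> k"
    using assms(1,3,4) edge_pt_nth[OF assms(1), of s i] edge_pt_nth[OF assms(1), of s k] by auto
  then show ?thesis using third_props(6)[OF assms(1), of "third i' k'"] by auto
qed

lemma third_eq_cases:
  assumes "i \<noteq> k" "i' \<noteq> k'" "third i k = third i' k'"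
  shows "(i' = i \<and> k' = k) \<or> (i' = k \<and> k' = i)"
  using third_props(7)[OF assms(1)] third_props(7)[OF assms(2)] assms(3) by auto

lemma side_pt_cases:
  assumes "i \<noteq> k"
  obtains "\<And>s. edge_pt i k s = side_pt (third i k) s"
    | "\<And>s. edge_pt i k s = side_pt (third i k) (1 - s)"
  using third_props(7)[OF assms] side_pt_edge_pt[of "third i k"] edge_pt_swap by metis

locale triangulated_surface =
  fixes M :: "'a topology" and T :: "'t set" and \<phi> :: "'t \<Rightarrow> real^3 \<Rightarrow> 'a"
  assumes surface: "closed_surface M"
    and triangulation: "surface_triangulation M T \<phi>"
begin

sublocale side_pairing T "side_edge \<phi>"
  using triangulation unfolding surface_triangulation_def by unfold_locales blast+

lemmas triangulation_facts = triangulation[unfolded surface_triangulation_def, THEN conjunct2]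

lemma cont_char: "t \<in> T \<Longrightarrow> continuous_map (top_of_set std_triangle) M (\<phi> t)"
  by (rule bspec[OF triangulation_facts[THEN conjunct1]])

lemma topspace_M: "topspace M = (\<Union>t\<in>T. \<phi> t ` std_triangle)"
  by (rule triangulation_facts[THEN conjunct2, THEN conjunct1])

lemma char_in_M: "t \<in> T \<Longrightarrow> x \<in> std_triangle \<Longrightarrow> \<phi> t x \<in> topspace M"
  unfolding topspace_M by blast

lemma pointE:
  assumes "p \<in> topspace M"
  obtains t x where "t \<in> T" "x \<in> std_triangle" "p = \<phi> t x"
  using assms unfolding topspace_M by blast

lemma same_point_open:
  assumes "t \<in> T" "x \<in> open_triangle" "t' \<in> T" "x' \<in> std_triangle" "\<phi> t' x' = \<phi> t x"
  shows "t' = t \<and> x' = x"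
  using triangulation_facts[THEN conjunct2, THEN conjunct2, THEN conjunct1, rule_format, of t x t' x'] assms by simp

lemma side_inj: "t \<in> T \<Longrightarrow> inj_on (\<lambda>s. \<phi> t (side_pt i s)) {0<..<1}"
  using triangulation_facts[THEN conjunct2, THEN conjunct2, THEN conjunct2, THEN conjunct1, rule_format, of t i] by simp

lemma side_match:
  assumes "t \<in> T" "0 < s" "s < 1" "t' \<in> T" "x' \<in> std_triangle" "\<phi> t' x' = \<phi> t (side_pt i s)"
  shows "(\<exists>j. x' = side_pt j s \<and> (\<forall>u\<in>{0..1}. \<phi> t' (side_pt j u) = \<phi> t (side_pt i u))) \<or>
     (\<exists>j. x' = side_pt j (1 - s) \<and> (\<forall>u\<in>{0..1}. \<phi> t' (side_pt j (1 - u)) = \<phi> t (side_pt i u)))"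
  using triangulation_facts[THEN conjunct2, THEN conjunct2, THEN conjunct2, THEN conjunct2, THEN conjunct1,
      rule_format, of t s t' x' i] assms by simp

lemma edge_inj:
  assumes "t \<in> T" "i \<noteq> k" "0 < s" "s < 1" "0 < s'" "s' < 1" "\<phi> t (edge_pt i k s) = \<phi> t (edge_pt i k s')"
  shows "s = s'"
  using assms(2)
proof (cases rule: side_pt_cases)
  case 1
  then show ?thesis using inj_onD[OF side_inj[OF assms(1)], of "third i k" s s'] assms by simp
next
  case 2
  then show ?thesis using inj_onD[OF side_inj[OF assms(1)], of "third i k" "1 - s" "1 - s'"] assms by simp
qed

text \<open>The two alternatives of the triangulation axiom become one: a reversed gluing is
  absorbed into the order of the corners i' and k', so that parameters always agree.\<close>

lemma edge_match:
  assumes t: "t \<in> T" "i \<noteq> k" "0 < s" "s < 1" "t' \<in> T" "x' \<in> std_triangle" "\<phi> t' x' = \<phi> t (edge_pt i k s)"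
  shows "\<exists>i' k'. i' \<noteq> k' \<and> x' = edge_pt i' k' s \<and> (\<forall>u\<in>{0..1}. \<phi> t' (edge_pt i' k' u) = \<phi> t (edge_pt i k u))"
proof -
  have e1: "edge_pt (j + 1) (j + 2) u = side_pt j u" "edge_pt (j + 2) (j + 1) u = side_pt j (1 - u)" for j u
    by (simp_all add: side_pt_edge_pt edge_pt_swap[of "j + 2"])
  have n: "j + 1 \<noteq> j + 2" "j + 2 \<noteq> j + 1" for j :: 3 by (simp_all add: cyc3_neq)
  show ?thesis
    using t(2)
  proof (cases rule: side_pt_cases)
    case 1
    consider j where "x' = side_pt j s" "\<forall>u\<in>{0..1}. \<phi> t' (side_pt j u) = \<phi> t (side_pt (third i k) u)"
      | j where "x' = side_pt j (1 - s)" "\<forall>u\<in>{0..1}. \<phi> t' (side_pt j (1 - u)) = \<phi> t (side_pt (third i k) u)"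
      using side_match[OF t(1,3,4,5,6), of "third i k"] t(7) 1 by auto
    then show ?thesis
    proof cases
      case (1 j)
      show ?thesis
        by (rule exI[of _ "j + 1"], rule exI[of _ "j + 2"]) (use 1 n[of j] \<open>\<And>s. edge_pt i k s = _\<close> in \<open>simp add: e1\<close>)
    next
      case (2 j)
      show ?thesis
        by (rule exI[of _ "j + 2"], rule exI[of _ "j + 1"]) (use 2 n[of j] \<open>\<And>s. edge_pt i k s = _\<close> in \<open>simp add: e1\<close>)
    qed
  next
    case 2
    have flip: "(\<forall>u\<in>{0..1}. P (1 - u)) \<longleftrightarrow> (\<forall>u\<in>{0..1}. P u)" for P :: "real \<Rightarrow> bool"
    proof
      assume h: "\<forall>u\<in>{0..1}. P (1 - u)"
      show "\<forall>u\<in>{0..1}. P u"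
      proof
        fix u :: real assume "u \<in> {0..1}"
        then show "P u" using bspec[OF h, of "1 - u"] by simp
      qed
    qed simp
    consider j where "x' = side_pt j (1 - s)" "\<forall>u\<in>{0..1}. \<phi> t' (side_pt j u) = \<phi> t (side_pt (third i k) u)"
      | j where "x' = side_pt j s" "\<forall>u\<in>{0..1}. \<phi> t' (side_pt j (1 - u)) = \<phi> t (side_pt (third i k) u)"
      using side_match[OF t(1) _ _ t(5,6), of "1 - s" "third i k"] t(3,4,7) 2 by auto
    then show ?thesis
    proof cases
      case (1 j)
      have "\<forall>u\<in>{0..1}. \<phi> t' (side_pt j (1 - u)) = \<phi> t (side_pt (third i k) (1 - u))"
        using flip[of "\<lambda>u. \<phi> t' (side_pt j u) = \<phi> t (side_pt (third i k) u)"] 1(2) by simp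
      then show ?thesis
        by (intro exI[of _ "j + 2"] exI[of _ "j + 1"]) (use 1(1) n[of j] 2 in \<open>simp add: e1\<close>)
    next
      case (2 j)
      have "\<forall>u\<in>{0..1}. \<phi> t' (side_pt j u) = \<phi> t (side_pt (third i k) (1 - u))"
        using flip[of "\<lambda>u. \<phi> t' (side_pt j (1 - u)) = \<phi> t (side_pt (third i k) u)"] 2(2) by simp
      then show ?thesis
        by (intro exI[of _ "j + 1"] exI[of _ "j + 2"]) (use 2(1) n[of j] \<open>\<And>s. edge_pt i k s = _\<close> in \<open>simp add: e1\<close>)
    qed
  qed
qed

text \<open>The incidence axioms describe the points of open triangles and open sides; were x' of
  one of these kinds, the axioms at x' would make corner i a point of the same kind.\<close>

lemma same_point_corner:
  assumes "t \<in> T" "t' \<in> T" "x' \<in> std_triangle" "\<phi> t' x' = \<phi> t (corner i)"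
  shows "\<exists>i'. x' = corner i'"
  using assms(3)
proof (cases rule: std_triangle_cases)
  case 1
  then have "corner i = x'" using same_point_open[OF assms(2) 1 assms(1) corner_std] assms(4) by simp
  then show ?thesis by blast
next
  case (2 j k s)
  then obtain i' k' where "i' \<noteq> k'" "corner i = edge_pt i' k' s"
    using edge_match[OF assms(2) 2(1-3) assms(1) corner_std, of i] assms(4) by metis
  then show ?thesis using edge_pt_not_corner 2 by metis
qed blast

text \<open>The flag \<open>(t, i, k)\<close> stands for the end at corner \<open>i\<close> of the side of \<open>t\<close> joining the corners
  \<open>i\<close> and \<open>k\<close>.\<close>

definition flags :: "('t \<times> 3 \<times> 3) set" where
  "flags = {(t, i, k). t \<in> T \<and> i \<noteq> k}"

definition flag_pt :: "'t \<times> 3 \<times> 3 \<Rightarrow> real \<Rightarrow> 'a" where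
  "flag_pt f s = (case f of (t, i, k) \<Rightarrow> \<phi> t (edge_pt i k s))"

definition flag_side :: "'t \<times> 3 \<times> 3 \<Rightarrow> 't \<times> 3" where
  "flag_side f = (case f of (t, i, k) \<Rightarrow> (t, third i k))"

definition flag_rev :: "'t \<times> 3 \<times> 3 \<Rightarrow> 't \<times> 3 \<times> 3" where
  "flag_rev f = (case f of (t, i, k) \<Rightarrow> (t, k, i))"

text \<open>Passage to the other side at the same corner. Alternating \<open>turn\<close> and
  \<open>glue\<close> walks around a vertex.\<close>

definition turn :: "'t \<times> 3 \<times> 3 \<Rightarrow> 't \<times> 3 \<times> 3" where
  "turn f = (case f of (t, i, k) \<Rightarrow> (t, i, third i k))"

definition matching :: "'t \<times> 3 \<times> 3 \<Rightarrow> 't \<times> 3 \<times> 3 \<Rightarrow> bool" where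
  "matching f g \<longleftrightarrow> (\<forall>u\<in>{0..1}. flag_pt g u = flag_pt f u)"

text \<open>Matching compares parametrised edges, not just their point sets, so the partner flag
  carries the direction along with the side.\<close>

definition glue :: "'t \<times> 3 \<times> 3 \<Rightarrow> 't \<times> 3 \<times> 3" where
  "glue f = (THE g. g \<in> flags \<and> g \<noteq> f \<and> matching f g)"

lemma mem_flags: "(t, i, k) \<in> flags \<longleftrightarrow> t \<in> T \<and> i \<noteq> k"
  by (simp add: flags_def)

lemma finite_flags: "finite flags"
  by (rule finite_subset[of _ "T \<times> (UNIV \<times> UNIV)"]) (use finite_T in \<open>auto simp: flags_def\<close>)

lemma flag_side_sides: "f \<in> flags \<Longrightarrow> flag_side f \<in> sides"
  by (cases f) (simp add: flag_side_def mem_sides mem_flags)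

lemma edge_at_flag_side:
  assumes "f \<in> flags"
  shows "edge_at (flag_side f) = flag_pt f ` {0..1}"
proof -
  obtain t i k where f: "f = (t, i, k)" by (cases f)
  have ik: "i \<noteq> k" using assms by (simp add: f mem_flags)
  have "side_edge \<phi> t (third i k) = (\<lambda>s. \<phi> t (edge_pt i k s)) ` {0..1}"
    using ik
  proof (cases rule: side_pt_cases)
    case 2
    have r: "(\<lambda>s. 1 - s) ` {0..1} = {0..1::real}" using image_diff_atLeastAtMost[of 1 0 "1::real"] by simp
    have "side_edge \<phi> t (third i k) = (\<lambda>s. \<phi> t (side_pt (third i k) s)) ` (\<lambda>s. 1 - s) ` {0..1}"
      by (simp only: side_edge_def r)
    then show ?thesis by (simp only: image_image 2)
  qed (simp add: side_edge_def)
  then show ?thesis by (simp add: f edge_at_def flag_side_def flag_pt_def)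
qed

text \<open>A side cannot match its own reversal: the parameters 1/3 and 2/3 would name the same
  point, against injectivity on the open side.\<close>

lemma matching_same_side:
  assumes f: "f \<in> flags" "g \<in> flags" and m: "matching f g" and s: "flag_side f = flag_side g"
  shows "g = f"
proof -
  obtain t i k where fe: "f = (t, i, k)" by (cases f)
  obtain t' i' k' where ge: "g = (t', i', k')" by (cases g)
  have *: "t \<in> T" "i \<noteq> k" "i' \<noteq> k'" "t' = t" "third i k = third i' k'"
    using f s by (auto simp: fe ge mem_flags flag_side_def)
  have "\<not> (i' = k \<and> k' = i)"
  proof
    assume h: "i' = k \<and> k' = i"
    have "\<phi> t (edge_pt k i (1/3)) = \<phi> t (edge_pt i k (1/3))"
      using m h * unfolding matching_def by (auto simp: fe ge flag_pt_def)
    then have "\<phi> t (edge_pt i k (2/3)) = \<phi> t (edge_pt i k (1/3))" by (simp add: edge_pt_swap[of k i])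
    then show False using edge_inj[OF *(1,2), of "2/3" "1/3"] by simp
  qed
  then show ?thesis using third_eq_cases[OF *(2,3,5)] *(4) by (auto simp: fe ge)
qed

lemma matching_sym: "matching f g \<longleftrightarrow> matching g f"
  unfolding matching_def by metis

lemma matching_trans: "matching f g \<Longrightarrow> matching g h \<Longrightarrow> matching f h"
  unfolding matching_def by metis

lemma matching_edge: "f \<in> flags \<Longrightarrow> g \<in> flags \<Longrightarrow> matching f g \<Longrightarrow> edge_at (flag_side g) = edge_at (flag_side f)"
  unfolding edge_at_flag_side by (intro image_cong) (auto simp: matching_def)

text \<open>The point with parameter 1/3 also lies on the opposite side of the edge, and
  \<open>edge_match\<close> extends the coincidence there to the whole side. Uniqueness holds
  because an edge has two sides and one side matches in a single direction.\<close>

lemma glue_ex1: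
  assumes f: "f \<in> flags"
  shows "\<exists>!g. g \<in> flags \<and> g \<noteq> f \<and> matching f g"
proof -
  obtain t i k where fe: "f = (t, i, k)" by (cases f)
  have *: "t \<in> T" "i \<noteq> k" using f by (auto simp: fe mem_flags)
  define p where "p = flag_side f"
  have p: "p \<in> sides" unfolding p_def by (rule flag_side_sides[OF f])
  obtain t' j where q: "opp p = (t', j)" by (cases "opp p")
  have t': "t' \<in> T" using opp_props(1)[OF p] by (simp add: q mem_sides)
  have "edge_at (opp p) = flag_pt f ` {0..1}"
    using opp_props(3)[OF p] edge_at_flag_side[OF f] p_def by simp
  then have "flag_pt f (1/3) \<in> edge_at (opp p)" by simp
  then obtain s' where s': "s' \<in> {0..1}" "\<phi> t' (side_pt j s') = \<phi> t (edge_pt i k (1/3))"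
    unfolding q edge_at_def side_edge_def by (auto simp: fe flag_pt_def)
  have "side_pt j s' \<in> std_triangle" using s'(1) by (simp add: side_pt_edge_pt edge_pt_std)
  then obtain i' k' where ik': "i' \<noteq> k'" "side_pt j s' = edge_pt i' k' (1/3)"
    "\<forall>u\<in>{0..1}. \<phi> t' (edge_pt i' k' u) = \<phi> t (edge_pt i k u)"
    using edge_match[OF * _ _ t', of "1/3" "side_pt j s'"] s'(2) by auto
  have "third i' k' = third (j + 1) (j + 2)"
    using edge_pt_eq_third[OF ik'(1), of "j + 1" "j + 2" "1/3" s'] ik'(2) by (simp add: side_pt_edge_pt cyc3_neq)
  then have j: "third i' k' = j" by (simp add: third_cyc)
  define g where "g = (t', i', k')"
  have g: "g \<in> flags" "matching f g" using t' ik' by (simp_all add: g_def mem_flags matching_def flag_pt_def fe)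
  have gs: "flag_side g = opp p" by (simp add: g_def flag_side_def j q)
  then have "g \<noteq> f" using opp_props(2)[OF p] p_def by metis
  moreover have "h = g" if h: "h \<in> flags" "h \<noteq> f" "matching f h" for h
  proof -
    have "edge_at (flag_side h) = edge_at p" using matching_edge[OF f h(1,3)] by (simp add: p_def)
    then have "flag_side h = p \<or> flag_side h = opp p" by (rule opp_cases[OF p flag_side_sides[OF h(1)]])
    moreover have "flag_side h \<noteq> p" using matching_same_side[OF f h(1,3)] h(2) p_def by metis
    ultimately have "flag_side g = flag_side h" using gs by simp
    then show ?thesis
      using matching_same_side[OF g(1) h(1)] matching_trans[of g f h] matching_sym g(2) h(3) by blast
  qed
  ultimately show ?thesis using g by blast
qed

lemma glue_props:
  assumes f: "f \<in> flags"
  shows glue_flags: "glue f \<in> flags" and glue_neq: "glue f \<noteq> f" and glue_matching: "matching f (glue f)"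
    and glue_glue: "glue (glue f) = f"
    and matching_cases: "g \<in> flags \<Longrightarrow> matching f g \<Longrightarrow> g = f \<or> g = glue f"
    and flag_side_glue: "flag_side (glue f) = opp (flag_side f)"
proof -
  have *: "glue f \<in> flags \<and> glue f \<noteq> f \<and> matching f (glue f)"
    unfolding glue_def by (rule theI'[OF glue_ex1[OF f]])
  then show 1: "glue f \<in> flags" "glue f \<noteq> f" "matching f (glue f)" by blast+
  have "glue (glue f) \<in> flags \<and> glue (glue f) \<noteq> glue f \<and> matching (glue f) (glue (glue f))"
    unfolding glue_def[of "glue f"] by (rule theI'[OF glue_ex1[OF 1(1)]])
  then show "glue (glue f) = f" using glue_ex1[OF 1(1)] f 1 matching_sym by metis
  show "g = f \<or> g = glue f" if "g \<in> flags" "matching f g"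
    using glue_ex1[OF f] * that by blast
  have "flag_side (glue f) = flag_side f \<or> flag_side (glue f) = opp (flag_side f)"
    by (rule opp_cases[OF flag_side_sides[OF f] flag_side_sides[OF 1(1)] matching_edge[OF f 1(1,3)]])
  then show "flag_side (glue f) = opp (flag_side f)"
    using matching_same_side[OF f 1(1,3)] 1(2) by metis
qed

lemma flag_pt_glue: "f \<in> flags \<Longrightarrow> 0 \<le> s \<Longrightarrow> s \<le> 1 \<Longrightarrow> flag_pt (glue f) s = flag_pt f s"
  using glue_matching unfolding matching_def by simp

lemma flag_rev_props:
  assumes f: "f \<in> flags"
  shows "flag_rev f \<in> flags" "flag_rev (flag_rev f) = f" "flag_pt (flag_rev f) s = flag_pt f (1 - s)" "flag_side (flag_rev f) = flag_side f"
proof -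
  obtain t i k where fe: "f = (t, i, k)" by (cases f)
  show "flag_rev f \<in> flags" using f by (auto simp: fe flag_rev_def mem_flags)
  show "flag_rev (flag_rev f) = f" by (simp add: fe flag_rev_def)
  show "flag_pt (flag_rev f) s = flag_pt f (1 - s)" by (simp add: fe flag_rev_def flag_pt_def edge_pt_swap[of k])
  show "flag_side (flag_rev f) = flag_side f" by (simp add: fe flag_rev_def flag_side_def third_def add.commute)
qed

lemma glue_rev:
  assumes f: "f \<in> flags"
  shows "glue (flag_rev f) = flag_rev (glue f)"
proof -
  have r: "flag_rev f \<in> flags" "flag_rev (glue f) \<in> flags" using flag_rev_props(1) f glue_flags[OF f] by blast+
  have "matching (flag_rev f) (flag_rev (glue f))"
    unfolding matching_def flag_rev_props(3)[OF f] flag_rev_props(3)[OF glue_flags[OF f]]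
    using flag_pt_glue[OF f] by simp
  then have "flag_rev (glue f) = flag_rev f \<or> flag_rev (glue f) = glue (flag_rev f)" by (rule matching_cases[OF r])
  moreover have "flag_rev (glue f) \<noteq> flag_rev f" using flag_rev_props(2) f glue_flags[OF f] glue_neq[OF f] by metis
  ultimately show ?thesis by simp
qed

lemma same_point_edge:
  assumes f: "(t, i, k) \<in> flags" and s: "0 < s" "s < 1" and t': "t' \<in> T" "x' \<in> std_triangle"
    and eq: "\<phi> t' x' = \<phi> t (edge_pt i k s)"
  shows "(t' = t \<and> x' = edge_pt i k s) \<or> (\<exists>i' k'. glue (t, i, k) = (t', i', k') \<and> x' = edge_pt i' k' s)"
proof -
  have t: "t \<in> T" "i \<noteq> k" using f by (auto simp: mem_flags)
  obtain i' k' where ik: "i' \<noteq> k'" "x' = edge_pt i' k' s" "\<forall>u\<in>{0..1}. \<phi> t' (edge_pt i' k' u) = \<phi> t (edge_pt i k u)"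
    using edge_match[OF t s t' eq] by blast
  then have "matching (t, i, k) (t', i', k')" "(t', i', k') \<in> flags" using t' by (simp_all add: matching_def flag_pt_def mem_flags)
  then have "(t', i', k') = (t, i, k) \<or> (t', i', k') = glue (t, i, k)" using matching_cases[OF f] by blast
  then show ?thesis
  proof
    assume "(t', i', k') = (t, i, k)"
    then show ?thesis using ik(2) by simp
  next
    assume "(t', i', k') = glue (t, i, k)"
    then have "glue (t, i, k) = (t', i', k')" by simp
    then show ?thesis using ik(2) by blast
  qed
qed

lemma turn_props:
  assumes f: "f \<in> flags"
  shows "turn f \<in> flags" "turn f \<noteq> f" "turn (turn f) = f"
proof -
  obtain t i k where fe: "f = (t, i, k)" by (cases f)
  have "t \<in> T" "i \<noteq> k" using f by (auto simp: fe mem_flags)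
  then show "turn f \<in> flags" "turn f \<noteq> f" "turn (turn f) = f"
    using third_props(1,2,4)[of i k] by (auto simp: fe turn_def mem_flags)
qed

definition flag_vertex :: "'t \<times> 3 \<times> 3 \<Rightarrow> 'a" where
  "flag_vertex f = flag_pt f 0"

lemma flag_vertex_simp: "flag_vertex (t, i, k) = \<phi> t (corner i)"
  by (simp add: flag_vertex_def flag_pt_def edge_pt_ends)

lemma flag_vertex_turn: "flag_vertex (turn f) = flag_vertex f"
  by (cases f) (simp add: turn_def flag_vertex_simp)

lemma flag_vertex_glue: "f \<in> flags \<Longrightarrow> flag_vertex (glue f) = flag_vertex f"
  by (simp add: flag_vertex_def flag_pt_glue)

section \<open>The quotient topology\<close>

lemma compact_M: "compact_space M" and Hausdorff_M: "Hausdorff_space M"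
  using surface by (simp_all add: closed_surface_def)

lemma closedin_image:
  assumes "t \<in> T" "closedin (top_of_set std_triangle) C"
  shows "closedin M (\<phi> t ` C)"
proof -
  have "compact_space (top_of_set std_triangle)" using compact_std_triangle by (simp add: compact_space_subtopology)
  then have "compactin (top_of_set std_triangle) C" using assms(2) closedin_compact_space by blast
  then have "compactin M (\<phi> t ` C)" using image_compactin cont_char[OF assms(1)] by blast
  then show ?thesis using compactin_imp_closedin Hausdorff_M by blast
qed

lemma closedin_std_diff: "openin (top_of_set std_triangle) U \<Longrightarrow> closedin (top_of_set std_triangle) (std_triangle - U)"
  using closedin_diff[OF closedin_topspace, of "top_of_set std_triangle"] by simp

text \<open>M carries the quotient topology: characteristic maps send closed sets to compact, hence
  closed sets of a Hausdorff space, and the complement of U is a finite union of such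
  images.\<close>

lemma openin_quotient:
  assumes U: "U \<subseteq> topspace M" and op: "\<And>t. t \<in> T \<Longrightarrow> openin (top_of_set std_triangle) {x \<in> std_triangle. \<phi> t x \<in> U}"
  shows "openin M U"
proof -
  have "topspace M - U = (\<Union>t\<in>T. \<phi> t ` (std_triangle - {x \<in> std_triangle. \<phi> t x \<in> U}))"
    unfolding topspace_M by blast
  moreover have "closedin M (\<phi> t ` (std_triangle - {x \<in> std_triangle. \<phi> t x \<in> U}))" if "t \<in> T" for t
    by (rule closedin_image[OF that closedin_std_diff[OF op[OF that]]])
  ultimately have "closedin M (topspace M - U)"
    using finite_T by (auto intro!: closedin_Union)
  then show ?thesis using U by (simp add: openin_closedin)
qed

lemma openin_preimage:
  assumes "t \<in> T" "openin M U"
  shows "openin (top_of_set std_triangle) {x \<in> std_triangle. \<phi> t x \<in> U}"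
  using openin_continuous_map_preimage[OF cont_char[OF assms(1)] assms(2)] by simp

text \<open>Neighbourhoods chosen separately around all preimages of p contain the preimages of a
  genuine neighbourhood: the images of what they leave over are finitely many closed sets missing
  p.\<close>

lemma nbhd_from_pieces:
  assumes p: "p \<in> topspace M"
    and W: "\<And>t x. t \<in> T \<Longrightarrow> x \<in> std_triangle \<Longrightarrow> \<phi> t x = p \<Longrightarrow> openin (top_of_set std_triangle) (W t x) \<and> x \<in> W t x"
  shows "\<exists>N. openin M N \<and> p \<in> N \<and>
    (\<forall>t\<in>T. \<forall>y\<in>std_triangle. \<phi> t y \<in> N \<longrightarrow> (\<exists>x\<in>std_triangle. \<phi> t x = p \<and> y \<in> W t x))"
proof -
  define R where "R t = std_triangle - (\<Union>x\<in>{x\<in>std_triangle. \<phi> t x = p}. W t x)" for t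
  have R: "closedin (top_of_set std_triangle) (R t)" if "t \<in> T" for t
  proof -
    have "openin (top_of_set std_triangle) (\<Union>x\<in>{x\<in>std_triangle. \<phi> t x = p}. W t x)"
      by (rule openin_Union) (use W[OF that] in auto)
    then show ?thesis unfolding R_def by (rule closedin_std_diff)
  qed
  define N where "N = topspace M - (\<Union>t\<in>T. \<phi> t ` R t)"
  have "closedin M (\<Union>t\<in>T. \<phi> t ` R t)" using finite_T closedin_image R by (auto intro!: closedin_Union)
  then have "openin M N" unfolding N_def by (simp add: openin_diff)
  moreover have "p \<in> N" using p W unfolding N_def R_def by blast
  moreover have "\<exists>x\<in>std_triangle. \<phi> t x = p \<and> y \<in> W t x" if "t \<in> T" "y \<in> std_triangle" "\<phi> t y \<in> N" for t y
    using that unfolding N_def R_def by blast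
  ultimately show ?thesis by (intro exI[of _ N]) simp
qed

end

section \<open>Links of vertices are connected\<close>

lemma edge_pt_eventually:
  assumes W: "openin (top_of_set std_triangle) W" "edge_pt i k s \<in> W" and s: "0 \<le> s" "s < 1"
  shows "\<forall>\<^sub>F u in at_right s. s < u \<and> u < 1 \<and> edge_pt i k u \<in> W"
proof -
  obtain S where S: "open S" "W = std_triangle \<inter> S" using W(1) by (auto simp: openin_open)
  have "((\<lambda>u. edge_pt i k u) \<longlongrightarrow> edge_pt i k s) (at_right s)"
    unfolding edge_pt_def by (intro tendsto_intros)
  then have "\<forall>\<^sub>F u in at_right s. edge_pt i k u \<in> S" using topological_tendstoD S W(2) by blast
  moreover have "\<forall>\<^sub>F u in at_right s. u \<in> {s<..<1}" by (rule eventually_at_right_real[OF s(2)])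
  ultimately show ?thesis by eventually_elim (use s S(2) edge_pt_std in auto)
qed

lemma openin_coordinate_gt: "openin (top_of_set std_triangle) {y \<in> std_triangle. c < y $ i}"
proof -
  have "open {y :: real^3. c < y $ i}" by (intro open_Collect_less continuous_intros)
  moreover have "{y \<in> std_triangle. c < y $ i} = std_triangle \<inter> {y. c < y $ i}" by blast
  ultimately show ?thesis by (simp add: openin_open_Int)
qed

text \<open>The reason for the bound 1/2 in all arguments around vertices: it keeps the
  neighbourhoods of the three corners of a triangle disjoint.\<close>

lemma near_corner_unique:
  assumes "y \<in> std_triangle" "1 / 2 < y $ i" "1 / 2 < y $ j"
  shows "i = j"
proof (rule ccontr)
  assume n: "i \<noteq> j"
  have "y $ i + y $ j + y $ third i j = 1" using std_triangleD(2)[OF assms(1)] by (simp add: sum_third[OF n])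
  then show False using assms(2,3) std_triangleD(1)[OF assms(1), of "third i j"] by simp
qed

lemma near_corner_cases:
  assumes "y \<in> std_triangle" "1 / 2 < y $ i"
  obtains "y \<in> open_triangle" | "y = corner i" | k s where "k \<noteq> i" "0 < s" "s < 1 / 2" "y = edge_pt i k s"
  using assms(1)
proof (cases rule: std_triangle_cases)
  case 1
  then show ?thesis by (rule that(1))
next
  case (2 j m s)
  show ?thesis
  proof (cases "i = j")
    case True
    have "y $ i = 1 - s" unfolding 2(4) edge_pt_nth[OF 2(1)] using True by simp
    then have "s < 1 / 2" using assms(2) by simp
    then show ?thesis using 2 True that(3)[of m s] by metis
  next
    case False
    have yi: "y $ i = (if i = m then s else 0)" unfolding 2(4) edge_pt_nth[OF 2(1)] using False by simp
    have im: "i = m"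
    proof (rule ccontr)
      assume "i \<noteq> m"
      then have "y $ i = 0" using yi by simp
      then show False using assms(2) by simp
    qed
    then have "1 / 2 < s" using assms(2) yi by simp
    moreover have "y = edge_pt i j (1 - s)" using 2(4) im edge_pt_swap[of j m s] by simp
    ultimately show ?thesis using 2(1,3) im that(3)[of j "1 - s"] by simp
  qed
next
  case (3 j)
  have "i = j"
  proof (rule ccontr)
    assume "i \<noteq> j"
    then have "y $ i = 0" unfolding 3 corner_nth by simp
    then show False using assms(2) by simp
  qed
  then show ?thesis using 3 that(2) by simp
qed

context triangulated_surface
begin

text \<open>A point near corner i is inner to its triangle or lies on a side at that corner. In the
  second case the other triangle is reached by \<open>glue\<close>, with the same parameter below
  1/2, hence again near the corresponding corner.\<close>

lemma flag_induct_saturated: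
  assumes Fl: "Fl \<subseteq> flags" "\<And>f. f \<in> Fl \<Longrightarrow> glue f \<in> Fl" "\<And>f. f \<in> Fl \<Longrightarrow> turn f \<in> Fl"
    and f: "(t, i, k) \<in> Fl" and y: "y \<in> std_triangle" "1 / 2 < y $ i" "y \<noteq> corner i"
    and t': "t' \<in> T" "y' \<in> std_triangle" and eq: "\<phi> t' y' = \<phi> t y"
  shows "\<exists>i' k'. (t', i', k') \<in> Fl \<and> 1 / 2 < y' $ i' \<and> y' \<noteq> corner i'"
proof -
  have fl: "t \<in> T" "i \<noteq> k" using Fl(1) f by (auto simp: flags_def)
  from y(1,2) show ?thesis
  proof (cases rule: near_corner_cases)
    case 1
    then have "t' = t \<and> y' = y" using same_point_open[OF fl(1) 1 t' eq] by simp
    then show ?thesis using f y by blast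
  next
    case (3 m s)
    have "m = k \<or> m = third i k" using third_props(6)[OF fl(2), of m] 3(1) by blast
    then have g: "(t, i, m) \<in> Fl" using Fl(3)[OF f] f by (auto simp: turn_def)
    then have "(t, i, m) \<in> flags" using Fl(1) by blast
    from same_point_edge[OF this 3(2) _ t', unfolded 3(4)[symmetric], OF _ eq] 3(3)
    consider "t' = t" "y' = y" | i' k' where "glue (t, i, m) = (t', i', k')" "y' = edge_pt i' k' s"
      by auto
    then show ?thesis
    proof cases
      case 1
      then show ?thesis using f y by blast
    next
      case (2 i' k')
      then have g': "(t', i', k') \<in> Fl" using Fl(2)[OF g] by simp
      then have n: "i' \<noteq> k'" using Fl(1) by (auto simp: flags_def)
      have "1 / 2 < y' $ i'" using 3(3) by (simp add: 2(2) edge_pt_nth[OF n])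
      moreover have "y' \<noteq> corner i'" using edge_pt_not_corner[OF n 3(2)] 3(3) by (simp add: 2(2))
      ultimately show ?thesis using g' by blast
    qed
  qed (use y(3) in blast)
qed

definition punctured_star :: "('t \<times> 3 \<times> 3) set \<Rightarrow> 'a set" where
  "punctured_star Fl = {p. \<exists>t i k y. (t, i, k) \<in> Fl \<and> y \<in> std_triangle \<and> 1 / 2 < y $ i \<and> y \<noteq> corner i \<and> p = \<phi> t y}"

lemma openin_punctured_star:
  assumes Fl: "Fl \<subseteq> flags" "\<And>f. f \<in> Fl \<Longrightarrow> glue f \<in> Fl" "\<And>f. f \<in> Fl \<Longrightarrow> turn f \<in> Fl"
  shows "openin M (punctured_star Fl)"
proof (rule openin_quotient)
  show "punctured_star Fl \<subseteq> topspace M"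
    unfolding punctured_star_def using Fl(1) char_in_M by (auto simp: flags_def)
  fix t' assume t': "t' \<in> T"
  have "{y' \<in> std_triangle. \<phi> t' y' \<in> punctured_star Fl}
      = (\<Union>(i', k')\<in>{(i', k'). (t', i', k') \<in> Fl}. {y \<in> std_triangle. 1 / 2 < y $ i'} - {corner i'})" (is "?L = ?R")
  proof
    show "?L \<subseteq> ?R"
    proof
      fix y' assume "y' \<in> ?L"
      then obtain t i k y where h: "y' \<in> std_triangle" "(t, i, k) \<in> Fl" "y \<in> std_triangle" "1 / 2 < y $ i" "y \<noteq> corner i" "\<phi> t' y' = \<phi> t y"
        unfolding punctured_star_def by blast
      obtain i' k' where "(t', i', k') \<in> Fl" "1 / 2 < y' $ i'" "y' \<noteq> corner i'"
        using flag_induct_saturated[OF Fl h(2-5) t' h(1,6)] by blast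
      then show "y' \<in> ?R" using h(1) by blast
    qed
    show "?R \<subseteq> ?L" unfolding punctured_star_def by blast
  qed
  moreover have "openin (top_of_set std_triangle) ({y \<in> std_triangle. 1 / 2 < y $ i'} - {corner i'})" for i'
    by (intro openin_diff openin_coordinate_gt) (use corner_std in \<open>simp add: closedin_closed_eq[of std_triangle] closed_subset\<close>)
  ultimately show "openin (top_of_set std_triangle) {y' \<in> std_triangle. \<phi> t' y' \<in> punctured_star Fl}"
    by auto
qed

text \<open>Local Euclideanness excludes pinched vertices, such as two cones with a common apex,
  because a punctured plane disc is connected.\<close>

lemma vertex_disc:
  assumes v: "v \<in> topspace M" and N: "openin M N" "v \<in> N"
  obtains V where "openin M V" "v \<in> V" "V \<subseteq> N" "connectedin M (V - {v})"
proof -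
  obtain U where U: "openin M U" "v \<in> U" "subtopology M U homeomorphic_space top_of_set (ball (0::complex) 1)"
    using surface v unfolding closed_surface_def by blast
  then obtain \<psi> \<xi> where h: "homeomorphic_maps (subtopology M U) (top_of_set (ball (0::complex) 1)) \<psi> \<xi>"
    unfolding homeomorphic_space_def by blast
  have UM: "U \<subseteq> topspace M" using U(1) by (rule openin_subset)
  have ts: "topspace (subtopology M U) = U" using UM by auto
  have \<psi>: "homeomorphic_map (subtopology M U) (top_of_set (ball 0 1)) \<psi>"
    and \<xi>: "homeomorphic_map (top_of_set (ball 0 1)) (subtopology M U) \<xi>"
    and inv: "\<And>x. x \<in> U \<Longrightarrow> \<xi> (\<psi> x) = x" "\<And>z. z \<in> ball 0 1 \<Longrightarrow> \<psi> (\<xi> z) = z"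
    using h ts unfolding homeomorphic_maps_map by auto
  have "openin (subtopology M U) (U \<inter> N)" using N(1) by (auto simp: openin_subtopology)
  then have "openin (top_of_set (ball 0 1)) (\<psi> ` (U \<inter> N))"
    using homeomorphic_imp_open_map[OF \<psi>] unfolding open_map_def by blast
  then have op: "open (\<psi> ` (U \<inter> N))" "\<psi> ` (U \<inter> N) \<subseteq> ball 0 1" by (auto simp: openin_open_eq)
  have "\<psi> v \<in> \<psi> ` (U \<inter> N)" using U(2) N(2) by blast
  then obtain r where r: "0 < r" "ball (\<psi> v) r \<subseteq> \<psi> ` (U \<inter> N)" using op(1) open_contains_ball by blast
  let ?B = "ball (\<psi> v) r"
  have B1: "?B \<subseteq> ball 0 1" using r(2) op(2) by blast
  define V where "V = \<xi> ` ?B"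
  have cont: "continuous_map (top_of_set (ball 0 1)) M \<xi>"
    using h unfolding homeomorphic_maps_def continuous_map_in_subtopology by blast
  have "openin (top_of_set (ball 0 1)) ?B" using B1 by (simp add: openin_open_eq)
  then have "openin (subtopology M U) V"
    using homeomorphic_imp_open_map[OF \<xi>] unfolding open_map_def V_def by blast
  then have 1: "openin M V" using U(1) openin_trans_full by blast
  have 2: "v \<in> V" unfolding V_def using inv(1)[OF U(2)] r(1) by (metis centre_in_ball image_eqI)
  have 3: "V \<subseteq> N"
  proof
    fix x assume "x \<in> V"
    then obtain z where z: "z \<in> ?B" "x = \<xi> z" unfolding V_def by blast
    then obtain w where "w \<in> U \<inter> N" "z = \<psi> w" using r(2) by blast
    then show "x \<in> N" using z inv(1)[of w] by simp
  qed
  have "V - {v} = \<xi> ` (?B - {\<psi> v})"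
  proof
    show "V - {v} \<subseteq> \<xi> ` (?B - {\<psi> v})" unfolding V_def using inv(1)[OF U(2)] by blast
    show "\<xi> ` (?B - {\<psi> v}) \<subseteq> V - {v}"
    proof
      fix x assume "x \<in> \<xi> ` (?B - {\<psi> v})"
      then obtain z where z: "z \<in> ?B" "z \<noteq> \<psi> v" "x = \<xi> z" by blast
      have "z \<in> ball 0 1" by (rule subsetD[OF B1 z(1)])
      then have "\<psi> x = z" using inv(2) z(3) by simp
      then have "x \<noteq> v" using z(2) by metis
      moreover have "x \<in> V" unfolding V_def z(3) by (rule imageI[OF z(1)])
      ultimately show "x \<in> V - {v}" by simp
    qed
  qed
  moreover have "connectedin (top_of_set (ball 0 1)) (?B - {\<psi> v})"
    using connected_punctured_ball[of "\<psi> v" r] B1 by (auto simp: connectedin_subtopology)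
  then have "connectedin M (\<xi> ` (?B - {\<psi> v}))" using connectedin_continuous_map_image[OF cont] by blast
  ultimately have "connectedin M (V - {v})" by simp
  then show ?thesis using that 1 2 3 by blast
qed

text \<open>Otherwise the flags at \<open>v\<close> would split into two classes whose punctured stars disconnect a small
  punctured disc around \<open>v\<close>.\<close>

theorem link_connected:
  assumes Fl: "Fl \<subseteq> flags" "\<And>f. f \<in> Fl \<Longrightarrow> glue f \<in> Fl" "\<And>f. f \<in> Fl \<Longrightarrow> turn f \<in> Fl" "\<And>f. f \<in> Fl \<Longrightarrow> flag_vertex f = v"
    and f0: "f0 \<in> Fl" and g0: "g0 \<in> flags" "flag_vertex g0 = v"
  shows "g0 \<in> Fl"
proof (rule ccontr)
  assume g0O: "g0 \<notin> Fl"
  define Fl' where "Fl' = {f \<in> flags. flag_vertex f = v \<and> f \<notin> Fl}"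
  have Fl': "Fl' \<subseteq> flags" "\<And>f. f \<in> Fl' \<Longrightarrow> glue f \<in> Fl'" "\<And>f. f \<in> Fl' \<Longrightarrow> turn f \<in> Fl'"
  proof -
    show "Fl' \<subseteq> flags" by (auto simp: Fl'_def)
    fix f assume "f \<in> Fl'"
    then have f: "f \<in> flags" "flag_vertex f = v" "f \<notin> Fl" by (auto simp: Fl'_def)
    show "glue f \<in> Fl'" unfolding Fl'_def
      using f glue_flags[OF f(1)] flag_vertex_glue[OF f(1)] glue_glue[OF f(1)] Fl(2)[of "glue f"] by auto
    show "turn f \<in> Fl'" unfolding Fl'_def
      using f turn_props[OF f(1)] flag_vertex_turn[of f] Fl(3)[of "turn f"] by auto
  qed
  let ?A = "punctured_star Fl" and ?B = "punctured_star Fl'"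
  have oA: "openin M ?A" and oB: "openin M ?B"
    using openin_punctured_star[OF Fl(1-3)] openin_punctured_star[OF Fl'] by auto
  have AB: "?A \<inter> ?B = {}"
  proof (rule ccontr)
    assume "?A \<inter> ?B \<noteq> {}"
    then obtain p where p: "p \<in> ?A" "p \<in> ?B" by blast
    obtain t i k y where a: "(t, i, k) \<in> Fl" "y \<in> std_triangle" "1 / 2 < y $ i" "y \<noteq> corner i" "p = \<phi> t y"
      using p(1) unfolding punctured_star_def by blast
    obtain t' i' k' y' where b: "(t', i', k') \<in> Fl'" "y' \<in> std_triangle" "1 / 2 < y' $ i'" "y' \<noteq> corner i'" "p = \<phi> t' y'"
      using p(2) unfolding punctured_star_def by blast
    have t': "t' \<in> T" "i' \<noteq> k'" using b(1) Fl'(1) by (auto simp: flags_def)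
    have e: "\<phi> t' y' = \<phi> t y" using a(5) b(5) by simp
    obtain i2 k2 where c: "(t', i2, k2) \<in> Fl" "1 / 2 < y' $ i2"
      using flag_induct_saturated[OF Fl(1-3) a(1-4) t'(1) b(2) e] by blast
    have i2: "i2 = i'" using near_corner_unique[OF b(2) c(2) b(3)] .
    have n: "i2 \<noteq> k2" using c(1) Fl(1) by (auto simp: flags_def)
    have "k' = k2 \<or> k' = third i2 k2" using third_props(6)[OF n, of k'] t'(2) i2 by auto
    then have "(t', i', k') \<in> Fl" using c(1) Fl(3)[OF c(1)] i2 by (auto simp: turn_def)
    then show False using b(1) by (simp add: Fl'_def)
  qed
  obtain t0 i0 k0 where f0e: "f0 = (t0, i0, k0)" by (cases f0)
  have f0': "t0 \<in> T" "i0 \<noteq> k0" "\<phi> t0 (corner i0) = v" using f0 Fl(1,4) by (auto simp: f0e flags_def flag_vertex_simp)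
  have vM: "v \<in> topspace M" using char_in_M[OF f0'(1) corner_std] f0'(3) by metis
  \<comment> \<open>Only corners lie over v; for other points the condition is void and the whole
    triangle is taken.\<close>
  define W where "W t x = {y \<in> std_triangle. \<forall>i. x = corner i \<longrightarrow> 1 / 2 < y $ i}" for t :: 't and x :: "real^3"
  have Wc: "W t (corner i) = {y \<in> std_triangle. 1 / 2 < y $ i}" for t i
    by (auto simp: W_def corner_inj)
  have corner: "\<exists>i. x = corner i" if "t \<in> T" "x \<in> std_triangle" "\<phi> t x = v" for t x
    using same_point_corner[OF f0'(1) that(1,2), of i0] f0'(3) that(3) by auto
  have Wp: "openin (top_of_set std_triangle) (W t x) \<and> x \<in> W t x"
    if "t \<in> T" "x \<in> std_triangle" "\<phi> t x = v" for t x
  proof -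
    from corner[OF that] obtain i where i: "x = corner i" by (rule exE)
    show ?thesis using openin_coordinate_gt[of "1 / 2" i] corner_std[of i] by (simp add: i Wc corner_nth)
  qed
  have "\<exists>N. openin M N \<and> v \<in> N \<and>
    (\<forall>t\<in>T. \<forall>y\<in>std_triangle. \<phi> t y \<in> N \<longrightarrow> (\<exists>x\<in>std_triangle. \<phi> t x = v \<and> y \<in> W t x))"
    by (rule nbhd_from_pieces[OF vM Wp])
  then obtain N where N: "openin M N" "v \<in> N"
    "\<forall>t\<in>T. \<forall>y\<in>std_triangle. \<phi> t y \<in> N \<longrightarrow> (\<exists>x\<in>std_triangle. \<phi> t x = v \<and> y \<in> W t x)"
    by (elim exE conjE)
  obtain V where V: "openin M V" "v \<in> V" "V \<subseteq> N" "connectedin M (V - {v})"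
    by (rule vertex_disc[OF vM N(1,2)])
  have sub: "V - {v} \<subseteq> ?A \<union> ?B"
  proof
    fix q assume q: "q \<in> V - {v}"
    then have qN: "q \<in> N" "q \<in> topspace M" using V(1,3) openin_subset by auto
    obtain t y where ty: "t \<in> T" "y \<in> std_triangle" "q = \<phi> t y" by (rule pointE[OF qN(2)])
    obtain x where x: "x \<in> std_triangle" "\<phi> t x = v" "y \<in> W t x" using bspec[OF bspec[OF N(3) ty(1)] ty(2)] qN(1) ty(3) by auto
    obtain i where i: "x = corner i" using corner[OF ty(1) x(1,2)] by blast
    have y: "1 / 2 < y $ i" using x(3) by (simp add: i Wc)
    have yc: "y \<noteq> corner i" using q ty(3) x(2) i by auto
    have fl: "(t, i, i + 1) \<in> flags" "flag_vertex (t, i, i + 1) = v"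
      using ty(1) x(2) i by (simp_all add: mem_flags cyc3_neq flag_vertex_simp)
    then have "(t, i, i + 1) \<in> Fl \<or> (t, i, i + 1) \<in> Fl'" by (auto simp: Fl'_def)
    then show "q \<in> ?A \<union> ?B" unfolding punctured_star_def using ty y yc by blast
  qed
  \<comment> \<open>The side of any flag at v starts at v and so enters the small punctured disc;
    neither class can be missed by it.\<close>
  have meets: "P \<inter> (V - {v}) \<noteq> {}" if f: "(t, i, k) \<in> Q" "P = punctured_star Q" "(t, i, k) \<in> flags" "flag_vertex (t, i, k) = v" for t i k Q P
  proof -
    have t: "t \<in> T" "i \<noteq> k" "\<phi> t (corner i) = v" using f(3,4) by (auto simp: mem_flags flag_vertex_simp)
    have "edge_pt i k 0 \<in> {x \<in> std_triangle. \<phi> t x \<in> V}" using t V(2) corner_std by (simp add: edge_pt_ends)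
    from edge_pt_eventually[OF openin_preimage[OF t(1) V(1)] this]
    have "\<forall>\<^sub>F u in at_right 0. 0 < u \<and> u < 1 \<and> edge_pt i k u \<in> {x \<in> std_triangle. \<phi> t x \<in> V}" by simp
    moreover have "\<forall>\<^sub>F u::real in at_right 0. u \<in> {0<..<1/2}" by (rule eventually_at_right_real) simp
    ultimately have "\<forall>\<^sub>F u in at_right 0. (0 < u \<and> u < 1 \<and> edge_pt i k u \<in> {x \<in> std_triangle. \<phi> t x \<in> V}) \<and> u \<in> {0<..<1/2}"
      by (rule eventually_conj)
    then obtain u where u: "0 < u" "u < 1 / 2" "edge_pt i k u \<in> std_triangle" "\<phi> t (edge_pt i k u) \<in> V"
      by (auto dest!: eventually_happens)
    have nc: "edge_pt i k u \<noteq> corner j" for j using edge_pt_not_corner[OF t(2) u(1)] u(2) by simp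
    have "\<phi> t (edge_pt i k u) \<noteq> v" using corner[OF t(1) u(3)] nc by auto
    moreover have "\<phi> t (edge_pt i k u) \<in> punctured_star Q"
      unfolding punctured_star_def using f(1) u nc[of i] edge_pt_nth[OF t(2), of u i] by force
    ultimately show ?thesis using u(4) f(2) by blast
  qed
  obtain t1 i1 k1 where g0e: "g0 = (t1, i1, k1)" by (cases g0)
  have "?A \<inter> (V - {v}) \<noteq> {}" by (rule meets[of t0 i0 k0 Fl]) (use f0 Fl(1,4) f0e in auto)
  moreover have "?B \<inter> (V - {v}) \<noteq> {}" by (rule meets[of t1 i1 k1 Fl']) (use g0 g0O g0e in \<open>auto simp: Fl'_def\<close>)
  ultimately show False using connectedinD[OF V(4) oA oB sub] AB by blast
qed

end

section \<open>Construction of the hyperbolic structure on M\<close>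

section \<open>Developing charts\<close>

lemma isometry_triangle:
  assumes g: "hyp_isometry g" and a: "hyp_triangle a"
  shows "hyp_triangle (\<lambda>i. g (a i))" "side_cosh (\<lambda>i. g (a i)) j = side_cosh a j"
proof -
  have a': "\<And>i. a i \<in> hyp_plane" and v: "tri_vol a \<noteq> 0" using a unfolding hyp_triangle_iff by auto
  have sc: "side_cosh (\<lambda>i. g (a i)) j = side_cosh a j" for j
    unfolding side_cosh_def by (rule hyp_isometry_lor[OF g a' a'])
  then show "side_cosh (\<lambda>i. g (a i)) j = side_cosh a j" .
  have "(tri_vol (\<lambda>i. g (a i)))\<^sup>2 = (tri_vol a)\<^sup>2"
    unfolding tri_vol_sq[of a 0, OF a'] tri_vol_sq[of "\<lambda>i. g (a i)" 0, OF hyp_isometry_mem[OF g a']] sc ..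
  then show "hyp_triangle (\<lambda>i. g (a i))"
    unfolding hyp_triangle_iff using v hyp_isometry_mem[OF g a'] by auto
qed

text \<open>The assumptions are those needed to compare charts. The angle sum 2\<pi> is kept apart
  and appears as a hypothesis of \<open>vertex_chart\<close> and
  \<open>dev_hyperbolic_surface\<close>.\<close>

locale hyperbolic_triangulation = triangulated_surface M T \<phi>
  for M :: "'a topology" and T :: "'t set" and \<phi> :: "'t \<Rightarrow> real^3 \<Rightarrow> 'a" +
  fixes a :: "'t \<Rightarrow> 3 \<Rightarrow> complex"
  assumes triangle: "\<And>t. t \<in> T \<Longrightarrow> hyp_triangle (a t)"
    and side_length: "\<And>t i k t' i' k'. (t, i, k) \<in> flags \<Longrightarrow> glue (t, i, k) = (t', i', k') \<Longrightarrow>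
      lor (lift (a t i)) (lift (a t k)) = lor (lift (a t' i')) (lift (a t' k'))"
begin

lemma vertex_mem: "t \<in> T \<Longrightarrow> a t i \<in> hyp_plane"
  using triangle unfolding hyp_triangle_iff by blast

definition dev_piece ::
  "'a set \<Rightarrow> ('a \<Rightarrow> complex) \<Rightarrow> 't \<Rightarrow> real^3 \<Rightarrow> (complex \<Rightarrow> complex) \<Rightarrow> (real^3) set \<Rightarrow> bool" where
  "dev_piece U c t x g W \<longleftrightarrow> hyp_isometry g \<and> openin (top_of_set std_triangle) W \<and> x \<in> W \<and>
     (\<forall>y\<in>W. \<phi> t y \<in> U \<and> c (\<phi> t y) = g (bary (a t) y))"

text \<open>Isometry is demanded on each triangle separately; injectivity then forces neighbouring
  triangles to be laid out on opposite sides of their common edge.\<close>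

definition dev_chart :: "'a set \<Rightarrow> ('a \<Rightarrow> complex) \<Rightarrow> bool" where
  "dev_chart U c \<longleftrightarrow> openin M U \<and> continuous_map (subtopology M U) euclidean c \<and> inj_on c U \<and>
     (\<forall>t\<in>T. \<forall>x\<in>std_triangle. \<phi> t x \<in> U \<longrightarrow> (\<exists>g W. dev_piece U c t x g W))"

lemma dev_pieceD:
  assumes "dev_piece U c t x g W"
  shows "hyp_isometry g" "openin (top_of_set std_triangle) W" "x \<in> W" "W \<subseteq> std_triangle"
    "y \<in> W \<Longrightarrow> \<phi> t y \<in> U" "y \<in> W \<Longrightarrow> c (\<phi> t y) = g (bary (a t) y)"
  using assms openin_imp_subset unfolding dev_piece_def by auto

lemma dev_piece_move: "dev_piece U c t x g W \<Longrightarrow> x' \<in> W \<Longrightarrow> dev_piece U c t x' g W"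
  unfolding dev_piece_def by blast

text \<open>The images of the two triangles agree at two nearby parameters of the glued side and
  hence in its endpoints. If both third vertices lay on the same side,
  \<open>same_side_overlap\<close> would produce distinct points of U with the same image.\<close>

lemma develops_adjacent:
  assumes dc: "dev_chart U c" and f: "(t, i, k) \<in> flags" and gl: "glue (t, i, k) = (t', i', k')"
    and s: "0 < s" "s < 1"
    and P: "dev_piece U c t (edge_pt i k s) g W" and P': "dev_piece U c t' (edge_pt i' k' s) g' W'"
  shows "g (a t i) = g' (a t' i')" "g (a t k) = g' (a t' k')"
    "vol (lift (g (a t i))) (lift (g (a t k))) (lift (g (a t (third i k)))) *
     vol (lift (g (a t i))) (lift (g (a t k))) (lift (g' (a t' (third i' k')))) < 0"
proof -
  have f': "(t', i', k') \<in> flags" using glue_flags[OF f] gl by simp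
  have t: "t \<in> T" "i \<noteq> k" and t': "t' \<in> T" "i' \<noteq> k'" using f f' by (auto simp: mem_flags)
  define X where "X = (\<lambda>j. g (a t j))"
  define Y where "Y = (\<lambda>j. g' (a t' j))"
  note PD = dev_pieceD[OF P] and PD' = dev_pieceD[OF P']
  have tX: "hyp_triangle X" and tY: "hyp_triangle Y"
    unfolding X_def Y_def using isometry_triangle(1) PD(1) PD'(1) triangle t(1) t'(1) by blast+
  have X: "\<And>j. X j \<in> hyp_plane" and Y: "\<And>j. Y j \<in> hyp_plane"
    using tX tY unfolding hyp_triangle_iff by auto
  have bX: "bary X y = c (\<phi> t y)" if "y \<in> W" for y
    unfolding X_def using isometry_bary[OF PD(1), of "a t" y] vertex_mem[OF t(1)] PD(4,6) that by auto
  have bY: "bary Y y = c (\<phi> t' y)" if "y \<in> W'" for y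
    unfolding Y_def using isometry_bary[OF PD'(1), of "a t'" y] vertex_mem[OF t'(1)] PD'(4,6) that by auto
  have len: "lor (lift (X i)) (lift (X k)) = lor (lift (Y i')) (lift (Y k'))"
    unfolding X_def Y_def
    using hyp_isometry_lor[OF PD(1)] hyp_isometry_lor[OF PD'(1)] vertex_mem t(1) t'(1) side_length[OF f gl] by simp
  have pts: "\<phi> t' (edge_pt i' k' u) = \<phi> t (edge_pt i k u)" if "0 \<le> u" "u \<le> 1" for u
    using flag_pt_glue[OF f that] gl by (simp add: flag_pt_def)
  have "\<forall>\<^sub>F u in at_right s. (s < u \<and> u < 1 \<and> edge_pt i k u \<in> W) \<and> (s < u \<and> u < 1 \<and> edge_pt i' k' u \<in> W')"
    using s by (intro eventually_conj edge_pt_eventually PD(2,3) PD'(2,3)) auto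
  then obtain u where u: "s < u" "u < 1" "edge_pt i k u \<in> W" "edge_pt i' k' u \<in> W'"
    by (auto dest!: eventually_happens)
  have ends: "X i = Y i'" "X k = Y k'"
  proof -
    have e1: "bary X (edge_pt i k s) = bary Y (edge_pt i' k' s)" "bary X (edge_pt i k u) = bary Y (edge_pt i' k' u)"
      using bX bY PD(3) PD'(3) u pts s by simp_all
    show "X i = Y i'" "X k = Y k'"
      using bary_edge_pt_eqD[of X Y, OF X Y len _ u(1) _ e1] s u by simp_all
  qed
  then show "g (a t i) = g' (a t' i')" "g (a t k) = g' (a t' k')" by (simp_all add: X_def Y_def)
  let ?v = "vol (lift (X i)) (lift (X k)) (lift (X (third i k)))"
  let ?w = "vol (lift (X i)) (lift (X k)) (lift (Y (third i' k')))"
  have "?v\<^sup>2 \<noteq> 0" unfolding tri_vol_third[OF t(2)] using tX by (simp add: hyp_triangle_iff)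
  moreover have "?w\<^sup>2 \<noteq> 0" unfolding ends tri_vol_third[OF t'(2)] using tY by (simp add: hyp_triangle_iff)
  ultimately have "?v * ?w \<noteq> 0" by simp
  moreover have "\<not> 0 < ?v * ?w"
  proof
    assume vw: "0 < ?v * ?w"
    \<comment> \<open>For a triangle glued to itself the two overlapping points could be one point
      counted twice. Disjoint neighbourhoods of the two positions of the edge point exclude
      this.\<close>
    have "\<exists>O1 O2. open O1 \<and> open O2 \<and> edge_pt i k s \<in> O1 \<and> edge_pt i' k' s \<in> O2 \<and> (t = t' \<longrightarrow> O1 \<inter> O2 = {})"
    proof (cases "t = t'")
      case True
      have "edge_pt i k s \<noteq> edge_pt i' k' s"
      proof
        assume "edge_pt i k s = edge_pt i' k' s"
        then have "third i k = third i' k'" by (rule edge_pt_eq_third[OF t(2) t'(2) s])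
        then have "flag_side (glue (t, i, k)) = flag_side (t, i, k)" using True gl by (simp add: flag_side_def)
        then show False using flag_side_glue[OF f] opp_props(2)[OF flag_side_sides[OF f]] by simp
      qed
      then show ?thesis using hausdorff by metis
    qed (intro exI[of _ UNIV], simp)
    then obtain O1 O2 where O12: "open O1" "open O2" "edge_pt i k s \<in> O1" "edge_pt i' k' s \<in> O2" "t = t' \<Longrightarrow> O1 \<inter> O2 = {}"
      by blast
    have "openin (top_of_set std_triangle) (W \<inter> O1)" "openin (top_of_set std_triangle) (W' \<inter> O2)"
      using PD(2) PD'(2) O12(1,2) by (auto intro: openin_Int_open)
    from same_side_overlap[of X Y i k i' k' s, OF X Y t(2) t'(2) ends vw s this(1) _ this(2)]
    obtain y y' where y: "y \<in> W \<inter> O1 \<inter> open_triangle" "y' \<in> W' \<inter> O2 \<inter> open_triangle" "bary X y = bary Y y'"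
      using PD(3) PD'(3) O12(3,4) by blast
    then have "c (\<phi> t y) = c (\<phi> t' y')" using bX bY by simp
    moreover have "\<phi> t y \<in> U" "\<phi> t' y' \<in> U" using PD(5) PD'(5) y by auto
    ultimately have e: "\<phi> t' y' = \<phi> t y" using dc unfolding dev_chart_def by (metis inj_onD)
    have "y \<in> open_triangle" "y' \<in> std_triangle" using y open_subset_std by auto
    then have "t' = t \<and> y' = y" using same_point_open[OF t(1) _ t'(1) _ e] by blast
    then show False using O12(5) y by blast
  qed
  ultimately have "?v * ?w < 0" by (metis linorder_neqE_linordered_idom)
  then show "vol (lift (g (a t i))) (lift (g (a t k))) (lift (g (a t (third i k)))) *
     vol (lift (g (a t i))) (lift (g (a t k))) (lift (g' (a t' (third i' k')))) < 0"
    by (simp only: X_def Y_def)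
qed

text \<open>H and H' are the coordinate changes computed in the two triangles at an edge. They agree
  on the image of the edge, and \<open>develops_adjacent\<close> for both charts supplies the
  separation conditions of \<open>adjacent_isometries_agree\<close>.\<close>

lemma edge_transition:
  assumes dc: "dev_chart U c" "dev_chart V d" and f: "(t, i, k) \<in> flags" and gl: "glue (t, i, k) = (t', i', k')"
    and s: "0 < s" "s < 1"
    and P: "dev_piece U c t (edge_pt i k s) g W" "dev_piece U c t' (edge_pt i' k' s) g' W'"
    and Q: "dev_piece V d t (edge_pt i k s) h S" "dev_piece V d t' (edge_pt i' k' s) h' S'"
    and H: "hyp_isometry H" "\<And>z. z \<in> hyp_plane \<Longrightarrow> H (g z) = h z"
    and H': "hyp_isometry H'" "\<And>z. z \<in> hyp_plane \<Longrightarrow> H' (g' z) = h' z"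
    and z: "z \<in> hyp_plane"
  shows "H z = H' z"
proof -
  have f': "(t', i', k') \<in> flags" using glue_flags[OF f] gl by simp
  have t: "t \<in> T" "i \<noteq> k" and t': "t' \<in> T" "i' \<noteq> k'" using f f' by (auto simp: mem_flags)
  note gi = dev_pieceD(1)[OF P(1)] dev_pieceD(1)[OF P(2)]
  note A = develops_adjacent[OF dc(1) f gl s P] and B = develops_adjacent[OF dc(2) f gl s Q]
  have m: "a t j \<in> hyp_plane" "a t' j \<in> hyp_plane" for j using vertex_mem t(1) t'(1) by auto
  have "a t i \<noteq> a t k"
    using triangle[OF t(1)] t(2) unfolding hyp_triangle_def by (metis inj_eq)
  then have ne: "g (a t i) \<noteq> g (a t k)" using hyp_isometry_inj[OF gi(1) m(1) m(1)] by simp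
  show ?thesis
  proof (rule adjacent_isometries_agree[OF H(1) H'(1) _ _ _ _ ne _ _ A(3) _ z])
    show "g (a t i) \<in> hyp_plane" "g (a t k) \<in> hyp_plane" "g (a t (third i k)) \<in> hyp_plane"
      "g' (a t' (third i' k')) \<in> hyp_plane" using hyp_isometry_mem gi m by blast+
    show "H (g (a t i)) = H' (g (a t i))" 
      using H(2)[OF m(1)[of i]] H'(2)[OF m(2)[of i']] A(1) B(1) by simp
    show "H (g (a t k)) = H' (g (a t k))" 
      using H(2)[OF m(1)[of k]] H'(2)[OF m(2)[of k']] A(2) B(2) by simp
    show "vol (lift (H (g (a t i)))) (lift (H (g (a t k)))) (lift (H (g (a t (third i k))))) *
      vol (lift (H (g (a t i)))) (lift (H (g (a t k)))) (lift (H' (g' (a t' (third i' k'))))) < 0"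
      unfolding H(2)[OF m(1)] H'(2)[OF m(2)] by (rule B(3))
  qed
qed

text \<open>Each triangle at p yields its own coordinate change. These agree across an edge, and at
  a vertex agreement spreads to all triangles because the link is connected.\<close>

theorem dev_chart_transition:
  assumes dc: "dev_chart U c" "dev_chart V d" and p: "p \<in> U" "p \<in> V"
  shows "\<exists>H N. hyp_isometry H \<and> openin M N \<and> p \<in> N \<and> N \<subseteq> U \<inter> V \<and> (\<forall>q\<in>N. d q = H (c q))"
proof -
  have pM: "p \<in> topspace M" using dc(1) p(1) openin_subset unfolding dev_chart_def by blast
  have "\<exists>g W h S. t \<in> T \<and> x \<in> std_triangle \<and> \<phi> t x = p \<longrightarrow> dev_piece U c t x g W \<and> dev_piece V d t x h S" for t x
    using dc p unfolding dev_chart_def by metis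
  then obtain g W h S where pieces: "\<And>t x. t \<in> T \<Longrightarrow> x \<in> std_triangle \<Longrightarrow> \<phi> t x = p \<Longrightarrow> dev_piece U c t x (g t x) (W t x)"
    "\<And>t x. t \<in> T \<Longrightarrow> x \<in> std_triangle \<Longrightarrow> \<phi> t x = p \<Longrightarrow> dev_piece V d t x (h t x) (S t x)"
    by metis
  have "\<exists>H. hyp_isometry H \<and> (\<forall>z\<in>hyp_plane. H (g t x z) = h t x z)"
    if t: "t \<in> T" "x \<in> std_triangle" "\<phi> t x = p" for t x
  proof -
    have gi: "hyp_isometry (g t x)" "hyp_isometry (h t x)" using dev_pieceD(1) pieces t by blast+
    obtain g' where g': "hyp_isometry g'" "\<And>z. z \<in> hyp_plane \<Longrightarrow> g' (g t x z) = z" "\<And>z. z \<in> hyp_plane \<Longrightarrow> g t x (g' z) = z"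
      by (rule hyp_isometry_inv[OF gi(1)]) (rule that)
    have "hyp_isometry (\<lambda>z. h t x (g' z))" by (rule hyp_isometry_comp[OF gi(2) g'(1)])
    then show ?thesis using g'(2) by (intro exI[of _ "\<lambda>z. h t x (g' z)"]) simp
  qed
  then obtain H where H: "\<And>t x. t \<in> T \<Longrightarrow> x \<in> std_triangle \<Longrightarrow> \<phi> t x = p \<Longrightarrow> hyp_isometry (H t x)"
    "\<And>t x z. t \<in> T \<Longrightarrow> x \<in> std_triangle \<Longrightarrow> \<phi> t x = p \<Longrightarrow> z \<in> hyp_plane \<Longrightarrow> H t x (g t x z) = h t x z"
    by metis
  obtain t0 x0 where t0: "t0 \<in> T" "x0 \<in> std_triangle" "p = \<phi> t0 x0" by (rule pointE[OF pM])
  have agree: "H t x z = H t0 x0 z" if t: "t \<in> T" "x \<in> std_triangle" "\<phi> t x = p" and z: "z \<in> hyp_plane" for t x z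
    using t0(2)
  proof (cases rule: std_triangle_cases)
    case 1
    then show ?thesis using same_point_open[OF t0(1) 1 t(1,2)] t(3) t0(3) by metis
  next
    case (2 i k s)
    have f: "(t0, i, k) \<in> flags" using t0(1) 2(1) by (simp add: mem_flags)
    have "\<phi> t x = \<phi> t0 (edge_pt i k s)" using t(3) t0(3) 2(4) by simp
    from same_point_edge[OF f 2(2,3) t(1,2) this]
    consider "t = t0" "x = x0" | i' k' where "glue (t0, i, k) = (t, i', k')" "x = edge_pt i' k' s"
      using 2(4) by blast
    then show ?thesis
    proof cases
      case (2 i' k')
      have e: "x0 = edge_pt i k s" by fact
      note P = pieces[OF t0(1,2) t0(3)[symmetric]] pieces[OF t]
      show ?thesis
        by (rule edge_transition[OF dc f 2(1) \<open>0 < s\<close> \<open>s < 1\<close> P(1)[unfolded e] P(3)[unfolded 2(2)] P(2)[unfolded e] P(4)[unfolded 2(2)], symmetric])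
          (use H[OF t0(1,2) t0(3)[symmetric]] H[OF t] z in \<open>simp_all add: e 2(2)\<close>)
    qed simp
  next
    case (3 i0)
    \<comment> \<open>The flags at the vertex whose coordinate change agrees with that of the
      reference triangle. Closure under \<open>turn\<close> is immediate since the corner stays the
      same.\<close>
    define Fl where "Fl = {(t, i, k). (t, i, k) \<in> flags \<and> \<phi> t (corner i) = p \<and> (\<forall>z\<in>hyp_plane. H t (corner i) z = H t0 x0 z)}"
    have mem: "(t, i, k) \<in> Fl \<longleftrightarrow> t \<in> T \<and> i \<noteq> k \<and> \<phi> t (corner i) = p \<and> (\<forall>z\<in>hyp_plane. H t (corner i) z = H t0 x0 z)" for t i k
      by (simp add: Fl_def mem_flags)
    have tF: "turn f \<in> Fl" if f: "f \<in> Fl" for f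
    proof -
      obtain t1 i k where fe: "f = (t1, i, k)" by (cases f)
      then have "i \<noteq> k" using f by (simp add: mem)
      then have "i \<noteq> third i k" using third_props(1) by metis
      then show ?thesis using f by (simp add: fe mem turn_def)
    qed
    have gF: "glue f \<in> Fl" if fF: "f \<in> Fl" for f
    proof -
      obtain t1 i k where fe: "f = (t1, i, k)" by (cases f)
      obtain t2 i' k' where ge: "glue f = (t2, i', k')" by (cases "glue f")
      have f: "(t1, i, k) \<in> flags" "\<phi> t1 (corner i) = p" and eq1: "\<And>z. z \<in> hyp_plane \<Longrightarrow> H t1 (corner i) z = H t0 x0 z"
        using fF by (auto simp: fe mem mem_flags)
      have g2: "(t2, i', k') \<in> flags" "\<phi> t2 (corner i') = p"
        using glue_flags[OF f(1)] flag_vertex_glue[OF f(1)] f(2) ge by (auto simp: fe flag_vertex_simp)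
      have T12: "t1 \<in> T" "i \<noteq> k" "t2 \<in> T" "i' \<noteq> k'" using f g2 by (auto simp: mem_flags)
      note P1 = pieces[OF T12(1) corner_std f(2)] and P2 = pieces[OF T12(3) corner_std g2(2)]
      \<comment> \<open>Every piece around the corner also contains the nearby points of the sides
        there, so agreement at the vertex is reduced to \<open>edge_transition\<close> at such a
        point.\<close>
      have ev: "\<forall>\<^sub>F u in at_right 0. 0 < u \<and> u < 1 \<and> edge_pt j m u \<in> X"
        if "openin (top_of_set std_triangle) X" "corner j \<in> X" for j m X
        by (rule edge_pt_eventually) (use that in \<open>simp_all add: edge_pt_ends\<close>)
      have "\<forall>\<^sub>F u in at_right 0. (0 < u \<and> u < 1 \<and> edge_pt i k u \<in> W t1 (corner i)) \<and> (0 < u \<and> u < 1 \<and> edge_pt i k u \<in> S t1 (corner i))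
         \<and> (0 < u \<and> u < 1 \<and> edge_pt i' k' u \<in> W t2 (corner i')) \<and> (0 < u \<and> u < 1 \<and> edge_pt i' k' u \<in> S t2 (corner i'))"
        using dev_pieceD(2,3)[OF P1(1)] dev_pieceD(2,3)[OF P1(2)] dev_pieceD(2,3)[OF P2(1)] dev_pieceD(2,3)[OF P2(2)]
        by (intro eventually_conj ev) auto
      then obtain u where u: "0 < u" "u < 1" "edge_pt i k u \<in> W t1 (corner i)" "edge_pt i k u \<in> S t1 (corner i)"
        "edge_pt i' k' u \<in> W t2 (corner i')" "edge_pt i' k' u \<in> S t2 (corner i')"
        by (auto dest!: eventually_happens)
      have "H t1 (corner i) z = H t2 (corner i') z" if "z \<in> hyp_plane" for z
        by (rule edge_transition[OF dc f(1) ge[unfolded fe] u(1,2) dev_piece_move[OF P1(1) u(3)] dev_piece_move[OF P2(1) u(5)]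
              dev_piece_move[OF P1(2) u(4)] dev_piece_move[OF P2(2) u(6)]
              H(1)[OF T12(1) corner_std f(2)] H(2)[OF T12(1) corner_std f(2)] H(1)[OF T12(3) corner_std g2(2)] H(2)[OF T12(3) corner_std g2(2)] that])
      then show ?thesis using g2 T12 eq1 by (simp add: ge mem)
    qed
    have f0: "(t0, i0, i0 + 1) \<in> Fl" using t0 3 by (simp add: mem cyc3_neq)
    obtain i where i: "x = corner i" using same_point_corner[OF t0(1) t(1,2), of i0] t(3) t0(3) 3 by auto
    have "(t, i, i + 1) \<in> Fl"
    proof (rule link_connected[OF _ gF tF _ f0])
      show "Fl \<subseteq> flags" by (auto simp: Fl_def)
      show "flag_vertex f = p" if "f \<in> Fl" for f using that by (cases f) (simp add: mem flag_vertex_simp)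
      show "(t, i, i + 1) \<in> flags" "flag_vertex (t, i, i + 1) = p"
        using t i by (simp_all add: mem_flags cyc3_neq flag_vertex_simp)
    qed
    then show ?thesis using z i by (simp add: mem)
  qed
  have "\<exists>N. openin M N \<and> p \<in> N \<and>
    (\<forall>t\<in>T. \<forall>y\<in>std_triangle. \<phi> t y \<in> N \<longrightarrow> (\<exists>x\<in>std_triangle. \<phi> t x = p \<and> y \<in> W t x \<inter> S t x))"
    by (rule nbhd_from_pieces[OF pM]) (use dev_pieceD(2,3) pieces in blast)
  then obtain N where N: "openin M N" "p \<in> N"
    "\<forall>t\<in>T. \<forall>y\<in>std_triangle. \<phi> t y \<in> N \<longrightarrow> (\<exists>x\<in>std_triangle. \<phi> t x = p \<and> y \<in> W t x \<inter> S t x)"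
    by (elim exE conjE)
  have good: "q \<in> U \<inter> V \<and> d q = H t0 x0 (c q)" if q: "q \<in> N" for q
  proof -
    have "q \<in> topspace M" using N(1) q openin_subset by blast
    then obtain t y where ty: "t \<in> T" "y \<in> std_triangle" "q = \<phi> t y" by (rule pointE)
    obtain x where x: "x \<in> std_triangle" "\<phi> t x = p" "y \<in> W t x" "y \<in> S t x"
      using bspec[OF bspec[OF N(3) ty(1)] ty(2)] q ty(3) by auto
    note P = pieces[OF ty(1) x(1,2)]
    have b: "bary (a t) y \<in> hyp_plane" by (rule bary_mem[of "a t", OF vertex_mem[OF ty(1)] ty(2)])
    have "c q = g t x (bary (a t) y)" "d q = h t x (bary (a t) y)" "q \<in> U" "q \<in> V"
      using dev_pieceD(5,6)[OF P(1) x(3)] dev_pieceD(5,6)[OF P(2) x(4)] ty(3) by simp_all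
    moreover have "H t x (g t x (bary (a t) y)) = h t x (bary (a t) y)" by (rule H(2)[OF ty(1) x(1,2) b])
    moreover have "H t x (g t x (bary (a t) y)) = H t0 x0 (g t x (bary (a t) y))"
      by (rule agree[OF ty(1) x(1,2) hyp_isometry_mem[OF dev_pieceD(1)[OF P(1)] b]])
    ultimately show ?thesis by simp
  qed
  show ?thesis
    by (rule exI[of _ "H t0 x0"], rule exI[of _ N]) (use H(1)[OF t0(1,2) t0(3)[symmetric]] N(1,2) good in blast)
qed

lemma dev_chart_mem:
  assumes dc: "dev_chart U c"
  shows "c ` U \<subseteq> hyp_plane"
proof
  fix z assume "z \<in> c ` U"
  then obtain q where q: "q \<in> U" "z = c q" by blast
  then have "q \<in> topspace M" using dc openin_subset unfolding dev_chart_def by blast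
  then obtain t y where ty: "t \<in> T" "y \<in> std_triangle" "q = \<phi> t y" by (rule pointE)
  then obtain g W where P: "dev_piece U c t y g W" using dc q(1) unfolding dev_chart_def by blast
  show "z \<in> hyp_plane"
    using dev_pieceD(6)[OF P dev_pieceD(3)[OF P]] hyp_isometry_mem[OF dev_pieceD(1)[OF P] bary_mem[of "a t", OF vertex_mem[OF ty(1)] ty(2)]]
      q(2) ty(3) by simp
qed

end

context triangulated_surface
begin

text \<open>Composition with a local parametrisation of the surface by a plane disc gives an
  injective continuous map between plane sets, which is open by invariance of domain.\<close>

lemma injective_chart_open_map:
  fixes c :: "'a \<Rightarrow> complex"
  assumes U: "openin M U" and cont: "continuous_map (subtopology M U) euclidean c" and inj: "inj_on c U"
    and S: "openin M S" "S \<subseteq> U"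
  shows "open (c ` S)"
proof (subst open_subopen, rule ballI)
  fix z assume "z \<in> c ` S"
  then obtain p where p: "p \<in> S" "z = c p" by blast
  have "p \<in> topspace M" using S(1) p(1) openin_subset by blast
  then obtain V where V: "openin M V" "p \<in> V" "subtopology M V homeomorphic_space top_of_set (ball (0::complex) 1)"
    using surface unfolding closed_surface_def by blast
  then obtain \<psi> \<xi> where h: "homeomorphic_maps (subtopology M V) (top_of_set (ball (0::complex) 1)) \<psi> \<xi>"
    unfolding homeomorphic_space_def by blast
  have ts: "topspace (subtopology M V) = V" using openin_subset[OF V(1)] by auto
  have \<psi>: "homeomorphic_map (subtopology M V) (top_of_set (ball 0 1)) \<psi>"
    and inv: "\<And>x. x \<in> V \<Longrightarrow> \<xi> (\<psi> x) = x"
    and \<xi>: "continuous_map (top_of_set (ball 0 1)) M \<xi>"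
    using h ts unfolding homeomorphic_maps_map by (auto simp: homeomorphic_imp_continuous_map continuous_map_in_subtopology dest: homeomorphic_imp_continuous_map)
  have "openin (subtopology M V) (V \<inter> S)" using S(1) by (auto simp: openin_subtopology)
  then have "openin (top_of_set (ball 0 1)) (\<psi> ` (V \<inter> S))"
    using homeomorphic_imp_open_map[OF \<psi>] unfolding open_map_def by blast
  then have op: "open (\<psi> ` (V \<inter> S))" "\<psi> ` (V \<inter> S) \<subseteq> ball 0 1" by (auto simp: openin_open_eq)
  have im: "\<xi> ` \<psi> ` (V \<inter> S) = V \<inter> S" using inv by (force simp: image_image)
  have "continuous_map (top_of_set (\<psi> ` (V \<inter> S))) (subtopology M U) \<xi>"
    unfolding continuous_map_in_subtopology
    using continuous_map_from_subtopology_mono[OF \<xi> op(2)] im S(2) by auto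
  then have "continuous_map (top_of_set (\<psi> ` (V \<inter> S))) euclidean (c \<circ> \<xi>)"
    using cont by (rule continuous_map_compose)
  then have "continuous_on (\<psi> ` (V \<inter> S)) (c \<circ> \<xi>)" by simp
  moreover have "inj_on (c \<circ> \<xi>) (\<psi> ` (V \<inter> S))"
  proof (rule comp_inj_on)
    show "inj_on \<xi> (\<psi> ` (V \<inter> S))" by (rule inj_onI) (use inv in auto)
    show "inj_on c (\<xi> ` \<psi> ` (V \<inter> S))" unfolding im by (rule inj_on_subset[OF inj]) (use S(2) in blast)
  qed
  ultimately have "open ((c \<circ> \<xi>) ` \<psi> ` (V \<inter> S))" using op(1) by (intro invariance_of_domain)
  moreover have "(c \<circ> \<xi>) ` \<psi> ` (V \<inter> S) = c ` (V \<inter> S)" unfolding image_comp[symmetric] im ..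
  ultimately show "\<exists>A. open A \<and> z \<in> A \<and> A \<subseteq> c ` S" using p V(2) by (intro exI[of _ "c ` (V \<inter> S)"]) auto
qed

lemma injective_chart_homeomorphic:
  fixes c :: "'a \<Rightarrow> complex"
  assumes U: "openin M U" and cont: "continuous_map (subtopology M U) euclidean c" and inj: "inj_on c U"
  shows "open (c ` U)" "homeomorphic_map (subtopology M U) (top_of_set (c ` U)) c"
proof -
  show o: "open (c ` U)" by (rule injective_chart_open_map[OF U cont inj U subset_refl])
  have ts: "topspace (subtopology M U) = U" using openin_subset[OF U] by auto
  show "homeomorphic_map (subtopology M U) (top_of_set (c ` U)) c"
  proof (rule bijective_open_imp_homeomorphic_map)
    show "continuous_map (subtopology M U) (top_of_set (c ` U)) c"
      using cont openin_subset[OF U] by (auto simp: continuous_map_in_subtopology)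
    show "open_map (subtopology M U) (top_of_set (c ` U)) c"
      unfolding open_map_def
    proof (intro allI impI)
      fix S assume "openin (subtopology M U) S"
      then have "openin M S" "S \<subseteq> U" using U openin_trans_full openin_subset ts by blast+
      then have "open (c ` S)" "c ` S \<subseteq> c ` U" using injective_chart_open_map[OF U cont inj] by auto
      then show "openin (top_of_set (c ` U)) (c ` S)" by (simp add: open_openin_trans open_subset)
    qed
    show "c ` topspace (subtopology M U) = topspace (top_of_set (c ` U))" using ts by simp
    show "inj_on c (topspace (subtopology M U))" using ts inj by simp
  qed
qed

end

section \<open>Charts around faces and edges\<close>

lemma side_cosh_third:
  assumes "i \<noteq> k"
  shows "side_cosh a (third i k) = lor (lift (a i)) (lift (a k))"
proof -
  define l where "l = third i k"
  have "(i = l + 1 \<and> k = l + 2) \<or> (i = l + 2 \<and> k = l + 1)" using third_props(7)[OF assms] by (simp add: l_def)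
  then show ?thesis unfolding l_def[symmetric] side_cosh_def by (auto simp: lor_commute)
qed

lemma cosine_law_at:
  assumes a: "hyp_triangle a" and ik: "i \<noteq> k"
  shows "lor (lift (a k)) (lift (a (third i k))) = lor (lift (a i)) (lift (a k)) * lor (lift (a i)) (lift (a (third i k)))
     - sqrt ((lor (lift (a i)) (lift (a k)))\<^sup>2 - 1) * sqrt ((lor (lift (a i)) (lift (a (third i k))))\<^sup>2 - 1) * cos (tri_angle a i)"
proof -
  have a': "\<And>i. a i \<in> hyp_plane" and v: "tri_vol a \<noteq> 0" using a unfolding hyp_triangle_iff by auto
  have \<Delta>: "0 < 1 + 2 * side_cosh a i * side_cosh a (i + 1) * side_cosh a (i + 2)
     - (side_cosh a i)\<^sup>2 - (side_cosh a (i + 1))\<^sup>2 - (side_cosh a (i + 2))\<^sup>2"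
    using tri_vol_sq[of a i, OF a'] v by (metis zero_less_power2)
  have "cos (tri_angle a i) = (side_cosh a (i + 1) * side_cosh a (i + 2) - side_cosh a i)
     / (sqrt ((side_cosh a (i + 1))\<^sup>2 - 1) * sqrt ((side_cosh a (i + 2))\<^sup>2 - 1))"
    unfolding tri_angle_side_cosh[of a i, OF a']
    by (rule cosine_laws(4)[OF side_cosh_gt1[OF a] side_cosh_gt1[OF a] side_cosh_gt1[OF a] \<Delta>])
  moreover have "0 < (side_cosh a (i + 1))\<^sup>2 - 1" "0 < (side_cosh a (i + 2))\<^sup>2 - 1"
    using side_cosh_gt1[OF a] by simp_all
  ultimately have e: "side_cosh a i = side_cosh a (i + 1) * side_cosh a (i + 2)
     - sqrt ((side_cosh a (i + 1))\<^sup>2 - 1) * sqrt ((side_cosh a (i + 2))\<^sup>2 - 1) * cos (tri_angle a i)"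
    by simp
  define l where "l = third i k"
  have ne: "l \<noteq> i" "l \<noteq> k" using third_props(1,2)[OF ik] by (auto simp: l_def)
  have s: "side_cosh a l = lor (lift (a i)) (lift (a k))" "side_cosh a k = lor (lift (a i)) (lift (a l))"
    "side_cosh a i = lor (lift (a k)) (lift (a l))"
    using side_cosh_third[of i k a] side_cosh_third[of i l a] side_cosh_third[of k l a] ik ne third_props(4,5)[OF ik]
      third_props(3,4)[of k i] ik by (auto simp: l_def)
  have "(k = i + 1 \<and> l = i + 2) \<or> (k = i + 2 \<and> l = i + 1)"
    using exhaust_cyc3[of k i] exhaust_cyc3[of l i] ik ne by auto
  then show ?thesis unfolding l_def[symmetric] s[symmetric] using e by (auto simp: mult_ac)
qed

text \<open>A copy of the triangle with corner i at the origin and the sides at i in the directions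
  \<alpha> and \<beta>; it is congruent to \<open>a\<close> if these enclose the angle at i.\<close>

definition polar_tri :: "(3 \<Rightarrow> complex) \<Rightarrow> 3 \<Rightarrow> 3 \<Rightarrow> real \<Rightarrow> real \<Rightarrow> 3 \<Rightarrow> complex" where
  "polar_tri a i k \<alpha> \<beta> j = (if j = i then 0 else
     polar (lor (lift (a i)) (lift (a j))) (if j = k then \<alpha> else \<beta>))"

lemma polar_tri_simps:
  assumes "i \<noteq> k"
  shows "polar_tri a i k \<alpha> \<beta> i = 0" "polar_tri a i k \<alpha> \<beta> k = polar (lor (lift (a i)) (lift (a k))) \<alpha>"
    "polar_tri a i k \<alpha> \<beta> (third i k) = polar (lor (lift (a i)) (lift (a (third i k)))) \<beta>"
  using assms third_props(1,2)[OF assms] by (auto simp: polar_tri_def)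

lemma polar_tri_props:
  assumes a: "hyp_triangle a" and ik: "i \<noteq> k" and \<alpha>\<beta>: "cos (\<alpha> - \<beta>) = cos (tri_angle a i)"
  shows "polar_tri a i k \<alpha> \<beta> j \<in> hyp_plane" "side_cosh (polar_tri a i k \<alpha> \<beta>) j = side_cosh a j"
    "hyp_triangle (polar_tri a i k \<alpha> \<beta>)"
proof -
  have a': "\<And>i. a i \<in> hyp_plane" and inj: "inj a"
    using a unfolding hyp_triangle_def by auto
  have gt: "1 < lor (lift (a i)) (lift (a j))" if "j \<noteq> i" for j
    using that inj by (intro lor_lift_gt1 a') (auto simp: inj_eq)
  let ?b = "polar_tri a i k \<alpha> \<beta>"
  have b: "?b j \<in> hyp_plane" for j
    using polar_mem less_imp_le[OF gt] by (auto simp: polar_tri_def hyp_plane_def)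
  then show "?b j \<in> hyp_plane" .
  define l where "l = third i k"
  have ne: "l \<noteq> i" "l \<noteq> k" using third_props(1,2)[OF ik] by (auto simp: l_def)
  have t: "third i k = l" "third i l = k" "third k l = i"
    using third_props(4,5)[OF ik] third_props(3,4)[of k i] ik by (auto simp: l_def)
  note bs = polar_tri_simps[OF ik, of a \<alpha> \<beta>, unfolded t]
  have 1: "side_cosh ?b l = side_cosh a l"
    using side_cosh_third[OF ik, of ?b] side_cosh_third[OF ik, of a] less_imp_le[OF gt[of k]] ik by (simp add: t bs lor_polar_0)
  have 2: "side_cosh ?b k = side_cosh a k"
    using side_cosh_third[of i l ?b] side_cosh_third[of i l a] less_imp_le[OF gt[of l]] ne by (simp add: t bs lor_polar_0)
  have 3: "side_cosh ?b i = side_cosh a i"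
    using side_cosh_third[of k l ?b] side_cosh_third[of k l a] less_imp_le[OF gt[of l]] less_imp_le[OF gt[of k]] ne ik
      cosine_law_at[OF a ik] \<alpha>\<beta> by (simp add: t bs lor_polar)
  show sc: "side_cosh ?b j = side_cosh a j" for j
    using third_props(6)[OF ik, of j] 1 2 3 by (auto simp: t)
  have "(tri_vol ?b)\<^sup>2 = (tri_vol a)\<^sup>2"
    unfolding tri_vol_sq[of a 0, OF a'] tri_vol_sq[of ?b 0, OF b] sc ..
  then show "hyp_triangle ?b" using a b by (auto simp: hyp_triangle_iff)
qed

lemma cis_scaled_eq:
  assumes "0 < r" "0 < r'" "r *\<^sub>R cis \<gamma> = r' *\<^sub>R cis \<gamma>'"
  shows "\<exists>n::int. \<gamma> = \<gamma>' + 2 * pi * of_int n"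
proof -
  have "norm (r *\<^sub>R cis \<gamma>) = norm (r' *\<^sub>R cis \<gamma>')" using assms(3) by simp
  then have "r = r'" using assms(1,2) by simp
  then have "cis \<gamma> = cis \<gamma>'" using assms by simp
  then have "sin \<gamma> = sin \<gamma>' \<and> cos \<gamma> = cos \<gamma>'" by (simp add: complex_eq_iff)
  then obtain n :: int where "\<gamma> = \<gamma>' + 2 * pi * of_int n" unfolding sin_cos_eq_iff by blast
  then show ?thesis by blast
qed

lemma cis_scaled_eq_near:
  assumes "0 < r" "0 < r'" "r *\<^sub>R cis \<gamma> = r' *\<^sub>R cis \<gamma>'" "\<bar>\<gamma> - \<gamma>'\<bar> \<le> 2 * pi"
  shows "\<gamma> = \<gamma>' \<or> \<gamma> = \<gamma>' + 2 * pi \<or> \<gamma>' = \<gamma> + 2 * pi"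
proof -
  obtain n :: int where n: "\<gamma> = \<gamma>' + 2 * pi * of_int n" using cis_scaled_eq[OF assms(1-3)] by blast
  then have "\<bar>2 * pi * of_int n\<bar> \<le> 2 * pi * 1" using assms(4) by simp
  then have "\<bar>of_int n\<bar> \<le> (1::real)" by (simp add: abs_mult)
  then have "\<bar>n\<bar> \<le> 1" by linarith
  then have "n = 0 \<or> n = 1 \<or> n = -1" by auto
  then show ?thesis using n by auto
qed

lemma openin_open_triangle: "openin (top_of_set std_triangle) open_triangle"
proof -
  have "open (\<Inter>i\<in>UNIV. {y :: real^3. 0 < y $ i})"
    by (intro open_INT finite ballI open_Collect_less continuous_intros)
  moreover have "open_triangle = std_triangle \<inter> (\<Inter>i\<in>UNIV. {y :: real^3. 0 < y $ i})"
    by (auto simp: open_triangle_def std_triangle_def less_imp_le)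
  ultimately show ?thesis by (metis openin_open_Int)
qed

context hyperbolic_triangulation
begin

text \<open>The common gluing argument for faces, edges and vertices: \<open>b n\<close> is a
  congruent copy of the triangle \<open>tt n\<close>, used on the region \<open>R n\<close>.
  \<open>inj\<close> makes the resulting map well defined and injective, \<open>sat\<close> makes
  the union of the regions open. Indices are separate from triangles because one triangle can
  contribute several regions.\<close>

lemma dev_chart_of_pieces:
  fixes I :: "'n set" and tt :: "'n \<Rightarrow> 't" and R :: "'n \<Rightarrow> (real^3) set" and b :: "'n \<Rightarrow> 3 \<Rightarrow> complex"
  assumes tt: "\<And>n. n \<in> I \<Longrightarrow> tt n \<in> T" and R: "\<And>n. n \<in> I \<Longrightarrow> openin (top_of_set std_triangle) (R n)"
    and b: "\<And>n i. n \<in> I \<Longrightarrow> b n i \<in> hyp_plane" and ab: "\<And>n i. n \<in> I \<Longrightarrow> side_cosh (b n) i = side_cosh (a (tt n)) i"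
    and inj: "\<And>n m y y'. n \<in> I \<Longrightarrow> m \<in> I \<Longrightarrow> y \<in> R n \<Longrightarrow> y' \<in> R m \<Longrightarrow>
       \<phi> (tt n) y = \<phi> (tt m) y' \<longleftrightarrow> bary (b n) y = bary (b m) y'"
    and sat: "\<And>n y t' y'. n \<in> I \<Longrightarrow> y \<in> R n \<Longrightarrow> t' \<in> T \<Longrightarrow> y' \<in> std_triangle \<Longrightarrow> \<phi> t' y' = \<phi> (tt n) y \<Longrightarrow>
       \<exists>m\<in>I. tt m = t' \<and> y' \<in> R m"
    and ny: "n0 \<in> I" "y0 \<in> R n0"
  shows "\<exists>U c. dev_chart U c \<and> \<phi> (tt n0) y0 \<in> U"
proof -
  define U where "U = (\<Union>n\<in>I. \<phi> (tt n) ` R n)"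
  define c where "c p = (case (SOME ny. fst ny \<in> I \<and> snd ny \<in> R (fst ny) \<and> p = \<phi> (tt (fst ny)) (snd ny)) of (n, y) \<Rightarrow> bary (b n) y)" for p
  have Rs: "R n \<subseteq> std_triangle" if "n \<in> I" for n using R[OF that] openin_imp_subset by blast
  have c: "c (\<phi> (tt n) y) = bary (b n) y" if n: "n \<in> I" "y \<in> R n" for n y
  proof -
    define q where "q = (SOME ny. fst ny \<in> I \<and> snd ny \<in> R (fst ny) \<and> \<phi> (tt n) y = \<phi> (tt (fst ny)) (snd ny))"
    have "fst q \<in> I \<and> snd q \<in> R (fst q) \<and> \<phi> (tt n) y = \<phi> (tt (fst q)) (snd q)"
      unfolding q_def by (rule someI[of _ "(n, y)"]) (use n in simp)
    then have "bary (b n) y = bary (b (fst q)) (snd q)" using inj[OF n(1) _ n(2)] by blast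
    then show ?thesis unfolding c_def q_def[symmetric] by (simp add: case_prod_beta)
  qed
  have preU: "{x \<in> std_triangle. \<phi> t x \<in> U} = (\<Union>m\<in>{m\<in>I. tt m = t}. R m)" if t: "t \<in> T" for t
  proof
    show "{x \<in> std_triangle. \<phi> t x \<in> U} \<subseteq> (\<Union>m\<in>{m\<in>I. tt m = t}. R m)"
    proof
      fix x assume "x \<in> {x \<in> std_triangle. \<phi> t x \<in> U}"
      then obtain n y where "x \<in> std_triangle" "n \<in> I" "y \<in> R n" "\<phi> t x = \<phi> (tt n) y" unfolding U_def by blast
      then show "x \<in> (\<Union>m\<in>{m\<in>I. tt m = t}. R m)" using sat[of n y t x] t by blast
    qed
    show "(\<Union>m\<in>{m\<in>I. tt m = t}. R m) \<subseteq> {x \<in> std_triangle. \<phi> t x \<in> U}" unfolding U_def using Rs by blast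
  qed
  have UM: "U \<subseteq> topspace M" unfolding U_def using char_in_M tt Rs by blast
  have oU: "openin M U"
    by (rule openin_quotient[OF UM]) (use R in \<open>auto simp: preU\<close>)
  have ts: "topspace (subtopology M U) = U" using UM by auto
  have "continuous_map (subtopology M U) euclidean c"
    unfolding continuous_map_def
  proof (intro conjI allI impI)
    fix V :: "complex set" assume "openin euclidean V"
    then have V: "open V" by simp
    have "openin M {x \<in> U. c x \<in> V}"
    proof (rule openin_quotient)
      fix t assume t: "t \<in> T"
      have "{x \<in> std_triangle. \<phi> t x \<in> {x \<in> U. c x \<in> V}} = (\<Union>m\<in>{m\<in>I. tt m = t}. R m \<inter> (std_triangle \<inter> bary (b m) -` V))"
        (is "?L = ?S")
      proof
        show "?L \<subseteq> ?S"
        proof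
          fix x assume x: "x \<in> ?L"
          then have "x \<in> {x \<in> std_triangle. \<phi> t x \<in> U}" by simp
          then obtain m where m: "m \<in> I" "tt m = t" "x \<in> R m" unfolding preU[OF t] by blast
          then show "x \<in> ?S" using x c[OF m(1,3)] by auto
        qed
        show "?S \<subseteq> ?L"
        proof
          fix x assume "x \<in> ?S"
          then obtain m where m: "m \<in> I" "tt m = t" "x \<in> R m" "x \<in> std_triangle" "bary (b m) x \<in> V" by blast
          then show "x \<in> ?L" using c[OF m(1,3)] by (auto simp: U_def)
        qed
      qed
      moreover have "openin (top_of_set std_triangle) (R m \<inter> (std_triangle \<inter> bary (b m) -` V))" if "m \<in> I" for m
        by (intro openin_Int R[OF that] continuous_openin_preimage_gen[OF _ V] continuous_on_bary[of "b m", OF b[OF that]])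
      ultimately show "openin (top_of_set std_triangle) {x \<in> std_triangle. \<phi> t x \<in> {x \<in> U. c x \<in> V}}" by auto
    qed (use UM in blast)
    then show "openin (subtopology M U) {x \<in> topspace (subtopology M U). c x \<in> V}"
      unfolding ts by (auto simp: openin_subtopology)
  qed simp
  moreover have "inj_on c U"
  proof (rule inj_onI)
    fix p q assume "p \<in> U" "q \<in> U" and e: "c p = c q"
    then obtain n y m y' where h: "n \<in> I" "y \<in> R n" "p = \<phi> (tt n) y" "m \<in> I" "y' \<in> R m" "q = \<phi> (tt m) y'"
      unfolding U_def by blast
    then have "bary (b n) y = bary (b m) y'" using c e by simp
    then show "p = q" using inj[OF h(1,4,2,5)] h by simp
  qed
  moreover have "\<exists>g W. dev_piece U c t x g W" if t: "t \<in> T" "x \<in> std_triangle" "\<phi> t x \<in> U" for t x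
  proof -
    have "x \<in> {x \<in> std_triangle. \<phi> t x \<in> U}" using t by simp
    then obtain m where m: "m \<in> I" "tt m = t" "x \<in> R m" unfolding preU[OF t(1)] by blast
    obtain g where g: "hyp_isometry g" "\<And>i. g (a t i) = b m i"
      using triangle_congruence[of "a t" "b m", OF triangle[OF t(1)] b[OF m(1)]] ab[OF m(1)] m(2) by metis
    have "c (\<phi> t y) = g (bary (a t) y)" "\<phi> t y \<in> U" if "y \<in> R m" for y
    proof -
      have "g (bary (a t) y) = bary (b m) y"
        using isometry_bary[of g "a t" y, OF g(1) vertex_mem[OF t(1)]] Rs[OF m(1)] that g(2) by auto
      then show "c (\<phi> t y) = g (bary (a t) y)" using c[OF m(1) that] m(2) by simp
      show "\<phi> t y \<in> U" unfolding U_def using m that by blast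
    qed
    then have "dev_piece U c t x g (R m)" unfolding dev_piece_def using g(1) R[OF m(1)] m(3) by blast
    then show ?thesis by blast
  qed
  ultimately have "dev_chart U c" unfolding dev_chart_def using oU by blast
  moreover have "\<phi> (tt n0) y0 \<in> U" unfolding U_def using ny by blast
  ultimately show ?thesis by blast
qed

lemma face_chart:
  assumes t: "t \<in> T" and x: "x \<in> open_triangle"
  shows "\<exists>U c. dev_chart U c \<and> \<phi> t x \<in> U"
proof (rule dev_chart_of_pieces[where I = "{()}" and tt = "\<lambda>_. t" and R = "\<lambda>_. open_triangle" and b = "\<lambda>_. a t" and ?n0.0 = "()"])
  fix y y' assume y: "y \<in> open_triangle" "y' \<in> open_triangle"
  then have s: "y \<in> std_triangle" "y' \<in> std_triangle" using open_subset_std by auto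
  show "\<phi> t y = \<phi> t y' \<longleftrightarrow> bary (a t) y = bary (a t) y'"
    using same_point_open[OF t y(2) t s(1)] bary_inj[OF triangle[OF t] s] by blast
next
  fix y t' y' assume "y \<in> open_triangle" "t' \<in> T" "y' \<in> std_triangle" "\<phi> t' y' = \<phi> t y"
  then show "\<exists>m\<in>{()}. t = t' \<and> y' \<in> open_triangle" using same_point_open[OF t] by blast
qed (use t x vertex_mem openin_open_triangle in auto)

text \<open>The coordinate opposite to the side is strictly smallest. Regions of different sides are
  therefore disjoint, so a triangle glued to itself can take part twice in an edge chart.\<close>

definition side_region :: "3 \<Rightarrow> 3 \<Rightarrow> (real^3) set" where
  "side_region i k = {y \<in> std_triangle. y $ third i k < y $ i \<and> y $ third i k < y $ k}"

lemma openin_side_region: "openin (top_of_set std_triangle) (side_region i k)"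
proof -
  have "open {y :: real^3. y $ third i k < y $ i \<and> y $ third i k < y $ k}"
    by (intro open_Collect_conj open_Collect_less continuous_intros)
  moreover have "side_region i k = std_triangle \<inter> {y. y $ third i k < y $ i \<and> y $ third i k < y $ k}"
    by (auto simp: side_region_def)
  ultimately show ?thesis by (simp add: openin_open_Int)
qed

lemma edge_pt_side_region:
  assumes "i \<noteq> k" "0 < s" "s < 1"
  shows "edge_pt i k s \<in> side_region i k"
  using assms third_props(1,2)[OF assms(1)] edge_pt_std[of s i k] by (simp add: side_region_def edge_pt_nth[OF assms(1)])

lemma side_region_cases:
  assumes ik: "i \<noteq> k" and y: "y \<in> side_region i k"
  obtains "y \<in> open_triangle" | s where "0 < s" "s < 1" "y = edge_pt i k s"
proof (cases "y $ third i k = 0")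
  case True
  have ys: "y \<in> std_triangle" and p: "0 < y $ i" "0 < y $ k" using y True by (auto simp: side_region_def)
  have sum: "y $ i + y $ k = 1" using std_triangleD(2)[OF ys] True by (simp add: sum_third[OF ik])
  have "y = edge_pt i k (y $ k)"
  proof (rule vec_eq_iff[THEN iffD2], rule allI)
    fix j show "y $ j = edge_pt i k (y $ k) $ j"
      using third_props(6)[OF ik, of j] third_props(1,2)[OF ik] sum True ik by (auto simp: edge_pt_nth[OF ik])
  qed
  then show ?thesis using that(2)[of "y $ k"] p sum by simp
next
  case False
  have ys: "y \<in> std_triangle" using y by (simp add: side_region_def)
  then have t: "0 < y $ third i k" using False std_triangleD(1)[OF ys, of "third i k"] by simp
  then have "0 < y $ i" "0 < y $ k" using y by (auto simp: side_region_def)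
  then have "0 < y $ j" for j using third_props(6)[OF ik, of j] t by auto
  then show ?thesis using that(1) std_triangleD(2)[OF ys] by (simp add: open_triangle_def)
qed

lemma side_region_disjoint: "y \<in> side_region i k \<Longrightarrow> y \<in> side_region i' k' \<Longrightarrow> i \<noteq> k \<Longrightarrow> i' \<noteq> k' \<Longrightarrow> third i k = third i' k'"
  using third_props(6)[of i k "third i' k'"] third_props(6)[of i' k' "third i k"] by (auto simp: side_region_def)

lemma side_region_same_point:
  assumes f: "(t, i, k) \<in> flags" and y: "y \<in> side_region i k" and t': "t' \<in> T" "y' \<in> std_triangle"
    and eq: "\<phi> t' y' = \<phi> t y"
  shows "(t' = t \<and> y' = y) \<or> (\<exists>s i' k'. 0 < s \<and> s < 1 \<and> y = edge_pt i k s \<and> glue (t, i, k) = (t', i', k') \<and> y' = edge_pt i' k' s)"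
proof -
  have t: "t \<in> T" "i \<noteq> k" using f by (auto simp: mem_flags)
  from t(2) y show ?thesis
  proof (cases rule: side_region_cases)
    case 1
    then show ?thesis using same_point_open[OF t(1) 1 t' eq] by blast
  next
    case (2 s)
    then show ?thesis using same_point_edge[OF f 2(1,2) t'] eq by blast
  qed
qed

text \<open>Corner i goes to the origin and the common side to direction 0, one triangle into the
  sector from 0 to A and the other into the sector from -A' to 0. The images can then meet only
  along the ray of the common side.\<close>

lemma edge_chart:
  assumes f: "(t, i, k) \<in> flags" and s0: "0 < s0" "s0 < 1"
  shows "\<exists>U c. dev_chart U c \<and> \<phi> t (edge_pt i k s0) \<in> U"
proof -
  obtain t' i' k' where gl: "glue (t, i, k) = (t', i', k')" by (cases "glue (t, i, k)")
  have f': "(t', i', k') \<in> flags" using glue_flags[OF f] gl by simp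
  have gl': "glue (t', i', k') = (t, i, k)" using glue_glue[OF f] gl by simp
  have t: "t \<in> T" "i \<noteq> k" and t': "t' \<in> T" "i' \<noteq> k'" using f f' by (auto simp: mem_flags)
  have side_ne: "third i k \<noteq> third i' k'" if "t' = t"
    using flag_side_glue[OF f] opp_props(2)[OF flag_side_sides[OF f]] that gl by (auto simp: flag_side_def)
  define A where "A = tri_angle (a t) i"
  define A' where "A' = tri_angle (a t') i'"
  have A: "0 < A" "A < pi" "0 < A'" "A' < pi"
    using hyp_triangle_laws(1,2) triangle t(1) t'(1) by (auto simp: A_def A'_def)
  define B where "B = polar_tri (a t) i k 0 A"
  define B' where "B' = polar_tri (a t') i' k' 0 (- A')"
  note Bp = polar_tri_props[OF triangle[OF t(1)] t(2), of 0 A, folded B_def]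
  note Bp' = polar_tri_props[OF triangle[OF t'(1)] t'(2), of 0 "- A'", folded B'_def]
  have cosA: "cos (0 - A) = cos (tri_angle (a t) i)" "cos (0 - - A') = cos (tri_angle (a t') i')"
    by (simp_all add: A_def A'_def)
  note Bm = Bp(1)[OF cosA(1)] Bp(2)[OF cosA(1)] Bp(3)[OF cosA(1)] and Bm' = Bp'(1)[OF cosA(2)] Bp'(2)[OF cosA(2)] Bp'(3)[OF cosA(2)]
  have ends: "B i = B' i'" "B k = B' k'"
    using side_length[OF f gl] by (simp_all add: B_def B'_def polar_tri_simps t(2) t'(2))
  have gt: "1 < lor (lift (a u j)) (lift (a u m))" if "u \<in> T" "j \<noteq> m" for u j m
    using triangle[OF that(1)] that(2) vertex_mem[OF that(1)] unfolding hyp_triangle_def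
    by (intro lor_lift_gt1) (auto simp: inj_eq)
  have onedge: "bary B (edge_pt i k s) = bary B' (edge_pt i' k' s)" for s
    by (rule bary_edge_pt_cong[of B i B' i' k k', OF ends])
  have cross: "\<phi> t y = \<phi> t' y' \<longleftrightarrow> bary B y = bary B' y'" if y: "y \<in> side_region i k" "y' \<in> side_region i' k'" for y y'
  proof -
    have ys: "y \<in> std_triangle" "y' \<in> std_triangle" using y by (auto simp: side_region_def)
    show ?thesis
    proof
      assume "\<phi> t y = \<phi> t' y'"
      then have "\<phi> t' y' = \<phi> t y" by simp
      from side_region_same_point[OF f y(1) t'(1) ys(2) this]
      show "bary B y = bary B' y'"
      proof (elim disjE exE conjE)
        assume "t' = t" "y' = y"
        then show ?thesis using side_region_disjoint[of y i k i' k'] y t(2) t'(2) side_ne by blast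
      next
        fix s i2 k2 assume h: "y = edge_pt i k s" "glue (t, i, k) = (t', i2, k2)" "y' = edge_pt i2 k2 s"
        then show ?thesis using gl onedge[of s] by simp
      qed
    next
      assume eq: "bary B y = bary B' y'"
      have nc: "y \<noteq> corner i" "y' \<noteq> corner i'"
      proof -
        have "corner i \<notin> side_region i k" "corner i' \<notin> side_region i' k'"
          using third_props(1,2)[OF t(2)] third_props(1,2)[OF t'(2)] t(2) t'(2) by (auto simp: side_region_def corner_nth)
        then show "y \<noteq> corner i" "y' \<noteq> corner i'" using y by auto
      qed
      have l: "third i k \<noteq> i" "third i' k' \<noteq> i'" using third_props(1) t(2) t'(2) by blast+
      obtain r \<gamma> where r: "0 < r" "0 \<le> \<gamma>" "\<gamma> \<le> A" "bary B y = r *\<^sub>R cis \<gamma>" "\<gamma> = 0 \<longleftrightarrow> y $ third i k = 0"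
        by (rule bary_sector[of B i k "lor (lift (a t i)) (lift (a t k))" 0 "lor (lift (a t i)) (lift (a t (third i k)))" A y])
          (use Bm(1) t(2) polar_tri_simps[OF t(2)] gt[OF t(1)] A ys nc l in \<open>auto simp: B_def\<close>)
      have th: "third i' (third i' k') = k'" by (rule third_props(4)[OF t'(2)])
      obtain r' \<gamma>' where r': "0 < r'" "- A' \<le> \<gamma>'" "\<gamma>' \<le> 0" "bary B' y' = r' *\<^sub>R cis \<gamma>'" "\<gamma>' = 0 \<longleftrightarrow> y' $ third i' k' = 0"
        by (rule bary_sector[of B' i' "third i' k'" "lor (lift (a t' i')) (lift (a t' (third i' k')))" "- A'" "lor (lift (a t' i')) (lift (a t' k'))" 0 y'])
          (use Bm'(1) t'(2) polar_tri_simps[OF t'(2)] gt[OF t'(1)] A ys nc l th in \<open>auto simp: B'_def\<close>)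
      \<comment> \<open>The two sectors together span less than a full turn, so equal directions
        must both be 0.\<close>
      have "\<gamma> = \<gamma>' \<or> \<gamma> = \<gamma>' + 2 * pi \<or> \<gamma>' = \<gamma> + 2 * pi"
        by (rule cis_scaled_eq_near[OF r(1) r'(1)]) (use eq r r' A in auto)
      then have "\<gamma> = 0" "\<gamma>' = 0" using r(2,3) r'(2,3) A by auto
      then have z: "y $ third i k = 0" "y' $ third i' k' = 0" using r(5) r'(5) by auto
      have no: "y \<notin> open_triangle" "y' \<notin> open_triangle" using z by (auto simp: open_triangle_def) (metis less_irrefl)+
      obtain s where s: "0 < s" "s < 1" "y = edge_pt i k s" using side_region_cases[OF t(2) y(1)] no(1) by blast
      obtain s' where s': "0 < s'" "s' < 1" "y' = edge_pt i' k' s'" using side_region_cases[OF t'(2) y(2)] no(2) by blast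
      have "bary B' (edge_pt i' k' s) = bary B' (edge_pt i' k' s')" using eq onedge[of s] s(3) s'(3) by simp
      then have "edge_pt i' k' s = edge_pt i' k' s'"
        using bary_inj[OF Bm'(3)] edge_pt_std s s' by (metis less_imp_le)
      then have "s = s'" using edge_pt_inj[OF t'(2)] by simp
      then show "\<phi> t y = \<phi> t' y'"
        using flag_pt_glue[OF f, of s] gl s s'(3) by (simp add: flag_pt_def)
    qed
  qed
  have cross_sym: "\<phi> t' y = \<phi> t y' \<longleftrightarrow> bary B' y = bary B y'" if "y \<in> side_region i' k'" "y' \<in> side_region i k" for y y'
    using cross[OF that(2,1)] by metis
  have same: "\<phi> u y = \<phi> u y' \<longleftrightarrow> bary C y = bary C y'"
    if u: "(u, j, m) \<in> flags" "hyp_triangle C" "y \<in> side_region j m" "y' \<in> side_region j m" for u j m C y y'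
  proof -
    have ys: "y \<in> std_triangle" "y' \<in> std_triangle" using u by (auto simp: side_region_def)
    have jm: "u \<in> T" "j \<noteq> m" using u(1) by (auto simp: mem_flags)
    have "y' = y" if e: "\<phi> u y = \<phi> u y'"
      using side_region_same_point[OF u(1,3) jm(1) ys(2) e[symmetric]]
    proof (elim disjE exE conjE)
      fix s i2 k2 assume h: "0 < s" "s < 1" "glue (u, j, m) = (u, i2, k2)" "y' = edge_pt i2 k2 s"
      then have n2: "i2 \<noteq> k2" using glue_flags[OF u(1)] by (simp add: mem_flags)
      have "y' \<in> side_region i2 k2" unfolding h(4) by (rule edge_pt_side_region[OF n2 h(1,2)])
      then have "third j m = third i2 k2" using side_region_disjoint u(4) jm(2) n2 by blast
      then have "flag_side (glue (u, j, m)) = flag_side (u, j, m)" using h(3) by (simp add: flag_side_def)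
      then show ?thesis using flag_side_glue[OF u(1)] opp_props(2)[OF flag_side_sides[OF u(1)]] by simp
    qed
    then show ?thesis using bary_inj[OF u(2) ys] by blast
  qed
  have sat1: "(t2 = u \<and> y' \<in> side_region j m) \<or> (t2 = u' \<and> y' \<in> side_region j' m')"
    if u: "(u, j, m) \<in> flags" "glue (u, j, m) = (u', j', m')" "y \<in> side_region j m" "t2 \<in> T" "y' \<in> std_triangle" "\<phi> t2 y' = \<phi> u y"
    for u j m u' j' m' y t2 y'
    using side_region_same_point[OF u(1,3,4,5,6)]
  proof (elim disjE exE conjE)
    fix s i2 k2 assume h: "0 < s" "s < 1" "glue (u, j, m) = (t2, i2, k2)" "y' = edge_pt i2 k2 s"
    then have n2: "i2 \<noteq> k2" using glue_flags[OF u(1)] by (simp add: mem_flags)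
    then show ?thesis using h u(2) edge_pt_side_region[OF n2 h(1,2)] by simp
  qed (use u(3) in simp)
  \<comment> \<open>The two pieces are indexed by truth values, not by their triangles, which may
    coincide.\<close>
  have "\<exists>U c. dev_chart U c \<and> \<phi> (if True then t else t') (edge_pt i k s0) \<in> U"
  proof (rule dev_chart_of_pieces[where I = "UNIV :: bool set" and tt = "\<lambda>n. if n then t else t'"
        and R = "\<lambda>n. if n then side_region i k else side_region i' k'" and b = "\<lambda>n. if n then B else B'" and ?n0.0 = True])
    fix n m y y' assume y: "y \<in> (if n then side_region i k else side_region i' k')" "y' \<in> (if m then side_region i k else side_region i' k')"
    show "\<phi> (if n then t else t') y = \<phi> (if m then t else t') y' \<longleftrightarrow> bary (if n then B else B') y = bary (if m then B else B') y'"
      using y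
      by (cases n; cases m; simp only: if_True if_False)
        (erule (1) same[OF f Bm(3)] cross cross_sym same[OF f' Bm'(3)])+
  next
    fix n y t2 y' assume h: "y \<in> (if n then side_region i k else side_region i' k')" "t2 \<in> T" "y' \<in> std_triangle" "\<phi> t2 y' = \<phi> (if n then t else t') y"
    have "(t2 = t \<and> y' \<in> side_region i k) \<or> (t2 = t' \<and> y' \<in> side_region i' k')"
      using h sat1[OF f gl, of y t2 y'] sat1[OF f' gl', of y t2 y'] by (cases n) auto
    then show "\<exists>m\<in>UNIV. (if m then t else t') = t2 \<and> y' \<in> (if m then side_region i k else side_region i' k')"
      by (elim disjE) (rule bexI[of _ True], simp, simp, rule bexI[of _ False], simp, simp)
  qed (use t(1) t'(1) openin_side_region Bm(1,2) Bm'(1,2) edge_pt_side_region[OF t(2) s0] in auto)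
  then show ?thesis by simp
qed

end

section \<open>Charts around vertices\<close>

lemma edge_pt_of_third_zero:
  assumes ik: "i \<noteq> k" and y: "y \<in> std_triangle" "y $ third i k = 0"
  shows "y = edge_pt i k (y $ k)"
proof (rule vec_eq_iff[THEN iffD2], rule allI)
  have sum: "y $ i + y $ k = 1" using std_triangleD(2)[OF y(1)] y(2) by (simp add: sum_third[OF ik])
  fix j show "y $ j = edge_pt i k (y $ k) $ j"
    using third_props(6)[OF ik, of j] third_props(1,2)[OF ik] sum y(2) ik by (auto simp: edge_pt_nth[OF ik])
qed

context triangulated_surface
begin

definition rho :: "'t \<times> 3 \<times> 3 \<Rightarrow> 't \<times> 3 \<times> 3" where
  "rho f = glue (turn f)"

lemma rho_inj: "f \<in> flags \<Longrightarrow> g \<in> flags \<Longrightarrow> rho f = rho g \<Longrightarrow> f = g"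
  unfolding rho_def using glue_glue turn_props(1,3) by metis

definition corner_of :: "'t \<times> 3 \<times> 3 \<Rightarrow> 't \<times> 3" where
  "corner_of f = (fst f, fst (snd f))"

definition corners_at :: "'a \<Rightarrow> ('t \<times> 3) set" where
  "corners_at v = {(t, i). t \<in> T \<and> \<phi> t (corner i) = v}"

text \<open>The walk around the vertex is injective on a finite set, hence periodic, and N is its
  least period. It never meets the turned version of one of its own flags, so no corner repeats
  within a period; that all corners occur is \<open>link_connected\<close>.\<close>

theorem vertex_cycle:
  assumes f0: "f0 \<in> flags"
  obtains N F where "0 < (N::nat)" "\<forall>n. F n \<in> flags" "\<forall>n. F (Suc n) = glue (turn (F n))" "F N = F 0" "F 0 = f0"
    "inj_on (\<lambda>n. corner_of (F n)) {..<N}" "(\<lambda>n. corner_of (F n)) ` {..<N} = corners_at (flag_vertex f0)"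
proof -
  define F where "F n = (rho ^^ n) f0" for n
  have F0: "F 0 = f0" by (simp add: F_def)
  have FS: "F (Suc n) = glue (turn (F n))" for n by (simp add: F_def rho_def)
  have Ff: "F n \<in> flags" for n
  proof (induction n)
    case 0
    show ?case unfolding F0 by (rule f0)
  next
    case (Suc n)
    show ?case unfolding FS by (rule glue_flags[OF turn_props(1)[OF Suc]])
  qed
  have step: "F (Suc m) = F (Suc n) \<Longrightarrow> F m = F n" for m n
    using rho_inj[OF Ff Ff, of m n] by (simp add: FS rho_def)
  have shift: "F (m + d) = F (n + d) \<Longrightarrow> F m = F n" for m n d
  proof (induction d)
    case (Suc d)
    then have "F (Suc (m + d)) = F (Suc (n + d))" by simp
    then show ?case using step Suc.IH by blast
  qed simp
  have "\<not> inj_on F UNIV"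
    using finite_flags Ff by (metis finite_imageD finite_subset image_subsetI infinite_UNIV_nat)
  then obtain m n where mn: "m < n" "F m = F n" unfolding inj_on_def by (metis linorder_neqE_nat)
  then have "F (0 + m) = F ((n - m) + m)" by simp
  then have "F 0 = F (n - m)" by (rule shift)
  then have ex: "\<exists>N. 0 < N \<and> F N = F 0" using mn(1) by (intro exI[of _ "n - m"]) auto
  define N where "N = (LEAST N. 0 < N \<and> F N = F 0)"
  have N: "0 < N" "F N = F 0" using LeastI_ex[OF ex] unfolding N_def by auto
  have Nmin: "\<not> (0 < d \<and> F d = F 0)" if "d < N" for d using not_less_Least[of d] that unfolding N_def by blast
  have inj: "m = n" if "F m = F n" "m < N" "n < N" for m n
  proof -
    have "False" if h: "F m = F n" "m < n" "n < N" for m n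
    proof -
      have "F (0 + m) = F ((n - m) + m)" using h by simp
      then have "F 0 = F (n - m)" by (rule shift)
      moreover have "n - m < N" "0 < n - m" using h by linarith+
      ultimately show False using Nmin[of "n - m"] by simp
    qed
    then show ?thesis using that by (metis linorder_neqE_nat)
  qed
  \<comment> \<open>A meeting at distance d + 2 yields one at distance d with m raised by 1. Descent
    ends at distance 0 or 1, where it contradicts that \<open>turn\<close> and \<open>glue\<close>
    fix no flag.\<close>
  have noturn: "F (m + d) \<noteq> turn (F m)" for d m
  proof (induction d arbitrary: m rule: induct_nat_012)
    case 0
    show ?case using turn_props(2)[OF Ff, of m] by simp
  next
    case 1
    show ?case using glue_neq[OF turn_props(1)[OF Ff], of m] by (simp add: FS)
  next
    case (ge2 d)
    show ?case
    proof
      assume "F (m + Suc (Suc d)) = turn (F m)"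
      then have "glue (turn (F (Suc m + d))) = turn (F m)" by (simp add: FS)
      then have "turn (F (Suc m + d)) = F (Suc m)"
        using glue_glue[OF turn_props(1)[OF Ff]] FS by metis
      then have "F (Suc m + d) = turn (F (Suc m))" using turn_props(3)[OF Ff] by metis
      then show False using ge2(1) by blast
    qed
  qed
  have noturn': "F n \<noteq> turn (F m)" for m n
  proof (cases "m \<le> n")
    case True
    then show ?thesis using noturn[of m "n - m"] by simp
  next
    case False
    then have "F m \<noteq> turn (F n)" using noturn[of n "m - n"] by simp
    then show ?thesis using turn_props(3)[OF Ff] by metis
  qed
  have same_corner: "g = f \<or> g = turn f" if fg: "f \<in> flags" "g \<in> flags" "corner_of f = corner_of g" for f g
  proof -
    obtain t i k where fe: "f = (t, i, k)" by (cases f)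
    obtain k' where ge: "g = (t, i, k')" using fg(3) by (cases g) (auto simp: fe corner_of_def)
    have "i \<noteq> k" "i \<noteq> k'" using fg by (auto simp: fe ge mem_flags)
    then show ?thesis using third_props(6)[of i k k'] by (auto simp: fe ge turn_def)
  qed
  have injc: "inj_on (\<lambda>n. corner_of (F n)) {..<N}"
  proof (rule inj_onI)
    fix m n assume h: "m \<in> {..<N}" "n \<in> {..<N}" "corner_of (F m) = corner_of (F n)"
    then have "F n = F m" using same_corner[OF Ff Ff] noturn' by metis
    then show "m = n" using inj h by simp
  qed
  have per: "F (n + N) = F n" for n
  proof (induction n)
    case (Suc n)
    have "F (Suc n + N) = glue (turn (F (n + N)))" using FS[of "n + N"] by simp
    then show ?case unfolding Suc FS .
  qed (simp add: N)
  have perq: "F (n + q * N) = F n" for n q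
  proof (induction q)
    case (Suc q)
    have "F (n + Suc q * N) = F ((n + q * N) + N)" by (simp add: add_ac)
    then show ?case using per Suc by simp
  qed simp
  have mod: "F n = F (n mod N)" for n
    using perq[of "n mod N" "n div N"] by (simp add: mod_mult_div_eq mult.commute)
  define Fl where "Fl = range F \<union> turn ` range F"
  have vF: "flag_vertex (F n) = flag_vertex f0" for n
  proof (induction n)
    case (Suc n)
    show ?case unfolding FS flag_vertex_glue[OF turn_props(1)[OF Ff]] flag_vertex_turn by (rule Suc)
  qed (simp add: F0)
  have gl: "glue f \<in> Fl" if "f \<in> Fl" for f
  proof -
    consider n where "f = F n" | n where "f = turn (F n)" using \<open>f \<in> Fl\<close> unfolding Fl_def by blast
    then show ?thesis
    proof cases
      case (1 n)
      \<comment> \<open>Shifting by a period provides a predecessor also for n = 0.\<close>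
      have "f = F (n + N)" using per 1 by simp
      then have "f = F (Suc (n + N - 1))" using N(1) by simp
      then have "glue f = turn (F (n + N - 1))" using FS glue_glue[OF turn_props(1)[OF Ff]] by metis
      then show ?thesis unfolding Fl_def by blast
    next
      case (2 n)
      then have "glue f = F (Suc n)" by (simp add: FS)
      then show ?thesis unfolding Fl_def by blast
    qed
  qed
  have tu: "turn f \<in> Fl" if "f \<in> Fl" for f
    using that turn_props(3)[OF Ff] unfolding Fl_def by auto
  have all: "g \<in> Fl" if "g \<in> flags" "flag_vertex g = flag_vertex f0" for g
  proof (rule link_connected[OF _ gl tu _ _ that])
    show "Fl \<subseteq> flags" using Ff turn_props(1) unfolding Fl_def by blast
    show "flag_vertex f = flag_vertex f0" if "f \<in> Fl" for f
    proof -
      obtain n where "f = F n \<or> f = turn (F n)" using \<open>f \<in> Fl\<close> unfolding Fl_def by blast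
      then show ?thesis by (elim disjE) (simp_all only: flag_vertex_turn vF)
    qed
    show "f0 \<in> Fl" unfolding Fl_def using F0 by (metis UnI1 rangeI)
  qed
  have ct: "corner_of (turn f) = corner_of f" for f by (cases f) (simp add: corner_of_def turn_def)
  have "(\<lambda>n. corner_of (F n)) ` {..<N} = corners_at (flag_vertex f0)"
  proof
    show "(\<lambda>n. corner_of (F n)) ` {..<N} \<subseteq> corners_at (flag_vertex f0)"
    proof
      fix c assume "c \<in> (\<lambda>n. corner_of (F n)) ` {..<N}"
      then obtain n where n: "c = corner_of (F n)" by blast
      obtain t i k where Fe: "F n = (t, i, k)" by (cases "F n")
      have "\<phi> t (corner i) = flag_vertex f0" using vF[of n] by (simp add: Fe flag_vertex_simp)
      moreover have "t \<in> T" using Ff[of n] by (simp add: Fe mem_flags)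
      ultimately show "c \<in> corners_at (flag_vertex f0)" by (simp add: n Fe corner_of_def corners_at_def)
    qed
    show "corners_at (flag_vertex f0) \<subseteq> (\<lambda>n. corner_of (F n)) ` {..<N}"
    proof
      fix c assume "c \<in> corners_at (flag_vertex f0)"
      then obtain t i where c: "c = (t, i)" "t \<in> T" "\<phi> t (corner i) = flag_vertex f0" unfolding corners_at_def by blast
      have "(t, i, i + 1) \<in> Fl" using c by (intro all) (simp_all add: mem_flags cyc3_neq flag_vertex_simp)
      then obtain n where "(t, i, i + 1) = F n \<or> (t, i, i + 1) = turn (F n)" unfolding Fl_def by blast
      then have "corner_of (t, i, i + 1) = corner_of (F n)" using ct by metis
      then have "c = corner_of (F (n mod N))" using mod[of n] c by (simp add: corner_of_def)
      then show "c \<in> (\<lambda>n. corner_of (F n)) ` {..<N}" using N(1) by simp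
    qed
  qed
  then show ?thesis using that[of N F] N Ff FS F0 injc by blast
qed

end

context hyperbolic_triangulation
begin

text \<open>The triangles of the cycle are laid out around the origin, the n-th in the sector from
  the partial angle sum \<open>\<alpha> n\<close> to \<open>\<alpha> (Suc n)\<close>. The total
  2\<pi> makes the last sector close up with the first one.\<close>

theorem vertex_chart:
  assumes t0: "t0 \<in> T" and angles: "(\<Sum>(t, i)\<in>corners_at (\<phi> t0 (corner i0)). tri_angle (a t) i) = 2 * pi"
  shows "\<exists>U c. dev_chart U c \<and> \<phi> t0 (corner i0) \<in> U"
proof -
  define v where "v = \<phi> t0 (corner i0)"
  have f0: "(t0, i0, i0 + 1) \<in> flags" using t0 by (simp add: mem_flags cyc3_neq)
  have v0: "flag_vertex (t0, i0, i0 + 1) = v" by (simp add: flag_vertex_simp v_def)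
  obtain N F where NF: "0 < (N::nat)" "\<forall>n. F n \<in> flags" "\<forall>n. F (Suc n) = glue (turn (F n))" "F N = F 0" "F 0 = (t0, i0, i0 + 1)"
    "inj_on (\<lambda>n. corner_of (F n)) {..<N}" "(\<lambda>n. corner_of (F n)) ` {..<N} = corners_at v"
    by (rule vertex_cycle[OF f0, unfolded v0])
  define tt ii kk where "tt n = fst (F n)" and "ii n = fst (snd (F n))" and "kk n = snd (snd (F n))" for n
  define xx where "xx n = third (ii n) (kk n)" for n
  have Fe: "F n = (tt n, ii n, kk n)" for n by (simp add: tt_def ii_def kk_def)
  have tT: "tt n \<in> T" and ik: "ii n \<noteq> kk n" for n using NF(2)[rule_format, of n] by (simp_all add: Fe mem_flags)
  have ix: "ii n \<noteq> xx n" "third (ii n) (xx n) = kk n" for n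
    using third_props(1,4)[OF ik[of n]] by (auto simp: xx_def)
  have xf: "(tt n, ii n, xx n) \<in> flags" for n using tT ix by (simp add: mem_flags)
  have glx: "glue (tt n, ii n, xx n) = F (Suc n)" for n using NF(3)[rule_format, of n] by (simp add: Fe[of n] turn_def xx_def)
  \<comment> \<open>Cyclic successor on {..<N}: \<open>F\<close> has period N, but the sectors are
    indexed by a single period.\<close>
  define nx where "nx n = (if Suc n = N then 0 else Suc n)" for n
  have nxN: "nx n < N" if "n < N" for n using that NF(1) by (auto simp: nx_def)
  have Fnx: "F (nx n) = F (Suc n)" for n using NF(4) by (auto simp: nx_def)
  have glnx: "glue (tt n, ii n, xx n) = (tt (nx n), ii (nx n), kk (nx n))" for n
    using glx[of n] Fnx[of n] Fe[of "nx n"] by simp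
  have pv: "\<exists>m<N. nx m = n" if "n < N" for n
  proof (cases n)
    case 0
    then show ?thesis using NF(1) by (intro exI[of _ "N - 1"]) (auto simp: nx_def)
  next
    case (Suc m)
    then show ?thesis using that by (intro exI[of _ m]) (auto simp: nx_def)
  qed
  have cinj: "n = m" if "n < N" "m < N" "tt n = tt m" "ii n = ii m" for n m
    using inj_onD[OF NF(6), of n m] that by (simp add: corner_of_def tt_def ii_def)
  have cat: "\<phi> (tt n) (corner (ii n)) = v" if "n < N" for n
  proof -
    have "corner_of (F n) \<in> corners_at v" using NF(7) that by blast
    then show ?thesis by (simp add: corners_at_def corner_of_def tt_def ii_def)
  qed
  have call: "\<exists>n<N. tt n = t \<and> ii n = i" if "t \<in> T" "\<phi> t (corner i) = v" for t i
  proof -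
    have "(t, i) \<in> (\<lambda>n. corner_of (F n)) ` {..<N}" unfolding NF(7) using that by (simp add: corners_at_def)
    then show ?thesis by (auto simp: corner_of_def tt_def ii_def)
  qed
  define A where "A n = tri_angle (a (tt n)) (ii n)" for n
  define \<alpha> where "\<alpha> n = (\<Sum>m<n. A m)" for n
  have A: "0 < A n" "A n < pi" for n using hyp_triangle_laws(1,2)[OF triangle[OF tT]] by (auto simp: A_def)
  have "(\<Sum>(t, i)\<in>corners_at v. tri_angle (a t) i) = (\<Sum>n<N. A n)"
    unfolding NF(7)[symmetric] sum.reindex[OF NF(6)] by (simp add: A_def corner_of_def tt_def ii_def)
  then have \<alpha>N: "\<alpha> N = 2 * pi" using angles by (simp add: \<alpha>_def v_def)
  have \<alpha>S: "\<alpha> (Suc n) = \<alpha> n + A n" for n by (simp add: \<alpha>_def)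
  have \<alpha>0: "\<alpha> 0 = 0" by (simp add: \<alpha>_def)
  have \<alpha>mono: "strict_mono \<alpha>" by (rule strict_monoI_Suc) (simp add: \<alpha>S A)
  have \<alpha>le: "\<alpha> m \<le> \<alpha> n \<longleftrightarrow> m \<le> n" and \<alpha>eq: "\<alpha> m = \<alpha> n \<longleftrightarrow> m = n" for m n
    using strict_mono_less_eq[OF \<alpha>mono] strict_mono_eq[OF \<alpha>mono] by auto
  define B where "B n = polar_tri (a (tt n)) (ii n) (kk n) (\<alpha> n) (\<alpha> (Suc n))" for n
  define R where "R n = {y \<in> std_triangle. 1 / 2 < y $ ii n}" for n
  have cosA: "cos (\<alpha> n - \<alpha> (Suc n)) = cos (tri_angle (a (tt n)) (ii n))" for n by (simp add: \<alpha>S A_def)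
  note Bp = polar_tri_props[OF triangle[OF tT] ik cosA, folded B_def]
  note Bs = polar_tri_simps[OF ik, of "a (tt n)" n "\<alpha> n" "\<alpha> (Suc n)" for n, folded B_def, folded xx_def]
  have gt: "1 < lor (lift (a u j)) (lift (a u m))" if "u \<in> T" "j \<noteq> m" for u j m
    using triangle[OF that(1)] that(2) vertex_mem[OF that(1)] unfolding hyp_triangle_def
    by (intro lor_lift_gt1) (auto simp: inj_eq)
  have Bnx: "B n (xx n) = B (nx n) (kk (nx n))" "B n (ii n) = B (nx n) (ii (nx n))" if "n < N" for n
  proof -
    have "cis (\<alpha> (Suc n)) = cis (\<alpha> (nx n))" using \<alpha>N \<alpha>0 by (auto simp: nx_def)
    then show "B n (xx n) = B (nx n) (kk (nx n))"
      using side_length[OF xf glnx, of n] by (simp add: Bs polar_def)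
    show "B n (ii n) = B (nx n) (ii (nx n))" by (simp add: Bs)
  qed
  have onray: "bary (B n) (edge_pt (ii n) (xx n) s) = bary (B (nx n)) (edge_pt (ii (nx n)) (kk (nx n)) s)" if "n < N" for n s
    by (rule bary_edge_pt_cong[of "B n" "ii n" "B (nx n)" "ii (nx n)" "xx n" "kk (nx n)", OF Bnx(2,1)[OF that]])
  have ptnx: "\<phi> (tt n) (edge_pt (ii n) (xx n) s) = \<phi> (tt (nx n)) (edge_pt (ii (nx n)) (kk (nx n)) s)" if "0 \<le> s" "s \<le> 1" for n s
    using flag_pt_glue[OF xf that, of n] glnx[of n] by (simp add: flag_pt_def)
  have Rstd: "y \<in> std_triangle" "1 / 2 < y $ ii n" if "y \<in> R n" for y n using that by (auto simp: R_def)
  \<comment> \<open>All ways for a second point to lie over the same point of M: it is the same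
    point, both are corners, or the point is on a bounding side and the second one is in the next or
    the previous sector.\<close>
  have same: "(t' = tt n \<and> y' = y) \<or> (\<exists>i'. y' = corner i' \<and> y = corner (ii n)) \<or>
      (\<exists>s. 0 < s \<and> s < 1 / 2 \<and> y = edge_pt (ii n) (xx n) s \<and> t' = tt (nx n) \<and> y' = edge_pt (ii (nx n)) (kk (nx n)) s) \<or>
      (\<exists>m s. m < N \<and> nx m = n \<and> 0 < s \<and> s < 1 / 2 \<and> y = edge_pt (ii n) (kk n) s \<and> t' = tt m \<and> y' = edge_pt (ii m) (xx m) s)"
    if h: "n < N" "y \<in> R n" "t' \<in> T" "y' \<in> std_triangle" "\<phi> t' y' = \<phi> (tt n) y" for n y t' y'
    using Rstd[OF h(2)]
  proof (cases rule: near_corner_cases)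
    case 1
    then show ?thesis using same_point_open[OF tT 1 h(3,4,5)] by blast
  next
    case 2
    then show ?thesis using same_point_corner[OF tT h(3,4), of n "ii n"] h(5) by blast
  next
    case (3 k s)
    have s1: "s < 1" using 3(3) by simp
    have "k = kk n \<or> k = xx n" using third_props(6)[OF ik, of k n] 3(1) by (simp add: xx_def)
    then show ?thesis
    proof
      assume k: "k = xx n"
      have "\<phi> t' y' = \<phi> (tt n) (edge_pt (ii n) (xx n) s)" using h(5) 3(4) k by simp
      from same_point_edge[OF xf 3(2) s1 h(3,4) this] show ?thesis
        using 3 k glnx[of n] by auto
    next
      assume k: "k = kk n"
      obtain m where m: "m < N" "nx m = n" using pv[OF h(1)] by blast
      have "glue (tt n, ii n, kk n) = (tt m, ii m, xx m)" using glue_glue[OF xf, of m] glnx[of m] m(2) by simp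
      moreover have "(tt n, ii n, kk n) \<in> flags" using tT ik by (simp add: mem_flags)
      moreover have "\<phi> t' y' = \<phi> (tt n) (edge_pt (ii n) (kk n) s)" using h(5) 3(4) k by simp
      ultimately show ?thesis
        using same_point_edge[OF _ 3(2) s1 h(3,4), of "tt n" "ii n" "kk n"] 3 k m by auto
    qed
  qed
  have in_R: "edge_pt (ii n) k s \<in> R n" if "ii n \<noteq> k" "0 < s" "s < 1 / 2" for n k s
    using that edge_pt_std[of s] by (simp add: R_def edge_pt_nth[OF that(1)])
  have Rm: "m' = m" if "y \<in> R m" "y \<in> R m'" "m < N" "m' < N" "tt m = tt m'" for y m m'
    using near_corner_unique[of y "ii m" "ii m'"] Rstd that cinj by metis
  have corner_R: "corner i \<in> R n \<Longrightarrow> i = ii n" for i n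
    by (rule ccontr) (auto simp: R_def corner_nth)
  have forward: "bary (B n) y = bary (B m) y'"
    if h: "n < N" "m < N" "y \<in> R n" "y' \<in> R m" "\<phi> (tt n) y = \<phi> (tt m) y'" for n m y y'
    using same[OF h(1,3) tT Rstd(1)[OF h(4)] h(5)[symmetric]]
  proof (elim disjE exE conjE)
    assume e: "tt m = tt n" "y' = y"
    have "m = n" by (rule Rm[OF h(3) h(4)[unfolded e(2)] h(1,2) e(1)[symmetric]])
    then show ?thesis using e(2) by simp
  next
    fix i' assume "y' = corner i'" "y = corner (ii n)"
    then have "y' = corner (ii m)" "y = corner (ii n)" using corner_R[of i' m] h(4) by simp_all
    then show ?thesis by (simp only: bary_corner[OF Bp(1)] Bs)
  next
    fix s assume e: "0 < s" "s < 1 / 2" "y = edge_pt (ii n) (xx n) s" "tt m = tt (nx n)" "y' = edge_pt (ii (nx n)) (kk (nx n)) s"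
    have "y' \<in> R (nx n)" unfolding e(5) by (rule in_R[OF ik e(1,2)])
    then have "m = nx n" by (rule Rm[OF _ h(4) nxN[OF h(1)] h(2) e(4)[symmetric]])
    then show ?thesis using onray[OF h(1), of s] by (simp only: e(3,5))
  next
    fix j s assume e: "j < N" "nx j = n" "0 < s" "s < 1 / 2" "y = edge_pt (ii n) (kk n) s" "tt m = tt j" "y' = edge_pt (ii j) (xx j) s"
    have "y' \<in> R j" unfolding e(7) by (rule in_R[OF ix(1) e(3,4)])
    then have "m = j" by (rule Rm[OF _ h(4) e(1) h(2) e(6)[symmetric]])
    then show ?thesis using onray[OF e(1), of s] by (simp only: e(2,5,7))
  qed
  have ray: "\<phi> (tt n) y = \<phi> (tt (nx n)) y'"
    if h: "n < N" "y \<in> R n" "y' \<in> R (nx n)" "y $ kk n = 0" "y' $ xx (nx n) = 0" "bary (B n) y = bary (B (nx n)) y'" for n y y'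
  proof -
    have y: "y = edge_pt (ii n) (xx n) (y $ xx n)"
      by (rule edge_pt_of_third_zero[OF ix(1) Rstd(1)[OF h(2)]]) (simp add: ix h(4))
    have y': "y' = edge_pt (ii (nx n)) (kk (nx n)) (y' $ kk (nx n))"
      by (rule edge_pt_of_third_zero[OF ik Rstd(1)[OF h(3)]]) (use h(5) in \<open>simp add: xx_def\<close>)
    have s: "0 \<le> y $ xx n" "y $ xx n \<le> 1" using std_triangleD(1) std_triangle_le1 Rstd(1)[OF h(2)] by blast+
    have "bary (B (nx n)) (edge_pt (ii (nx n)) (kk (nx n)) (y $ xx n)) = bary (B (nx n)) y'"
      using onray[OF h(1), of "y $ xx n"] y h(6) by simp
    then have "edge_pt (ii (nx n)) (kk (nx n)) (y $ xx n) = y'"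
      using bary_inj[OF Bp(3) edge_pt_std[OF s] Rstd(1)[OF h(3)]] by simp
    then show ?thesis using ptnx[OF s, of n] y by simp
  qed
  have sector: "\<exists>r \<gamma>. 0 < r \<and> \<alpha> n \<le> \<gamma> \<and> \<gamma> \<le> \<alpha> (Suc n) \<and> bary (B n) y = r *\<^sub>R cis \<gamma> \<and> (\<gamma> = \<alpha> n \<longleftrightarrow> y $ xx n = 0) \<and> (\<gamma> = \<alpha> (Suc n) \<longleftrightarrow> y $ kk n = 0)"
    if h: "y \<in> R n" "y \<noteq> corner (ii n)" for n y
  proof -
    have *: "ii n \<noteq> xx n" "xx n \<noteq> ii n" using ix[of n] by auto
    show ?thesis
      by (rule bary_sector[of "B n" "ii n" "kk n" "lor (lift (a (tt n) (ii n))) (lift (a (tt n) (kk n)))" "\<alpha> n"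
            "lor (lift (a (tt n) (ii n))) (lift (a (tt n) (xx n)))" "\<alpha> (Suc n)" y, folded xx_def])
        (use Bp(1) ik Bs gt[OF tT] * A[of n] Rstd(1)[OF h(1)] h(2) in \<open>auto simp: \<alpha>S\<close>)
  qed
  have nonzero: "bary (B n) y \<noteq> 0" if "y \<in> R n" "y \<noteq> corner (ii n)" for n y
    using sector[OF that] by auto
  have c0: "bary (B n) (corner (ii n)) = 0" for n unfolding bary_corner[OF Bp(1)] by (rule Bs(1))
  have backward_le: "\<phi> (tt n) y = \<phi> (tt m) y'"
    if h: "n < N" "m < N" "y \<in> R n" "y' \<in> R m" "bary (B n) y = bary (B m) y'" and nc: "y \<noteq> corner (ii n)" "y' \<noteq> corner (ii m)" for n m y y'
  proof -
    obtain r \<gamma> where r: "0 < r" "\<alpha> n \<le> \<gamma>" "\<gamma> \<le> \<alpha> (Suc n)" "bary (B n) y = r *\<^sub>R cis \<gamma>" "\<gamma> = \<alpha> n \<longleftrightarrow> y $ xx n = 0" "\<gamma> = \<alpha> (Suc n) \<longleftrightarrow> y $ kk n = 0"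
      using sector[OF h(3) nc(1)] by blast
    obtain r' \<gamma>' where r': "0 < r'" "\<alpha> m \<le> \<gamma>'" "\<gamma>' \<le> \<alpha> (Suc m)" "bary (B m) y' = r' *\<^sub>R cis \<gamma>'" "\<gamma>' = \<alpha> m \<longleftrightarrow> y' $ xx m = 0" "\<gamma>' = \<alpha> (Suc m) \<longleftrightarrow> y' $ kk m = 0"
      using sector[OF h(4) nc(2)] by blast
    have bd: "0 \<le> \<alpha> j \<and> \<alpha> (Suc j) \<le> 2 * pi" if "j < N" for j
      using \<alpha>le[of 0 j] \<alpha>le[of "Suc j" N] \<alpha>N \<alpha>0 that by auto
    have g: "0 \<le> \<gamma>" "\<gamma> \<le> 2 * pi" "0 \<le> \<gamma>'" "\<gamma>' \<le> 2 * pi"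
      using bd[OF h(1)] bd[OF h(2)] r(2,3) r'(2,3) by linarith+
    have consec: "\<phi> (tt p) w = \<phi> (tt q) w'"
      if "p < q" "p < N" "q < N" "w \<in> R p" "w' \<in> R q" "\<delta> \<le> \<alpha> (Suc p)" "\<alpha> q \<le> \<delta>"
        "\<delta> = \<alpha> (Suc p) \<longleftrightarrow> w $ kk p = 0" "\<delta> = \<alpha> q \<longleftrightarrow> w' $ xx q = 0" "bary (B p) w = bary (B q) w'" for p q w w' \<delta>
    proof -
      have "\<alpha> q \<le> \<alpha> (Suc p)" using that by linarith
      then have q: "q = Suc p" using that(1) by (simp add: \<alpha>le)
      then have d: "\<delta> = \<alpha> (Suc p)" "\<delta> = \<alpha> q" using that(6,7) by auto
      have "nx p = q" using q that(3) by (simp add: nx_def)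
      then show ?thesis using ray[OF that(2,4), of w'] that d by simp
    qed
    have wrap: "\<phi> (tt p) w = \<phi> (tt q) w'"
      if "p < N" "q < N" "w \<in> R p" "w' \<in> R q" "\<alpha> (Suc p) = 2 * pi" "\<alpha> q = 0" "w $ kk p = 0" "w' $ xx q = 0" "bary (B p) w = bary (B q) w'" for p q w w'
    proof -
      have "Suc p = N" using that(5) \<alpha>N \<alpha>eq by metis
      moreover have "q = 0" using that(6) \<alpha>0 \<alpha>eq by metis
      ultimately have "nx p = q" by (simp add: nx_def)
      then show ?thesis using ray[OF that(1,3), of w'] that by simp
    qed
    \<comment> \<open>Both directions lie between 0 and 2\<pi>, so they coincide or are the two ends
      of this interval. The second possibility is the passage from the last sector to the
      first.\<close>
    have "\<gamma> = \<gamma>' \<or> \<gamma> = \<gamma>' + 2 * pi \<or> \<gamma>' = \<gamma> + 2 * pi"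
      by (rule cis_scaled_eq_near[OF r(1) r'(1)]) (use h(5) r(4) r'(4) g in auto)
    then consider "\<gamma> = \<gamma>'" | "\<gamma> = 2 * pi" "\<gamma>' = 0" | "\<gamma>' = 2 * pi" "\<gamma> = 0" using g by force
    then show ?thesis
    proof cases
      case 1
      consider "n = m" | "n < m" | "m < n" by linarith
      then show ?thesis
      proof cases
        case 1
        then have "bary (B n) y = bary (B n) y'" using h(5) by simp
        then have "y = y'" by (rule bary_inj[OF Bp(3) Rstd(1)[OF h(3)] Rstd(1)[OF h(4)]])
        then show ?thesis using 1 by simp
      next
        case 2
        show ?thesis by (rule consec[OF 2 h(1,2,3,4) r(3) _ r(6) _ h(5)]) (use r' \<open>\<gamma> = \<gamma>'\<close> in auto)
      next
        case 3
        show ?thesis by (rule consec[OF 3 h(2,1,4,3) r'(3) _ r'(6) _ h(5)[symmetric], symmetric]) (use r \<open>\<gamma> = \<gamma>'\<close> in auto)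
      qed
    next
      case 2
      have "\<gamma> = \<alpha> (Suc n)" "\<gamma>' = \<alpha> m" using 2 bd[OF h(1)] bd[OF h(2)] r(3) r'(2) by linarith+
      then show ?thesis by (intro wrap[OF h(1,2,3,4)]) (use 2 r(6) r'(5) h(5) in auto)
    next
      case 3
      have "\<gamma>' = \<alpha> (Suc m)" "\<gamma> = \<alpha> n" using 3 bd[OF h(1)] bd[OF h(2)] r'(3) r(2) by linarith+
      then show ?thesis by (intro wrap[OF h(2,1,4,3), symmetric]) (use 3 r(5) r'(6) h(5) in auto)
    qed
  qed
  have backward: "\<phi> (tt n) y = \<phi> (tt m) y'"
    if h: "n < N" "m < N" "y \<in> R n" "y' \<in> R m" "bary (B n) y = bary (B m) y'" for n m y y'
  proof (cases "y = corner (ii n)")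
    case True
    then have "y' = corner (ii m)" using nonzero[OF h(4)] h(5) c0 by metis
    then show ?thesis using True cat h by simp
  next
    case False
    then have "y' \<noteq> corner (ii m)" using nonzero[OF h(3)] h(5) c0 by metis
    then show ?thesis using backward_le[OF h False] by simp
  qed
  obtain n0 where n0: "n0 < N" "tt n0 = t0" "ii n0 = i0" using call[OF t0, of i0] by (auto simp: v_def)
  have "\<exists>U c. dev_chart U c \<and> \<phi> (tt n0) (corner (ii n0)) \<in> U"
  proof (rule dev_chart_of_pieces[where I = "{..<N}" and tt = tt and R = R and b = B])
    show "\<phi> (tt n) y = \<phi> (tt m) y' \<longleftrightarrow> bary (B n) y = bary (B m) y'"
      if "n \<in> {..<N}" "m \<in> {..<N}" "y \<in> R n" "y' \<in> R m" for n m y y'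
      using forward[of n m y y'] backward[of n m y y'] that by blast
    show "\<exists>m\<in>{..<N}. tt m = t' \<and> y' \<in> R m"
      if h: "n \<in> {..<N}" "y \<in> R n" "t' \<in> T" "y' \<in> std_triangle" "\<phi> t' y' = \<phi> (tt n) y" for n y t' y'
    proof -
      have n: "n < N" using h(1) by simp
      from same[OF n h(2-5)] show ?thesis
      proof (elim disjE exE conjE)
        assume "t' = tt n" "y' = y"
        then show ?thesis using h by blast
      next
        fix i' assume e: "y' = corner i'" "y = corner (ii n)"
        then have "\<phi> t' (corner i') = v" using h(5) cat[OF n] by simp
        then obtain m where "m < N" "tt m = t'" "ii m = i'" using call[OF h(3)] by blast
        then show ?thesis using e h(4) by (intro bexI[of _ m]) (auto simp: R_def corner_nth)
      next
        fix s assume "0 < s" "s < 1 / 2" "t' = tt (nx n)" "y' = edge_pt (ii (nx n)) (kk (nx n)) s"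
        then show ?thesis using in_R[OF ik] nxN[OF n] by (intro bexI[of _ "nx n"]) auto
      next
        fix m s assume "m < N" "0 < s" "s < 1 / 2" "t' = tt m" "y' = edge_pt (ii m) (xx m) s"
        then show ?thesis using in_R[OF ix(1)] by (intro bexI[of _ m]) auto
      qed
    qed
    show "openin (top_of_set std_triangle) (R n)" for n unfolding R_def by (rule openin_coordinate_gt)
    show "corner (ii n0) \<in> R n0" using corner_std by (simp add: R_def corner_nth)
  qed (use n0 tT Bp(1,2) in auto)
  then show ?thesis using n0 by simp
qed

end

section \<open>The hyperbolic structure\<close>

context hyperbolic_triangulation
begin

definition dev_atlas :: "('a set \<times> ('a \<Rightarrow> complex)) set" where
  "dev_atlas = {(U, c). dev_chart U c}"

lemma dev_hyperbolic_surface: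
  assumes angles: "\<And>v. v \<in> vertices \<phi> T \<Longrightarrow> (\<Sum>(t, i)\<in>corners_at v. tri_angle (a t) i) = 2 * pi"
  shows "hyperbolic_surface M dev_atlas"
proof -
  have cover: "\<exists>U c. dev_chart U c \<and> p \<in> U" if p: "p \<in> topspace M" for p
  proof -
    obtain t x where tx: "t \<in> T" "x \<in> std_triangle" "p = \<phi> t x" by (rule pointE[OF p])
    from tx(2) show ?thesis
    proof (cases rule: std_triangle_cases)
      case 1
      then show ?thesis using face_chart[OF tx(1)] tx(3) by blast
    next
      case (2 i k s)
      have "(t, i, k) \<in> flags" using tx(1) 2(1) by (simp add: mem_flags)
      then show ?thesis using edge_chart[OF _ 2(2,3)] tx(3) 2(4) by blast
    next
      case (3 i)
      have "\<phi> t (corner i) \<in> vertices \<phi> T" using tx(1) unfolding vertices_def by blast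
      then show ?thesis using vertex_chart[OF tx(1) angles] tx(3) 3 by blast
    qed
  qed
  have op: "openin M U" if "dev_chart U c" for U c using that unfolding dev_chart_def by blast
  show ?thesis
    unfolding hyperbolic_surface_def
  proof (intro conjI)
    show "compact_space M" "Hausdorff_space M" by (rule compact_M Hausdorff_M)+
    show "(\<Union>(U, c)\<in>dev_atlas. U) = topspace M"
    proof
      show "(\<Union>(U, c)\<in>dev_atlas. U) \<subseteq> topspace M"
        unfolding dev_atlas_def using op openin_subset by blast
      show "topspace M \<subseteq> (\<Union>(U, c)\<in>dev_atlas. U)"
        unfolding dev_atlas_def using cover by blast
    qed
    show "\<forall>(U, c)\<in>dev_atlas. openin M U \<and> c ` U \<subseteq> hyp_plane \<and> open (c ` U) \<and>
        homeomorphic_map (subtopology M U) (top_of_set (c ` U)) c"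
    proof (intro ballI, clarify)
      fix U c assume "(U, c) \<in> dev_atlas"
      then have dc: "dev_chart U c" by (simp add: dev_atlas_def)
      then have "openin M U" "continuous_map (subtopology M U) euclidean c" "inj_on c U"
        unfolding dev_chart_def by blast+
      from this(1) injective_chart_homeomorphic[OF this] dev_chart_mem[OF dc]
      show "openin M U \<and> c ` U \<subseteq> hyp_plane \<and> open (c ` U) \<and>
        homeomorphic_map (subtopology M U) (top_of_set (c ` U)) c" by blast
    qed
    show "\<forall>(U, c)\<in>dev_atlas. \<forall>(U', c')\<in>dev_atlas. \<forall>p\<in>U \<inter> U'.
        \<exists>g W. hyp_isometry g \<and> openin M W \<and> p \<in> W \<and> W \<subseteq> U \<inter> U' \<and> (\<forall>q\<in>W. c' q = g (c q))"
    proof clarify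
      fix U c V d p assume "(U, c) \<in> dev_atlas" "(V, d) \<in> dev_atlas" "p \<in> U" "p \<in> V"
      then show "\<exists>g W. hyp_isometry g \<and> openin M W \<and> p \<in> W \<and> W \<subseteq> U \<inter> V \<and> (\<forall>q\<in>W. d q = g (c q))"
        unfolding dev_atlas_def by (intro dev_chart_transition) auto
    qed
  qed
qed

lemma dev_geodesic_triangle:
  assumes t: "t \<in> T"
  shows "geodesic_triangle M dev_atlas (\<phi> t) (a t)"
  unfolding geodesic_triangle_def
proof (intro conjI exI[of _ "bary (a t)"])
  show "hyp_triangle (a t)" by (rule triangle[OF t])
  show "homeomorphic_map (top_of_set std_triangle) (top_of_set (convex hull (range (a t)))) (bary (a t))"
    by (rule homeomorphic_map_bary[OF triangle[OF t]])
  show "\<forall>i. bary (a t) (corner i) = a t i" using bary_corner vertex_mem[OF t] by blast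
  show "\<forall>i. bary (a t) ` side_pt i ` {0..1} = closed_segment (a t (i + 1)) (a t (i + 2))"
    using bary_side_image[of "a t", OF vertex_mem[OF t]] by blast
  show "\<forall>x\<in>std_triangle. \<forall>(U, c)\<in>dev_atlas. \<phi> t x \<in> U \<longrightarrow>
     (\<exists>g W. hyp_isometry g \<and> openin (top_of_set std_triangle) W \<and> x \<in> W \<and> (\<forall>y\<in>W. \<phi> t y \<in> U \<and> c (\<phi> t y) = g (bary (a t) y)))"
  proof (intro ballI, clarify)
    fix x U c assume "x \<in> std_triangle" "(U, c) \<in> dev_atlas" "\<phi> t x \<in> U"
    then have "\<exists>g W. dev_piece U c t x g W" using t unfolding dev_atlas_def dev_chart_def by blast
    then show "\<exists>g W. hyp_isometry g \<and> openin (top_of_set std_triangle) W \<and> x \<in> W \<and> (\<forall>y\<in>W. \<phi> t y \<in> U \<and> c (\<phi> t y) = g (bary (a t) y))"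
      unfolding dev_piece_def .
  qed
qed

end

section \<open>The angle sum at a vertex\<close>

context triangulated_surface
begin

definition flags_at :: "'a \<Rightarrow> ('t \<times> 3 \<times> 3) set" where
  "flags_at v = {f \<in> flags. flag_vertex f = v}"

definition flag_edge :: "'t \<times> 3 \<times> 3 \<Rightarrow> 'a set" where
  "flag_edge f = edge_at (flag_side f)"

lemma flag_edge_glue: "f \<in> flags \<Longrightarrow> flag_edge (glue f) = flag_edge f"
  unfolding flag_edge_def by (simp add: flag_side_glue opp_props flag_side_sides)

lemma flag_edge_rev: "f \<in> flags \<Longrightarrow> flag_edge (flag_rev f) = flag_edge f"
  unfolding flag_edge_def by (simp add: flag_rev_props)

lemma flag_edge_image: "f \<in> flags \<Longrightarrow> flag_edge f = flag_pt f ` {0..1}"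
  unfolding flag_edge_def by (rule edge_at_flag_side)

lemma same_side_flags:
  assumes "f \<in> flags" "g \<in> flags" "flag_side f = flag_side g"
  shows "g = f \<or> g = flag_rev f"
proof -
  obtain t i k where fe: "f = (t, i, k)" by (cases f)
  obtain t' i' k' where ge: "g = (t', i', k')" by (cases g)
  have "i \<noteq> k" "i' \<noteq> k'" "t' = t" "third i k = third i' k'" using assms by (auto simp: fe ge mem_flags flag_side_def)
  then show ?thesis using third_eq_cases[of i k i' k'] by (auto simp: fe ge flag_rev_def)
qed

text \<open>Two sides, each with two directions.\<close>

lemma flags_of_edge:
  assumes f: "f \<in> flags"
  shows "{g \<in> flags. flag_edge g = flag_edge f} = {f, glue f, flag_rev f, flag_rev (glue f)}"
proof
  show "{g \<in> flags. flag_edge g = flag_edge f} \<subseteq> {f, glue f, flag_rev f, flag_rev (glue f)}"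
  proof
    fix g assume "g \<in> {g \<in> flags. flag_edge g = flag_edge f}"
    then have g: "g \<in> flags" "edge_at (flag_side g) = edge_at (flag_side f)" by (auto simp: flag_edge_def)
    have "flag_side g = flag_side f \<or> flag_side g = opp (flag_side f)"
      by (rule opp_cases[OF flag_side_sides[OF f] flag_side_sides[OF g(1)] g(2)])
    then show "g \<in> {f, glue f, flag_rev f, flag_rev (glue f)}"
      using same_side_flags[OF f g(1)] same_side_flags[OF glue_flags[OF f] g(1)] flag_side_glue[OF f] by auto
  qed
  show "{f, glue f, flag_rev f, flag_rev (glue f)} \<subseteq> {g \<in> flags. flag_edge g = flag_edge f}"
    using f glue_flags[OF f] flag_rev_props(1) flag_edge_glue flag_edge_rev by auto
qed

lemma vertex_not_inner:
  assumes f: "f \<in> flags" and s: "0 < s" "s < 1"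
  shows "flag_pt f s \<notin> vertices \<phi> T"
proof
  assume "flag_pt f s \<in> vertices \<phi> T"
  then obtain t' i' where v: "t' \<in> T" "flag_pt f s = \<phi> t' (corner i')" unfolding vertices_def by blast
  obtain t i k where fe: "f = (t, i, k)" by (cases f)
  have t: "t \<in> T" "i \<noteq> k" using f by (auto simp: fe mem_flags)
  have "\<phi> t (edge_pt i k s) = \<phi> t' (corner i')" using v(2) by (simp add: fe flag_pt_def)
  then obtain j where "edge_pt i k s = corner j"
    using same_point_corner[OF v(1) t(1) edge_pt_std, of s i k i'] s by auto
  then show False using edge_pt_not_corner[OF t(2) s] by blast
qed

lemma flag_vertex_in: "f \<in> flags \<Longrightarrow> flag_vertex f \<in> vertices \<phi> T"
  by (cases f) (auto simp: flag_vertex_simp vertices_def mem_flags)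

lemma flag_vertex_rev: "f \<in> flags \<Longrightarrow> flag_vertex (flag_rev f) = flag_pt f 1"
  unfolding flag_vertex_def by (simp add: flag_rev_props)

lemma edge_vertices:
  assumes f: "f \<in> flags"
  shows "flag_edge f \<inter> vertices \<phi> T = {flag_vertex f, flag_vertex (flag_rev f)}"
proof
  show "flag_edge f \<inter> vertices \<phi> T \<subseteq> {flag_vertex f, flag_vertex (flag_rev f)}"
  proof
    fix x assume x: "x \<in> flag_edge f \<inter> vertices \<phi> T"
    then obtain s where s: "0 \<le> s" "s \<le> 1" "x = flag_pt f s" unfolding flag_edge_image[OF f] by auto
    then have "\<not> (0 < s \<and> s < 1)" using vertex_not_inner[OF f] x by blast
    then have "s = 0 \<or> s = 1" using s by auto
    then show "x \<in> {flag_vertex f, flag_vertex (flag_rev f)}"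
      using s(3) by (auto simp: flag_vertex_def[of f] flag_vertex_rev[OF f])
  qed
  have "flag_vertex f \<in> flag_edge f" unfolding flag_edge_image[OF f] flag_vertex_def by simp
  moreover have "flag_vertex (flag_rev f) \<in> flag_edge f" unfolding flag_edge_image[OF f] flag_vertex_rev[OF f] by simp
  ultimately show "{flag_vertex f, flag_vertex (flag_rev f)} \<subseteq> flag_edge f \<inter> vertices \<phi> T"
    using flag_vertex_in f flag_rev_props(1)[OF f] by auto
qed

lemma filter_four:
  "{g \<in> {p, q, r, s}. h g = v} = (if h p = v then {p} else {}) \<union> (if h q = v then {q} else {})
     \<union> (if h r = v then {r} else {}) \<union> (if h s = v then {s} else {})"
  by auto

text \<open>Each end of an edge is seen by two flags, one in either adjacent side. For a loop both
  ends are at v, which matches the value 2 of \<open>ends_at\<close>.\<close>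

lemma card_flags_at_edge:
  assumes v: "v \<in> vertices \<phi> T" and e: "e \<in> edges \<phi> T"
  shows "card {f \<in> flags_at v. flag_edge f = e} = 2 * ends_at \<phi> T v e"
proof -
  obtain t l where tl: "t \<in> T" "e = side_edge \<phi> t l" using e unfolding edges_def by blast
  define f where "f = (t, l + 1, l + 2)"
  have f: "f \<in> flags" using tl by (simp add: f_def mem_flags cyc3_neq)
  have fe: "flag_edge f = e" by (simp add: flag_edge_def f_def flag_side_def third_cyc edge_at_def tl(2))
  define x y where "x = flag_vertex f" and "y = flag_vertex (flag_rev f)"
  have gf: "glue f \<in> flags" "flag_rev f \<in> flags" "flag_rev (glue f) \<in> flags"
    using glue_flags[OF f] flag_rev_props(1) f by blast+
  have vs: "flag_vertex (glue f) = x" "flag_vertex (flag_rev (glue f)) = y"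
    using flag_vertex_glue[OF f] flag_vertex_glue[OF gf(2)] glue_rev[OF f] by (simp_all add: x_def y_def)
  have sides_ne: "flag_side (glue f) \<noteq> flag_side f" using flag_side_glue[OF f] opp_props(2)[OF flag_side_sides[OF f]] by simp
  have rne: "flag_rev g \<noteq> g" if "g \<in> flags" for g using that by (cases g) (auto simp: flag_rev_def mem_flags)
  have d: "f \<noteq> glue f" "flag_rev f \<noteq> f" "flag_rev (glue f) \<noteq> glue f" "flag_rev f \<noteq> glue f" "flag_rev (glue f) \<noteq> f" "flag_rev (glue f) \<noteq> flag_rev f"
    using rne[OF f] rne[OF gf(1)] sides_ne flag_rev_props(4)[OF f] flag_rev_props(4)[OF gf(1)] by metis+
  have S: "{g \<in> flags_at v. flag_edge g = e} = {g \<in> {f, glue f, flag_rev f, flag_rev (glue f)}. flag_vertex g = v}"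
    unfolding flags_of_edge[OF f, symmetric] fe flags_at_def by blast
  have ev: "e \<inter> vertices \<phi> T = {x, y}" using edge_vertices[OF f] by (simp add: fe x_def y_def)
  have ve: "v \<in> e \<longleftrightarrow> v = x \<or> v = y" using ev v by blast
  have vals: "flag_vertex f = x" "flag_vertex (flag_rev f) = y" by (simp_all add: x_def y_def)
  have xy: "{x, y} = {v} \<longleftrightarrow> v = x \<and> v = y" by auto
  show ?thesis
    unfolding S filter_four vals vs ends_at_def ev ve xy
    using d by (auto simp: card_insert_if)
qed

lemma sum_flags_at:
  fixes w :: "'t \<times> 3 \<times> 3 \<Rightarrow> real"
  shows "(\<Sum>f\<in>flags_at v. w f) = (\<Sum>(t, i)\<in>corners_at v. w (t, i, i + 1) + w (t, i, i + 2))"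
proof -
  have fin: "finite (corners_at v)"
    by (rule finite_subset[of _ "T \<times> UNIV"]) (use finite_T in \<open>auto simp: corners_at_def\<close>)
  define J where "J c = {(fst c, snd c, snd c + 1), (fst c, snd c, snd c + 2)}" for c :: "'t \<times> 3"
  have "flags_at v = (\<Union>c\<in>corners_at v. J c)"
  proof
    show "flags_at v \<subseteq> (\<Union>c\<in>corners_at v. J c)"
    proof
      fix f assume f: "f \<in> flags_at v"
      obtain t i k where fe: "f = (t, i, k)" by (cases f)
      have h: "t \<in> T" "i \<noteq> k" "\<phi> t (corner i) = v" using f by (auto simp: fe flags_at_def mem_flags flag_vertex_simp)
      have "k = i + 1 \<or> k = i + 2" using exhaust_cyc3[of k i] h(2) by auto
      then have "f \<in> J (t, i)" by (auto simp: J_def fe)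
      moreover have "(t, i) \<in> corners_at v" using h by (simp add: corners_at_def)
      ultimately show "f \<in> (\<Union>c\<in>corners_at v. J c)" by blast
    qed
    show "(\<Union>c\<in>corners_at v. J c) \<subseteq> flags_at v"
      by (auto simp: J_def corners_at_def flags_at_def mem_flags flag_vertex_simp cyc3_neq)
  qed
  moreover have "J c \<inter> J c' = {}" if "c \<noteq> c'" for c c' using that by (cases c; cases c') (auto simp: J_def)
  ultimately have "(\<Sum>f\<in>flags_at v. w f) = (\<Sum>c\<in>corners_at v. \<Sum>f\<in>J c. w f)"
    using fin by (simp add: sum.UNION_disjoint J_def)
  also have "\<dots> = (\<Sum>c\<in>corners_at v. w (fst c, snd c, snd c + 1) + w (fst c, snd c, snd c + 2))"
    by (intro sum.cong refl) (simp add: J_def cyc3_neq)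
  finally show ?thesis by (simp add: case_prod_beta)
qed

text \<open>A corner angle \<pi> - \<psi> - \<psi>' is distributed over the two flags of the corner
  as \<pi>/2 - \<psi> each. Pairing flags by \<open>glue\<close> turns two such terms into \<pi> -
  \<theta>, and counting flags by edges recovers the vertex condition on \<theta>.\<close>

theorem vertex_angle_sum:
  assumes v: "v \<in> vertices \<phi> T" and sys: "angle_system \<theta> \<psi>"
    and \<theta>: "(\<Sum>e\<in>edges \<phi> T. real (ends_at \<phi> T v e) * (pi - \<theta> e)) = 2 * pi"
  shows "(\<Sum>(t, i)\<in>corners_at v. tri_ang (\<lambda>j. \<psi> (t, j)) i) = 2 * pi"
proof -
  define w where "w f = pi / 2 - \<psi> (flag_side f)" for f
  have fin: "finite (flags_at v)" by (rule finite_subset[OF _ finite_flags]) (auto simp: flags_at_def)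
  have s1: "(\<Sum>(t, i)\<in>corners_at v. tri_ang (\<lambda>j. \<psi> (t, j)) i) = (\<Sum>f\<in>flags_at v. w f)"
    unfolding sum_flags_at w_def flag_side_def case_prod_conv third_cyc
    by (intro sum.cong refl) (auto simp: tri_ang_def)
  have s2: "(\<Sum>f\<in>flags_at v. w f) = (\<Sum>f\<in>flags_at v. w (glue f))"
    by (rule sum.reindex_bij_witness[of _ glue glue])
      (auto simp: flags_at_def glue_glue glue_flags flag_vertex_glue)
  have "2 * (\<Sum>(t, i)\<in>corners_at v. tri_ang (\<lambda>j. \<psi> (t, j)) i) = (\<Sum>f\<in>flags_at v. w f) + (\<Sum>f\<in>flags_at v. w (glue f))"
    using s1 s2 by simp
  also have "\<dots> = (\<Sum>f\<in>flags_at v. w f + w (glue f))" by (simp add: sum.distrib)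
  also have "\<dots> = (\<Sum>f\<in>flags_at v. pi - \<theta> (flag_edge f))"
  proof (rule sum.cong[OF refl])
    fix f assume "f \<in> flags_at v"
    then have f: "f \<in> flags" by (simp add: flags_at_def)
    have "\<psi> (flag_side f) + \<psi> (opp (flag_side f)) = \<theta> (edge_at (flag_side f))"
      using sys flag_side_sides[OF f] unfolding angle_system_def by blast
    then show "w f + w (glue f) = pi - \<theta> (flag_edge f)"
      unfolding w_def flag_side_glue[OF f] flag_edge_def by simp
  qed
  also have "\<dots> = (\<Sum>e\<in>edges \<phi> T. \<Sum>f | f \<in> flags_at v \<and> flag_edge f = e. pi - \<theta> (flag_edge f))"
  proof (rule sum.group[symmetric, OF fin])
    show "finite (edges \<phi> T)" using finite_all_edges[of T] by (simp add: all_edges_def edges_def)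
    show "flag_edge ` flags_at v \<subseteq> edges \<phi> T"
      by (auto simp: flags_at_def flags_def flag_edge_def edge_at_def flag_side_def edges_def)
  qed
  also have "\<dots> = (\<Sum>e\<in>edges \<phi> T. 2 * (real (ends_at \<phi> T v e) * (pi - \<theta> e)))"
  proof (rule sum.cong[OF refl])
    fix e assume e: "e \<in> edges \<phi> T"
    have "(\<Sum>f | f \<in> flags_at v \<and> flag_edge f = e. pi - \<theta> (flag_edge f)) = (\<Sum>f | f \<in> flags_at v \<and> flag_edge f = e. pi - \<theta> e)"
      by (rule sum.cong) auto
    then show "(\<Sum>f | f \<in> flags_at v \<and> flag_edge f = e. pi - \<theta> (flag_edge f)) = 2 * (real (ends_at \<phi> T v e) * (pi - \<theta> e))"
      using card_flags_at_edge[OF v e] by simp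
  qed
  also have "\<dots> = 2 * (2 * pi)" unfolding sum_distrib_left[symmetric] \<theta> ..
  finally show ?thesis by simp
qed

end

section \<open>Uniqueness: comparison of an arbitrary realization with the constructed one\<close>

section \<open>Side lengths of a geodesic triangulation\<close>

text \<open>\<open>edge_pos C u\<close> is the distance from the start of the point with coordinate \<open>u\<close> on a segment
  of length \<open>arcosh C\<close>.\<close>

definition edge_norm :: "real \<Rightarrow> real \<Rightarrow> real" where
  "edge_norm C u = sqrt ((1 - u)\<^sup>2 + u\<^sup>2 + 2 * u * (1 - u) * C)"

definition edge_pos :: "real \<Rightarrow> real \<Rightarrow> real" where
  "edge_pos C u = arsinh (u * sqrt (C\<^sup>2 - 1) / edge_norm C u)"

lemma edge_norm_pos:
  assumes "1 < C" "0 \<le> u" "u \<le> 1"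
  shows "0 < edge_norm C u"
proof -
  have "0 < (1 - u)\<^sup>2 + u\<^sup>2"
    by (metis add_cancel_right_left diff_zero not_sum_power2_lt_zero not_less_iff_gr_or_eq sum_power2_gt_zero_iff zero_neq_one)
  moreover have "0 \<le> 2 * u * (1 - u) * C" using assms by (intro mult_nonneg_nonneg) auto
  ultimately show ?thesis unfolding edge_norm_def by (simp add: add_pos_nonneg)
qed

lemma sinh_cosh_edge_pos:
  assumes "1 < C" "0 \<le> u" "u \<le> 1"
  shows "sinh (edge_pos C u) = u * sqrt (C\<^sup>2 - 1) / edge_norm C u" "cosh (edge_pos C u) = ((1 - u) + u * C) / edge_norm C u"
proof -
  define z where "z = u * sqrt (C\<^sup>2 - 1) / edge_norm C u"
  have N: "0 < edge_norm C u" by (rule edge_norm_pos[OF assms])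
  have C1: "0 \<le> C\<^sup>2 - 1" using assms(1) by simp
  have N2: "(edge_norm C u)\<^sup>2 = (1 - u)\<^sup>2 + u\<^sup>2 + 2 * u * (1 - u) * C"
    using N unfolding edge_norm_def by (metis real_sqrt_gt_0_iff real_sqrt_pow2 less_imp_le)
  show "sinh (edge_pos C u) = z" unfolding edge_pos_def z_def by (rule sinh_arsinh_real)
  have "z\<^sup>2 + 1 = (((1 - u) + u * C) / edge_norm C u)\<^sup>2"
  proof -
    have "z\<^sup>2 = u\<^sup>2 * (C\<^sup>2 - 1) / (edge_norm C u)\<^sup>2" unfolding z_def using C1 by (simp add: power_divide power_mult_distrib)
    then have "z\<^sup>2 + 1 = (u\<^sup>2 * (C\<^sup>2 - 1) + (edge_norm C u)\<^sup>2) / (edge_norm C u)\<^sup>2" using N by (simp add: add_divide_distrib)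
    also have "u\<^sup>2 * (C\<^sup>2 - 1) + (edge_norm C u)\<^sup>2 = ((1 - u) + u * C)\<^sup>2"
      unfolding N2 by (simp add: power2_eq_square algebra_simps)
    finally show ?thesis by (simp add: power_divide)
  qed
  moreover have "0 \<le> ((1 - u) + u * C) / edge_norm C u" using assms N by simp
  ultimately have "sqrt (z\<^sup>2 + 1) = ((1 - u) + u * C) / edge_norm C u" by (metis real_sqrt_unique)
  then show "cosh (edge_pos C u) = ((1 - u) + u * C) / edge_norm C u"
    unfolding edge_pos_def z_def[symmetric] by (simp add: cosh_arsinh_real add.commute)
qed

lemma edge_pos_ends: "1 < C \<Longrightarrow> edge_pos C 0 = 0" "1 < C \<Longrightarrow> cosh (edge_pos C 1) = C" "1 < C \<Longrightarrow> 0 < edge_pos C 1"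
proof -
  assume C: "1 < C"
  show "edge_pos C 0 = 0" by (simp add: edge_pos_def)
  show "cosh (edge_pos C 1) = C" using sinh_cosh_edge_pos(2)[OF C, of 1] by (simp add: edge_norm_def)
  have "0 < sinh (edge_pos C 1)" using sinh_cosh_edge_pos(1)[OF C, of 1] C by (simp add: edge_norm_def)
  then show "0 < edge_pos C 1" by simp
qed

text \<open>By the addition theorem for cosh the distance of two points on a side is the difference
  of their positions, so \<open>edge_pos\<close> is an arc length parameter.\<close>

lemma lor_edge_pos:
  assumes a: "\<And>j. a j \<in> hyp_plane" and C: "lor (lift (a i)) (lift (a k)) = C" "1 < C"
    and u: "0 \<le> u" "u \<le> 1" and u': "0 \<le> u'" "u' \<le> 1"
  shows "lor (lift (bary a (edge_pt i k u))) (lift (bary a (edge_pt i k u'))) = cosh (edge_pos C u - edge_pos C u')"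
proof -
  have N: "0 < edge_norm C u" "0 < edge_norm C u'" using edge_norm_pos C(2) u u' by auto
  have C0: "sqrt (C\<^sup>2 - 1) * sqrt (C\<^sup>2 - 1) = C\<^sup>2 - 1" using C(2) by simp
  have n: "bnorm a (edge_pt i k w) = edge_norm C w" for w unfolding bnorm_edge_pt[of a i k w, OF a a] C(1) edge_norm_def ..
  have "lor (lift (bary a (edge_pt i k u))) (lift (bary a (edge_pt i k u')))
     = ((1 - u) * (1 - u') + u * u' + ((1 - u) * u' + u * (1 - u')) * C) / (edge_norm C u * edge_norm C u')"
    unfolding lift_bary[of a, OF a edge_pt_std[OF u]] lift_bary[of a, OF a edge_pt_std[OF u']] n bvec_edge_pt lor_algebra
    using N by (simp add: lor_lift_self[OF a] C(1) lor_commute[of "lift (a k)" "lift (a i)"] field_simps)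
  also have "(1 - u) * (1 - u') + u * u' + ((1 - u) * u' + u * (1 - u')) * C
     = ((1 - u) + u * C) * ((1 - u') + u' * C) - (u * u') * (sqrt (C\<^sup>2 - 1) * sqrt (C\<^sup>2 - 1))"
    unfolding C0 by (simp add: power2_eq_square algebra_simps)
  also have "\<dots> / (edge_norm C u * edge_norm C u') = cosh (edge_pos C u - edge_pos C u')"
    unfolding cosh_diff sinh_cosh_edge_pos[OF C(2) u] sinh_cosh_edge_pos[OF C(2) u'] using N
    by (simp add: diff_divide_distrib mult_ac)
  finally show ?thesis .
qed

lemma edge_pos_inj:
  assumes "1 < C"
  shows "inj_on (edge_pos C) {0..1}"
proof (rule inj_onI)
  fix u u' assume u: "u \<in> {0..1}" "u' \<in> {0..1}" and eq: "edge_pos C u = edge_pos C u'"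
  define S where "S = sqrt (C\<^sup>2 - 1)"
  have S: "0 < S" using assms by (simp add: S_def)
  have N: "0 < edge_norm C u" "0 < edge_norm C u'" using edge_norm_pos[OF assms] u by auto
  have c: "((1 - u) + u * C) / edge_norm C u = ((1 - u') + u' * C) / edge_norm C u'"
    and s: "u * S / edge_norm C u = u' * S / edge_norm C u'"
    using sinh_cosh_edge_pos[OF assms, of u] sinh_cosh_edge_pos[OF assms, of u'] eq u by (auto simp: S_def)
  have 1: "u * edge_norm C u' = u' * edge_norm C u" using s S N by (simp add: field_simps)
  have 2: "((1 - u) + u * C) * edge_norm C u' = ((1 - u') + u' * C) * edge_norm C u" using c N by (simp add: field_simps)
  have "edge_norm C u' + u * edge_norm C u' * (C - 1) = edge_norm C u + u' * edge_norm C u * (C - 1)"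
    using 2 by (simp add: algebra_simps)
  then have e: "edge_norm C u' = edge_norm C u" unfolding 1 by (rule add_right_imp_eq)
  have "u * edge_norm C u = u' * edge_norm C u" using 1 unfolding e .
  then show "u = u'" using N(1) by simp
qed

lemma continuous_on_edge_pos:
  assumes "1 < C"
  shows "continuous_on {0..1} (edge_pos C)"
proof -
  have "continuous_on {0..1} (edge_norm C)" unfolding edge_norm_def by (intro continuous_intros)
  moreover have "edge_norm C u \<noteq> 0" if "u \<in> {0..1}" for u using edge_norm_pos[OF assms, of u] that by auto
  ultimately show ?thesis unfolding edge_pos_def by (intro continuous_intros) auto
qed

lemma continuous_inj_increasing:
  fixes p :: "real \<Rightarrow> real"
  assumes cont: "continuous_on {0..1} p" and inj: "inj_on p {0..1}" and p: "p 0 < p 1"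
    and st: "0 \<le> s" "s < t" "t \<le> 1"
  shows "p s < p t"
proof -
  have mid: "p 0 < p w \<and> p w < p 1" if "0 < w" "w < 1" for w
    using continuous_inj_imp_mono[OF that cont inj] p by auto
  have t: "p 0 < p t" using mid[of t] p st by (cases "t = 1") auto
  show ?thesis
  proof (cases "s = 0")
    case False
    have "continuous_on {0..t} p" "inj_on p {0..t}"
      using continuous_on_subset[OF cont] inj_on_subset[OF inj] st by auto
    then show ?thesis using continuous_inj_imp_mono[of 0 s t p] t st False by auto
  qed (use t in simp)
qed

text \<open>The free homeomorphism of \<open>geodesic_triangle\<close> onto the developed triangle
  is factored through \<open>bary a\<close>. What remains is a self-homeomorphism q of the standard
  triangle, with inverse r, that preserves corners and sides and measures the deviation from
  barycentric parametrisation.\<close>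

definition geodesic_reparam ::
  "'a topology \<Rightarrow> ('a set \<times> ('a \<Rightarrow> complex)) set \<Rightarrow> (real^3 \<Rightarrow> 'a) \<Rightarrow> (3 \<Rightarrow> complex) \<Rightarrow>
   (real^3 \<Rightarrow> real^3) \<Rightarrow> (real^3 \<Rightarrow> real^3) \<Rightarrow> bool" where
  "geodesic_reparam N A \<sigma> a q r \<longleftrightarrow>
     homeomorphic_maps (top_of_set std_triangle) (top_of_set std_triangle) q r \<and>
     (\<forall>i. q (corner i) = corner i) \<and> (\<forall>i. \<forall>y\<in>std_triangle. q y $ i = 0 \<longleftrightarrow> y $ i = 0) \<and>
     (\<forall>x\<in>std_triangle. \<forall>(U, c)\<in>A. \<sigma> x \<in> U \<longrightarrow> (\<exists>g W. hyp_isometry g \<and> openin (top_of_set std_triangle) W \<and> x \<in> W \<and>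
       (\<forall>y\<in>W. \<sigma> y \<in> U \<and> c (\<sigma> y) = g (bary a (q y)))))"

lemma geodesic_reparamD:
  assumes "geodesic_reparam N A \<sigma> a q r"
  shows "homeomorphic_maps (top_of_set std_triangle) (top_of_set std_triangle) q r" "q (corner i) = corner i"
    "y \<in> std_triangle \<Longrightarrow> q y $ i = 0 \<longleftrightarrow> y $ i = 0"
    "x \<in> std_triangle \<Longrightarrow> (U, c) \<in> A \<Longrightarrow> \<sigma> x \<in> U \<Longrightarrow> \<exists>g W. hyp_isometry g \<and> openin (top_of_set std_triangle) W \<and> x \<in> W \<and>
       (\<forall>y\<in>W. \<sigma> y \<in> U \<and> c (\<sigma> y) = g (bary a (q y)))"
proof -
  note G = assms[unfolded geodesic_reparam_def]
  show "homeomorphic_maps (top_of_set std_triangle) (top_of_set std_triangle) q r" "q (corner i) = corner i"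
    "y \<in> std_triangle \<Longrightarrow> q y $ i = 0 \<longleftrightarrow> y $ i = 0"
    using G by simp_all
  show "\<exists>g W. hyp_isometry g \<and> openin (top_of_set std_triangle) W \<and> x \<in> W \<and>
       (\<forall>y\<in>W. \<sigma> y \<in> U \<and> c (\<sigma> y) = g (bary a (q y)))"
    if "x \<in> std_triangle" "(U, c) \<in> A" "\<sigma> x \<in> U"
    using bspec[OF bspec[OF G[THEN conjunct2, THEN conjunct2, THEN conjunct2] that(1)] that(2)] that(3) by simp
qed

lemma geodesic_triangle_reparam:
  assumes "geodesic_triangle N A \<sigma> a"
  shows "\<exists>q r. geodesic_reparam N A \<sigma> a q r"
proof -
  obtain k where a: "hyp_triangle a" and k: "homeomorphic_map (top_of_set std_triangle) (top_of_set (convex hull (range a))) k"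
    "\<forall>i. k (corner i) = a i" "\<forall>i. k ` side_pt i ` {0..1} = closed_segment (a (i + 1)) (a (i + 2))"
    "\<forall>x\<in>std_triangle. \<forall>(U, c)\<in>A. \<sigma> x \<in> U \<longrightarrow> (\<exists>g W. hyp_isometry g \<and> openin (top_of_set std_triangle) W \<and> x \<in> W \<and>
       (\<forall>y\<in>W. \<sigma> y \<in> U \<and> c (\<sigma> y) = g (k y)))"
    using assms unfolding geodesic_triangle_def by blast
  have a': "\<And>i. a i \<in> hyp_plane" using a unfolding hyp_triangle_iff by blast
  obtain b where b: "homeomorphic_maps (top_of_set std_triangle) (top_of_set (convex hull (range a))) (bary a) b"
    using homeomorphic_map_bary[OF a] unfolding homeomorphic_map_maps by blast
  have bb: "b z \<in> std_triangle" "bary a (b z) = z" if "z \<in> convex hull (range a)" for z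
    using b that unfolding homeomorphic_maps_def by (auto simp: continuous_map_def Pi_iff)
  have kin: "k y \<in> convex hull (range a)" if "y \<in> std_triangle" for y
    using homeomorphic_imp_surjective_map[OF k(1)] that by auto
  define q where "q y = b (k y)" for y
  have q: "q y \<in> std_triangle" "bary a (q y) = k y" if "y \<in> std_triangle" for y
    unfolding q_def using bb[OF kin[OF that]] by auto
  have "homeomorphic_map (top_of_set (convex hull (range a))) (top_of_set std_triangle) b"
    using b unfolding homeomorphic_maps_map by blast
  then have "homeomorphic_map (top_of_set std_triangle) (top_of_set std_triangle) (b \<circ> k)"
    by (rule homeomorphic_map_compose[OF k(1)])
  then have "homeomorphic_map (top_of_set std_triangle) (top_of_set std_triangle) q" by (simp add: q_def[abs_def] comp_def)
  then obtain r where r: "homeomorphic_maps (top_of_set std_triangle) (top_of_set std_triangle) q r"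
    unfolding homeomorphic_map_maps by blast
  have "q (corner i) = corner i" for i
  proof (rule bary_inj[OF a q(1)[OF corner_std] corner_std])
    show "bary a (q (corner i)) = bary a (corner i)" unfolding q(2)[OF corner_std] bary_corner[OF a'] using k(2) by blast
  qed
  moreover have "q y $ i = 0" if y: "y \<in> std_triangle" "y $ i = 0" for i y
  proof -
    have "y \<in> side_pt i ` {0..1}" using y by (simp add: side_image)
    then have "k y \<in> k ` side_pt i ` {0..1}" by blast
    then have "k y \<in> bary a ` side_pt i ` {0..1}" unfolding bary_side_image[of a, OF a'] using k(3) by simp
    then obtain w where w: "w \<in> side_pt i ` {0..1}" "k y = bary a w" by blast
    then have w': "w \<in> std_triangle" "w $ i = 0" unfolding side_image by auto
    have "q y = w" by (rule bary_inj[OF a q(1)[OF y(1)] w'(1)]) (simp add: q(2)[OF y(1)] w(2))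
    then show ?thesis using w'(2) by simp
  qed
  moreover have "y $ i = 0" if y: "y \<in> std_triangle" "q y $ i = 0" for i y
  proof -
    have "q y \<in> side_pt i ` {0..1}" using q(1)[OF y(1)] y(2) by (simp add: side_image)
    then have "bary a (q y) \<in> bary a ` side_pt i ` {0..1}" by (rule imageI)
    then have "k y \<in> k ` side_pt i ` {0..1}"
      unfolding q(2)[OF y(1)] bary_side_image[of a, OF a'] using k(3) by simp
    then obtain w where w: "w \<in> side_pt i ` {0..1}" "k y = k w" by (rule imageE) (rule that)
    then have w': "w \<in> std_triangle" "w $ i = 0" unfolding side_image by auto
    have "y = w"
      using homeomorphic_imp_injective_map[OF k(1)] w(2) y(1) w'(1) by (simp add: inj_on_def)
    then show ?thesis using w'(2) by simp
  qed
  moreover have "\<exists>g W. hyp_isometry g \<and> openin (top_of_set std_triangle) W \<and> x \<in> W \<and>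
       (\<forall>y\<in>W. \<sigma> y \<in> U \<and> c (\<sigma> y) = g (bary a (q y)))"
    if x: "x \<in> std_triangle" "(U, c) \<in> A" "\<sigma> x \<in> U" for x U c
  proof -
    obtain g W where gW: "hyp_isometry g" "openin (top_of_set std_triangle) W" "x \<in> W" "\<forall>y\<in>W. \<sigma> y \<in> U \<and> c (\<sigma> y) = g (k y)"
      using bspec[OF bspec[OF k(4) x(1)] x(2)] x(3) by auto
    have "\<forall>y\<in>W. \<sigma> y \<in> U \<and> c (\<sigma> y) = g (bary a (q y))"
      using gW(4) q(2) openin_imp_subset[OF gW(2)] by auto
    then show ?thesis using gW by blast
  qed
  ultimately show ?thesis unfolding geodesic_reparam_def using r by (intro exI[of _ q] exI[of _ r]) auto
qed

context triangulated_surface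
begin

text \<open>The positions of a point of an edge, measured in the two triangles at it, differ by a locally
  constant function.\<close>

theorem realization_side_match:
  fixes N' :: "'b topology"
  assumes cover: "(\<Union>(U, c)\<in>A'. U) = topspace N'" and hom: "homeomorphic_map M N' h'"
    and tri: "\<And>t. t \<in> T \<Longrightarrow> hyp_triangle (a' t)"
    and q: "\<And>t. t \<in> T \<Longrightarrow> geodesic_reparam N' A' (h' \<circ> \<phi> t) (a' t) (q t) (r t)"
    and f: "(t, i, k) \<in> flags" and gl: "glue (t, i, k) = (t', i', k')"
  shows "lor (lift (a' t i)) (lift (a' t k)) = lor (lift (a' t' i')) (lift (a' t' k'))"
    and "\<forall>s\<in>{0..1}. \<exists>u\<in>{0..1}. q t (edge_pt i k s) = edge_pt i k u \<and> q t' (edge_pt i' k' s) = edge_pt i' k' u"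
proof -
  note Q = geodesic_reparamD[OF q]
  have loc: "\<exists>g W. hyp_isometry g \<and> openin (top_of_set std_triangle) W \<and> x \<in> W \<and> (\<forall>y\<in>W. h' (\<phi> t y) \<in> U \<and> c (h' (\<phi> t y)) = g (bary (a' t) (q t y)))"
    if "t \<in> T" "x \<in> std_triangle" "(U, c) \<in> A'" "h' (\<phi> t x) \<in> U" for t x U c
    using Q(4)[OF that(1-3), unfolded comp_def] that(4) by simp
  have f': "(t', i', k') \<in> flags" using glue_flags[OF f] gl by simp
  have t: "t \<in> T" "i \<noteq> k" and t': "t' \<in> T" "i' \<noteq> k'" using f f' by (auto simp: mem_flags)
  \<comment> \<open>On each directed side q acts as a continuous injective change of parameter
    \<sigma> that fixes both ends.\<close>
  have side: "\<exists>\<sigma>. (\<forall>s\<in>{0..1}. \<sigma> s \<in> {0..1} \<and> q u (edge_pt j m s) = edge_pt j m (\<sigma> s)) \<and> continuous_on {0..1} \<sigma> \<and> inj_on \<sigma> {0..1} \<and> \<sigma> 0 = 0 \<and> \<sigma> 1 = 1"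
    if u: "u \<in> T" "j \<noteq> m" for u j m
  proof -
    have qc: "continuous_on std_triangle (q u)" "\<And>y. y \<in> std_triangle \<Longrightarrow> q u y \<in> std_triangle" "\<And>y. y \<in> std_triangle \<Longrightarrow> r u (q u y) = y"
      using Q(1)[OF u(1)] unfolding homeomorphic_maps_def by (auto simp: continuous_map_in_subtopology)
    define \<sigma> where "\<sigma> s = q u (edge_pt j m s) $ m" for s
    have e: "edge_pt j m s \<in> std_triangle" "edge_pt j m s $ third j m = 0" if "s \<in> {0..1}" for s
      using that third_props(1,2)[OF u(2)] by (auto simp: edge_pt_std edge_pt_nth[OF u(2)])
    have \<sigma>: "\<sigma> s \<in> {0..1} \<and> q u (edge_pt j m s) = edge_pt j m (\<sigma> s)" if "s \<in> {0..1}" for s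
      unfolding \<sigma>_def using qc(2)[OF e(1)[OF that]] std_triangleD(1) std_triangle_le1
        edge_pt_of_third_zero[OF u(2) _ Q(3)[OF u(1) e(1)[OF that], THEN iffD2, OF e(2)[OF that]]] by auto
    have "continuous_on {0..1} (\<lambda>s. edge_pt j m s)" unfolding edge_pt_def by (intro continuous_intros)
    then have "continuous_on {0..1} (\<lambda>s. q u (edge_pt j m s))"
      by (rule continuous_on_compose2[OF qc(1)]) (use e(1) in auto)
    then have "continuous_on {0..1} \<sigma>" unfolding \<sigma>_def by (intro continuous_intros)
    moreover have "inj_on \<sigma> {0..1}"
    proof (rule inj_onI)
      fix s s' assume s: "s \<in> {0..1}" "s' \<in> {0..1}" "\<sigma> s = \<sigma> s'"
      then have "q u (edge_pt j m s) = q u (edge_pt j m s')" using \<sigma> by simp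
      then have "edge_pt j m s = edge_pt j m s'" using qc(3) e(1) s by metis
      then show "s = s'" using edge_pt_inj[OF u(2)] by simp
    qed
    moreover have "\<sigma> 0 = 0" "\<sigma> 1 = 1" using Q(2)[OF u(1)] u(2) by (simp_all add: \<sigma>_def edge_pt_ends corner_nth)
    ultimately show ?thesis using \<sigma> by blast
  qed
  obtain \<sigma> where \<sigma>: "\<forall>s\<in>{0..1}. \<sigma> s \<in> {0..1} \<and> q t (edge_pt i k s) = edge_pt i k (\<sigma> s)" "continuous_on {0..1} \<sigma>" "inj_on \<sigma> {0..1}" "\<sigma> 0 = 0" "\<sigma> 1 = 1"
    using side[OF t] by blast
  obtain \<tau> where \<tau>: "\<forall>s\<in>{0..1}. \<tau> s \<in> {0..1} \<and> q t' (edge_pt i' k' s) = edge_pt i' k' (\<tau> s)" "continuous_on {0..1} \<tau>" "inj_on \<tau> {0..1}" "\<tau> 0 = 0" "\<tau> 1 = 1"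
    using side[OF t'] by blast
  have am: "\<And>j. a' t j \<in> hyp_plane" "\<And>j. a' t' j \<in> hyp_plane" using tri t(1) t'(1) unfolding hyp_triangle_iff by auto
  define C where "C = lor (lift (a' t i)) (lift (a' t k))"
  define D where "D = lor (lift (a' t' i')) (lift (a' t' k'))"
  have C: "1 < C" "1 < D"
    unfolding C_def D_def using tri[OF t(1)] tri[OF t'(1)] t(2) t'(2) am
    by (auto intro!: lor_lift_gt1 simp: hyp_triangle_def inj_eq)
  define p where "p s = edge_pos C (\<sigma> s)" for s
  define p' where "p' s = edge_pos D (\<tau> s)" for s
  have incr: "edge_pos E (\<rho> s) < edge_pos E (\<rho> s')"
    if "1 < E" "\<forall>s\<in>{0..1}. \<rho> s \<in> {0..1}" "continuous_on {0..1} \<rho>" "inj_on \<rho> {0..1}" "\<rho> 0 = 0" "\<rho> 1 = 1" "0 \<le> s" "s < s'" "s' \<le> 1" for E s s' and \<rho> :: "real \<Rightarrow> real"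
  proof (rule continuous_inj_increasing[where p = "\<lambda>s. edge_pos E (\<rho> s)"])
    show "continuous_on {0..1} (\<lambda>s. edge_pos E (\<rho> s))"
      by (rule continuous_on_compose2[OF continuous_on_edge_pos[OF that(1)] that(3)]) (use that(2) in auto)
    show "inj_on (\<lambda>s. edge_pos E (\<rho> s)) {0..1}"
      using that(2,4) edge_pos_inj[OF that(1)] unfolding inj_on_def by blast
    show "edge_pos E (\<rho> 0) < edge_pos E (\<rho> 1)" using edge_pos_ends[OF that(1)] that(5,6) by simp
  qed (use that in auto)
  have pinc: "p s < p s'" "p' s < p' s'" if "0 \<le> s" "s < s'" "s' \<le> 1" for s s'
    unfolding p_def p'_def using incr[OF C(1) _ \<sigma>(2-5) that] incr[OF C(2) _ \<tau>(2-5) that] \<sigma>(1) \<tau>(1) by auto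
  have pts: "\<phi> t' (edge_pt i' k' s) = \<phi> t (edge_pt i k s)" if "s \<in> {0..1}" for s
    using flag_pt_glue[OF f, of s] gl that by (simp add: flag_pt_def)
  have "(\<lambda>s. p s - p' s) constant_on {0..1}"
  proof (rule locally_constant_imp_constant)
    show "connected {0..1::real}" by simp
    fix s0 :: real assume s0: "s0 \<in> {0..1}"
    define z where "z = h' (\<phi> t (edge_pt i k s0))"
    have e0: "edge_pt i k s0 \<in> std_triangle" "edge_pt i' k' s0 \<in> std_triangle" using s0 by (auto simp: edge_pt_std)
    have "z \<in> topspace N'"
      unfolding z_def using homeomorphic_imp_surjective_map[OF hom] char_in_M[OF t(1) e0(1)] by blast
    then obtain U c where Uc: "(U, c) \<in> A'" "z \<in> U" unfolding cover[symmetric] by blast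
    obtain g W where g: "hyp_isometry g" "openin (top_of_set std_triangle) W" "edge_pt i k s0 \<in> W"
      "\<forall>y\<in>W. h' (\<phi> t y) \<in> U \<and> c (h' (\<phi> t y)) = g (bary (a' t) (q t y))"
      using loc[OF t(1) e0(1) Uc(1)] Uc(2) unfolding z_def by blast
    have z': "h' (\<phi> t' (edge_pt i' k' s0)) \<in> U" using Uc(2) pts[OF s0] by (simp add: z_def)
    obtain g' W' where g': "hyp_isometry g'" "openin (top_of_set std_triangle) W'" "edge_pt i' k' s0 \<in> W'"
      "\<forall>y\<in>W'. h' (\<phi> t' y) \<in> U \<and> c (h' (\<phi> t' y)) = g' (bary (a' t') (q t' y))"
      using loc[OF t'(1) e0(2) Uc(1) z'] by blast
    define V where "V = {s \<in> {0..1}. edge_pt i k s \<in> W} \<inter> {s \<in> {0..1}. edge_pt i' k' s \<in> W'}"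
    have op: "openin (top_of_set {0..1}) {s \<in> {0..1}. edge_pt j m s \<in> X}" if "openin (top_of_set std_triangle) X" for j m X
    proof -
      have "continuous_on {0..1} (\<lambda>s. edge_pt j m s)" unfolding edge_pt_def by (intro continuous_intros)
      then have "continuous_map (top_of_set {0..1}) (top_of_set std_triangle) (\<lambda>s. edge_pt j m s)"
        by (auto simp: continuous_map_in_subtopology edge_pt_std)
      from openin_continuous_map_preimage[OF this that] show ?thesis by simp
    qed
    have oV: "openin (top_of_set {0..1}) V" unfolding V_def by (intro openin_Int op g(2) g'(2))
    have sV: "s0 \<in> V" using s0 g(3) g'(3) by (simp add: V_def)
    have "p s - p' s = p s0 - p' s0" if s: "s \<in> V" for s
    proof -
      have s1: "s \<in> {0..1}" using s by (simp add: V_def)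
      have b: "g (bary (a' t) (edge_pt i k (\<sigma> w))) = g' (bary (a' t') (edge_pt i' k' (\<tau> w)))" if "w \<in> V" for w
      proof -
        have w: "w \<in> {0..1}" "edge_pt i k w \<in> W" "edge_pt i' k' w \<in> W'" using that by (auto simp: V_def)
        have "g (bary (a' t) (q t (edge_pt i k w))) = g' (bary (a' t') (q t' (edge_pt i' k' w)))"
          using bspec[OF g(4) w(2)] bspec[OF g'(4) w(3)] pts[OF w(1)] by simp
        then show ?thesis using \<sigma>(1) \<tau>(1) w(1) by simp
      qed
      have m: "bary (a' t) (edge_pt i k (\<sigma> w)) \<in> hyp_plane" "bary (a' t') (edge_pt i' k' (\<tau> w)) \<in> hyp_plane" if "w \<in> {0..1}" for w
        using bary_mem[of "a' t", OF am(1)] bary_mem[of "a' t'", OF am(2)] edge_pt_std \<sigma>(1) \<tau>(1) that by auto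
      have "cosh (p s - p s0) = lor (lift (bary (a' t) (edge_pt i k (\<sigma> s)))) (lift (bary (a' t) (edge_pt i k (\<sigma> s0))))"
        unfolding p_def using lor_edge_pos[of "a' t" i k C "\<sigma> s" "\<sigma> s0", OF am(1) C_def[symmetric] C(1)] \<sigma>(1) s1 s0 by auto
      also have "\<dots> = lor (lift (g (bary (a' t) (edge_pt i k (\<sigma> s))))) (lift (g (bary (a' t) (edge_pt i k (\<sigma> s0)))))"
        by (rule hyp_isometry_lor[OF g(1) m(1)[OF s1] m(1)[OF s0], symmetric])
      also have "\<dots> = lor (lift (bary (a' t') (edge_pt i' k' (\<tau> s)))) (lift (bary (a' t') (edge_pt i' k' (\<tau> s0))))"
        unfolding b[OF s] b[OF sV] by (rule hyp_isometry_lor[OF g'(1) m(2)[OF s1] m(2)[OF s0]])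
      also have "\<dots> = cosh (p' s - p' s0)"
        unfolding p'_def using lor_edge_pos[of "a' t'" i' k' D "\<tau> s" "\<tau> s0", OF am(2) D_def[symmetric] C(2)] \<tau>(1) s1 s0 by auto
      finally have "\<bar>p s - p s0\<bar> = \<bar>p' s - p' s0\<bar>" 
        by (metis arcosh_cosh_real abs_ge_zero cosh_real_abs)
      \<comment> \<open>Equal values of cosh determine the differences only up to sign; since both
        positions increase along the edge, the signs agree.\<close>
      moreover have "(p s < p s0 \<and> p' s < p' s0) \<or> (p s = p s0 \<and> p' s = p' s0) \<or> (p s0 < p s \<and> p' s0 < p' s)"
        using pinc[of s s0] pinc[of s0 s] s1 s0 by (cases s s0 rule: linorder_cases) auto
      ultimately show ?thesis by (auto simp: abs_if split: if_splits)
    qed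
    then show "\<exists>T. openin (top_of_set {0..1}) T \<and> s0 \<in> T \<and> (\<forall>x\<in>T. p x - p' x = p s0 - p' s0)"
      using oV sV by blast
  qed
  then obtain K where K: "\<And>s. s \<in> {0..1} \<Longrightarrow> p s - p' s = K" unfolding constant_on_def by blast
  have "K = 0" using K[of 0] edge_pos_ends(1) C by (simp add: p_def p'_def \<sigma>(4) \<tau>(4))
  then have pp: "p s = p' s" if "s \<in> {0..1}" for s using K[OF that] by simp
  have "p 1 = p' 1" by (rule pp) simp
  then have e1: "edge_pos C 1 = edge_pos D 1" unfolding p_def p'_def \<sigma>(5) \<tau>(5) .
  have CD: "C = D"
    using edge_pos_ends(2)[OF C(1)] unfolding e1 edge_pos_ends(2)[OF C(2)] by (rule sym)
  show "lor (lift (a' t i)) (lift (a' t k)) = lor (lift (a' t' i')) (lift (a' t' k'))"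
    using CD unfolding C_def D_def .
  show "\<forall>s\<in>{0..1}. \<exists>u\<in>{0..1}. q t (edge_pt i k s) = edge_pt i k u \<and> q t' (edge_pt i' k' s) = edge_pt i' k' u"
  proof
    fix s :: real assume s: "s \<in> {0..1}"
    have "\<sigma> s = \<tau> s"
    proof (rule inj_onD[OF edge_pos_inj[OF C(1)]])
      show "edge_pos C (\<sigma> s) = edge_pos C (\<tau> s)" using pp[OF s] unfolding p_def p'_def CD[symmetric] .
    qed (use bspec[OF \<sigma>(1) s] bspec[OF \<tau>(1) s] in simp_all)
    then have "\<sigma> s \<in> {0..1} \<and> q t (edge_pt i k s) = edge_pt i k (\<sigma> s) \<and> q t' (edge_pt i' k' s) = edge_pt i' k' (\<sigma> s)"
      using bspec[OF \<sigma>(1) s] bspec[OF \<tau>(1) s] by simp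
    then show "\<exists>u\<in>{0..1}. q t (edge_pt i k s) = edge_pt i k u \<and> q t' (edge_pt i' k' s) = edge_pt i' k' u"
      by (intro bexI[of _ "\<sigma> s"]) simp_all
  qed
qed

end

section \<open>Uniqueness of the realization\<close>

context triangulated_surface
begin

text \<open>Fixing corners and moving points of glued sides to equal parameters makes the maps of
  the single triangles respect all identifications. Continuity on M then comes from the quotient
  topology.\<close>

lemma glued_self_map:
  assumes r: "\<And>t. t \<in> T \<Longrightarrow> continuous_map (top_of_set std_triangle) (top_of_set std_triangle) (r t)"
    and corners: "\<And>t i. t \<in> T \<Longrightarrow> r t (corner i) = corner i"
    and sides: "\<And>t i k t' i' k'. (t, i, k) \<in> flags \<Longrightarrow> glue (t, i, k) = (t', i', k') \<Longrightarrow>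
      \<forall>s\<in>{0..1}. \<exists>u\<in>{0..1}. r t (edge_pt i k s) = edge_pt i k u \<and> r t' (edge_pt i' k' s) = edge_pt i' k' u"
  shows "\<exists>F. continuous_map M M F \<and> (\<forall>t\<in>T. \<forall>x\<in>std_triangle. F (\<phi> t x) = \<phi> t (r t x))"
proof -
  have well: "\<phi> t' (r t' x') = \<phi> t (r t x)"
    if t: "t \<in> T" "x \<in> std_triangle" and t': "t' \<in> T" "x' \<in> std_triangle" and eq: "\<phi> t' x' = \<phi> t x" for t x t' x'
    using t(2)
  proof (cases rule: std_triangle_cases)
    case 1
    then show ?thesis using same_point_open[OF t(1) 1 t' eq] by simp
  next
    case (2 i k s)
    have f: "(t, i, k) \<in> flags" using t(1) 2(1) by (simp add: mem_flags)
    have "(t' = t \<and> x' = edge_pt i k s) \<or> (\<exists>i' k'. glue (t, i, k) = (t', i', k') \<and> x' = edge_pt i' k' s)"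
      by (rule same_point_edge[OF f 2(2,3) t']) (simp only: eq 2(4))
    then show ?thesis
    proof (elim disjE exE conjE)
      fix i' k' assume gl: "glue (t, i, k) = (t', i', k')" "x' = edge_pt i' k' s"
      have "s \<in> {0..1}" using 2(2,3) by simp
      then obtain u where u: "u \<in> {0..1}" "r t (edge_pt i k s) = edge_pt i k u" "r t' (edge_pt i' k' s) = edge_pt i' k' u"
        using bspec[OF sides[OF f gl(1)]] by blast
      have "\<phi> t' (edge_pt i' k' u) = \<phi> t (edge_pt i k u)"
        using flag_pt_glue[OF f, of u] u(1) unfolding gl(1) by (simp add: flag_pt_def)
      then show ?thesis unfolding gl(2) 2(4) u(2,3) .
    qed (simp add: 2(4))
  next
    case (3 i)
    obtain j where j: "x' = corner j"
      using same_point_corner[OF t(1) t', of i] eq 3 by blast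
    show ?thesis using eq unfolding j 3 corners[OF t(1)] corners[OF t'(1)] .
  qed
  define ch where "ch p = (SOME tx. fst tx \<in> T \<and> snd tx \<in> std_triangle \<and> \<phi> (fst tx) (snd tx) = p)" for p
  define F where "F p = \<phi> (fst (ch p)) (r (fst (ch p)) (snd (ch p)))" for p
  have F: "F (\<phi> t x) = \<phi> t (r t x)" if tx: "t \<in> T" "x \<in> std_triangle" for t x
  proof -
    have "fst (ch (\<phi> t x)) \<in> T \<and> snd (ch (\<phi> t x)) \<in> std_triangle \<and> \<phi> (fst (ch (\<phi> t x))) (snd (ch (\<phi> t x))) = \<phi> t x"
      unfolding ch_def[of "\<phi> t x"] by (rule someI[of _ "(t, x)"]) (use tx in simp)
    then show ?thesis unfolding F_def using well[OF tx] by blast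
  qed
  have rs: "r t x \<in> std_triangle" if "t \<in> T" "x \<in> std_triangle" for t x
    using r[OF that(1)] that(2) by (auto simp: continuous_map_def Pi_iff)
  have "continuous_map M M F"
    unfolding continuous_map
  proof (intro conjI allI impI)
    show "F ` topspace M \<subseteq> topspace M"
    proof
      fix z assume "z \<in> F ` topspace M"
      then obtain p where p: "p \<in> topspace M" "z = F p" by blast
      obtain t x where tx: "t \<in> T" "x \<in> std_triangle" "p = \<phi> t x" by (rule pointE[OF p(1)])
      show "z \<in> topspace M" unfolding p(2) tx(3) F[OF tx(1,2)] by (rule char_in_M[OF tx(1) rs[OF tx(1,2)]])
    qed
    fix V assume V: "openin M V"
    show "openin M {p \<in> topspace M. F p \<in> V}"
    proof (rule openin_quotient)
      fix t assume t: "t \<in> T"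
      have "{x \<in> std_triangle. \<phi> t x \<in> {p \<in> topspace M. F p \<in> V}} = {x \<in> std_triangle. r t x \<in> {y \<in> std_triangle. \<phi> t y \<in> V}}"
        using char_in_M[OF t] rs[OF t] F[OF t] by (intro Collect_cong) auto
      moreover have "openin (top_of_set std_triangle) {x \<in> topspace (top_of_set std_triangle). r t x \<in> {y \<in> std_triangle. \<phi> t y \<in> V}}"
        by (rule openin_continuous_map_preimage[OF r[OF t] openin_preimage[OF t V]])
      ultimately show "openin (top_of_set std_triangle) {x \<in> std_triangle. \<phi> t x \<in> {p \<in> topspace M. F p \<in> V}}" by simp
    qed blast
  qed
  then show ?thesis using F by blast
qed

text \<open>Because q acts on glued sides by the same change of parameter, so does its inverse r;
  gluing both families gives mutually inverse maps of M.\<close>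

lemma glued_self_homeomorphism:
  assumes q: "\<And>t. t \<in> T \<Longrightarrow> homeomorphic_maps (top_of_set std_triangle) (top_of_set std_triangle) (q t) (r t)"
    "\<And>t i. t \<in> T \<Longrightarrow> q t (corner i) = corner i" "\<And>t i y. t \<in> T \<Longrightarrow> y \<in> std_triangle \<Longrightarrow> q t y $ i = 0 \<longleftrightarrow> y $ i = 0"
    and sides: "\<And>t i k t' i' k'. (t, i, k) \<in> flags \<Longrightarrow> glue (t, i, k) = (t', i', k') \<Longrightarrow>
      \<forall>s\<in>{0..1}. \<exists>u\<in>{0..1}. q t (edge_pt i k s) = edge_pt i k u \<and> q t' (edge_pt i' k' s) = edge_pt i' k' u"
  shows "\<exists>F. homeomorphic_map M M F \<and> (\<forall>t\<in>T. \<forall>x\<in>std_triangle. F (\<phi> t x) = \<phi> t (r t x))"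
proof -
  have qr: "q t x \<in> std_triangle" "r t x \<in> std_triangle" "r t (q t x) = x" "q t (r t x) = x" if "t \<in> T" "x \<in> std_triangle" for t x
    using q(1)[OF that(1)] that(2) unfolding homeomorphic_maps_def by (auto simp: continuous_map_def Pi_iff)
  have qc: "continuous_map (top_of_set std_triangle) (top_of_set std_triangle) (q t)"
    "continuous_map (top_of_set std_triangle) (top_of_set std_triangle) (r t)" if "t \<in> T" for t
    using q(1)[OF that] unfolding homeomorphic_maps_def by blast+
  have rc: "r t (corner i) = corner i" if "t \<in> T" for t i
    using qr(3)[OF that corner_std[of i]] q(2)[OF that] by simp
  have rs: "\<forall>s\<in>{0..1}. \<exists>u\<in>{0..1}. r t (edge_pt i k s) = edge_pt i k u \<and> r t' (edge_pt i' k' s) = edge_pt i' k' u"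
    if f: "(t, i, k) \<in> flags" and gl: "glue (t, i, k) = (t', i', k')" for t i k t' i' k'
  proof
    fix s :: real assume s: "s \<in> {0..1}"
    have t: "t \<in> T" "i \<noteq> k" using f by (auto simp: mem_flags)
    have t': "t' \<in> T" using glue_flags[OF f] gl by (simp add: mem_flags)
    have e: "edge_pt i k s \<in> std_triangle" using s by (simp add: edge_pt_std)
    define w where "w = r t (edge_pt i k s)"
    have w: "w \<in> std_triangle" unfolding w_def by (rule qr(2)[OF t(1) e])
    have qw: "q t w = edge_pt i k s" unfolding w_def by (rule qr(4)[OF t(1) e])
    have "q t w $ third i k = 0" unfolding qw using third_props(1,2)[OF t(2)] by (simp add: edge_pt_nth[OF t(2)])
    then have "w $ third i k = 0" unfolding q(3)[OF t(1) w] .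
    then have we: "w = edge_pt i k (w $ k)" by (rule edge_pt_of_third_zero[OF t(2) w])
    have wk: "w $ k \<in> {0..1}" using std_triangleD(1)[OF w] std_triangle_le1[OF w] by simp
    obtain u where u: "u \<in> {0..1}" "q t (edge_pt i k (w $ k)) = edge_pt i k u" "q t' (edge_pt i' k' (w $ k)) = edge_pt i' k' u"
      using bspec[OF sides[OF f gl] wk] by (elim bexE conjE)
    have "edge_pt i k u = edge_pt i k s" using u(2) unfolding we[symmetric] qw by (rule sym)
    then have us: "u = s" unfolding edge_pt_inj[OF t(2)] .
    have e': "edge_pt i' k' (w $ k) \<in> std_triangle" using wk by (simp add: edge_pt_std)
    have "r t' (edge_pt i' k' s) = edge_pt i' k' (w $ k)"
      using qr(3)[OF t' e'] unfolding u(3) us .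
    moreover have "r t (edge_pt i k s) = edge_pt i k (w $ k)" using we unfolding w_def[symmetric] .
    ultimately show "\<exists>u\<in>{0..1}. r t (edge_pt i k s) = edge_pt i k u \<and> r t' (edge_pt i' k' s) = edge_pt i' k' u"
      using wk by (intro bexI[of _ "w $ k"] conjI)
  qed
  have "\<exists>F. continuous_map M M F \<and> (\<forall>t\<in>T. \<forall>x\<in>std_triangle. F (\<phi> t x) = \<phi> t (r t x))"
    by (rule glued_self_map[of r, OF qc(2) rc rs])
  then obtain F where F: "continuous_map M M F" "\<forall>t\<in>T. \<forall>x\<in>std_triangle. F (\<phi> t x) = \<phi> t (r t x)" by (elim exE conjE)
  have "\<exists>G. continuous_map M M G \<and> (\<forall>t\<in>T. \<forall>x\<in>std_triangle. G (\<phi> t x) = \<phi> t (q t x))"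
    by (rule glued_self_map[of q, OF qc(1) q(2) sides])
  then obtain G where G: "continuous_map M M G" "\<forall>t\<in>T. \<forall>x\<in>std_triangle. G (\<phi> t x) = \<phi> t (q t x)" by (elim exE conjE)
  have "homeomorphic_maps M M F G"
    unfolding homeomorphic_maps_def
  proof (intro conjI F(1) G(1) ballI)
    fix p assume p: "p \<in> topspace M"
    obtain t x where tx: "t \<in> T" "x \<in> std_triangle" "p = \<phi> t x" by (rule pointE[OF p])
    show "G (F p) = p" "F (G p) = p" using F(2) G(2) tx qr[OF tx(1,2)] by auto
  qed
  then show ?thesis using F(2) homeomorphic_maps_map by blast
qed

end

context hyperbolic_triangulation
begin

text \<open>The charts of the realization, pulled back to \<open>M\<close> after correcting its parametrisations of the
  triangles, are developing charts.\<close>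

theorem realization_isometry:
  fixes N' :: "'b topology"
  assumes hyp: "hyperbolic_surface N' A'" and hom: "homeomorphic_map M N' h'"
    and real: "\<And>t. t \<in> T \<Longrightarrow> geodesic_triangle N' A' (h' \<circ> \<phi> t) (a' t)"
    and lengths: "\<And>t i. t \<in> T \<Longrightarrow> side_cosh (a' t) i = side_cosh (a t) i"
  shows "\<exists>f. surface_isometry M dev_atlas N' A' f \<and> (\<forall>t\<in>T. f ` \<phi> t ` std_triangle = h' ` \<phi> t ` std_triangle)"
proof -
  have cover: "(\<Union>(U, c)\<in>A'. U) = topspace N'"
    and charts: "\<forall>(U, c)\<in>A'. openin N' U \<and> c ` U \<subseteq> hyp_plane \<and> open (c ` U) \<and> homeomorphic_map (subtopology N' U) (top_of_set (c ` U)) c"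
    by (rule hyp[unfolded hyperbolic_surface_def, THEN conjunct2, THEN conjunct2, THEN conjunct1])
      (rule hyp[unfolded hyperbolic_surface_def, THEN conjunct2, THEN conjunct2, THEN conjunct2, THEN conjunct1])
  have tri': "hyp_triangle (a' t)" if "t \<in> T" for t using real[OF that] unfolding geodesic_triangle_def by blast
  have "\<forall>t\<in>T. \<exists>z. geodesic_reparam N' A' (h' \<circ> \<phi> t) (a' t) (fst z) (snd z)"
    using geodesic_triangle_reparam[OF real] by simp
  from bchoice[OF this] obtain z where z: "\<forall>t\<in>T. geodesic_reparam N' A' (h' \<circ> \<phi> t) (a' t) (fst (z t)) (snd (z t))" by (elim exE)
  define q where "q t = fst (z t)" for t
  define r where "r t = snd (z t)" for t
  have qr: "geodesic_reparam N' A' (h' \<circ> \<phi> t) (a' t) (q t) (r t)" if "t \<in> T" for t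
    using z that by (simp add: q_def r_def)
  note q1 = geodesic_reparamD(1)[OF qr] and q2 = geodesic_reparamD(2)[OF qr] and q3 = geodesic_reparamD(3)[OF qr]
  have loc: "\<exists>g W. hyp_isometry g \<and> openin (top_of_set std_triangle) W \<and> x \<in> W \<and>
       (\<forall>y\<in>W. h' (\<phi> t y) \<in> U \<and> c (h' (\<phi> t y)) = g (bary (a' t) (q t y)))"
    if "t \<in> T" "x \<in> std_triangle" "(U, c) \<in> A'" "h' (\<phi> t x) \<in> U" for t x U c
    using geodesic_reparamD(4)[OF qr[OF that(1)] that(2,3), unfolded comp_def] that(4) by simp
  have sides: "\<forall>s\<in>{0..1}. \<exists>u\<in>{0..1}. q t (edge_pt i k s) = edge_pt i k u \<and> q t' (edge_pt i' k' s) = edge_pt i' k' u"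
    if "(t, i, k) \<in> flags" "glue (t, i, k) = (t', i', k')" for t i k t' i' k'
    by (rule realization_side_match(2)[OF cover hom tri' qr that])
  have "\<exists>F. homeomorphic_map M M F \<and> (\<forall>t\<in>T. \<forall>x\<in>std_triangle. F (\<phi> t x) = \<phi> t (r t x))"
    by (rule glued_self_homeomorphism[OF q1 q2 q3 sides])
  then obtain F where F: "homeomorphic_map M M F" "\<forall>t\<in>T. \<forall>x\<in>std_triangle. F (\<phi> t x) = \<phi> t (r t x)" by (elim exE conjE)
  \<comment> \<open>Precomposition with r cancels q: on every triangle the charts of the
    realization, taken after \<open>f\<close>, are isometries applied to barycentric coordinates of
    \<open>a' t\<close>, and thus of \<open>a t\<close> by congruence.\<close>
  define f where "f = h' \<circ> F"
  have f: "homeomorphic_map M N' f" unfolding f_def by (rule homeomorphic_map_compose[OF F(1) hom])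
  have f_eq: "f (\<phi> t x) = h' (\<phi> t (r t x))" if "t \<in> T" "x \<in> std_triangle" for t x
    using F(2) that by (simp add: f_def)
  have rr: "r t x \<in> std_triangle" "q t (r t x) = x" if "t \<in> T" "x \<in> std_triangle" for t x
    using q1[OF that(1)] that(2) unfolding homeomorphic_maps_def by (auto simp: continuous_map_def Pi_iff)
  have rimg: "r t ` std_triangle = std_triangle" if "t \<in> T" for t
  proof -
    have "homeomorphic_map (top_of_set std_triangle) (top_of_set std_triangle) (r t)"
      using q1[OF that] unfolding homeomorphic_maps_map by blast
    from homeomorphic_imp_surjective_map[OF this] show ?thesis by simp
  qed
  have images: "f ` \<phi> t ` std_triangle = h' ` \<phi> t ` std_triangle" if t: "t \<in> T" for t
  proof -
    have "f ` \<phi> t ` std_triangle = (\<lambda>x. h' (\<phi> t (r t x))) ` std_triangle"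
      unfolding image_image by (rule image_cong[OF refl]) (rule f_eq[OF t])
    also have "\<dots> = h' ` \<phi> t ` r t ` std_triangle" unfolding image_image ..
    finally show ?thesis unfolding rimg[OF t] .
  qed
  have pull: "dev_chart {p \<in> topspace M. f p \<in> U} (\<lambda>p. c (f p))" if Uc: "(U, c) \<in> A'" for U c
    unfolding dev_chart_def
  proof (intro conjI ballI impI)
    let ?V = "{p \<in> topspace M. f p \<in> U}"
    have U: "openin N' U" and c: "homeomorphic_map (subtopology N' U) (top_of_set (c ` U)) c"
      using bspec[OF charts Uc] by auto
    have fc: "continuous_map M N' f" by (rule homeomorphic_imp_continuous_map[OF f])
    show "openin M ?V" by (rule openin_continuous_map_preimage[OF fc U])
    have "continuous_map (subtopology M ?V) (subtopology N' U) f"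
      by (rule continuous_map_into_subtopology[OF continuous_map_from_subtopology[OF fc]]) auto
    moreover have "continuous_map (subtopology N' U) euclidean c"
      using homeomorphic_imp_continuous_map[OF c] by (simp add: continuous_map_in_subtopology)
    ultimately have "continuous_map (subtopology M ?V) euclidean (c \<circ> f)" by (rule continuous_map_compose)
    then show "continuous_map (subtopology M ?V) euclidean (\<lambda>p. c (f p))" by (simp only: comp_def)
    have ci: "inj_on c U"
      using homeomorphic_imp_injective_map[OF c] openin_subset[OF U] by (simp add: Int_absorb1)
    show "inj_on (\<lambda>p. c (f p)) ?V"
    proof (rule inj_onI)
      fix p p' assume p: "p \<in> ?V" "p' \<in> ?V" and eq: "c (f p) = c (f p')"
      have "f p = f p'" by (rule inj_onD[OF ci eq]) (use p in auto)
      then show "p = p'" using inj_onD[OF homeomorphic_imp_injective_map[OF f]] p by simp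
    qed
    fix t x assume t: "t \<in> T" and x: "x \<in> std_triangle" and xV: "\<phi> t x \<in> ?V"
    have "h' (\<phi> t (r t x)) \<in> U" using xV f_eq[OF t x] by simp
    from loc[OF t rr(1)[OF t x] Uc this] obtain g W where g: "hyp_isometry g" "openin (top_of_set std_triangle) W" "r t x \<in> W"
      "\<forall>y\<in>W. h' (\<phi> t y) \<in> U \<and> c (h' (\<phi> t y)) = g (bary (a' t) (q t y))" by (elim exE conjE)
    have am: "\<And>i. a' t i \<in> hyp_plane" using tri'[OF t] unfolding hyp_triangle_iff by blast
    obtain m where m: "hyp_isometry m" "\<And>i. m (a t i) = a' t i"
      by (rule triangle_congruence[of "a t" "a' t", OF triangle[OF t] am lengths[OF t, symmetric]]) (rule that)
    have bm: "m (bary (a t) y) = bary (a' t) y" if "y \<in> std_triangle" for y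
      using isometry_bary[of m "a t" y, OF m(1) vertex_mem[OF t] that] unfolding m(2) .
    define W0 where "W0 = {y \<in> std_triangle. r t y \<in> W}"
    have rc: "continuous_map (top_of_set std_triangle) (top_of_set std_triangle) (r t)"
      using q1[OF t] unfolding homeomorphic_maps_def by blast
    have "openin (top_of_set std_triangle) W0"
      using openin_continuous_map_preimage[OF rc g(2)] by (simp add: W0_def)
    moreover have "\<phi> t y \<in> ?V \<and> c (f (\<phi> t y)) = (g \<circ> m) (bary (a t) y)" if y: "y \<in> W0" for y
    proof -
      have y': "y \<in> std_triangle" "r t y \<in> W" using y by (auto simp: W0_def)
      show ?thesis using bspec[OF g(4) y'(2)] char_in_M[OF t y'(1)]
        by (simp add: f_eq[OF t y'(1)] rr(2)[OF t y'(1)] bm[OF y'(1)])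
    qed
    moreover have "x \<in> W0" using x g(3) by (simp add: W0_def)
    moreover have "hyp_isometry (g \<circ> m)" using g(1) m(1) unfolding hyp_isometry_def
      by (auto intro: bij_betw_trans simp: bij_betwE)
    ultimately have "dev_piece ?V (\<lambda>p. c (f p)) t x (g \<circ> m) W0" unfolding dev_piece_def by simp
    then show "\<exists>g W. dev_piece ?V (\<lambda>p. c (f p)) t x g W" by blast
  qed
  have "surface_isometry M dev_atlas N' A' f"
    unfolding surface_isometry_def
  proof (intro conjI f ballI, clarify)
    fix U c U' c' p assume Uc: "(U, c) \<in> dev_atlas" and Uc': "(U', c') \<in> A'" and p: "p \<in> U" "f p \<in> U'"
    have dc: "dev_chart U c" using Uc by (simp add: dev_atlas_def)
    have pM: "p \<in> topspace M" using dc p(1) openin_subset unfolding dev_chart_def by blast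
    have "\<exists>H N. hyp_isometry H \<and> openin M N \<and> p \<in> N \<and> N \<subseteq> U \<inter> {p \<in> topspace M. f p \<in> U'} \<and> (\<forall>q\<in>N. c' (f q) = H (c q))"
      by (rule dev_chart_transition[OF dc pull[OF Uc'] p(1)]) (simp add: pM p(2))
    then obtain H N where H: "hyp_isometry H" "openin M N" "p \<in> N" "N \<subseteq> U \<inter> {p \<in> topspace M. f p \<in> U'}" "\<forall>q\<in>N. c' (f q) = H (c q)"
      by (elim exE conjE)
    have "N \<subseteq> U" "f ` N \<subseteq> U'" using H(4) by auto
    then show "\<exists>g W. hyp_isometry g \<and> openin M W \<and> p \<in> W \<and> W \<subseteq> U \<and> f ` W \<subseteq> U' \<and> (\<forall>q\<in>W. c' (f q) = g (c q))"
      using H by (intro exI[of _ H] exI[of _ N]) simp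
  qed
  then show ?thesis using images by blast
qed

end

section \<open>The angles of a realization determine its side lengths\<close>

context triangulated_surface
begin

lemma edges_eq: "edges \<phi> S = all_edges S"
  unfolding edges_def all_edges_def ..

text \<open>Glued sides of a realization have equal length by \<open>realization_side_match\<close>,
  and the length determines \<open>tri_grad\<close> because \<open>tri_cosh\<close> is injective in
  it.\<close>

lemma realization_balanced:
  fixes N' :: "'b topology"
  assumes hyp: "hyperbolic_surface N' A'" and hom: "homeomorphic_map M N' h'"
    and real: "\<And>t. t \<in> T \<Longrightarrow> geodesic_triangle N' A' (h' \<circ> \<phi> t) (a' t)"
  shows "balanced (\<lambda>(t, i). psi_of (a' t) i)"
  unfolding balanced_def
proof
  have cover: "(\<Union>(U, c)\<in>A'. U) = topspace N'"
    by (rule hyp[unfolded hyperbolic_surface_def, THEN conjunct2, THEN conjunct2, THEN conjunct1])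
  have tri': "hyp_triangle (a' t)" if "t \<in> T" for t using real[OF that] unfolding geodesic_triangle_def by blast
  fix p assume p: "p \<in> sides"
  obtain t l where pl: "p = (t, l)" by (cases p)
  define i where "i = l + 1"
  define k where "k = l + 2"
  have ik: "i \<noteq> k" "third i k = l" by (simp_all add: i_def k_def cyc3_neq third_cyc)
  have t: "t \<in> T" using p by (simp add: pl mem_sides)
  have f: "(t, i, k) \<in> flags" using t ik(1) by (simp add: mem_flags)
  obtain t' i' k' where gl: "glue (t, i, k) = (t', i', k')" by (cases "glue (t, i, k)")
  have t': "t' \<in> T" "i' \<noteq> k'" using glue_flags[OF f] gl by (auto simp: mem_flags)
  have "flag_side (t', i', k') = opp (flag_side (t, i, k))" using flag_side_glue[OF f] unfolding gl .
  then have op: "opp p = (t', third i' k')" unfolding flag_side_def pl by (simp add: ik(2))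
  have "\<forall>t\<in>T. \<exists>z. geodesic_reparam N' A' (h' \<circ> \<phi> t) (a' t) (fst z) (snd z)"
    using geodesic_triangle_reparam[OF real] by simp
  from bchoice[OF this] obtain z where z: "\<forall>t\<in>T. geodesic_reparam N' A' (h' \<circ> \<phi> t) (a' t) (fst (z t)) (snd (z t))" by (elim exE)
  have "lor (lift (a' t i)) (lift (a' t k)) = lor (lift (a' t' i')) (lift (a' t' k'))"
    by (rule realization_side_match(1)[OF cover hom tri' bspec[OF z] f gl])
  then have "side_cosh (a' t) l = side_cosh (a' t') (third i' k')"
    unfolding ik(2)[symmetric] side_cosh_third[OF ik(1)] side_cosh_third[OF t'(2)] .
  then have "tri_grad (psi_of (a' t)) l = tri_grad (psi_of (a' t')) (third i' k')"
    unfolding side_cosh_tri_cosh[OF tri'[OF t]] side_cosh_tri_cosh[OF tri'[OF t'(1)]] tri_cosh_def by simp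
  then show "side_grad (\<lambda>(t, i). psi_of (a' t) i) (opp p) = side_grad (\<lambda>(t, i). psi_of (a' t) i) p"
    unfolding op unfolding pl side_grad_def by simp
qed

lemma realization_angle_system:
  assumes tri: "\<And>t. t \<in> T \<Longrightarrow> hyp_triangle (a t)"
    and angle: "\<forall>t\<in>T. \<forall>t'\<in>T. \<forall>i j. (t, i) \<noteq> (t', j) \<and> side_edge \<phi> t i = side_edge \<phi> t' j \<longrightarrow>
      intersection_angle (a t) i (a t') j = \<theta> (side_edge \<phi> t i)"
  shows "angle_system \<theta> (\<lambda>(t, i). psi_of (a t) i)"
  unfolding angle_system_def
proof (intro conjI ballI)
  show "tri_dom (\<lambda>i. case (t, i) of (t, i) \<Rightarrow> psi_of (a t) i)" if "t \<in> T" for t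
    using tri_dom_psi_of[OF tri[OF that]] by simp
  fix p assume p: "p \<in> sides"
  obtain t i t' j where pq: "p = (t, i)" "opp p = (t', j)" by (cases p, cases "opp p")
  have t: "t \<in> T" "t' \<in> T" using p opp_props(1)[OF p] unfolding pq(2) by (simp_all add: pq(1) mem_sides)
  have "(t, i) \<noteq> (t', j)" using opp_props(2)[OF p] unfolding pq(2) unfolding pq(1) by (rule not_sym)
  moreover have "side_edge \<phi> t i = side_edge \<phi> t' j"
    using opp_props(3)[OF p] unfolding pq(2) unfolding edge_at_def pq(1) by simp
  ultimately have "intersection_angle (a t) i (a t') j = \<theta> (side_edge \<phi> t i)" using angle t by blast
  then show "(case p of (t, i) \<Rightarrow> psi_of (a t) i) + (case opp p of (t, i) \<Rightarrow> psi_of (a t) i) = \<theta> (edge_at p)"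
    unfolding pq(2) unfolding pq(1) edge_at_def by (simp add: intersection_angle_def psi_of_def)
qed

end

theorem theorem4:
  fixes M :: "'a topology" and T :: "'t set" and \<phi> :: "'t \<Rightarrow> real^3 \<Rightarrow> 'a"
    and \<theta> :: "'a set \<Rightarrow> real"
  assumes "closed_surface M"
    and "surface_triangulation M T \<phi>"
    and "euler_char \<phi> T < 0"
    and "\<forall>e\<in>edges \<phi> T. 0 < \<theta> e \<and> \<theta> e < pi"
    and "\<forall>S. S \<subseteq> T \<and> S \<noteq> {} \<longrightarrow> (\<Sum>e\<in>edges \<phi> S. \<theta> e) > pi * real (card S)"
    and "\<forall>v\<in>vertices \<phi> T. (\<Sum>e\<in>edges \<phi> T. real (ends_at \<phi> T v e) * (pi - \<theta> e)) = 2 * pi"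
  shows "\<exists>(N :: 'a topology) A h.
           geodesic_realization M T \<phi> \<theta> N A h \<and>
           (\<forall>(N' :: 'b topology) A' h'. geodesic_realization M T \<phi> \<theta> N' A' h' \<longrightarrow>
              (\<exists>f. surface_isometry N A N' A' f \<and>
                   (\<forall>t\<in>T. f ` h ` \<phi> t ` std_triangle = h' ` \<phi> t ` std_triangle)))"
proof -
  interpret triangulated_surface M T \<phi> using assms(1,2) by unfold_locales
  obtain \<psi> where \<psi>: "angle_system \<theta> \<psi>" "balanced \<psi>"
    using balanced_angle_system_exists[of \<theta>] assms(4,5) unfolding edges_eq by blast
  have "\<forall>t\<in>T. \<exists>b. hyp_triangle b \<and> (\<forall>i. side_cosh b i = tri_cosh (\<lambda>i. \<psi> (t, i)) i) \<and> (\<forall>i. tri_angle b i = tri_ang (\<lambda>i. \<psi> (t, i)) i)"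
  proof
    fix t assume t: "t \<in> T"
    have dom: "tri_dom (\<lambda>i. \<psi> (t, i))" using \<psi>(1) t unfolding angle_system_def by blast
    obtain b where "hyp_triangle b" "\<And>i. side_cosh b i = tri_cosh (\<lambda>i. \<psi> (t, i)) i"
      "\<And>i. tri_angle b i = tri_ang (\<lambda>i. \<psi> (t, i)) i" by (rule hyp_triangle_exists[OF dom]) (rule that)
    then show "\<exists>b. hyp_triangle b \<and> (\<forall>i. side_cosh b i = tri_cosh (\<lambda>i. \<psi> (t, i)) i) \<and> (\<forall>i. tri_angle b i = tri_ang (\<lambda>i. \<psi> (t, i)) i)"
      by (intro exI[of _ b]) simp
  qed
  from bchoice[OF this] obtain a where a: "\<forall>t\<in>T. hyp_triangle (a t) \<and> (\<forall>i. side_cosh (a t) i = tri_cosh (\<lambda>i. \<psi> (t, i)) i) \<and>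
      (\<forall>i. tri_angle (a t) i = tri_ang (\<lambda>i. \<psi> (t, i)) i)" by (elim exE)
  have at: "hyp_triangle (a t)" "side_cosh (a t) i = tri_cosh (\<lambda>i. \<psi> (t, i)) i" "tri_angle (a t) i = tri_ang (\<lambda>i. \<psi> (t, i)) i"
    if "t \<in> T" for t i using bspec[OF a that] by simp_all
  have psi: "psi_of (a t) i = \<psi> (t, i)" if "t \<in> T" for t i
    unfolding psi_of_def at(3)[OF that] by (simp add: tri_ang_def cyc3)
  interpret hyperbolic_triangulation M T \<phi> a
  proof unfold_locales
    show "hyp_triangle (a t)" if "t \<in> T" for t by (rule at(1)[OF that])
    fix t i k t' i' k' assume f: "(t, i, k) \<in> flags" and gl: "glue (t, i, k) = (t', i', k')"
    have t: "t \<in> T" "i \<noteq> k" using f by (auto simp: mem_flags)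
    have t': "t' \<in> T" "i' \<noteq> k'" using glue_flags[OF f] gl by (auto simp: mem_flags)
    have p: "(t, third i k) \<in> sides" using t(1) by (simp add: mem_sides)
    have "opp (t, third i k) = (t', third i' k')"
      using flag_side_glue[OF f] unfolding gl flag_side_def by simp
    then have "side_grad \<psi> (t', third i' k') = side_grad \<psi> (t, third i k)"
      using \<psi>(2) p unfolding balanced_def by metis
    then have "side_cosh (a t) (third i k) = side_cosh (a t') (third i' k')"
      unfolding at(2)[OF t(1)] at(2)[OF t'(1)] tri_cosh_def side_grad_def by simp
    then show "lor (lift (a t i)) (lift (a t k)) = lor (lift (a t' i')) (lift (a t' k'))"
      unfolding side_cosh_third[OF t(2)] side_cosh_third[OF t'(2)] .
  qed
  have angles: "(\<Sum>(t, i)\<in>corners_at v. tri_angle (a t) i) = 2 * pi" if v: "v \<in> vertices \<phi> T" for v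
  proof -
    have "(\<Sum>(t, i)\<in>corners_at v. tri_angle (a t) i) = (\<Sum>(t, i)\<in>corners_at v. tri_ang (\<lambda>j. \<psi> (t, j)) i)"
      by (rule sum.cong[OF refl]) (auto simp: corners_at_def at(3))
    also have "\<dots> = 2 * pi" by (rule vertex_angle_sum[OF v \<psi>(1) bspec[OF assms(6) v]])
    finally show ?thesis .
  qed
  \<comment> \<open>The underlying space is M itself with a new atlas, and the realizing map is the
    identity.\<close>
  have realized: "geodesic_realization M T \<phi> \<theta> M dev_atlas id"
    unfolding geodesic_realization_def
  proof (intro conjI exI[of _ a] ballI allI impI)
    show "hyperbolic_surface M dev_atlas" by (rule dev_hyperbolic_surface[OF angles])
    show "homeomorphic_map M M id" by (simp add: homeomorphic_map_id)
    show "geodesic_triangle M dev_atlas (id \<circ> \<phi> t) (a t)" if "t \<in> T" for t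
      using dev_geodesic_triangle[OF that] by simp
    fix t t' i j assume t: "t \<in> T" "t' \<in> T" and ij: "(t, i) \<noteq> (t', j) \<and> side_edge \<phi> t i = side_edge \<phi> t' j"
    have p: "(t, i) \<in> sides" and q: "(t', j) \<in> sides" using t by (simp_all add: mem_sides)
    have "edge_at (t', j) = edge_at (t, i)" using ij by (simp add: edge_at_def)
    then have "(t', j) = opp (t, i)" using opp_cases[OF p q] ij by metis
    then have "\<psi> (t, i) + \<psi> (t', j) = \<theta> (edge_at (t, i))" using \<psi>(1) p unfolding angle_system_def by metis
    then show "intersection_angle (a t) i (a t') j = \<theta> (side_edge \<phi> t i)"
      unfolding intersection_angle_def psi_of_def[symmetric] psi[OF t(1)] psi[OF t(2)] edge_at_def by simp
  qed
  have unique: "\<exists>f. surface_isometry M dev_atlas N' A' f \<and> (\<forall>t\<in>T. f ` id ` \<phi> t ` std_triangle = h' ` \<phi> t ` std_triangle)"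
    if R: "geodesic_realization M T \<phi> \<theta> N' A' h'" for N' :: "'b topology" and A' h'
  proof -
    have hyp: "hyperbolic_surface N' A'" and hom: "homeomorphic_map M N' h'"
      using R unfolding geodesic_realization_def by simp_all
    obtain a' where real: "\<forall>t\<in>T. geodesic_triangle N' A' (h' \<circ> \<phi> t) (a' t)"
      and angle: "\<forall>t\<in>T. \<forall>t'\<in>T. \<forall>i j. (t, i) \<noteq> (t', j) \<and> side_edge \<phi> t i = side_edge \<phi> t' j \<longrightarrow>
           intersection_angle (a' t) i (a' t') j = \<theta> (side_edge \<phi> t i)"
      using R unfolding geodesic_realization_def by (elim conjE exE)
    have tri': "hyp_triangle (a' t)" if "t \<in> T" for t
      using bspec[OF real that] unfolding geodesic_triangle_def by (rule conjunct1)
    \<comment> \<open>The angle condition makes the angles of the realization an angle system, and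
      matching of glued sides makes it balanced; uniqueness then identifies it with the constructed
      solution.\<close>
    have same: "psi_of (a' t) i = \<psi> (t, i)" if t: "t \<in> T" for t i
      using balanced_angle_system_unique[OF realization_angle_system[OF tri' angle] realization_balanced[OF hyp hom bspec[OF real]] \<psi> t, of i]
      by simp
    have "side_cosh (a' t) i = side_cosh (a t) i" if t: "t \<in> T" for t i
      unfolding side_cosh_tri_cosh[OF tri'[OF t]] at(2)[OF t] by (rule fun_cong[OF arg_cong[OF ext[OF same[OF t]]]])
    then show ?thesis using realization_isometry[OF hyp hom bspec[OF real]] by simp
  qed
  show ?thesis using realized unique by (intro exI[of _ M] exI[of _ dev_atlas] exI[of _ id]) blast
qed

end
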